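(* Let $H=L^2(\mathbb{R}_+)$, $\tilde H=L^2(\mathbb{R})$, and let $(S_t,\ t\ge 0)$ be the semigroup of shifts on $H$ and $(\tilde S_t,\ t\in\mathbb{R})$ the group of shifts on $\tilde H$ (see context). Let $(U_t,\ t\ge 0)$ be a strongly continuous semigroup of unitary operators on a separable Hilbert space $\mathcal H_0$, whose spectral measure is singular with respect to Lebesgue measure. Then there exists a cocycle $(W_t,\ t\ge 0)$ of $(S_t)$ such that $W_t-I\in\mathfrak S_p$ for all $p>1$ and all $t\ge 0$, and such that the cocyclic perturbation $V_t=W_tS_t$ satisfies: (a) $(V_t)$ is unitarily equivalent to $(U_t\oplus S_t)$, i.e. there is a unitary operator $J:H\to \mathcal H_0\oplus H$ with $JV_tJ^{-1}=U_t\oplus S_t$ for all $t\ge 0$; (b) $V_t-S_t\in\mathfrak S_1$ for all $t\ge 0$.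
   Context: $(S_tf)(x)=f(x-t)$ for $x>t$ and $(S_tf)(x)=0$ for $0\le x\le t$ ($f\in H$); $(\tilde S_tg)(x)=g(x-t)$ ($g\in\tilde H$). Bounded operators on $H$ are regarded as operators on $\tilde H$ by letting them act as the identity on functions supported in $\mathbb{R}_-=(-\infty,0]$. A cocycle of $(S_t)$ is a strongly continuous family $(W_t,\ t\ge0)$ of unitary operators on $H$ with $W_{t+s}=W_t\tilde S_tW_s\tilde S_{-t}$ for $t,s\ge0$ and $W_0=I$; then $V_t=W_tS_t$ is a semigroup of isometries, called a cocyclic perturbation of $(S_t)$. $\mathfrak S_p$ denotes the Schatten–von Neumann class. By Stone's theorem $U_t=e^{itA}$ with $A$ self-adjoint; "spectral measure singular" means that the spectral measure of $A$ is singular with respect to Lebesgue measure on $\mathbb{R}$ (all semigroups are strongly continuous). *)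

theory Defs
  imports "HOL-Analysis.Analysis"
begin

text \<open>A complex inner product space is given explicitly by its carrier, vector
operations and inner product (linear in the first, conjugate linear in the second
argument).  For concrete function spaces such as L2 the vectors are functions and
equality of vectors is understood modulo null vectors (heq below); all
operator-level notions are formulated modulo null vectors.\<close>

record 'v hspace =
  hcar  :: "'v set"
  hadd  :: "'v \<Rightarrow> 'v \<Rightarrow> 'v"
  hscl  :: "complex \<Rightarrow> 'v \<Rightarrow> 'v"
  hzero :: "'v"
  hinn  :: "'v \<Rightarrow> 'v \<Rightarrow> complex"

definition hnorm :: "'v hspace \<Rightarrow> 'v \<Rightarrow> real" where
  "hnorm V x = sqrt (Re (hinn V x x))"

definition hsub :: "'v hspace \<Rightarrow> 'v \<Rightarrow> 'v \<Rightarrow> 'v" where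
  "hsub V x y = hadd V x (hscl V (-1) y)"

definition hdist :: "'v hspace \<Rightarrow> 'v \<Rightarrow> 'v \<Rightarrow> real" where
  "hdist V x y = hnorm V (hsub V x y)"

definition heq :: "'v hspace \<Rightarrow> 'v \<Rightarrow> 'v \<Rightarrow> bool" where
  "heq V x y \<longleftrightarrow> hdist V x y = 0"

definition semi_hilbert :: "'v hspace \<Rightarrow> bool" where
  "semi_hilbert V \<longleftrightarrow>
     hzero V \<in> hcar V \<and>
     (\<forall>x\<in>hcar V. \<forall>y\<in>hcar V. hadd V x y \<in> hcar V) \<and>
     (\<forall>a. \<forall>x\<in>hcar V. hscl V a x \<in> hcar V) \<and>
     (\<forall>x\<in>hcar V. \<forall>y\<in>hcar V. \<forall>z\<in>hcar V. hadd V (hadd V x y) z = hadd V x (hadd V y z)) \<and>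
     (\<forall>x\<in>hcar V. \<forall>y\<in>hcar V. hadd V x y = hadd V y x) \<and>
     (\<forall>x\<in>hcar V. hadd V (hzero V) x = x) \<and>
     (\<forall>x\<in>hcar V. hadd V x (hscl V (-1) x) = hzero V) \<and>
     (\<forall>a. \<forall>x\<in>hcar V. \<forall>y\<in>hcar V. hscl V a (hadd V x y) = hadd V (hscl V a x) (hscl V a y)) \<and>
     (\<forall>a b. \<forall>x\<in>hcar V. hscl V (a + b) x = hadd V (hscl V a x) (hscl V b x)) \<and>
     (\<forall>a b. \<forall>x\<in>hcar V. hscl V a (hscl V b x) = hscl V (a * b) x) \<and>
     (\<forall>x\<in>hcar V. hscl V 1 x = x) \<and>
     (\<forall>x\<in>hcar V. \<forall>y\<in>hcar V. \<forall>z\<in>hcar V. hinn V (hadd V x y) z = hinn V x z + hinn V y z) \<and>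
     (\<forall>a. \<forall>x\<in>hcar V. \<forall>y\<in>hcar V. hinn V (hscl V a x) y = a * hinn V x y) \<and>
     (\<forall>x\<in>hcar V. \<forall>y\<in>hcar V. hinn V y x = cnj (hinn V x y)) \<and>
     (\<forall>x\<in>hcar V. Re (hinn V x x) \<ge> 0) \<and>
     (\<forall>X. (\<forall>n. X n \<in> hcar V) \<and>
          (\<forall>e>0. \<exists>N. \<forall>m\<ge>N. \<forall>n\<ge>N. hdist V (X m) (X n) < e)
          \<longrightarrow> (\<exists>x\<in>hcar V. (\<lambda>n. hdist V (X n) x) \<longlonglongrightarrow> 0))"

definition complex_hilbert :: "'v hspace \<Rightarrow> bool" where
  "complex_hilbert V \<longleftrightarrow> semi_hilbert V \<and> (\<forall>x\<in>hcar V. hinn V x x = 0 \<longrightarrow> x = hzero V)"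

definition separable_hs :: "'v hspace \<Rightarrow> bool" where
  "separable_hs V \<longleftrightarrow> (\<exists>D. countable D \<and> D \<subseteq> hcar V \<and>
      (\<forall>x\<in>hcar V. \<forall>e>0. \<exists>d\<in>D. hdist V x d < e))"

definition blin :: "'v hspace \<Rightarrow> 'w hspace \<Rightarrow> ('v \<Rightarrow> 'w) \<Rightarrow> bool" where
  "blin V W T \<longleftrightarrow>
     (\<forall>x\<in>hcar V. T x \<in> hcar W) \<and>
     (\<forall>x\<in>hcar V. \<forall>y\<in>hcar V. heq W (T (hadd V x y)) (hadd W (T x) (T y))) \<and>
     (\<forall>a. \<forall>x\<in>hcar V. heq W (T (hscl V a x)) (hscl W a (T x))) \<and>
     (\<exists>C. \<forall>x\<in>hcar V. hnorm W (T x) \<le> C * hnorm V x)"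

definition op_eq :: "'v hspace \<Rightarrow> 'w hspace \<Rightarrow> ('v \<Rightarrow> 'w) \<Rightarrow> ('v \<Rightarrow> 'w) \<Rightarrow> bool" where
  "op_eq V W T R \<longleftrightarrow> (\<forall>x\<in>hcar V. heq W (T x) (R x))"

definition unitary_op :: "'v hspace \<Rightarrow> 'w hspace \<Rightarrow> ('v \<Rightarrow> 'w) \<Rightarrow> bool" where
  "unitary_op V W T \<longleftrightarrow> blin V W T \<and>
     (\<forall>x\<in>hcar V. hnorm W (T x) = hnorm V x) \<and>
     (\<forall>y\<in>hcar W. \<exists>x\<in>hcar V. heq W (T x) y)"

definition opnorm :: "'v hspace \<Rightarrow> 'w hspace \<Rightarrow> ('v \<Rightarrow> 'w) \<Rightarrow> real" where
  "opnorm V W T = Sup {hnorm W (T x) | x. x \<in> hcar V \<and> hnorm V x \<le> 1}"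

fun lincomb :: "'w hspace \<Rightarrow> (nat \<Rightarrow> complex) \<Rightarrow> (nat \<Rightarrow> 'w) \<Rightarrow> nat \<Rightarrow> 'w" where
  "lincomb W c ys 0 = hzero W"
| "lincomb W c ys (Suc n) = hadd W (lincomb W c ys n) (hscl W (c n) (ys n))"

definition rank_le :: "'v hspace \<Rightarrow> 'w hspace \<Rightarrow> ('v \<Rightarrow> 'w) \<Rightarrow> nat \<Rightarrow> bool" where
  "rank_le V W F n \<longleftrightarrow> (\<exists>ys. (\<forall>i<n. ys i \<in> hcar W) \<and>
     (\<forall>x\<in>hcar V. \<exists>c. heq W (F x) (lincomb W c ys n)))"

definition sing_num :: "'v hspace \<Rightarrow> 'w hspace \<Rightarrow> ('v \<Rightarrow> 'w) \<Rightarrow> nat \<Rightarrow> real" where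
  "sing_num V W T n = Inf {opnorm V W (\<lambda>x. hsub W (T x) (F x)) | F. blin V W F \<and> rank_le V W F n}"

definition schatten :: "real \<Rightarrow> 'v hspace \<Rightarrow> 'w hspace \<Rightarrow> ('v \<Rightarrow> 'w) \<Rightarrow> bool" where
  "schatten p V W T \<longleftrightarrow> blin V W T \<and> summable (\<lambda>n. sing_num V W T n powr p)"

definition strongly_cont :: "'v hspace \<Rightarrow> (real \<Rightarrow> 'v \<Rightarrow> 'v) \<Rightarrow> bool" where
  "strongly_cont V F \<longleftrightarrow> (\<forall>x\<in>hcar V. \<forall>t\<ge>0. \<forall>e>0. \<exists>d>0. \<forall>s\<ge>0.
      \<bar>s - t\<bar> < d \<longrightarrow> hdist V (F s x) (F t x) < e)"

definition unitary_semigroup :: "'v hspace \<Rightarrow> (real \<Rightarrow> 'v \<Rightarrow> 'v) \<Rightarrow> bool" where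
  "unitary_semigroup V U \<longleftrightarrow> (\<forall>t\<ge>0. unitary_op V V (U t)) \<and> op_eq V V (U 0) id \<and>
     (\<forall>s\<ge>0. \<forall>t\<ge>0. op_eq V V (U (s + t)) (U s \<circ> U t)) \<and> strongly_cont V U"

text \<open>Spectral measure of the generator A (U t = exp (i t A)) singular w.r.t. Lebesgue
  measure: every scalar spectral measure mu_x = <E(.) x, x>, i.e. the finite Borel measure
  with <U_t x, x> = integral of exp(i t lambda) d mu_x(lambda), is singular.\<close>
definition singular_spectrum :: "'v hspace \<Rightarrow> (real \<Rightarrow> 'v \<Rightarrow> 'v) \<Rightarrow> bool" where
  "singular_spectrum V U \<longleftrightarrow> (\<forall>x\<in>hcar V. \<exists>\<mu> :: real measure.
      finite_measure \<mu> \<and> sets \<mu> = sets borel \<and>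
      (\<exists>N\<in>sets borel. emeasure lborel N = 0 \<and> emeasure \<mu> (UNIV - N) = 0) \<and>
      (\<forall>t\<ge>0. hinn V (U t x) x = (LINT l|\<mu>. exp (\<i> * complex_of_real (t * l)))))"

definition hs_dsum :: "'v hspace \<Rightarrow> 'w hspace \<Rightarrow> ('v \<times> 'w) hspace" where
  "hs_dsum V W = \<lparr> hcar = hcar V \<times> hcar W,
     hadd = (\<lambda>(a, b) (c, d). (hadd V a c, hadd W b d)),
     hscl = (\<lambda>k (a, b). (hscl V k a, hscl W k b)),
     hzero = (hzero V, hzero W),
     hinn = (\<lambda>(a, b) (c, d). hinn V a c + hinn W b d) \<rparr>"

definition opsum :: "('v \<Rightarrow> 'v) \<Rightarrow> ('w \<Rightarrow> 'w) \<Rightarrow> ('v \<times> 'w \<Rightarrow> 'v \<times> 'w)" where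
  "opsum T R = (\<lambda>(a, b). (T a, R b))"

definition L2R :: "(real \<Rightarrow> complex) hspace" where
  "L2R = \<lparr> hcar = {f. f \<in> borel_measurable borel \<and> integrable lborel (\<lambda>x. (cmod (f x))\<^sup>2)},
     hadd = (\<lambda>f g x. f x + g x),
     hscl = (\<lambda>a f x. a * f x),
     hzero = (\<lambda>x. 0),
     hinn = (\<lambda>f g. LINT x|lborel. f x * cnj (g x)) \<rparr>"

definition L2Rp :: "(real \<Rightarrow> complex) hspace" where
  "L2Rp = L2R \<lparr> hcar := {f \<in> hcar L2R. \<forall>x<0. f x = 0} \<rparr>"

definition shift :: "real \<Rightarrow> (real \<Rightarrow> complex) \<Rightarrow> (real \<Rightarrow> complex)" where
  "shift t f = (\<lambda>x. if x > t then f (x - t) else 0)"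

definition tshift :: "real \<Rightarrow> (real \<Rightarrow> complex) \<Rightarrow> (real \<Rightarrow> complex)" where
  "tshift t g = (\<lambda>x. g (x - t))"

text \<open>An operator on H regarded as an operator on H~, acting as the identity on
  functions supported in R_-.\<close>
definition ext_op :: "((real \<Rightarrow> complex) \<Rightarrow> (real \<Rightarrow> complex)) \<Rightarrow> (real \<Rightarrow> complex) \<Rightarrow> (real \<Rightarrow> complex)" where
  "ext_op T g = (\<lambda>x. T (\<lambda>y. if y \<ge> 0 then g y else 0) x + (if x < 0 then g x else 0))"

definition cocycle :: "(real \<Rightarrow> (real \<Rightarrow> complex) \<Rightarrow> (real \<Rightarrow> complex)) \<Rightarrow> bool" where
  "cocycle W \<longleftrightarrow> (\<forall>t\<ge>0. unitary_op L2Rp L2Rp (W t)) \<and> strongly_cont L2Rp W \<and>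
     op_eq L2Rp L2Rp (W 0) id \<and>
     (\<forall>t\<ge>0. \<forall>s\<ge>0. op_eq L2R L2R (ext_op (W (t + s)))
         (ext_op (W t) \<circ> tshift t \<circ> ext_op (W s) \<circ> tshift (- t)))"

end

theory Submission
  imports Defs
begin

text \<open>
  Work on \<open>L2R\<close> with the unitary group of shifts. A unitary \<open>G\<close> from \<open>H0 \<oplus> L2R\<close> onto \<open>L2R\<close> that
  restricts to the identity on functions supported in the negative half line yields the cocycle
  \<open>W t = G (U t \<oplus> tshift t) G\<^sup>-\<^sup>1 (tshift (- t))\<close>, and \<open>W t - I\<close> is of trace class as soon as \<open>G\<close> intertwines
  \<open>U t \<oplus> tshift t\<close> with \<open>tshift t\<close> up to trace class.

  Such a \<open>G\<close> absorbs \<open>H0\<close> by a Hilbert hotel argument. As the spectral measure is singular, it is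
  carried by open sets of arbitrarily small total length; the spectral projections of a cyclic
  vector onto their components form, for a decreasing sequence of such open sets, orthonormal bases
  \<open>e n\<close> of increasing subspaces \<open>M n\<close> of \<open>H0\<close> with dense union, and every \<open>e n k\<close> is an approximate
  eigenvector whose errors are summable over \<open>n\<close> and \<open>k\<close>. On the other side, long plane waves
  \<open>w n k\<close> with disjoint supports are approximate eigenvectors of the shifts for the same eigenvalues.
  Writing \<open>K n\<close> for the span of \<open>w n\<close>, identified with \<open>M n\<close>, the unitary \<open>G\<close> sends \<open>K n\<close> into
  \<open>K (n + 1)\<close> as \<open>M n\<close> sits in \<open>M (n + 1)\<close>, and the vacated space \<open>M (n + 1) \<ominus> M n\<close> is filled from \<open>H0\<close>.
\<close>

section \<open>Semi-inner product spaces and orthogonal series\<close>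

text \<open>Explicitly, \<open>G (h, f) = f + (\<Sum>n. X (n + 1) (h - P n h + Y n f - Y (n + 1)
  f))\<close>, where \<open>X n\<close> identifies \<open>M n\<close> with \<open>K n\<close>,
  \<open>Y n\<close> is its adjoint and \<open>P n\<close> projects onto \<open>M n\<close>. The
  commutator of \<open>G\<close> with the two groups is thus a series of commutators of single
  \<open>X n\<close> and \<open>Y n\<close>, which are controlled by the eigenvector errors. These
  errors are small for two different reasons: \<open>e n k\<close> lives on a short spectral
  interval, whereas a wave of length \<open>4 ^ m\<close> has amplitude \<open>1 / 2 ^ m\<close> and
  a shift alters it only near its two ends. The shifts of the half line are not unitary, so the work
  is done on the whole line and cut back at the end. Functions that vanish almost everywhere need
  not be zero, so vectors are compared through their inner products with all test vectors. The trace
  norm is handled in dual form, by sums of the moduli of \<open>hinn W (T (x i)) (z i)\<close> over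
  Bessel families; this is stable under weakly convergent sums and under contractions on either
  side. Approximation numbers appear only when such a bound is converted into the Schatten
  condition.\<close>

locale inner_space =
  fixes V :: "'v hspace"
  assumes zero_in [simp, intro]: "hzero V \<in> hcar V"
    and add_in [simp, intro]: "x \<in> hcar V \<Longrightarrow> y \<in> hcar V \<Longrightarrow> hadd V x y \<in> hcar V"
    and scl_in [simp, intro]: "x \<in> hcar V \<Longrightarrow> hscl V a x \<in> hcar V"
    and add_zero_l [simp]: "x \<in> hcar V \<Longrightarrow> hadd V (hzero V) x = x"
    and inn_add_l [simp]: "\<lbrakk>x \<in> hcar V; y \<in> hcar V; z \<in> hcar V\<rbrakk>
          \<Longrightarrow> hinn V (hadd V x y) z = hinn V x z + hinn V y z"
    and inn_scl_l [simp]: "\<lbrakk>x \<in> hcar V; z \<in> hcar V\<rbrakk> \<Longrightarrow> hinn V (hscl V a x) z = a * hinn V x z"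
    and inn_cnj: "\<lbrakk>x \<in> hcar V; y \<in> hcar V\<rbrakk> \<Longrightarrow> hinn V y x = cnj (hinn V x y)"
    and inn_ge: "x \<in> hcar V \<Longrightarrow> Re (hinn V x x) \<ge> 0"
begin

lemma inn_zero_l [simp]: "x \<in> hcar V \<Longrightarrow> hinn V (hzero V) x = 0"
  using inn_add_l[OF zero_in, of x x] by simp

lemma inn_zero_r [simp]: "x \<in> hcar V \<Longrightarrow> hinn V x (hzero V) = 0"
  by (metis complex_cnj_zero inn_cnj inn_zero_l zero_in)

lemma inn_add_r [simp]: "\<lbrakk>x \<in> hcar V; y \<in> hcar V; z \<in> hcar V\<rbrakk>
    \<Longrightarrow> hinn V x (hadd V y z) = hinn V x y + hinn V x z"
  using inn_cnj[of "hadd V y z" x] inn_cnj[of y x] inn_cnj[of z x] by simp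

lemma inn_scl_r [simp]: "\<lbrakk>x \<in> hcar V; y \<in> hcar V\<rbrakk> \<Longrightarrow> hinn V x (hscl V a y) = cnj a * hinn V x y"
  using inn_cnj[of "hscl V a y" x] inn_cnj[of y x] by simp

lemma sub_in [simp, intro]: "\<lbrakk>x \<in> hcar V; y \<in> hcar V\<rbrakk> \<Longrightarrow> hsub V x y \<in> hcar V"
  by (simp add: hsub_def)

lemma inn_sub_l [simp]: "\<lbrakk>x \<in> hcar V; y \<in> hcar V; z \<in> hcar V\<rbrakk>
    \<Longrightarrow> hinn V (hsub V x y) z = hinn V x z - hinn V y z"
  by (simp add: hsub_def)

lemma inn_sub_r [simp]: "\<lbrakk>x \<in> hcar V; y \<in> hcar V; z \<in> hcar V\<rbrakk>
    \<Longrightarrow> hinn V x (hsub V y z) = hinn V x y - hinn V x z"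
  by (simp add: hsub_def)

lemma norm_ge [simp]: "x \<in> hcar V \<Longrightarrow> 0 \<le> hnorm V x"
  by (simp add: hnorm_def inn_ge)

lemma norm2: "x \<in> hcar V \<Longrightarrow> (hnorm V x)\<^sup>2 = Re (hinn V x x)"
  by (simp add: hnorm_def inn_ge)

lemma inn_self: "x \<in> hcar V \<Longrightarrow> hinn V x x = of_real ((hnorm V x)\<^sup>2)"
  using inn_cnj[of x x] by (simp add: norm2 complex_eq_iff)

lemma cauchy_schwarz2:
  assumes [simp]: "x \<in> hcar V" "y \<in> hcar V"
  shows "(cmod (hinn V x y))\<^sup>2 \<le> (hnorm V x)\<^sup>2 * (hnorm V y)\<^sup>2"
proof -
  define b where "b = hinn V x y"
  have key: "0 \<le> (hnorm V x)\<^sup>2 - 2 * s * (cmod b)\<^sup>2 + s\<^sup>2 * (cmod b)\<^sup>2 * (hnorm V y)\<^sup>2" for s :: real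
  proof -
    define v where "v = hsub V x (hscl V (of_real s * b) y)"
    have v [simp]: "v \<in> hcar V" by (simp add: v_def)
    have yx: "hinn V y x = cnj b" unfolding b_def by (rule inn_cnj) auto
    have "hinn V v v = of_real ((hnorm V x)\<^sup>2) - 2 * of_real s * (b * cnj b)
             + (of_real s)\<^sup>2 * (b * cnj b) * of_real ((hnorm V y)\<^sup>2)"
    proof -
      have "hinn V v v = hinn V x x - of_real s * cnj b * b - of_real s * b * cnj b
          + of_real s * b * (of_real s * cnj b) * hinn V y y"
        unfolding v_def by (simp add: yx b_def[symmetric] algebra_simps)
      then show ?thesis unfolding inn_self[OF assms(1)] inn_self[OF assms(2)]
        by (simp add: power2_eq_square algebra_simps)
    qed
    also have "b * cnj b = of_real ((cmod b)\<^sup>2)" by (rule complex_norm_square[symmetric])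
    also have "of_real ((hnorm V x)\<^sup>2) - 2 * of_real s * of_real ((cmod b)\<^sup>2)
             + (of_real s)\<^sup>2 * of_real ((cmod b)\<^sup>2) * of_real ((hnorm V y)\<^sup>2) =
       complex_of_real ((hnorm V x)\<^sup>2 - 2 * s * (cmod b)\<^sup>2 + s\<^sup>2 * (cmod b)\<^sup>2 * (hnorm V y)\<^sup>2)"
      by simp
    finally show ?thesis using inn_ge[OF v] by (metis Re_complex_of_real)
  qed
  show ?thesis
  proof (cases "hnorm V y = 0")
    case True
    have "b = 0"
    proof (rule ccontr)
      assume "b \<noteq> 0"
      then have "(cmod b)\<^sup>2 > 0" by simp
      \<comment> \<open>For a null vector \<open>y\<close> the quadratic is affine in
        \<open>s\<close>, and this \<open>s\<close> gives it the value -1.\<close>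
      with key[of "((hnorm V x)\<^sup>2 + 1) / (2 * (cmod b)\<^sup>2)"] True show False by (simp add: field_simps)
    qed
    then show ?thesis by (simp add: b_def[symmetric])
  next
    case False
    then have p: "(hnorm V y)\<^sup>2 > 0" by simp
    have "(1 / (hnorm V y)\<^sup>2)\<^sup>2 * (cmod b)\<^sup>2 * (hnorm V y)\<^sup>2 = (cmod b)\<^sup>2 / (hnorm V y)\<^sup>2"
      using p by (simp add: power2_eq_square field_simps)
    with key[of "1 / (hnorm V y)\<^sup>2"] have "0 \<le> (hnorm V x)\<^sup>2 - (cmod b)\<^sup>2 / (hnorm V y)\<^sup>2" by simp
    with p show ?thesis by (simp add: b_def[symmetric] field_simps)
  qed
qed

lemma cauchy_schwarz:
  assumes "x \<in> hcar V" "y \<in> hcar V"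
  shows "cmod (hinn V x y) \<le> hnorm V x * hnorm V y"
  using cauchy_schwarz2[OF assms] assms by (auto intro: power2_le_imp_le simp: power_mult_distrib)

lemma norm_eq_0_inn:
  assumes "x \<in> hcar V" "hnorm V x = 0" "z \<in> hcar V"
  shows "hinn V x z = 0" "hinn V z x = 0"
  using cauchy_schwarz[of x z] cauchy_schwarz[of z x] assms by auto

text \<open>A null vector is orthogonal to everything by Cauchy-Schwarz; conversely the difference
  can be tested against itself. This turns equality modulo null vectors into identities between
  inner products, the form in which nearly every equality below is proved.\<close>

lemma heq_iff:
  assumes [simp]: "x \<in> hcar V" "y \<in> hcar V"
  shows "heq V x y \<longleftrightarrow> (\<forall>z\<in>hcar V. hinn V x z = hinn V y z)"
proof
  assume "heq V x y"
  then have "hnorm V (hsub V x y) = 0" by (simp add: heq_def hdist_def)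
  then show "\<forall>z\<in>hcar V. hinn V x z = hinn V y z"
    using norm_eq_0_inn[of "hsub V x y"] by auto
next
  assume "\<forall>z\<in>hcar V. hinn V x z = hinn V y z"
  then have "hinn V (hsub V x y) (hsub V x y) = 0" by simp
  then show "heq V x y" by (simp add: heq_def hdist_def hnorm_def)
qed

lemma heq_inn_l: "\<lbrakk>heq V x y; x \<in> hcar V; y \<in> hcar V; z \<in> hcar V\<rbrakk> \<Longrightarrow> hinn V x z = hinn V y z"
  by (simp add: heq_iff)

lemma heq_inn_r: "\<lbrakk>heq V x y; x \<in> hcar V; y \<in> hcar V; z \<in> hcar V\<rbrakk> \<Longrightarrow> hinn V z x = hinn V z y"
  using inn_cnj heq_inn_l by metis

lemma heq_refl [simp]: "x \<in> hcar V \<Longrightarrow> heq V x x"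
  by (simp add: heq_iff)

lemma heq_norm: "\<lbrakk>heq V x y; x \<in> hcar V; y \<in> hcar V\<rbrakk> \<Longrightarrow> hnorm V x = hnorm V y"
  unfolding hnorm_def by (metis heq_inn_l heq_inn_r)

lemma norm_zero [simp]: "hnorm V (hzero V) = 0"
  by (simp add: hnorm_def)

lemma norm_scl: "x \<in> hcar V \<Longrightarrow> hnorm V (hscl V a x) = cmod a * hnorm V x"
proof -
  assume x: "x \<in> hcar V"
  have "(hnorm V (hscl V a x))\<^sup>2 = Re ((a * cnj a) * hinn V x x)"
    using x by (simp add: norm2 algebra_simps)
  also have "a * cnj a = of_real ((cmod a)\<^sup>2)" by (rule complex_norm_square[symmetric])
  also have "Re (of_real ((cmod a)\<^sup>2) * hinn V x x) = (cmod a * hnorm V x)\<^sup>2"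
    using x by (simp add: norm2 power_mult_distrib)
  finally show ?thesis using x by (metis mult_nonneg_nonneg norm_ge norm_ge_zero power2_eq_imp_eq scl_in)
qed

lemma norm_add_le:
  assumes [simp]: "x \<in> hcar V" "y \<in> hcar V"
  shows "hnorm V (hadd V x y) \<le> hnorm V x + hnorm V y"
proof (rule power2_le_imp_le)
  have "(hnorm V (hadd V x y))\<^sup>2 = (hnorm V x)\<^sup>2 + 2 * Re (hinn V x y) + (hnorm V y)\<^sup>2"
    using inn_cnj[of x y] by (simp add: norm2)
  also have "Re (hinn V x y) \<le> hnorm V x * hnorm V y"
    using cauchy_schwarz[of x y] complex_Re_le_cmod order_trans by auto
  finally show "(hnorm V (hadd V x y))\<^sup>2 \<le> (hnorm V x + hnorm V y)\<^sup>2"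
    by (simp add: power2_sum)
qed simp

lemma norm_sub_le:
  "\<lbrakk>x \<in> hcar V; y \<in> hcar V\<rbrakk> \<Longrightarrow> hnorm V (hsub V x y) \<le> hnorm V x + hnorm V y"
  using norm_add_le[of x "hscl V (-1) y"] by (simp add: hsub_def norm_scl)

lemma dist_sym: "\<lbrakk>x \<in> hcar V; y \<in> hcar V\<rbrakk> \<Longrightarrow> hdist V x y = hdist V y x"
  unfolding hdist_def hnorm_def by (simp add: algebra_simps)

lemma norm_by_inn: "\<lbrakk>x \<in> hcar V; y \<in> hcar V; \<And>z. z \<in> hcar V \<Longrightarrow> hinn V x z = hinn V y z\<rbrakk> \<Longrightarrow> hnorm V x = hnorm V y"
  by (rule heq_norm) (simp_all add: heq_iff)

lemma dist_triangle:
  assumes [simp]: "x \<in> hcar V" "y \<in> hcar V" "z \<in> hcar V"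
  shows "hdist V x z \<le> hdist V x y + hdist V y z"
proof -
  have "hnorm V (hsub V x z) = hnorm V (hadd V (hsub V x y) (hsub V y z))"
    by (rule norm_by_inn) auto
  also have "\<dots> \<le> hnorm V (hsub V x y) + hnorm V (hsub V y z)" by (rule norm_add_le) auto
  finally show ?thesis by (simp add: hdist_def)
qed

lemma dist_ge [simp]: "\<lbrakk>x \<in> hcar V; y \<in> hcar V\<rbrakk> \<Longrightarrow> 0 \<le> hdist V x y"
  by (simp add: hdist_def)

lemma dist_zero: "x \<in> hcar V \<Longrightarrow> hdist V x (hzero V) = hnorm V x"
  unfolding hdist_def by (rule norm_by_inn) auto

lemma dist_heq: "\<lbrakk>heq V x x'; heq V y y'; x \<in> hcar V; x' \<in> hcar V; y \<in> hcar V; y' \<in> hcar V\<rbrakk>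
    \<Longrightarrow> hdist V x y = hdist V x' y'"
  unfolding hdist_def by (rule norm_by_inn) (auto simp: heq_iff)

lemma lincomb_in [simp, intro]: "(\<And>i. i < n \<Longrightarrow> ys i \<in> hcar V) \<Longrightarrow> lincomb V c ys n \<in> hcar V"
  by (induction n) auto

lemma inn_lincomb_l:
  "\<lbrakk>\<And>i. i < n \<Longrightarrow> ys i \<in> hcar V; z \<in> hcar V\<rbrakk>
    \<Longrightarrow> hinn V (lincomb V c ys n) z = (\<Sum>i<n. c i * hinn V (ys i) z)"
  by (induction n) auto

lemma inn_lincomb_r:
  "\<lbrakk>\<And>i. i < n \<Longrightarrow> ys i \<in> hcar V; z \<in> hcar V\<rbrakk>
    \<Longrightarrow> hinn V z (lincomb V c ys n) = (\<Sum>i<n. cnj (c i) * hinn V z (ys i))"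
  by (induction n) auto

lemma tendsto_inn_l:
  assumes "\<And>n. X n \<in> hcar V" "x \<in> hcar V" "z \<in> hcar V" "(\<lambda>n. hdist V (X n) x) \<longlonglongrightarrow> 0"
  shows "(\<lambda>n. hinn V (X n) z) \<longlonglongrightarrow> hinn V x z"
proof -
  have "norm (hinn V (X n) z - hinn V x z) \<le> hdist V (X n) x * hnorm V z" for n
    using cauchy_schwarz[of "hsub V (X n) x" z] assms by (simp add: hdist_def)
  moreover have "(\<lambda>n. hdist V (X n) x * hnorm V z) \<longlonglongrightarrow> 0"
    using tendsto_mult_right[OF assms(4), of "hnorm V z"] by simp
  ultimately have "(\<lambda>n. hinn V (X n) z - hinn V x z) \<longlonglongrightarrow> 0"
    by (rule Lim_null_comparison[OF always_eventually[OF allI]])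
  then show ?thesis by (simp add: LIM_zero_iff)
qed

end

section \<open>Completeness and weakly defined orthogonal series\<close>

locale hilbert = inner_space +
  assumes complete: "\<And>X. \<lbrakk>\<And>n. X n \<in> hcar V; \<And>e. e > 0 \<Longrightarrow> \<exists>N. \<forall>m\<ge>N. \<forall>n\<ge>N. hdist V (X m) (X n) < e\<rbrakk>
      \<Longrightarrow> \<exists>x\<in>hcar V. (\<lambda>n. hdist V (X n) x) \<longlonglongrightarrow> 0"

lemma semi_hilbert_imp_hilbert:
  assumes "semi_hilbert V" shows "hilbert V"
proof -
  note a = assms[unfolded semi_hilbert_def]
  have "\<forall>x\<in>hcar V. \<forall>y\<in>hcar V. hadd V x y \<in> hcar V" "\<forall>a. \<forall>x\<in>hcar V. hscl V a x \<in> hcar V"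
    "\<forall>x\<in>hcar V. \<forall>y\<in>hcar V. \<forall>z\<in>hcar V. hinn V (hadd V x y) z = hinn V x z + hinn V y z"
    "\<forall>a. \<forall>x\<in>hcar V. \<forall>y\<in>hcar V. hinn V (hscl V a x) y = a * hinn V x y"
    "\<forall>x\<in>hcar V. \<forall>y\<in>hcar V. hinn V y x = cnj (hinn V x y)" "\<forall>x\<in>hcar V. Re (hinn V x x) \<ge> 0"
    using a by - (elim conjE, assumption)+
  note b = this
  show ?thesis
  proof (unfold_locales, goal_cases)
    case (4 x)
    have "\<forall>x\<in>hcar V. hadd V (hzero V) x = x" using a by (elim conjE)
    then show ?case using 4 by blast
  next
    case (9 X)
    have "\<forall>X. (\<forall>n. X n \<in> hcar V) \<and>
          (\<forall>e>0. \<exists>N. \<forall>m\<ge>N. \<forall>n\<ge>N. hdist V (X m) (X n) < e)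
          \<longrightarrow> (\<exists>x\<in>hcar V. (\<lambda>n. hdist V (X n) x) \<longlonglongrightarrow> 0)" using a by (elim conjE)
    then show ?case using 9 by blast
  next
    case 1 show ?case using a by (elim conjE)
  qed (use b in blast)+
qed

text \<open>The sum is determined by its inner products only, hence up to a null vector. For
  \<open>orth_summable\<close> families the choice is meaningful by
  \<open>orth_sum_ex\<close>.\<close>

definition orth_sum :: "'v hspace \<Rightarrow> (nat \<Rightarrow> 'v) \<Rightarrow> 'v" where
  "orth_sum V g = (SOME v. v \<in> hcar V \<and> (\<forall>z\<in>hcar V. (\<lambda>n. hinn V (g n) z) sums hinn V v z))"

definition orth_summable :: "'v hspace \<Rightarrow> (nat \<Rightarrow> 'v) \<Rightarrow> bool" where
  "orth_summable V g \<longleftrightarrow> (\<forall>n. g n \<in> hcar V) \<and> (\<forall>m n. m \<noteq> n \<longrightarrow> hinn V (g m) (g n) = 0)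
     \<and> summable (\<lambda>n. (hnorm V (g n))\<^sup>2)"

context hilbert begin

text \<open>By orthogonality the squared distance of two partial sums is the difference of the
  corresponding partial sums of squared norms, so convergence of the numerical series gives a Cauchy
  sequence.\<close>

lemma orth_sum_ex:
  assumes "orth_summable V g"
  shows "\<exists>v\<in>hcar V. \<forall>z\<in>hcar V. (\<lambda>n. hinn V (g n) z) sums hinn V v z"
proof -
  have g [simp]: "\<And>n. g n \<in> hcar V" and o: "\<And>m n. m \<noteq> n \<Longrightarrow> hinn V (g m) (g n) = 0"
    and s: "summable (\<lambda>n. (hnorm V (g n))\<^sup>2)" using assms by (auto simp: orth_summable_def)
  define X where "X n = lincomb V (\<lambda>_. 1) g n" for n
  have X [simp]: "X n \<in> hcar V" for n by (simp add: X_def)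
  have iX: "z \<in> hcar V \<Longrightarrow> hinn V (X n) z = (\<Sum>i<n. hinn V (g i) z)" for n z
    by (simp add: X_def inn_lincomb_l)
  have iXr: "z \<in> hcar V \<Longrightarrow> hinn V z (X n) = (\<Sum>i<n. hinn V z (g i))" for n z
    by (simp add: X_def inn_lincomb_r)
  have XX: "hinn V (X m) (X n) = of_real (\<Sum>i<min m n. (hnorm V (g i))\<^sup>2)" for m n
  proof -
    have "hinn V (X m) (X n) = (\<Sum>i<m. \<Sum>j<n. hinn V (g i) (g j))"
      using iX[OF X, of m n] by (simp add: iXr)
    also have "\<dots> = (\<Sum>i<m. \<Sum>j<n. if j = i then of_real ((hnorm V (g i))\<^sup>2) else 0)"
      by (intro sum.cong refl) (auto simp: o inn_self)
    also have "\<dots> = (\<Sum>i<m. if i < n then of_real ((hnorm V (g i))\<^sup>2) else 0)"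
      by (intro sum.cong refl) (simp add: sum.delta)
    also have "\<dots> = (\<Sum>i\<in>{..<m} \<inter> {i. i < n}. of_real ((hnorm V (g i))\<^sup>2))"
      by (simp add: sum.If_cases)
    also have "{..<m} \<inter> {i. i < n} = {..<min m n}" by auto
    finally show ?thesis by simp
  qed
  have le: "(hdist V (X m) (X n))\<^sup>2 = \<bar>(\<Sum>i<m. (hnorm V (g i))\<^sup>2) - (\<Sum>i<n. (hnorm V (g i))\<^sup>2)\<bar>" for m n
  proof -
    have mono: "i \<le> j \<Longrightarrow> (\<Sum>i<i. (hnorm V (g i))\<^sup>2) \<le> (\<Sum>i<j. (hnorm V (g i))\<^sup>2)" for i j
      by (intro sum_mono2) auto
    show ?thesis unfolding hdist_def
      using mono[of m n] mono[of n m]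
      by (cases "m \<le> n") (simp_all add: norm2 XX min_def del: of_real_sum)
  qed
  have "\<exists>N. \<forall>m\<ge>N. \<forall>n\<ge>N. hdist V (X m) (X n) < e" if e: "e > 0" for e
  proof -
    have "Cauchy (\<lambda>n. \<Sum>i<n. (hnorm V (g i))\<^sup>2)"
      using s by (simp add: summable_iff_convergent convergent_Cauchy)
    then obtain N where N: "\<And>m n. m \<ge> N \<Longrightarrow> n \<ge> N \<Longrightarrow> dist (\<Sum>i<m. (hnorm V (g i))\<^sup>2) (\<Sum>i<n. (hnorm V (g i))\<^sup>2) < e\<^sup>2"
      using e unfolding Cauchy_def by (meson zero_less_power)
    have "hdist V (X m) (X n) < e" if "m \<ge> N" "n \<ge> N" for m n
      using N[OF that] le[of m n] e by (auto simp: dist_real_def intro: power2_less_imp_less)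
    then show ?thesis by blast
  qed
  with complete[of X] obtain v where v: "v \<in> hcar V" "(\<lambda>n. hdist V (X n) v) \<longlonglongrightarrow> 0" by auto
  have "(\<lambda>n. hinn V (g n) z) sums hinn V v z" if "z \<in> hcar V" for z
    using tendsto_inn_l[OF X v(1) that v(2)] that by (simp add: sums_def iX)
  with v show ?thesis by blast
qed

lemma
  assumes "orth_summable V g"
  shows orth_sum_in: "orth_sum V g \<in> hcar V"
    and orth_sum_sums: "z \<in> hcar V \<Longrightarrow> (\<lambda>n. hinn V (g n) z) sums hinn V (orth_sum V g) z"
  using someI_ex[OF orth_sum_ex[OF assms, unfolded Bex_def]] unfolding orth_sum_def by auto

lemma orth_sum_sums_r:
  assumes "orth_summable V g" "z \<in> hcar V"
  shows "(\<lambda>n. hinn V z (g n)) sums hinn V z (orth_sum V g)"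
proof -
  have "(\<lambda>n. cnj (hinn V (g n) z)) sums cnj (hinn V (orth_sum V g) z)"
    using orth_sum_sums[OF assms] by (simp only: sums_cnj)
  then show ?thesis using assms orth_sum_in[OF assms(1)] inn_cnj[of _ z] by (simp add: orth_summable_def)
qed

lemma orth_sum_inn_term:
  assumes "orth_summable V g"
  shows "hinn V (orth_sum V g) (g n) = of_real ((hnorm V (g n))\<^sup>2)"
proof -
  have g: "\<And>n. g n \<in> hcar V" and o: "\<And>m n. m \<noteq> n \<Longrightarrow> hinn V (g m) (g n) = 0"
    using assms by (auto simp: orth_summable_def)
  have "(\<lambda>m. if m = n then hinn V (g n) (g n) else 0) sums hinn V (g n) (g n)" by (rule sums_single)
  moreover have "(\<lambda>m. if m = n then hinn V (g n) (g n) else 0) = (\<lambda>m. hinn V (g m) (g n))"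
    using o by auto
  ultimately show ?thesis using orth_sum_sums[OF assms g[of n]] inn_self[OF g[of n]] sums_unique2 by metis
qed

lemma orth_sum_norm2: 
  assumes "orth_summable V g"
  shows "(\<lambda>n. (hnorm V (g n))\<^sup>2) sums (hnorm V (orth_sum V g))\<^sup>2"
proof -
  have "(\<lambda>n. hinn V (orth_sum V g) (g n)) sums hinn V (orth_sum V g) (orth_sum V g)"
    by (rule orth_sum_sums_r[OF assms orth_sum_in[OF assms]])
  then have "(\<lambda>n. complex_of_real ((hnorm V (g n))\<^sup>2)) sums of_real ((hnorm V (orth_sum V g))\<^sup>2)"
    by (simp only: orth_sum_inn_term[OF assms] inn_self[OF orth_sum_in[OF assms]])
  then show ?thesis by (simp only: sums_of_real_iff)
qed

end

lemma inner_space_dsum: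
  assumes "inner_space V" "inner_space W" shows "inner_space (hs_dsum V W)"
proof -
  interpret V: inner_space V by fact
  interpret W: inner_space W by fact
  show ?thesis
    by unfold_locales
      (auto simp: hs_dsum_def V.inn_ge W.inn_ge algebra_simps V.inn_cnj[symmetric] W.inn_cnj[symmetric])
qed

section \<open>Trace bounds and approximation numbers\<close>

lemma square_le_mult: "(a::real)\<^sup>2 \<le> a * b \<Longrightarrow> 0 \<le> a \<Longrightarrow> 0 \<le> b \<Longrightarrow> a \<le> b"
  using mult_left_le_imp_le[of a a b] by (cases "a = 0") (auto simp: power2_eq_square)

section \<open>Linear maps modulo null vectors and a dual form of the trace norm\<close>

definition weakly_linear :: "'v hspace \<Rightarrow> 'w hspace \<Rightarrow> ('v \<Rightarrow> 'w) \<Rightarrow> bool" where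
  "weakly_linear V W T \<longleftrightarrow> (\<forall>x\<in>hcar V. T x \<in> hcar W) \<and>
     (\<forall>x\<in>hcar V. \<forall>y\<in>hcar V. \<forall>z\<in>hcar W. hinn W (T (hadd V x y)) z = hinn W (T x) z + hinn W (T y) z) \<and>
     (\<forall>a. \<forall>x\<in>hcar V. \<forall>z\<in>hcar W. hinn W (T (hscl V a x)) z = a * hinn W (T x) z)"

definition contractive :: "'v hspace \<Rightarrow> 'w hspace \<Rightarrow> ('v \<Rightarrow> 'w) \<Rightarrow> bool" where
  "contractive V W T \<longleftrightarrow> weakly_linear V W T \<and> (\<forall>x\<in>hcar V. hnorm W (T x) \<le> hnorm V x)"

definition adjoint_pair :: "'v hspace \<Rightarrow> 'w hspace \<Rightarrow> ('v \<Rightarrow> 'w) \<Rightarrow> ('w \<Rightarrow> 'v) \<Rightarrow> bool" where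
  "adjoint_pair V W T T' \<longleftrightarrow> (\<forall>x\<in>hcar V. T x \<in> hcar W) \<and> (\<forall>y\<in>hcar W. T' y \<in> hcar V) \<and>
     (\<forall>x\<in>hcar V. \<forall>y\<in>hcar W. hinn W (T x) y = hinn V x (T' y))"

text \<open>The map from the coefficients \<open>a\<close> to the combination is a contraction.
  Unlike orthonormality, this property passes to images under contractions, which is why
  \<open>trace_bound\<close> quantifies over such families.\<close>

definition bessel_family :: "'v hspace \<Rightarrow> nat \<Rightarrow> (nat \<Rightarrow> 'v) \<Rightarrow> bool" where
  "bessel_family V N x \<longleftrightarrow> (\<forall>i<N. x i \<in> hcar V) \<and>
     (\<forall>a. (hnorm V (lincomb V a x N))\<^sup>2 \<le> (\<Sum>i<N. (cmod (a i))\<^sup>2))"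

text \<open>A trace norm of at most \<open>B\<close>, expressed by duality. Each instance involves
  finitely many inner products, so the bound survives weak limits.\<close>

definition trace_bound :: "'v hspace \<Rightarrow> 'w hspace \<Rightarrow> ('v \<Rightarrow> 'w) \<Rightarrow> real \<Rightarrow> bool" where
  "trace_bound V W T B \<longleftrightarrow> (\<forall>N x z. bessel_family V N x \<longrightarrow> bessel_family W N z \<longrightarrow> (\<Sum>i<N. cmod (hinn W (T (x i)) (z i))) \<le> B)"

definition on_or_zero :: "'v hspace \<Rightarrow> nat \<Rightarrow> (nat \<Rightarrow> 'v) \<Rightarrow> bool" where
  "on_or_zero V N x \<longleftrightarrow> (\<forall>i<N. x i \<in> hcar V \<and> hinn V (x i) (x i) \<in> {0, 1}) \<and>
     (\<forall>i<N. \<forall>j<N. i \<noteq> j \<longrightarrow> hinn V (x i) (x j) = 0)"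

lemma weakly_linearD:
  assumes "weakly_linear V W T" "x \<in> hcar V"
  shows "T x \<in> hcar W"
    and "y \<in> hcar V \<Longrightarrow> z \<in> hcar W \<Longrightarrow> hinn W (T (hadd V x y)) z = hinn W (T x) z + hinn W (T y) z"
    and "z \<in> hcar W \<Longrightarrow> hinn W (T (hscl V a x)) z = a * hinn W (T x) z"
  using assms unfolding weakly_linear_def by blast+

lemma adjoint_pairD:
  assumes "adjoint_pair V W T T'"
  shows "x \<in> hcar V \<Longrightarrow> T x \<in> hcar W" "y \<in> hcar W \<Longrightarrow> T' y \<in> hcar V"
    "x \<in> hcar V \<Longrightarrow> y \<in> hcar W \<Longrightarrow> hinn W (T x) y = hinn V x (T' y)"
  using assms unfolding adjoint_pair_def by blast+

lemma contractiveD: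
  assumes "contractive V W T"
  shows "weakly_linear V W T" "x \<in> hcar V \<Longrightarrow> hnorm W (T x) \<le> hnorm V x" "x \<in> hcar V \<Longrightarrow> T x \<in> hcar W"
  using assms unfolding contractive_def weakly_linear_def by blast+

lemma weakly_linear_sub:
  assumes "inner_space V" "inner_space W" "weakly_linear V W T" "x \<in> hcar V" "y \<in> hcar V" "z \<in> hcar W"
  shows "hinn W (T (hsub V x y)) z = hinn W (T x) z - hinn W (T y) z"
proof -
  interpret V: inner_space V by fact
  show ?thesis using assms by (simp add: hsub_def weakly_linearD)
qed

lemma weakly_linear_zero:
  assumes "inner_space V" "inner_space W" "weakly_linear V W T" "z \<in> hcar W"
  shows "hinn W (T (hzero V)) z = 0"
proof -
  interpret V: inner_space V by fact
  interpret W: inner_space W by fact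
  show ?thesis using weakly_linearD(2)[OF assms(3) V.zero_in V.zero_in assms(4)] by simp
qed

lemma weakly_linear_lincomb:
  assumes "inner_space V" "inner_space W" "weakly_linear V W T" "\<And>i. i < n \<Longrightarrow> x i \<in> hcar V" "z \<in> hcar W"
  shows "hinn W (T (lincomb V c x n)) z = (\<Sum>i<n. c i * hinn W (T (x i)) z)"
proof -
  interpret V: inner_space V by fact
  show ?thesis using assms(4)
    by (induction n) (simp_all add: weakly_linearD[OF assms(3)] weakly_linear_zero[OF assms(1-3)] assms(5))
qed

lemma blin_iff:
  assumes "inner_space V" "inner_space W"
  shows "blin V W T \<longleftrightarrow> weakly_linear V W T \<and> (\<exists>C. \<forall>x\<in>hcar V. hnorm W (T x) \<le> C * hnorm V x)"
proof -
  interpret V: inner_space V by fact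
  interpret W: inner_space W by fact
  show ?thesis unfolding blin_def weakly_linear_def by (auto simp: W.heq_iff)
qed

lemma contractive_blin: "\<lbrakk>inner_space V; inner_space W; contractive V W T\<rbrakk> \<Longrightarrow> blin V W T"
  unfolding blin_iff contractive_def by (auto intro!: exI[of _ 1])

lemma adjoint_pair_linear:
  assumes "inner_space V" "inner_space W" "adjoint_pair V W T T'"
  shows "weakly_linear V W T"
proof -
  interpret V: inner_space V by fact
  interpret W: inner_space W by fact
  show ?thesis unfolding weakly_linear_def using adjoint_pairD[OF assms(3)] by simp
qed

lemma adjoint_pair_sym:
  assumes "inner_space V" "inner_space W" "adjoint_pair V W T T'"
  shows "adjoint_pair W V T' T"
proof -
  interpret V: inner_space V by fact
  interpret W: inner_space W by fact
  have "hinn V (T' y) x = hinn W y (T x)" if "x \<in> hcar V" "y \<in> hcar W" for x y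
    using adjoint_pairD[OF assms(3)] that V.inn_cnj[of x "T' y"] W.inn_cnj[of "T x" y] by simp
  then show ?thesis using adjoint_pairD[OF assms(3)] by (simp add: adjoint_pair_def)
qed

text \<open>The squared norm of \<open>T' y\<close> is \<open>hinn W (T (T' y)) y\<close>;
  Cauchy-Schwarz and the bound for \<open>T\<close> then allow one factor to be cancelled.\<close>

lemma adjoint_pair_contractive:
  assumes "inner_space V" "inner_space W" "adjoint_pair V W T T'" "\<And>x. x \<in> hcar V \<Longrightarrow> hnorm W (T x) \<le> hnorm V x"
  shows "contractive V W T" "contractive W V T'"
proof -
  interpret V: inner_space V by fact
  interpret W: inner_space W by fact
  show "contractive V W T" using assms adjoint_pair_linear by (auto simp: contractive_def)
  have "hnorm V (T' y) \<le> hnorm W y" if y: "y \<in> hcar W" for y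
  proof (cases "hnorm V (T' y) = 0")
    case False
    have c: "T' y \<in> hcar V" "T (T' y) \<in> hcar W" using y adjoint_pairD[OF assms(3)] by auto
    have "of_real ((hnorm V (T' y))\<^sup>2) = hinn W (T (T' y)) y"
      using adjoint_pairD(3)[OF assms(3) c(1) y] c by (simp add: V.inn_self)
    then have "(hnorm V (T' y))\<^sup>2 = cmod (hinn W (T (T' y)) y)"
      by (metis norm_of_real abs_of_nonneg zero_le_power2)
    also have "\<dots> \<le> hnorm W (T (T' y)) * hnorm W y" using W.cauchy_schwarz[OF c(2) y] .
    also have "\<dots> \<le> hnorm V (T' y) * hnorm W y"
      using assms(4)[OF c(1)] y by (intro mult_right_mono) auto
    finally show ?thesis using False V.norm_ge[OF c(1)] by (simp add: power2_eq_square)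
  qed (use y in simp)
  then show "contractive W V T'" using adjoint_pair_linear[OF assms(2,1) adjoint_pair_sym[OF assms(1-3)]] by (simp add: contractive_def)
qed

text \<open>As \<open>T\<close> is additive only up to null vectors, \<open>R\<close> has to send
  vectors that differ by a null vector to vectors that differ by a null vector. This follows from
  its contractivity.\<close>

lemma contractive_comp:
  assumes "inner_space V" "inner_space W" "inner_space Z" "contractive V W T" "contractive W Z R"
  shows "contractive V Z (\<lambda>x. R (T x))"
proof -
  interpret V: inner_space V by fact
  interpret W: inner_space W by fact
  interpret Z: inner_space Z by fact
  have R: "hinn Z (R x) z = hinn Z (R y) z" if "x \<in> hcar W" "y \<in> hcar W" "z \<in> hcar Z" "heq W x y" for x y z
  proof -
    have "hnorm W (hsub W x y) = 0" using that by (simp add: heq_def hdist_def)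
    then have "hnorm Z (R (hsub W x y)) = 0"
      using contractiveD(2)[OF assms(5), of "hsub W x y"] contractiveD(3)[OF assms(5), of "hsub W x y"] that
        Z.norm_ge[of "R (hsub W x y)"] by (intro antisym) auto
    then have "hinn Z (R (hsub W x y)) z = 0"
      using Z.norm_eq_0_inn that contractiveD(3)[OF assms(5), of "hsub W x y"] by simp
    then show ?thesis using weakly_linear_sub[OF assms(2,3) contractiveD(1)[OF assms(5)] that(1-3)] by simp
  qed
  have T: "x \<in> hcar V \<Longrightarrow> T x \<in> hcar W" for x using contractiveD[OF assms(4)] by simp
  have l1: "heq W (T (hadd V x y)) (hadd W (T x) (T y))" if "x \<in> hcar V" "y \<in> hcar V" for x y
    using that T by (subst W.heq_iff) (auto simp: weakly_linearD[OF contractiveD(1)[OF assms(4)]])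
  have l2: "heq W (T (hscl V a x)) (hscl W a (T x))" if "x \<in> hcar V" for a x
    using that T by (subst W.heq_iff) (auto simp: weakly_linearD[OF contractiveD(1)[OF assms(4)]])
  show ?thesis unfolding contractive_def weakly_linear_def
    using T contractiveD[OF assms(5)] contractiveD[OF assms(4)] R[OF _ _ _ l1] R[OF _ _ _ l2]
    by (auto simp: weakly_linearD[OF contractiveD(1)[OF assms(5)]] intro: order_trans)
qed

context inner_space begin

lemma norm_lincomb_le:
  "(\<And>i. i < n \<Longrightarrow> ys i \<in> hcar V) \<Longrightarrow> hnorm V (lincomb V c ys n) \<le> (\<Sum>i<n. cmod (c i) * hnorm V (ys i))"
proof (induction n)
  case (Suc n)
  have "hnorm V (lincomb V c ys (Suc n)) \<le> hnorm V (lincomb V c ys n) + hnorm V (hscl V (c n) (ys n))"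
    using Suc.prems by (simp add: norm_add_le)
  then show ?case using Suc by (simp add: norm_scl)
qed simp

text \<open>The combination \<open>y\<close> with coefficients \<open>hinn V v (x i)\<close>
  satisfies \<open>hinn V v y = s\<close> and has squared norm at most \<open>s\<close>.
  Cauchy-Schwarz gives that \<open>s\<close> squared is at most \<open>s\<close> times the squared
  norm of \<open>v\<close>.\<close>

lemma bessel_ineq:
  assumes "bessel_family V N x" "v \<in> hcar V"
  shows "(\<Sum>i<N. (cmod (hinn V v (x i)))\<^sup>2) \<le> (hnorm V v)\<^sup>2" "(\<Sum>i<N. (cmod (hinn V (x i) v))\<^sup>2) \<le> (hnorm V v)\<^sup>2"
proof -
  define s where "s = (\<Sum>i<N. (cmod (hinn V v (x i)))\<^sup>2)"
  define y where "y = lincomb V (\<lambda>i. hinn V v (x i)) x N"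
  have x: "i < N \<Longrightarrow> x i \<in> hcar V" for i using assms by (simp add: bessel_family_def)
  have y: "y \<in> hcar V" unfolding y_def using x by blast
  have s0: "s \<ge> 0" by (simp add: s_def sum_nonneg)
  have ny: "(hnorm V y)\<^sup>2 \<le> s" using assms(1) unfolding bessel_family_def y_def s_def by blast
  have "hinn V v y = of_real s"
    unfolding y_def s_def using x assms(2)
    by (simp add: inn_lincomb_r complex_norm_square mult.commute del: of_real_power)
  then have "s \<le> hnorm V v * hnorm V y" using cauchy_schwarz[OF assms(2) y] s0 by simp
  then have "s\<^sup>2 \<le> (hnorm V v * hnorm V y)\<^sup>2" using s0 by (simp add: power_mono)
  also have "\<dots> \<le> (hnorm V v)\<^sup>2 * s" using ny by (simp add: power_mult_distrib mult_left_mono)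
  finally have "s \<le> (hnorm V v)\<^sup>2" using s0 by (cases "s = 0") (auto simp: power2_eq_square)
  then show "(\<Sum>i<N. (cmod (hinn V v (x i)))\<^sup>2) \<le> (hnorm V v)\<^sup>2" by (simp add: s_def)
  moreover have "(\<Sum>i<N. (cmod (hinn V (x i) v))\<^sup>2) = s" unfolding s_def
    by (intro sum.cong refl) (metis assms(2) complex_mod_cnj inn_cnj lessThan_iff x)
  ultimately show "(\<Sum>i<N. (cmod (hinn V (x i) v))\<^sup>2) \<le> (hnorm V v)\<^sup>2" by (simp add: s_def)
qed

lemma on_or_zero_bessel:
  assumes "on_or_zero V N x" shows "bessel_family V N x"
  unfolding bessel_family_def
proof (intro conjI allI impI)
  have x: "i < N \<Longrightarrow> x i \<in> hcar V" for i using assms by (simp add: on_or_zero_def)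
  then show "i < N \<Longrightarrow> x i \<in> hcar V" for i .
  fix a :: "nat \<Rightarrow> complex"
  have le: "cmod (hinn V (x i) (x i)) \<le> 1" if "i < N" for i using assms that by (auto simp: on_or_zero_def)
  have "hinn V (lincomb V a x N) (lincomb V a x N) = (\<Sum>i<N. a i * (\<Sum>j<N. cnj (a j) * hinn V (x i) (x j)))"
    using x by (subst inn_lincomb_l) (auto simp: inn_lincomb_r)
  also have "\<dots> = (\<Sum>i<N. a i * (\<Sum>j<N. if j = i then cnj (a i) * hinn V (x i) (x i) else 0))"
    using assms by (intro sum.cong refl arg_cong2[where f = "(*)"]) (auto simp: on_or_zero_def)
  also have "\<dots> = (\<Sum>i<N. a i * cnj (a i) * hinn V (x i) (x i))"
    by (intro sum.cong refl) (simp add: sum.delta mult.assoc)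
  finally have "(hnorm V (lincomb V a x N))\<^sup>2 = Re (\<Sum>i<N. a i * cnj (a i) * hinn V (x i) (x i))"
    using x by (simp add: norm2 lincomb_in)
  also have "\<dots> \<le> cmod (\<Sum>i<N. a i * cnj (a i) * hinn V (x i) (x i))" by (rule complex_Re_le_cmod)
  also have "\<dots> \<le> (\<Sum>i<N. (cmod (a i))\<^sup>2)"
  proof (rule sum_norm_le)
    fix i assume "i \<in> {..<N}"
    then show "cmod (a i * cnj (a i) * hinn V (x i) (x i)) \<le> (cmod (a i))\<^sup>2"
      using le[of i] mult_left_mono[of "cmod (hinn V (x i) (x i))" 1 "(cmod (a i))\<^sup>2"]
      by (simp add: norm_mult power2_eq_square)
  qed
  finally show "(hnorm V (lincomb V a x N))\<^sup>2 \<le> (\<Sum>i<N. (cmod (a i))\<^sup>2)" .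
qed

end

lemma bessel_family_contractive:
  assumes "inner_space V" "inner_space W" "contractive V W T" "bessel_family V N x"
  shows "bessel_family W N (\<lambda>i. T (x i))"
proof -
  interpret V: inner_space V by fact
  interpret W: inner_space W by fact
  have x: "i < N \<Longrightarrow> x i \<in> hcar V" for i using assms by (simp add: bessel_family_def)
  have T: "y \<in> hcar V \<Longrightarrow> T y \<in> hcar W" for y using contractiveD(3)[OF assms(3)] .
  have "(hnorm W (lincomb W a (\<lambda>i. T (x i)) N))\<^sup>2 \<le> (\<Sum>i<N. (cmod (a i))\<^sup>2)" for a
  proof -
    have "hnorm W (lincomb W a (\<lambda>i. T (x i)) N) = hnorm W (T (lincomb V a x N))"
      by (rule W.norm_by_inn)
        (use x T in \<open>auto simp: W.inn_lincomb_l weakly_linear_lincomb[OF assms(1,2) contractiveD(1)[OF assms(3)]]\<close>)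
    also have "\<dots> \<le> hnorm V (lincomb V a x N)" using x by (intro contractiveD(2)[OF assms(3)]) auto
    finally have "(hnorm W (lincomb W a (\<lambda>i. T (x i)) N))\<^sup>2 \<le> (hnorm V (lincomb V a x N))\<^sup>2"
      using x T by (intro power_mono) auto
    also have "\<dots> \<le> (\<Sum>i<N. (cmod (a i))\<^sup>2)" using assms(4) by (simp add: bessel_family_def)
    finally show ?thesis .
  qed
  then show ?thesis using x T by (simp add: bessel_family_def)
qed

lemma trace_bound_mono: "trace_bound V W T B \<Longrightarrow> B \<le> C \<Longrightarrow> trace_bound V W T C"
  unfolding trace_bound_def by (meson order_trans)

lemma trace_bound_add:
  assumes "trace_bound V W T B" "trace_bound V W R C"
    and "\<And>x z. x \<in> hcar V \<Longrightarrow> z \<in> hcar W \<Longrightarrow> cmod (hinn W (Q x) z) \<le> cmod (hinn W (T x) z) + cmod (hinn W (R x) z)"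
  shows "trace_bound V W Q (B + C)"
  unfolding trace_bound_def
proof (intro allI impI)
  fix N x z assume b: "bessel_family V N x" "bessel_family W N z"
  have "(\<Sum>i<N. cmod (hinn W (Q (x i)) (z i))) \<le> (\<Sum>i<N. cmod (hinn W (T (x i)) (z i)) + cmod (hinn W (R (x i)) (z i)))"
    using b by (intro sum_mono assms(3)) (auto simp: bessel_family_def)
  also have "\<dots> = (\<Sum>i<N. cmod (hinn W (T (x i)) (z i))) + (\<Sum>i<N. cmod (hinn W (R (x i)) (z i)))"
    by (rule sum.distrib)
  also have "\<dots> \<le> B + C" using assms(1,2) b unfolding trace_bound_def by (meson add_mono)
  finally show "(\<Sum>i<N. cmod (hinn W (Q (x i)) (z i))) \<le> B + C" .
qed

lemma trace_bound_cong:
  assumes "trace_bound V W T B" "\<And>x z. x \<in> hcar V \<Longrightarrow> z \<in> hcar W \<Longrightarrow> cmod (hinn W (Q x) z) = cmod (hinn W (T x) z)"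
  shows "trace_bound V W Q B"
proof -
  have "(\<Sum>i<N. cmod (hinn W (Q (x i)) (z i))) = (\<Sum>i<N. cmod (hinn W (T (x i)) (z i)))"
    if "bessel_family V N x" "bessel_family W N z" for N x z
    using that by (intro sum.cong refl assms(2)) (auto simp: bessel_family_def)
  then show ?thesis using assms(1) by (simp add: trace_bound_def)
qed

text \<open>Weak convergence is enough, because each finite sum in \<open>trace_bound\<close> passes
  to the limit: the bound is lower semicontinuous.\<close>

lemma trace_bound_sums:
  assumes "\<And>n. trace_bound V W (T n) (b n)" "summable b"
    and "\<And>x z. x \<in> hcar V \<Longrightarrow> z \<in> hcar W \<Longrightarrow> (\<lambda>n. hinn W (T n x) z) sums hinn W (Q x) z"
  shows "trace_bound V W Q (suminf b)"
  unfolding trace_bound_def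
proof (intro allI impI)
  fix N x z assume b: "bessel_family V N x" "bessel_family W N z"
  have b0: "0 \<le> b n" for n
    by (rule order_trans[OF sum_nonneg assms(1)[of n, unfolded trace_bound_def, rule_format, OF b]]) simp
  have "(\<lambda>m. \<Sum>i<N. cmod (\<Sum>n<m. hinn W (T n (x i)) (z i))) \<longlonglongrightarrow> (\<Sum>i<N. cmod (hinn W (Q (x i)) (z i)))"
    using b assms(3) by (intro tendsto_sum tendsto_norm) (auto simp: bessel_family_def sums_def)
  then show "(\<Sum>i<N. cmod (hinn W (Q (x i)) (z i))) \<le> suminf b"
  proof (rule LIMSEQ_le_const2, intro exI allI impI)
    fix m
    have "(\<Sum>i<N. cmod (\<Sum>n<m. hinn W (T n (x i)) (z i))) \<le> (\<Sum>i<N. \<Sum>n<m. cmod (hinn W (T n (x i)) (z i)))"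
      by (intro sum_mono norm_sum)
    also have "\<dots> = (\<Sum>n<m. \<Sum>i<N. cmod (hinn W (T n (x i)) (z i)))" by (rule sum.swap)
    also have "\<dots> \<le> (\<Sum>n<m. b n)" using assms(1) b by (intro sum_mono) (auto simp: trace_bound_def)
    also have "\<dots> \<le> suminf b" using b0 assms(2) by (intro sum_le_suminf) auto
    finally show "(\<Sum>i<N. cmod (\<Sum>n<m. hinn W (T n (x i)) (z i))) \<le> suminf b" .
  qed
qed

lemma trace_bound_right:
  assumes "inner_space U" "inner_space V" "trace_bound V W T B" "contractive U V A"
  shows "trace_bound U W (\<lambda>x. T (A x)) B"
  unfolding trace_bound_def
proof (intro allI impI)
  fix N x z assume "bessel_family U N x" "bessel_family W N z"
  then show "(\<Sum>i<N. cmod (hinn W (T (A (x i))) (z i))) \<le> B"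
    using assms(3)[unfolded trace_bound_def, rule_format, OF bessel_family_contractive[OF assms(1,2,4)]] by blast
qed

lemma trace_bound_left:
  assumes "inner_space W" "inner_space W'" "trace_bound V W T B" "contractive W' W A"
    and "\<And>x z. x \<in> hcar V \<Longrightarrow> z \<in> hcar W' \<Longrightarrow> hinn W' (R x) z = hinn W (T x) (A z)"
  shows "trace_bound V W' R B"
  unfolding trace_bound_def
proof (intro allI impI)
  fix N x z assume b: "bessel_family V N x" "bessel_family W' N z"
  then have "(\<Sum>i<N. cmod (hinn W' (R (x i)) (z i))) = (\<Sum>i<N. cmod (hinn W (T (x i)) (A (z i))))"
    using assms(5) by (intro sum.cong refl) (auto simp: bessel_family_def)
  also have "\<dots> \<le> B" 
    using assms(3)[unfolded trace_bound_def, rule_format, OF b(1) bessel_family_contractive[OF assms(2,1,4) b(2)]] .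
  finally show "(\<Sum>i<N. cmod (hinn W' (R (x i)) (z i))) \<le> B" .
qed

text \<open>Cauchy-Schwarz for the sum over \<open>i\<close> separates the two sides, and Bessel's
  inequality bounds each of them.\<close>

lemma trace_bound_rank1:
  assumes "inner_space V" "inner_space W" "v \<in> hcar V" "y \<in> hcar W"
    and "\<And>x z. x \<in> hcar V \<Longrightarrow> z \<in> hcar W \<Longrightarrow> hinn W (T x) z = hinn V x v * hinn W y z"
  shows "trace_bound V W T (hnorm V v * hnorm W y)"
  unfolding trace_bound_def
proof (intro allI impI)
  interpret V: inner_space V by fact
  interpret W: inner_space W by fact
  fix N x z assume b: "bessel_family V N x" "bessel_family W N z"
  have "(\<Sum>i<N. cmod (hinn W (T (x i)) (z i))) = (\<Sum>i<N. \<bar>cmod (hinn V (x i) v)\<bar> * \<bar>cmod (hinn W y (z i))\<bar>)"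
    using b assms(5) by (intro sum.cong refl) (auto simp: bessel_family_def norm_mult)
  also have "\<dots> \<le> L2_set (\<lambda>i. cmod (hinn V (x i) v)) {..<N} * L2_set (\<lambda>i. cmod (hinn W y (z i))) {..<N}"
    by (rule L2_set_mult_ineq)
  also have "\<dots> \<le> hnorm V v * hnorm W y"
    unfolding L2_set_def
    using V.bessel_ineq(2)[OF b(1) assms(3)] W.bessel_ineq(1)[OF b(2) assms(4)] assms(3,4)
    by (intro mult_mono real_le_lsqrt sum_nonneg) (auto intro!: sum_nonneg)
  finally show "(\<Sum>i<N. cmod (hinn W (T (x i)) (z i))) \<le> hnorm V v * hnorm W y" .
qed

section \<open>Approximation numbers and their control by the trace bound\<close>

lemma sum_lessThan_add: "(\<Sum>i<N + M. f i) = (\<Sum>i<N. f i) + (\<Sum>i<M. f (N + i :: nat) :: 'a :: comm_monoid_add)"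
  by (induction M) (simp_all add: add.assoc)

lemma blin_lincomb:
  assumes "inner_space V" "inner_space W" "\<And>i. i < n \<Longrightarrow> ys i \<in> hcar W"
    and "\<And>i x y. \<lbrakk>i < n; x \<in> hcar V; y \<in> hcar V\<rbrakk> \<Longrightarrow> \<phi> i (hadd V x y) = \<phi> i x + \<phi> i y"
    and "\<And>i a x. \<lbrakk>i < n; x \<in> hcar V\<rbrakk> \<Longrightarrow> \<phi> i (hscl V a x) = a * \<phi> i x"
    and "\<And>i x. \<lbrakk>i < n; x \<in> hcar V\<rbrakk> \<Longrightarrow> cmod (\<phi> i x) \<le> K i * hnorm V x"
  shows "blin V W (\<lambda>x. lincomb W (\<lambda>i. \<phi> i x) ys n)"
  unfolding blin_iff[OF assms(1,2)] weakly_linear_def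
proof (intro conjI ballI allI)
  interpret V: inner_space V by fact
  interpret W: inner_space W by fact
  show "x \<in> hcar V \<Longrightarrow> lincomb W (\<lambda>i. \<phi> i x) ys n \<in> hcar W" for x using assms(3) by blast
  show "hinn W (lincomb W (\<lambda>i. \<phi> i (hadd V x y)) ys n) z =
      hinn W (lincomb W (\<lambda>i. \<phi> i x) ys n) z + hinn W (lincomb W (\<lambda>i. \<phi> i y) ys n) z"
    if "x \<in> hcar V" "y \<in> hcar V" "z \<in> hcar W" for x y z
    using that assms(3,4) by (simp add: W.inn_lincomb_l algebra_simps sum.distrib)
  show "hinn W (lincomb W (\<lambda>i. \<phi> i (hscl V a x)) ys n) z = a * hinn W (lincomb W (\<lambda>i. \<phi> i x) ys n) z"
    if "x \<in> hcar V" "z \<in> hcar W" for a x z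
    using that assms(3,5) by (simp add: W.inn_lincomb_l mult.assoc sum_distrib_left)
  have "hnorm W (lincomb W (\<lambda>i. \<phi> i x) ys n) \<le> (\<Sum>i<n. K i * hnorm W (ys i)) * hnorm V x" if "x \<in> hcar V" for x
  proof -
    have "hnorm W (lincomb W (\<lambda>i. \<phi> i x) ys n) \<le> (\<Sum>i<n. cmod (\<phi> i x) * hnorm W (ys i))"
      using assms(3) by (rule W.norm_lincomb_le)
    also have "\<dots> \<le> (\<Sum>i<n. K i * hnorm V x * hnorm W (ys i))"
      using assms(3,6) that by (intro sum_mono mult_right_mono) auto
    also have "\<dots> = (\<Sum>i<n. K i * hnorm W (ys i)) * hnorm V x"
      by (simp add: sum_distrib_right sum_distrib_left algebra_simps)
    finally show ?thesis .
  qed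
  then show "\<exists>C. \<forall>x\<in>hcar V. hnorm W (lincomb W (\<lambda>i. \<phi> i x) ys n) \<le> C * hnorm V x" by blast
qed

lemma blin_sub:
  assumes "inner_space V" "inner_space W" "blin V W T" "blin V W R"
  shows "blin V W (\<lambda>x. hsub W (T x) (R x))"
proof -
  interpret V: inner_space V by fact
  interpret W: inner_space W by fact
  obtain C D where C: "\<And>x. x \<in> hcar V \<Longrightarrow> hnorm W (T x) \<le> C * hnorm V x"
    and D: "\<And>x. x \<in> hcar V \<Longrightarrow> hnorm W (R x) \<le> D * hnorm V x"
    using assms(3,4) blin_iff[OF assms(1,2)] by blast
  have l: "weakly_linear V W T" "weakly_linear V W R" using assms(3,4) blin_iff[OF assms(1,2)] by blast+
  have "hnorm W (hsub W (T x) (R x)) \<le> (C + D) * hnorm V x" if "x \<in> hcar V" for x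
    using W.norm_sub_le[of "T x" "R x"] C[OF that] D[OF that] l that by (auto simp: weakly_linearD algebra_simps)
  moreover have "weakly_linear V W (\<lambda>x. hsub W (T x) (R x))"
    unfolding weakly_linear_def by (auto simp: weakly_linearD[OF l(1)] weakly_linearD[OF l(2)] algebra_simps)
  ultimately show ?thesis using blin_iff[OF assms(1,2)] by blast
qed

text \<open>\<open>opnorm\<close> is a supremum of real numbers, so a bound and a member of the set
  must be supplied before anything can be concluded from it.\<close>

lemma opnorm_set:
  assumes "inner_space V" "inner_space W" "blin V W T"
  shows "bdd_above {hnorm W (T x) | x. x \<in> hcar V \<and> hnorm V x \<le> 1}" (is "bdd_above ?S")
    and "0 \<in> {hnorm W (T x) | x. x \<in> hcar V \<and> hnorm V x \<le> 1}" and "opnorm V W T \<ge> 0"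
proof -
  interpret V: inner_space V by fact
  interpret W: inner_space W by fact
  obtain C where C: "\<And>x. x \<in> hcar V \<Longrightarrow> hnorm W (T x) \<le> C * hnorm V x"
    using assms(3) blin_iff[OF assms(1,2)] by blast
  have T: "\<And>x. x \<in> hcar V \<Longrightarrow> T x \<in> hcar W"
    using assms(3) blin_iff[OF assms(1,2)] by (auto simp: weakly_linear_def)
  have "hnorm W (T x) \<le> \<bar>C\<bar>" if "x \<in> hcar V" "hnorm V x \<le> 1" for x
  proof -
    have "C * hnorm V x \<le> \<bar>C\<bar> * 1"
      using that by (intro mult_mono) auto
    then show ?thesis using C[OF that(1)] by simp
  qed
  then show b: "bdd_above ?S" by (intro bdd_aboveI[of _ "\<bar>C\<bar>"]) auto
  have "hnorm W (T (hzero V)) = 0" using C[of "hzero V"] T[of "hzero V"] W.norm_ge[of "T (hzero V)"]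
    by (intro antisym) auto
  then show m: "0 \<in> ?S" by (auto intro: exI[of _ "hzero V"])
  show "opnorm V W T \<ge> 0" unfolding opnorm_def by (rule cSup_upper[OF m b])
qed

lemma sing_num_le:
  assumes "inner_space V" "inner_space W" "blin V W T" "blin V W F" "rank_le V W F n"
  shows "sing_num V W T n \<le> opnorm V W (\<lambda>x. hsub W (T x) (F x))"
  unfolding sing_num_def
  by (rule cInf_lower) (use assms opnorm_set(3)[OF assms(1,2)] blin_sub[OF assms(1,2)] in \<open>auto intro!: bdd_belowI[of _ 0]\<close>)

lemma rank_le_Suc:
  assumes "inner_space V" "inner_space W" "blin V W F" "rank_le V W F n"
  shows "rank_le V W F (Suc n)"
proof -
  interpret W: inner_space W by fact
  obtain ys where ys: "\<And>i. i < n \<Longrightarrow> ys i \<in> hcar W" and e: "\<And>x. x \<in> hcar V \<Longrightarrow> \<exists>c. heq W (F x) (lincomb W c ys n)"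
    using assms(4) unfolding rank_le_def by blast
  define zs where "zs = ys(n := hzero W)"
  have zs: "zs i \<in> hcar W" if "i < Suc n" for i using that ys by (auto simp: zs_def)
  have F: "F x \<in> hcar W" if "x \<in> hcar V" for x using assms(3) that by (auto simp: blin_def)
  have "heq W (F x) (lincomb W c zs (Suc n))" if "x \<in> hcar V" "heq W (F x) (lincomb W c ys n)" for x c
  proof -
    have "hinn W (lincomb W c ys n) z = hinn W (lincomb W c zs (Suc n)) z" if "z \<in> hcar W" for z
      using that W.inn_lincomb_l[of n ys z c] W.inn_lincomb_l[of "Suc n" zs z c] ys zs
      by (simp add: zs_def del: lincomb.simps)
    moreover have "lincomb W c ys n \<in> hcar W" "lincomb W c zs (Suc n) \<in> hcar W"
      using ys zs by (auto simp del: lincomb.simps)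
    ultimately show ?thesis using that F[OF that(1)] by (simp add: W.heq_iff del: lincomb.simps)
  qed
  then show ?thesis unfolding rank_le_def using zs e by (intro exI[of _ zs]) blast
qed

lemma rank_le_zero:
  assumes "inner_space V" "inner_space W"
  shows "blin V W (\<lambda>x. hzero W)" "rank_le V W (\<lambda>x. hzero W) n"
proof -
  interpret V: inner_space V by fact
  interpret W: inner_space W by fact
  show b: "blin V W (\<lambda>x. hzero W)"
    unfolding blin_iff[OF assms] by (auto simp: weakly_linear_def intro!: exI[of _ 0])
  have "rank_le V W (\<lambda>x. hzero W) 0" by (auto simp: rank_le_def)
  then show "rank_le V W (\<lambda>x. hzero W) n"
    by (induction n) (auto intro: rank_le_Suc[OF assms b])
qed

lemma sing_num_props:
  assumes "inner_space V" "inner_space W" "blin V W T"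
  shows "sing_num V W T n \<ge> 0" "sing_num V W T (Suc n) \<le> sing_num V W T n"
proof -
  let ?S = "\<lambda>n. {opnorm V W (\<lambda>x. hsub W (T x) (F x)) | F. blin V W F \<and> rank_le V W F n}"
  have ne: "?S n \<noteq> {}" for n using rank_le_zero[OF assms(1,2)] by blast
  have g: "\<And>x. x \<in> ?S n \<Longrightarrow> 0 \<le> x" for n
    using opnorm_set(3)[OF assms(1,2)] blin_sub[OF assms(1-3)] by blast
  show "sing_num V W T n \<ge> 0" unfolding sing_num_def by (rule cInf_greatest[OF ne g])
  show "sing_num V W T (Suc n) \<le> sing_num V W T n" unfolding sing_num_def
    by (rule cInf_superset_mono[OF ne]) (use g rank_le_Suc[OF assms(1,2)] in \<open>auto intro!: bdd_belowI[of _ 0]\<close>)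
qed

lemma on_or_zero_extend:
  assumes "inner_space V" "on_or_zero V N x" "y \<in> hcar V" "hinn V y y \<in> {0, 1}" "\<And>i. i < N \<Longrightarrow> hinn V y (x i) = 0"
  shows "on_or_zero V (Suc N) (x(N := y))"
proof -
  interpret V: inner_space V by fact
  have x: "\<And>i. i < N \<Longrightarrow> x i \<in> hcar V" using assms(2) by (simp add: on_or_zero_def)
  have "hinn V (x i) y = 0" if "i < N" for i
    using V.inn_cnj[OF assms(3) x[OF that]] assms(5)[OF that] by simp
  then show ?thesis using assms(2-5) by (auto simp: on_or_zero_def less_Suc_eq)
qed

lemma normalize:
  assumes "inner_space V" "y \<in> hcar V" "hnorm V y > 0"
  shows "hinn V (hscl V (of_real (1 / hnorm V y)) y) (hscl V (of_real (1 / hnorm V y)) y) = 1"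
proof -
  interpret V: inner_space V by fact
  have "hinn V (hscl V (of_real (1 / hnorm V y)) y) (hscl V (of_real (1 / hnorm V y)) y)
      = of_real (1 / hnorm V y) * of_real (1 / hnorm V y) * hinn V y y"
    using assms(2) by simp
  also have "\<dots> = 1" unfolding V.inn_self[OF assms(2)] using assms(3) by (simp add: power2_eq_square)
  finally show ?thesis .
qed

lemma on_or_zero_proj:
  assumes "inner_space V" "on_or_zero V N x" "y \<in> hcar V" "k < N"
  shows "hinn V (lincomb V (\<lambda>i. hinn V y (x i)) x N) (x k) = hinn V y (x k)"
proof -
  interpret V: inner_space V by fact
  have x: "\<And>i. i < N \<Longrightarrow> x i \<in> hcar V" using assms(2) by (simp add: on_or_zero_def)
  have "hinn V (lincomb V (\<lambda>i. hinn V y (x i)) x N) (x k) = (\<Sum>i<N. hinn V y (x i) * hinn V (x i) (x k))"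
    using x assms(4) by (intro V.inn_lincomb_l) auto
  also have "\<dots> = (\<Sum>i<N. if i = k then hinn V y (x k) * hinn V (x k) (x k) else 0)"
    using assms(2,4) by (intro sum.cong refl) (auto simp: on_or_zero_def)
  also have "\<dots> = hinn V y (x k) * hinn V (x k) (x k)" using assms(4) by simp
  also have "\<dots> = hinn V y (x k)"
  proof (cases "hinn V (x k) (x k) = 0")
    case True
    then have "hnorm V (x k) = 0" by (simp add: hnorm_def)
    then show ?thesis using V.norm_eq_0_inn(2)[OF x[OF assms(4)]] assms(3) by simp
  qed (use assms in \<open>auto simp: on_or_zero_def\<close>)
  finally show ?thesis .
qed

text \<open>Two orthonormal systems are grown greedily: having split off the spans of the first \<open>N\<close> vectors
  on both sides, which costs rank \<open>2 N\<close>, the remainder of the operator still has norm at least the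
  approximation number with index \<open>2 N\<close>, so a nearly maximising vector yields the next pair.\<close>

lemma sing_num_orthonormal_bound:
  assumes "inner_space V" "inner_space W" "blin V W T"
  shows "\<exists>x z. on_or_zero V N x \<and> on_or_zero W N z \<and> (\<forall>n<N. sing_num V W T (2 * n) \<le> 2 * cmod (hinn W (T (x n)) (z n)))"
proof (induction N)
  case 0
  show ?case by (simp add: on_or_zero_def)
next
  case (Suc N)
  interpret V: inner_space V by fact
  interpret W: inner_space W by fact
  from Suc obtain x z where xz: "on_or_zero V N x" "on_or_zero W N z"
    and le: "\<And>n. n < N \<Longrightarrow> sing_num V W T (2 * n) \<le> 2 * cmod (hinn W (T (x n)) (z n))" by blast
  have x: "\<And>i. i < N \<Longrightarrow> x i \<in> hcar V" and z: "\<And>i. i < N \<Longrightarrow> z i \<in> hcar W" using xz by (auto simp: on_or_zero_def)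
  have lT: "weakly_linear V W T" using assms(3) blin_iff[OF assms(1,2)] by blast
  note T = weakly_linearD(1)[OF lT]
  obtain C where C: "\<And>x. x \<in> hcar V \<Longrightarrow> hnorm W (T x) \<le> C * hnorm V x"
    using assms(3) blin_iff[OF assms(1,2)] by blast
  define \<sigma> where "\<sigma> = sing_num V W T (2 * N)"
  have "\<exists>x' z'. x' \<in> hcar V \<and> z' \<in> hcar W \<and> hinn V x' x' \<in> {0, 1} \<and> hinn W z' z' \<in> {0, 1} \<and>
     (\<forall>i<N. hinn V x' (x i) = 0) \<and> (\<forall>i<N. hinn W z' (z i) = 0) \<and> \<sigma> \<le> 2 * cmod (hinn W (T x') z')"
  proof (cases "\<sigma> = 0")
    case True
    then show ?thesis using x z by (intro exI[of _ "hzero V"] exI[of _ "hzero W"]) auto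
  next
    case False
    then have \<sigma>: "\<sigma> > 0" using sing_num_props(1)[OF assms, of "2 * N"] by (simp add: \<sigma>_def)
    define P where "P y = lincomb V (\<lambda>i. hinn V y (x i)) x N" for y
    define y' where "y' y = hsub V y (P y)" for y
    \<comment> \<open>With \<open>P\<close> and \<open>Q\<close> the projections onto the spans of
      the \<open>x i\<close> and the \<open>z i\<close>, \<open>F\<close> is
      \<open>T P + Q T (1 - P)\<close>, so that \<open>T - F = (1 - Q) T (1 - P)\<close>. The range
      of \<open>F\<close> lies in the span of the \<open>T (x i)\<close> and the \<open>z i\<close>,
      whence the rank \<open>2 * N\<close>.\<close>
    define ys where "ys i = (if i < N then T (x i) else z (i - N))" for i
    define \<phi> where "\<phi> i y = (if i < N then hinn V y (x i) else hinn W (T (y' y)) (z (i - N)))" for i y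
    define F where "F y = lincomb W (\<lambda>i. \<phi> i y) ys (2 * N)" for y
    have Pin [simp]: "y \<in> hcar V \<Longrightarrow> P y \<in> hcar V" for y unfolding P_def using x by blast
    have y'in [simp]: "y \<in> hcar V \<Longrightarrow> y' y \<in> hcar V" for y by (simp add: y'_def)
    have TP: "hinn W (T (P y)) u = (\<Sum>i<N. hinn V y (x i) * hinn W (T (x i)) u)"
      if "u \<in> hcar W" for y u unfolding P_def by (rule weakly_linear_lincomb[OF assms(1,2) lT x that])
    have Ty': "hinn W (T (y' y)) u = hinn W (T y) u - hinn W (T (P y)) u" if "y \<in> hcar V" "u \<in> hcar W" for y u
      unfolding y'_def using that by (intro weakly_linear_sub[OF assms(1,2) lT]) auto
    have ys: "ys i \<in> hcar W" if "i < 2 * N" for i using that x z T by (auto simp: ys_def)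
    have \<phi>b: "cmod (\<phi> i y) \<le> (if i < N then hnorm V (x i) else (\<bar>C\<bar> + (\<Sum>j<N. hnorm V (x j) * hnorm W (T (x j)))) * hnorm W (z (i - N))) * hnorm V y"
      if "i < 2 * N" "y \<in> hcar V" for i y
    proof (cases "i < N")
      case True
      then show ?thesis using V.cauchy_schwarz[OF that(2) x[OF True]] by (simp add: \<phi>_def mult.commute)
    next
      case False
      then have j: "i - N < N" using that by auto
      have zc: "z (i - N) \<in> hcar W" using z[OF j] .
      have "cmod (\<phi> i y) \<le> cmod (hinn W (T y) (z (i - N))) + cmod (hinn W (T (P y)) (z (i - N)))"
        using False Ty'[OF that(2) zc] norm_triangle_ineq4 by (simp add: \<phi>_def)
      also have "cmod (hinn W (T y) (z (i - N))) \<le> (\<bar>C\<bar> * hnorm V y) * hnorm W (z (i - N))"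
      proof (rule order_trans[OF W.cauchy_schwarz[OF T[OF that(2)] zc]], rule mult_right_mono)
        show "hnorm W (T y) \<le> \<bar>C\<bar> * hnorm V y"
          by (rule order_trans[OF C[OF that(2)]], rule mult_right_mono) (use that in auto)
      qed (use zc in simp)
      also have "cmod (hinn W (T (P y)) (z (i - N))) \<le> (\<Sum>j<N. hnorm V (x j) * hnorm W (T (x j))) * hnorm V y * hnorm W (z (i - N))"
        unfolding TP[OF zc] sum_distrib_right
      proof (rule sum_norm_le)
        fix j assume "j \<in> {..<N}"
        then have xj: "x j \<in> hcar V" using x by simp
        show "cmod (hinn V y (x j) * hinn W (T (x j)) (z (i - N))) \<le> hnorm V (x j) * hnorm W (T (x j)) * hnorm V y * hnorm W (z (i - N))"
          using mult_mono[OF V.cauchy_schwarz[OF that(2) xj] W.cauchy_schwarz[OF T[OF xj] zc]] xj that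
          by (simp add: norm_mult algebra_simps)
      qed
      finally show ?thesis using False by (simp add: algebra_simps)
    qed
    have Py: "hinn V (P y) u = (\<Sum>i<N. hinn V y (x i) * hinn V (x i) u)" if "u \<in> hcar V" for y u
      unfolding P_def using x that by (rule V.inn_lincomb_l)
    have bF: "blin V W F" unfolding F_def
    proof (rule blin_lincomb[OF assms(1,2) ys _ _ \<phi>b])
      show "\<phi> i (hadd V u v) = \<phi> i u + \<phi> i v" if "i < 2 * N" "u \<in> hcar V" "v \<in> hcar V" for i u v
      proof (cases "i < N")
        case False
        then have "z (i - N) \<in> hcar W" using that z[of "i - N"] by auto
        then show ?thesis using False that x
          by (simp add: \<phi>_def Ty' TP weakly_linearD[OF lT] sum.distrib algebra_simps)
      qed (use that x in \<open>simp add: \<phi>_def\<close>)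
      show "\<phi> i (hscl V a u) = a * \<phi> i u" if "i < 2 * N" "u \<in> hcar V" for i u a
      proof (cases "i < N")
        case False
        then have "z (i - N) \<in> hcar W" using that z[of "i - N"] by auto
        then show ?thesis using False that x
          by (simp add: \<phi>_def Ty' TP weakly_linearD[OF lT] sum_distrib_left algebra_simps)
      qed (use that x in \<open>simp add: \<phi>_def\<close>)
    qed
    have "rank_le V W F (2 * N)"
      unfolding rank_le_def F_def using ys by (intro exI[of _ ys]) (auto intro!: W.heq_refl W.lincomb_in)
    then have "\<sigma> \<le> opnorm V W (\<lambda>y. hsub W (T y) (F y))"
      unfolding \<sigma>_def by (rule sing_num_le[OF assms bF])
    \<comment> \<open>The supremum need not be attained. Halving \<open>\<sigma>\<close> makes room
      for a witness and is the origin of the factor 2 in the estimate.\<close>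
    then have "\<sigma> / 2 < opnorm V W (\<lambda>y. hsub W (T y) (F y))" using \<sigma> by simp
    then obtain y where y: "y \<in> hcar V" "hnorm V y \<le> 1" "\<sigma> / 2 < hnorm W (hsub W (T y) (F y))"
      unfolding opnorm_def using opnorm_set(2)[OF assms(1,2) blin_sub[OF assms bF]]
      by (elim less_cSupE) auto
    define v where "v = hsub W (T y) (F y)"
    have Fin: "F y \<in> hcar W" using bF y by (auto simp: blin_def)
    have v: "v \<in> hcar W" using Fin T y by (simp add: v_def)
    have ty: "T (y' y) \<in> hcar W" using y T by simp
    have Fu: "hinn W (F y) u = hinn W (T (P y)) u + (\<Sum>i<N. hinn W (T (y' y)) (z i) * hinn W (z i) u)"
      if "u \<in> hcar W" for u
    proof -
      have "hinn W (F y) u = (\<Sum>i<2 * N. \<phi> i y * hinn W (ys i) u)"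
        unfolding F_def by (rule W.inn_lincomb_l[OF ys that])
      then show ?thesis unfolding mult_2 sum_lessThan_add TP[OF that] by (simp add: \<phi>_def ys_def)
    qed
    have vu: "hinn W v u = hinn W (T (y' y)) u - (\<Sum>i<N. hinn W (T (y' y)) (z i) * hinn W (z i) u)"
      if "u \<in> hcar W" for u
      using that y T Fin by (simp add: v_def Fu Ty')
    have vz: "hinn W v (z k) = 0" if "k < N" for k
      using on_or_zero_proj[OF assms(2) xz(2) ty that] W.inn_lincomb_l[OF z z[OF that], where c = "\<lambda>i. hinn W (T (y' y)) (z i)"]
      by (simp add: vu[OF z[OF that]])
    have zv: "hinn W (z k) v = 0" if "k < N" for k
      using vz[OF that] W.inn_cnj[OF v z[OF that]] by simp
    \<comment> \<open>\<open>v\<close> is the part of \<open>T (y' y)\<close> orthogonal to the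
      \<open>z i\<close>, hence orthogonal to the remaining part.\<close>
    have Tv: "hinn W (T (y' y)) v = of_real ((hnorm W v)\<^sup>2)"
      using vu[OF v] zv by (simp add: W.inn_self[OF v])
    have yx: "hinn V (y' y) (x k) = 0" if "k < N" for k
      using on_or_zero_proj[OF assms(1) xz(1) y(1) that] x[OF that] y by (simp add: y'_def P_def[symmetric])
    have nv: "hnorm W v > 0" "hnorm W v > \<sigma> / 2" using y(3) \<sigma> by (simp_all add: v_def)
    have ny1: "hnorm V (y' y) \<le> 1"
    proof -
      have "hinn V (y' y) (P y) = 0"
        unfolding P_def using x y yx by (subst V.inn_lincomb_r) auto
      then have "hinn V (y' y) (y' y) = hinn V (y' y) y"
        using y by (subst (2) y'_def) simp
      then have "(hnorm V (y' y))\<^sup>2 = cmod (hinn V (y' y) y)"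
        using y V.inn_self[of "y' y"] by (metis norm_of_real abs_of_nonneg zero_le_power2 y'in)
      also have "\<dots> \<le> hnorm V (y' y) * hnorm V y" using y by (intro V.cauchy_schwarz) auto
      also have "\<dots> \<le> hnorm V (y' y) * 1" using y by (intro mult_left_mono) auto
      finally show ?thesis
        by (rule square_le_mult) (use y in auto)
    qed
    have ny: "hnorm V (y' y) > 0"
    proof (rule ccontr)
      assume "\<not> hnorm V (y' y) > 0"
      then have "hnorm V (y' y) = 0" using V.norm_ge[OF y'in[OF y(1)]] by linarith
      moreover have "hnorm W (T (y' y)) \<le> C * hnorm V (y' y)" using C y by simp
      ultimately have "hnorm W (T (y' y)) = 0" using W.norm_ge[OF ty] by simp
      then have "hinn W (T (y' y)) v = 0" using W.norm_eq_0_inn ty v by simp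
      then show False using Tv nv by simp
    qed
    \<comment> \<open>The norm of \<open>y' y\<close> is at most 1, so normalising it can only
      enlarge the pairing.\<close>
    define x' where "x' = hscl V (of_real (1 / hnorm V (y' y))) (y' y)"
    define z' where "z' = hscl W (of_real (1 / hnorm W v)) v"
    have "hinn W (T x') z' = of_real (hnorm W v / hnorm V (y' y))"
      unfolding x'_def z'_def using y v ty nv(1)
      by (simp add: weakly_linearD[OF lT] Tv power2_eq_square)
    then have "cmod (hinn W (T x') z') = hnorm W v / hnorm V (y' y)"
      using nv ny by (simp only: norm_of_real) simp
    also have "\<dots> \<ge> hnorm W v" using ny1 ny nv by (simp add: field_simps)
    finally have "\<sigma> \<le> 2 * cmod (hinn W (T x') z')" using nv by simp
    moreover have "hinn V x' x' = 1" unfolding x'_def using y ny by (intro normalize assms) auto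
    moreover have "hinn W z' z' = 1" unfolding z'_def using v nv by (intro normalize assms) auto
    ultimately show ?thesis using yx vz y v x z
      by (intro exI[of _ x'] exI[of _ z']) (auto simp: x'_def z'_def)
  qed
  then obtain x' z' where n: "x' \<in> hcar V" "z' \<in> hcar W" "hinn V x' x' \<in> {0, 1}" "hinn W z' z' \<in> {0, 1}"
    "\<forall>i<N. hinn V x' (x i) = 0" "\<forall>i<N. hinn W z' (z i) = 0" "\<sigma> \<le> 2 * cmod (hinn W (T x') z')" by blast
  show ?case
  proof (intro exI conjI allI impI)
    show "on_or_zero V (Suc N) (x(N := x'))" using n by (intro on_or_zero_extend assms xz) auto
    show "on_or_zero W (Suc N) (z(N := z'))" using n by (intro on_or_zero_extend assms xz) auto
    show "sing_num V W T (2 * k) \<le> 2 * cmod (hinn W (T ((x(N := x')) k)) ((z(N := z')) k))" if "k < Suc N" for k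
      using that le n(7) by (auto simp: less_Suc_eq \<sigma>_def)
  qed
qed

text \<open>The orthonormal pairs bound the sum of the approximation numbers of even index by
  \<open>2 * B\<close>; as these numbers decrease, the sum over all indices is at most twice as
  large.\<close>

lemma trace_bound_schatten:
  assumes "inner_space V" "inner_space W" "blin V W T" "trace_bound V W T B" "p \<ge> 1"
  shows "schatten p V W T"
proof -
  interpret V: inner_space V by fact
  interpret W: inner_space W by fact
  let ?s = "sing_num V W T"
  note s0 = sing_num_props(1)[OF assms(1-3)]
  have le: "(\<Sum>n<N. ?s (2 * n)) \<le> 2 * B" for N
  proof -
    obtain x z where xz: "on_or_zero V N x" "on_or_zero W N z" "\<forall>n<N. ?s (2 * n) \<le> 2 * cmod (hinn W (T (x n)) (z n))"
      using sing_num_orthonormal_bound[OF assms(1-3)] by blast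
    have "(\<Sum>n<N. ?s (2 * n)) \<le> (\<Sum>n<N. 2 * cmod (hinn W (T (x n)) (z n)))" using xz(3) by (intro sum_mono) auto
    also have "\<dots> \<le> 2 * B"
      using assms(4)[unfolded trace_bound_def] V.on_or_zero_bessel[OF xz(1)] W.on_or_zero_bessel[OF xz(2)] by (simp add: sum_distrib_left[symmetric])
    finally show ?thesis .
  qed
  have le2: "(\<Sum>n<2 * N. ?s n) \<le> 2 * (\<Sum>n<N. ?s (2 * n))" for N
  proof (induction N)
    case (Suc N)
    then show ?case using sing_num_props(2)[OF assms(1-3), of "2 * N"] by simp
  qed simp
  have sm: "summable ?s"
  proof (rule bounded_imp_summable[OF s0])
    fix N
    have "(\<Sum>n\<le>N. ?s n) \<le> (\<Sum>n<2 * Suc N. ?s n)" using s0 by (intro sum_mono2) auto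
    then show "(\<Sum>n\<le>N. ?s n) \<le> 4 * B" using le2[of "Suc N"] le[of "Suc N"] by linarith
  qed
  \<comment> \<open>A summable sequence is eventually below 1, and numbers below 1 do not grow when
    raised to a power \<open>p \<ge> 1\<close>.\<close>
  have "eventually (\<lambda>n. ?s n < 1) sequentially"
    using summable_LIMSEQ_zero[OF sm] by (rule order_tendstoD(2)) simp
  then have "eventually (\<lambda>n. norm (?s n powr p) \<le> ?s n) sequentially"
  proof eventually_elim
    case (elim n)
    then show ?case using s0[of n] powr_mono'[of 1 p "?s n"] assms(5) by simp
  qed
  then have "summable (\<lambda>n. ?s n powr p)" using sm by (rule summable_comparison_test_ev)
  then show ?thesis using assms(3) by (simp add: schatten_def)
qed

section \<open>The absorbing unitary\<close>

definition on_or_zero_seq :: "'v hspace \<Rightarrow> (nat \<Rightarrow> 'v) \<Rightarrow> bool" where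
  "on_or_zero_seq V u \<longleftrightarrow> (\<forall>k. u k \<in> hcar V \<and> hinn V (u k) (u k) \<in> {0, 1}) \<and>
     (\<forall>k l. k \<noteq> l \<longrightarrow> hinn V (u k) (u l) = 0)"

text \<open>For sequences as in \<open>on_or_zero_seq\<close> this is the partial isometry that
  takes \<open>u k\<close> to \<open>v k\<close> whenever neither vector is null. Exchanging the two
  sequences gives its adjoint, see \<open>transfer_adj\<close>.\<close>

definition transfer :: "'v hspace \<Rightarrow> 'w hspace \<Rightarrow> (nat \<Rightarrow> 'v) \<Rightarrow> (nat \<Rightarrow> 'w) \<Rightarrow> 'v \<Rightarrow> 'w" where
  "transfer V W u v h = orth_sum W (\<lambda>k. hscl W (hinn V h (u k)) (v k))"

lemma on_or_zero_seqD:
  assumes "on_or_zero_seq V u"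
  shows "u k \<in> hcar V" "hinn V (u k) (u k) \<in> {0, 1}" "k \<noteq> l \<Longrightarrow> hinn V (u k) (u l) = 0" "on_or_zero V N u"
  using assms unfolding on_or_zero_seq_def on_or_zero_def by blast+

lemma on_or_zero_seq_norm: "on_or_zero_seq V u \<Longrightarrow> hnorm V (u k) \<le> 1"
  using on_or_zero_seqD(2)[of V u k] by (auto simp: hnorm_def)

lemma (in inner_space) bessel_sums:
  assumes "on_or_zero_seq V u" "h \<in> hcar V"
  shows "summable (\<lambda>k. (cmod (hinn V h (u k)))\<^sup>2)" "(\<Sum>k. (cmod (hinn V h (u k)))\<^sup>2) \<le> (hnorm V h)\<^sup>2"
proof -
  have b: "(\<Sum>k<N. (cmod (hinn V h (u k)))\<^sup>2) \<le> (hnorm V h)\<^sup>2" for N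
    using bessel_ineq(1)[OF on_or_zero_bessel[OF on_or_zero_seqD(4)[OF assms(1)]] assms(2)] .
  show s: "summable (\<lambda>k. (cmod (hinn V h (u k)))\<^sup>2)"
    by (rule summableI_nonneg_bounded[OF _ b]) simp
  show "(\<Sum>k. (cmod (hinn V h (u k)))\<^sup>2) \<le> (hnorm V h)\<^sup>2"
    by (rule suminf_le_const[OF s b])
qed

text \<open>If \<open>u k\<close> is null, both sides vanish by Cauchy-Schwarz, so formulas for unit
  vectors can be used without a case distinction.\<close>

lemma on_or_zero_seq_self:
  assumes "inner_space V" "on_or_zero_seq V u" "z \<in> hcar V"
  shows "hinn V (u k) (u k) * hinn V (u k) z = hinn V (u k) z"
    "hinn V z (u k) * hinn V (u k) (u k) = hinn V z (u k)"
proof -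
  interpret V: inner_space V by fact
  have u: "u k \<in> hcar V" using on_or_zero_seqD(1)[OF assms(2)] .
  consider "hinn V (u k) (u k) = 1" | "hinn V (u k) (u k) = 0" using on_or_zero_seqD(2)[OF assms(2)] by blast
  then have "hinn V (u k) (u k) * hinn V (u k) z = hinn V (u k) z \<and> hinn V z (u k) * hinn V (u k) (u k) = hinn V z (u k)"
  proof cases
    case 2
    then have "hnorm V (u k) = 0" by (simp add: hnorm_def)
    then show ?thesis using V.norm_eq_0_inn[OF u _ assms(3)] by simp
  qed simp
  then show "hinn V (u k) (u k) * hinn V (u k) z = hinn V (u k) z"
    "hinn V z (u k) * hinn V (u k) (u k) = hinn V z (u k)" by auto
qed

locale two_hilberts = A: hilbert A + B: hilbert B for A :: "'a hspace" and B :: "'b hspace" +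
  fixes u :: "nat \<Rightarrow> 'a" and v :: "nat \<Rightarrow> 'b"
  assumes u: "on_or_zero_seq A u" and v: "on_or_zero_seq B v"
begin

lemma uin [simp]: "u k \<in> hcar A" and vin [simp]: "v k \<in> hcar B"
  using on_or_zero_seqD(1)[OF u] on_or_zero_seqD(1)[OF v] by auto

lemma term_norm: "h \<in> hcar A \<Longrightarrow> (hnorm B (hscl B (hinn A h (u k)) (v k)))\<^sup>2 \<le> (cmod (hinn A h (u k)))\<^sup>2"
  using on_or_zero_seq_norm[OF v, of k] B.norm_ge[OF vin, of k]
  by (auto simp: B.norm_scl power_mult_distrib intro!: mult_left_le power_le_one)

lemma transfer_summable:
  assumes "h \<in> hcar A"
  shows "orth_summable B (\<lambda>k. hscl B (hinn A h (u k)) (v k))"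
  unfolding orth_summable_def
proof (intro conjI allI impI)
  show "summable (\<lambda>n. (hnorm B (hscl B (hinn A h (u n)) (v n)))\<^sup>2)"
    by (rule summable_comparison_test'[OF A.bessel_sums(1)[OF u assms], of 0]) (simp add: term_norm[OF assms])
qed (use on_or_zero_seqD(3)[OF v] in auto)

lemma transfer_in [simp]: "h \<in> hcar A \<Longrightarrow> transfer A B u v h \<in> hcar B"
  unfolding transfer_def by (rule B.orth_sum_in[OF transfer_summable])

lemma transfer_sums:
  assumes "h \<in> hcar A" "z \<in> hcar B"
  shows "(\<lambda>k. hinn A h (u k) * hinn B (v k) z) sums hinn B (transfer A B u v h) z"
  using B.orth_sum_sums[OF transfer_summable[OF assms(1)] assms(2)] assms by (simp add: transfer_def)

lemma transfer_norm:
  assumes "h \<in> hcar A"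
  shows "hnorm B (transfer A B u v h) \<le> hnorm A h"
proof (rule power2_le_imp_le)
  have "(hnorm B (transfer A B u v h))\<^sup>2 = (\<Sum>n. (hnorm B (hscl B (hinn A h (u n)) (v n)))\<^sup>2)"
    unfolding transfer_def by (rule sums_unique[OF B.orth_sum_norm2[OF transfer_summable[OF assms]]])
  also have "\<dots> \<le> (\<Sum>k. (cmod (hinn A h (u k)))\<^sup>2)"
    using transfer_summable[OF assms] A.bessel_sums(1)[OF u assms] term_norm[OF assms]
    by (intro suminf_le) (auto simp: orth_summable_def)
  also have "\<dots> \<le> (hnorm A h)\<^sup>2" by (rule A.bessel_sums(2)[OF u assms])
  finally show "(hnorm B (transfer A B u v h))\<^sup>2 \<le> (hnorm A h)\<^sup>2" .
qed (use assms in simp)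

lemma transfer_coef:
  assumes "h \<in> hcar A"
  shows "hinn B (transfer A B u v h) (v k) = hinn A h (u k) * hinn B (v k) (v k)"
proof -
  have "(\<lambda>j. if j = k then hinn A h (u k) * hinn B (v k) (v k) else 0) sums (hinn A h (u k) * hinn B (v k) (v k))"
    by (rule sums_single)
  moreover have "(\<lambda>j. if j = k then hinn A h (u k) * hinn B (v k) (v k) else 0) = (\<lambda>j. hinn A h (u j) * hinn B (v j) (v k))"
    using on_or_zero_seqD(3)[OF v] by auto
  ultimately show ?thesis using transfer_sums[OF assms vin[of k]] sums_unique2 by metis
qed

end

lemma transfer_adj:
  assumes "hilbert A" "hilbert B" "on_or_zero_seq A u" "on_or_zero_seq B v"
  shows "adjoint_pair A B (transfer A B u v) (transfer B A v u)"
proof -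
  interpret two_hilberts A B u v by (rule two_hilberts.intro) (use assms in \<open>auto simp: two_hilberts_axioms_def\<close>)
  interpret t: two_hilberts B A v u by (rule two_hilberts.intro) (use assms in \<open>auto simp: two_hilberts_axioms_def\<close>)
  have "hinn B (transfer A B u v x) y = hinn A x (transfer B A v u y)" if "x \<in> hcar A" "y \<in> hcar B" for x y
  proof -
    have "(\<lambda>k. cnj (hinn B y (v k) * hinn A (u k) x)) sums cnj (hinn A (transfer B A v u y) x)"
      using t.transfer_sums[OF that(2,1)] by (simp only: sums_cnj)
    also have "(\<lambda>k. cnj (hinn B y (v k) * hinn A (u k) x)) = (\<lambda>k. hinn A x (u k) * hinn B (v k) y)"
    proof
      fix k
      show "cnj (hinn B y (v k) * hinn A (u k) x) = hinn A x (u k) * hinn B (v k) y"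
        using that A.inn_cnj[of x "u k"] B.inn_cnj[of y "v k"] A.inn_cnj[of "u k" x] B.inn_cnj[of "v k" y] by simp
    qed
    finally show ?thesis
      using transfer_sums[OF that] A.inn_cnj[of "transfer B A v u y" x] that sums_unique2 by fastforce
  qed
  then show ?thesis by (simp add: adjoint_pair_def)
qed

section \<open>Nested levels, their projections and their copies in the second space\<close>

locale absorb0 = A: hilbert A + B: hilbert B for A :: "'a hspace" and B :: "'b hspace" +
  fixes e :: "nat \<Rightarrow> nat \<Rightarrow> 'a" and w :: "nat \<Rightarrow> nat \<Rightarrow> 'b"
  assumes e: "\<And>n. on_or_zero_seq A (e n)" and w: "\<And>n. on_or_zero_seq B (w n)"
    and w_orth: "\<And>m n k l. m \<noteq> n \<Longrightarrow> hinn B (w m k) (w n l) = 0"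
    and w_norm: "\<And>n k. hinn B (w n k) (w n k) = 1"
    and e0: "\<And>k. hnorm A (e 0 k) = 0"
    and nested: "\<And>n k z. z \<in> hcar A \<Longrightarrow> (\<lambda>l. hinn A (e n k) (e (Suc n) l) * hinn A (e (Suc n) l) z) sums hinn A (e n k) z"
begin

sublocale AB: two_hilberts A B "e n" "w n" for n
  by unfold_locales (rule e w)+
sublocale BA: two_hilberts B A "w n" "e n" for n
  by unfold_locales (rule e w)+

text \<open>With M n the closed span of the \<open>e n k\<close>, \<open>X n\<close> is isometric on
  M n, sends each non-null \<open>e n k\<close> to \<open>w n k\<close> and kills the complement of
  M n. \<open>Y n\<close> is its adjoint and \<open>P n\<close> the projection onto M n. By
  \<open>e0\<close> the level 0 is trivial, which gives the telescoping sums below their starting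
  value.\<close>

definition "X n = transfer A B (e n) (w n)"
definition "Y n = transfer B A (w n) (e n)"
definition "P n h = Y n (X n h)"

lemma XY: "adjoint_pair A B (X n) (Y n)" and YX: "adjoint_pair B A (Y n) (X n)"
  unfolding X_def Y_def by (rule transfer_adj; unfold_locales | rule e w)+

lemma X_in [simp]: "h \<in> hcar A \<Longrightarrow> X n h \<in> hcar B" and Y_in [simp]: "f \<in> hcar B \<Longrightarrow> Y n f \<in> hcar A"
  and P_in [simp]: "h \<in> hcar A \<Longrightarrow> P n h \<in> hcar A"
  by (simp_all add: X_def Y_def P_def)

lemma Xadj: "\<lbrakk>h \<in> hcar A; f \<in> hcar B\<rbrakk> \<Longrightarrow> hinn B (X n h) f = hinn A h (Y n f)"
  using XY by (simp add: adjoint_pair_def)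
lemma Yadj: "\<lbrakk>h \<in> hcar A; f \<in> hcar B\<rbrakk> \<Longrightarrow> hinn A (Y n f) h = hinn B f (X n h)"
  using YX by (simp add: adjoint_pair_def)

lemma X_ctr: "contractive A B (X n)" and Y_ctr: "contractive B A (Y n)"
  using adjoint_pair_contractive[OF A.inner_space_axioms B.inner_space_axioms XY] AB.transfer_norm by (auto simp: X_def)

lemma P_adj: "\<lbrakk>h \<in> hcar A; z \<in> hcar A\<rbrakk> \<Longrightarrow> hinn A (P n h) z = hinn A h (P n z)"
  by (simp add: P_def Yadj Xadj)

lemma X_coef: "h \<in> hcar A \<Longrightarrow> hinn B (X n h) (w n k) = hinn A h (e n k)"
  unfolding X_def by (simp add: AB.transfer_coef w_norm)

lemma P_sums: 
  assumes "h \<in> hcar A" "z \<in> hcar A"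
  shows "(\<lambda>k. hinn A h (e n k) * hinn A (e n k) z) sums hinn A (P n h) z"
proof -
  have "hinn B (w n k) (X n z) = hinn A (e n k) z" for k
    using X_coef[OF assms(2), of n k] B.inn_cnj[of "X n z" "w n k"] A.inn_cnj[of z "e n k"] assms by simp
  then show ?thesis
    using AB.transfer_sums[OF assms(1), of "X n z" n] assms by (simp add: P_def Yadj X_def[symmetric])
qed

lemma P_e: "z \<in> hcar A \<Longrightarrow> hinn A (P n (e n k)) z = hinn A (e n k) z"
proof -
  assume z: "z \<in> hcar A"
  have "(\<lambda>j. if j = k then hinn A (e n k) (e n k) * hinn A (e n k) z else 0) sums (hinn A (e n k) (e n k) * hinn A (e n k) z)"
    by (rule sums_single)
  moreover have "(\<lambda>j. if j = k then hinn A (e n k) (e n k) * hinn A (e n k) z else 0) = (\<lambda>j. hinn A (e n k) (e n j) * hinn A (e n j) z)"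
    using on_or_zero_seqD(3)[OF e] by auto
  ultimately have "(\<lambda>j. hinn A (e n k) (e n j) * hinn A (e n j) z) sums (hinn A (e n k) (e n k) * hinn A (e n k) z)"
    by simp
  from sums_unique2[OF P_sums[OF AB.uin z] this] show ?thesis by (simp add: on_or_zero_seq_self(1)[OF A.inner_space_axioms e z])
qed

lemma P_coef: "h \<in> hcar A \<Longrightarrow> hinn A (P n h) (e n k) = hinn A h (e n k)"
  using P_e[of h n k] A.inn_cnj[of "e n k" h] A.inn_cnj[of "P n (e n k)" h] by (simp add: P_adj)

lemma X_P: 
  assumes "h \<in> hcar A" "z \<in> hcar B"
  shows "hinn B (X n (P n h)) z = hinn B (X n h) z"
  using AB.transfer_sums[OF P_in[OF assms(1)] assms(2), of n n] AB.transfer_sums[OF assms, of n] assms(1)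
  by (simp add: P_coef X_def[symmetric] sums_unique2)

lemma P_Y: "\<lbrakk>f \<in> hcar B; z \<in> hcar A\<rbrakk> \<Longrightarrow> hinn A (P n (Y n f)) z = hinn A (Y n f) z"
  using X_P[of z f n] B.inn_cnj[of "X n (P n z)" f] B.inn_cnj[of "X n z" f] by (simp add: P_adj Yadj)

lemma P_Y_r: "\<lbrakk>f \<in> hcar B; z \<in> hcar A\<rbrakk> \<Longrightarrow> hinn A z (P n (Y n f)) = hinn A z (Y n f)"
  using P_Y[of f z n] A.inn_cnj[of "P n (Y n f)" z] A.inn_cnj[of "Y n f" z] by simp

lemma P_P: "\<lbrakk>h \<in> hcar A; z \<in> hcar A\<rbrakk> \<Longrightarrow> hinn A (P n (P n h)) z = hinn A (P n h) z"
  unfolding P_def[of n h] by (rule P_Y) auto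

text \<open>\<open>nested\<close> says that \<open>P (Suc n)\<close> fixes every
  \<open>e n k\<close>, hence every vector of M n.\<close>

lemma P_Suc_P:
  assumes "h \<in> hcar A" "z \<in> hcar A"
  shows "hinn A (P (Suc n) (P n h)) z = hinn A (P n h) z"
proof -
  have pe: "hinn A (e n k) (P (Suc n) z) = hinn A (e n k) z" for k
    using sums_unique2[OF P_sums[OF AB.uin assms(2), of n k "Suc n"] nested[OF assms(2), of n k]] assms(2)
    by (simp add: P_adj)
  have "hinn A (P (Suc n) (P n h)) z = hinn A (P n h) (P (Suc n) z)" using assms by (simp add: P_adj)
  moreover have "(\<lambda>k. hinn A h (e n k) * hinn A (e n k) z) sums hinn A (P n h) (P (Suc n) z)"
    using P_sums[OF assms(1) P_in[OF assms(2)], of n "Suc n"] by (simp add: pe)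
  ultimately show ?thesis using P_sums[OF assms, of n] sums_unique2 by metis
qed

text \<open>The first identity propagates from \<open>P_Suc_P\<close> along the chain of levels, and
  the second is its adjoint.\<close>

lemma P_le:
  assumes "m \<le> n" "h \<in> hcar A" "z \<in> hcar A"
  shows "hinn A (P n (P m h)) z = hinn A (P m h) z" "hinn A (P m (P n h)) z = hinn A (P m h) z"
proof -
  have a: "hinn A (P m (P n h)) z = hinn A (P m h) z" if "\<And>h z. h \<in> hcar A \<Longrightarrow> z \<in> hcar A \<Longrightarrow> hinn A (P n (P m h)) z = hinn A (P m h) z"
    "h \<in> hcar A" "z \<in> hcar A" for m n h z
    using that(1)[of z h] that(2,3) A.inn_cnj[of "P n (P m z)" h] A.inn_cnj[of "P m z" h] by (simp add: P_adj)
  have b: "\<And>h z. h \<in> hcar A \<Longrightarrow> z \<in> hcar A \<Longrightarrow> hinn A (P n (P m h)) z = hinn A (P m h) z"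
    using assms(1)
  proof (induction n rule: dec_induct)
    case base
    then show ?case by (simp add: P_P)
  next
    case (step n)
    have "hinn A (P (Suc n) (P m h)) z = hinn A (P m h) (P (Suc n) z)" using step by (simp add: P_adj)
    also have "\<dots> = hinn A (P n (P m h)) (P (Suc n) z)" using step by simp
    also have "\<dots> = hinn A (P m h) (P n (P (Suc n) z))" using step by (simp add: P_adj)
    also have "\<dots> = hinn A (P m h) (P n z)"
      using a[where m = n and n = "Suc n" and h = z and z = "P m h", OF P_Suc_P] step A.inn_cnj[of "P n (P (Suc n) z)" "P m h"] A.inn_cnj[of "P n z" "P m h"] by simp
    also have "\<dots> = hinn A (P n (P m h)) z" using step by (simp add: P_adj)
    finally show ?case using step by simp
  qed
  show "hinn A (P n (P m h)) z = hinn A (P m h) z" using b assms by simp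
  show "hinn A (P m (P n h)) z = hinn A (P m h) z" using a[OF b] assms by simp
qed

lemma P_Y_le:
  assumes "m \<le> n" "f \<in> hcar B" "z \<in> hcar A"
  shows "hinn A (P n (Y m f)) z = hinn A (Y m f) z"
proof -
  have "hinn A (P n (Y m f)) z = hinn A (Y m f) (P n z)" using assms by (simp add: P_adj)
  also have "\<dots> = hinn A (P m (Y m f)) (P n z)" using assms by (simp add: P_Y)
  also have "\<dots> = hinn A (P n (P m (Y m f))) z" using assms by (simp add: P_adj)
  also have "\<dots> = hinn A (P m (Y m f)) z" using assms by (simp add: P_le)
  finally show ?thesis using assms by (simp add: P_Y)
qed

lemma X_orth:
  assumes "m \<noteq> n" "h \<in> hcar A" "k \<in> hcar A"
  shows "hinn B (X m h) (X n k) = 0"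
proof -
  have "hinn B (w m j) (X n k) = 0" for j
  proof -
    have "(\<lambda>i. hinn A k (e n i) * hinn B (w n i) (w m j)) sums hinn B (X n k) (w m j)"
      unfolding X_def by (rule AB.transfer_sums[OF assms(3)]) simp
    then have "(\<lambda>i. 0 :: complex) sums hinn B (X n k) (w m j)" using w_orth assms(1) by simp
    then have "hinn B (X n k) (w m j) = 0" by (metis sums_unique2 sums_zero)
    then show ?thesis using B.inn_cnj[of "X n k" "w m j"] assms by simp
  qed
  then have "(\<lambda>i. 0 :: complex) sums hinn B (X m h) (X n k)"
    using AB.transfer_sums[OF assms(2), of "X n k" m] assms by (simp add: X_def[symmetric])
  then show ?thesis by (metis sums_unique2 sums_zero)
qed

lemma P_norm2: "h \<in> hcar A \<Longrightarrow> (hnorm A (P n h))\<^sup>2 = Re (hinn A (P n h) h)"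
  using P_P[of h h n] by (simp add: A.norm2 P_adj)

lemma P_suminf:
  assumes h: "h \<in> hcar A"
  shows "(\<Sum>k. (cmod (hinn A h (e n k)))\<^sup>2) = (hnorm A (P n h))\<^sup>2"
proof -
  have "hinn A h (e n k) * hinn A (e n k) h = of_real ((cmod (hinn A h (e n k)))\<^sup>2)" for k
    using A.inn_cnj[of h "e n k"] h by (simp add: complex_norm_square del: of_real_power)
  then have "(\<lambda>k. Re (of_real ((cmod (hinn A h (e n k)))\<^sup>2))) sums Re (hinn A (P n h) h)"
    using sums_Re[OF P_sums[OF h h, of n]] by (simp del: of_real_power)
  then show ?thesis using P_norm2[OF h] by (simp add: sums_iff)
qed

lemma Y_norm2: "f \<in> hcar B \<Longrightarrow> (hnorm A (Y n f))\<^sup>2 = (hnorm B (X n (Y n f)))\<^sup>2"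
  using P_Y_r[of f "Y n f" n] by (simp add: A.norm2 B.norm2 Xadj P_def)

text \<open>The copies of distinct levels are orthogonal, so the vectors \<open>X n (Y n f)\<close>
  are components of \<open>f\<close> in mutually orthogonal subspaces and Bessel's inequality
  applies to them.\<close>

lemma Y_summable:
  assumes f: "f \<in> hcar B"
  shows "summable (\<lambda>n. (hnorm A (Y n f))\<^sup>2)"
proof (rule summableI_nonneg_bounded)
  fix N
  define g where "g n = X n (Y n f)" for n
  define s where "s = lincomb B (\<lambda>_. 1) g N"
  have g [simp]: "g n \<in> hcar B" for n using f by (simp add: g_def)
  have s [simp]: "s \<in> hcar B" by (simp add: s_def)
  have gg: "hinn B (g n) (g m) = (if n = m then hinn B (g n) f else 0)" for n m
    using X_orth[of n m] f P_Y_r[of f "Y m f" m] by (auto simp: g_def Xadj P_def)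
  have "hinn B s s = (\<Sum>n<N. hinn B (g n) f)" unfolding s_def
    by (subst B.inn_lincomb_l) (auto simp: B.inn_lincomb_r gg sum.delta)
  also have "\<dots> = hinn B s f" unfolding s_def using f by (simp add: B.inn_lincomb_l)
  finally have "hinn B s s = hinn B s f" .
  then have "(hnorm B s)\<^sup>2 = cmod (hinn B s f)" using B.inn_self[OF s] by (metis norm_of_real abs_of_nonneg zero_le_power2)
  also have "\<dots> \<le> hnorm B s * hnorm B f" using B.cauchy_schwarz[OF s f] .
  finally have "hnorm B s \<le> hnorm B f"
    by (rule square_le_mult) (use f in auto)
  then have "(hnorm B s)\<^sup>2 \<le> (hnorm B f)\<^sup>2" by (intro power_mono) auto
  moreover have "(hnorm B s)\<^sup>2 = (\<Sum>n<N. (hnorm B (g n))\<^sup>2)"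
    using \<open>hinn B s s = (\<Sum>n<N. hinn B (g n) f)\<close> gg by (simp add: B.norm2)
  ultimately show "(\<Sum>n<N. (hnorm A (Y n f))\<^sup>2) \<le> (hnorm B f)\<^sup>2"
    using f by (simp add: Y_norm2 g_def)
qed simp

lemma Y0: "\<lbrakk>f \<in> hcar B; z \<in> hcar A\<rbrakk> \<Longrightarrow> hinn A (Y 0 f) z = 0"
proof -
  assume a: "f \<in> hcar B" "z \<in> hcar A"
  have "hinn A (e 0 k) z = 0" for k using A.norm_eq_0_inn(1)[OF AB.uin e0 a(2)] .
  then have "(\<lambda>k. 0 :: complex) sums hinn A (Y 0 f) z" using BA.transfer_sums[OF a, of 0] by (simp add: Y_def)
  then show ?thesis by (metis sums_unique2 sums_zero)
qed

lemma P0: "\<lbrakk>h \<in> hcar A; z \<in> hcar A\<rbrakk> \<Longrightarrow> hinn A (P 0 h) z = 0"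
  by (simp add: P_def Y0)


lemma alpha_norm:
  assumes h: "h \<in> hcar A"
  shows "(hnorm A (hsub A (P (Suc n) h) (P n h)))\<^sup>2 = (hnorm A (P (Suc n) h))\<^sup>2 - (hnorm A (P n h))\<^sup>2"
proof -
  have "hinn A (P k h) (P n h) = hinn A (P n h) h" if "n \<le> k" for k
    using that h P_le(2)[of n k h h] P_le(1)[of n k h h] by (simp add: P_adj)
  then have "hinn A (P (Suc n) h) (P n h) = hinn A (P n h) h" "hinn A (P n h) (P n h) = hinn A (P n h) h" by auto
  moreover from this have "hinn A (P n h) (P (Suc n) h) = cnj (hinn A (P n h) h)"
    using A.inn_cnj[of "P (Suc n) h" "P n h"] h by simp
  ultimately show ?thesis using h by (simp add: A.norm2)
qed

lemma P_le_norm: "h \<in> hcar A \<Longrightarrow> hnorm A (P n h) \<le> hnorm A h"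
  using contractiveD(2)[OF Y_ctr, of "X n h" n] contractiveD(2)[OF X_ctr, of h n] by (simp add: P_def)

text \<open>The increments of an increasing sequence of projections are orthogonal, and their
  squared norms telescope to at most the squared norm of \<open>h\<close>.\<close>

lemma alpha_summable:
  assumes h: "h \<in> hcar A"
  shows "orth_summable A (\<lambda>n. hsub A (P (Suc n) h) (P n h))"
  unfolding orth_summable_def
proof (intro conjI allI impI)
  have *: "hinn A (hsub A (P (Suc m) h) (P m h)) (hsub A (P (Suc n) h) (P n h)) = 0" if "m < n" for m n
  proof -
    have "hinn A (P a h) (P b h) = hinn A (P a h) h" if "a \<le> b" for a b
    proof -
      have "hinn A (P a h) (P b h) = hinn A (P b (P a h)) h" using h by (simp add: P_adj)
      then show ?thesis using P_le(1)[OF that h h] by simp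
    qed
    then show ?thesis using that h by simp
  qed
  show "hinn A (hsub A (P (Suc m) h) (P m h)) (hsub A (P (Suc n) h) (P n h)) = 0" if "m \<noteq> n" for m n
    using *[of m n] *[of n m] that h
      A.inn_cnj[of "hsub A (P (Suc n) h) (P n h)" "hsub A (P (Suc m) h) (P m h)"] by (cases "m < n") auto
  show "summable (\<lambda>n. (hnorm A (hsub A (P (Suc n) h) (P n h)))\<^sup>2)"
  proof (rule summableI_nonneg_bounded)
    fix N
    have "(\<Sum>n<N. (hnorm A (hsub A (P (Suc n) h) (P n h)))\<^sup>2) = (hnorm A (P N h))\<^sup>2 - (hnorm A (P 0 h))\<^sup>2"
      unfolding alpha_norm[OF h] by (rule sum_lessThan_telescope)
    also have "\<dots> \<le> (hnorm A h)\<^sup>2"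
      using power_mono[OF P_le_norm[OF h, of N], of 2] h by (simp add: diff_le_eq add_increasing2)
    finally show "(\<Sum>n<N. (hnorm A (hsub A (P (Suc n) h) (P n h)))\<^sup>2) \<le> (hnorm A h)\<^sup>2" .
  qed simp
qed (use h in simp)

text \<open>Density of the union of the levels need only be tested on a total set. The projections
  \<open>P n h\<close> converge weakly to some \<open>p\<close>. For \<open>d\<close> in
  \<open>D\<close> the vectors \<open>P n d\<close> converge to \<open>d\<close> in norm, so
  \<open>h - p\<close> is orthogonal to \<open>d\<close>, and totality of \<open>D\<close> makes
  \<open>h - p\<close> null.\<close>

lemma complI:
  assumes D: "\<And>d. d \<in> D \<Longrightarrow> d \<in> hcar A"
    and good: "\<And>d. d \<in> D \<Longrightarrow> (\<lambda>n. \<Sum>k. (cmod (hinn A d (e n k)))\<^sup>2) \<longlonglongrightarrow> (hnorm A d)\<^sup>2"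
    and total: "\<And>z. z \<in> hcar A \<Longrightarrow> (\<And>d. d \<in> D \<Longrightarrow> hinn A z d = 0) \<Longrightarrow> hnorm A z = 0"
    and h: "h \<in> hcar A"
  shows "(\<lambda>n. \<Sum>k. (cmod (hinn A h (e n k)))\<^sup>2) \<longlonglongrightarrow> (hnorm A h)\<^sup>2"
proof -
  define p where "p = orth_sum A (\<lambda>n. hsub A (P (Suc n) h) (P n h))"
  have p [simp]: "p \<in> hcar A" unfolding p_def by (rule A.orth_sum_in[OF alpha_summable[OF h]])
  have lim: "(\<lambda>n. hinn A (P n h) z) \<longlonglongrightarrow> hinn A p z" if z: "z \<in> hcar A" for z
  proof -
    have "(\<lambda>n. hinn A (hsub A (P (Suc n) h) (P n h)) z) sums hinn A p z"
      unfolding p_def by (rule A.orth_sum_sums[OF alpha_summable[OF h] z])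
    moreover have "(\<Sum>n<N. hinn A (hsub A (P (Suc n) h) (P n h)) z) = hinn A (P N h) z" for N
    proof -
      have "(\<Sum>n<N. hinn A (hsub A (P (Suc n) h) (P n h)) z) = (\<Sum>n<N. hinn A (P (Suc n) h) z - hinn A (P n h) z)"
        using h z by simp
      also have "\<dots> = hinn A (P N h) z - hinn A (P 0 h) z" by (rule sum_lessThan_telescope)
      finally show ?thesis using P0[OF h z] by simp
    qed
    ultimately show ?thesis by (simp add: sums_def)
  qed
  have "hinn A (hsub A h p) d = 0" if d: "d \<in> D" for d
  proof -
    note dc = D[OF d]
    have nd: "(hnorm A (hsub A d (P n d)))\<^sup>2 = (hnorm A d)\<^sup>2 - (hnorm A (P n d))\<^sup>2" for n
    proof -
      have "hinn A (P n d) (P n d) = hinn A (P n d) d" using P_P[OF dc dc, of n] dc by (simp add: P_adj)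
      moreover from this have "hinn A d (P n d) = cnj (hinn A (P n d) d)"
        using A.inn_cnj[of "P n d" d] dc by simp
      ultimately show ?thesis using dc by (simp add: A.norm2)
    qed
    have "(\<lambda>n. (hnorm A d)\<^sup>2 - (hnorm A (P n d))\<^sup>2) \<longlonglongrightarrow> (hnorm A d)\<^sup>2 - (hnorm A d)\<^sup>2"
      using good[OF d] unfolding P_suminf[OF dc] by (rule tendsto_diff[OF tendsto_const])
    then have "(\<lambda>n. (hnorm A (hsub A d (P n d)))\<^sup>2) \<longlonglongrightarrow> 0" by (simp only: nd diff_self)
    from tendsto_real_sqrt[OF this] have "(\<lambda>n. hdist A (P n d) d) \<longlonglongrightarrow> 0"
      using dc A.dist_sym[of d "P _ d"] by (simp add: hdist_def)
    from A.tendsto_inn_l[OF _ dc h this] have "(\<lambda>n. hinn A (P n d) h) \<longlonglongrightarrow> hinn A d h" using dc by simp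
    from tendsto_cnj[OF this] have "(\<lambda>n. hinn A (P n h) d) \<longlonglongrightarrow> hinn A h d"
      using A.inn_cnj[OF _ h, of "P _ d"] A.inn_cnj[OF dc h] dc h by (simp add: P_adj)
    from LIMSEQ_unique[OF this lim[OF dc]] show ?thesis using h dc by simp
  qed
  then have "hnorm A (hsub A h p) = 0" using h by (intro total) auto
  then have "hinn A p h = hinn A h h" using A.norm_eq_0_inn(1)[of "hsub A h p" h] h by simp
  then have "(\<lambda>n. Re (hinn A (P n h) h)) \<longlonglongrightarrow> Re (hinn A h h)" using tendsto_Re[OF lim[OF h]] by simp
  then show ?thesis unfolding P_suminf[OF h] P_norm2[OF h] A.norm2[OF h] .
qed

end

section \<open>The unitary on the direct sum and its explicit inverse\<close>

lemma hs_dsum_simps [simp]: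
  "hcar (hs_dsum V W) = hcar V \<times> hcar W"
  "hinn (hs_dsum V W) (a, b) (c, d) = hinn V a c + hinn W b d"
  "hadd (hs_dsum V W) (a, b) (c, d) = (hadd V a c, hadd W b d)"
  "hscl (hs_dsum V W) k (a, b) = (hscl V k a, hscl W k b)"
  "hzero (hs_dsum V W) = (hzero V, hzero W)"
  by (simp_all add: hs_dsum_def)

locale absorb = absorb0 +
  assumes compl: "\<And>h. h \<in> hcar A \<Longrightarrow> (\<lambda>n. \<Sum>k. (cmod (hinn A h (e n k)))\<^sup>2) \<longlonglongrightarrow> (hnorm A h)\<^sup>2"
begin

lemma P_tendsto: "h \<in> hcar A \<Longrightarrow> (\<lambda>n. (hnorm A (P n h))\<^sup>2) \<longlonglongrightarrow> (hnorm A h)\<^sup>2"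
  using compl by (simp add: P_suminf)

text \<open>\<open>D n\<close> is the change that \<open>G\<close> makes to \<open>f\<close> inside
  the copy of level n + 1. Applying \<open>X (Suc n)\<close> replaces \<open>h - P n h\<close> by
  its part in M (n + 1), the directions new at this level. The term \<open>Y n f\<close> arrives
  from the copy of level n, and \<open>- Y (Suc n) f\<close> removes what moves on to level n +
  2.\<close>

definition q :: "nat \<Rightarrow> 'a \<Rightarrow> 'b \<Rightarrow> 'a" where
  "q n h f = hadd A (hsub A h (P n h)) (hsub A (Y n f) (Y (Suc n) f))"

definition D :: "nat \<Rightarrow> 'a \<Rightarrow> 'b \<Rightarrow> 'b" where
  "D n h f = X (Suc n) (q n h f)"

definition G :: "'a \<times> 'b \<Rightarrow> 'b" where
  "G p = hadd B (snd p) (orth_sum B (\<lambda>n. D n (fst p) (snd p)))"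

lemma q_in [simp]: "\<lbrakk>h \<in> hcar A; f \<in> hcar B\<rbrakk> \<Longrightarrow> q n h f \<in> hcar A"
  and D_in [simp]: "\<lbrakk>h \<in> hcar A; f \<in> hcar B\<rbrakk> \<Longrightarrow> D n h f \<in> hcar B"
  by (simp_all add: q_def D_def)

lemma inn_q: "\<lbrakk>h \<in> hcar A; f \<in> hcar B; z \<in> hcar A\<rbrakk> \<Longrightarrow>
    hinn A (q n h f) z = hinn A h z - hinn A (P n h) z + (hinn A (Y n f) z - hinn A (Y (Suc n) f) z)"
  by (simp add: q_def)

lemma Dadj: "\<lbrakk>h \<in> hcar A; f \<in> hcar B; z \<in> hcar B\<rbrakk> \<Longrightarrow> hinn B (D n h f) z = hinn A (q n h f) (Y (Suc n) z)"
  by (simp add: D_def Xadj)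

lemma P_r: 
  assumes "m \<le> n" "h \<in> hcar A" "f \<in> hcar B" "z \<in> hcar A"
  shows "hinn A z (P n (P m h)) = hinn A z (P m h)" "hinn A z (P m (P n h)) = hinn A z (P m h)"
    "hinn A z (P n (Y m f)) = hinn A z (Y m f)"
  using P_le[OF assms(1,2,4)] P_Y_le[OF assms(1,3,4)] assms
    A.inn_cnj[of "P n (P m h)" z] A.inn_cnj[of "P m (P n h)" z] A.inn_cnj[of "P m h" z]
    A.inn_cnj[of "P n (Y m f)" z] A.inn_cnj[of "Y m f" z] by auto

lemma q_P:
  assumes h: "h \<in> hcar A" and f: "f \<in> hcar B" and z: "z \<in> hcar A"
  shows "hinn A (q n h f) (P (Suc n) z) = hinn A (P (Suc n) h) z - hinn A (P n h) z + (hinn A (Y n f) z - hinn A (Y (Suc n) f) z)"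
proof -
  have "hinn A (q n h f) (P (Suc n) z) = hinn A (P (Suc n) h) z - hinn A (P (Suc n) (P n h)) z
      + (hinn A (P (Suc n) (Y n f)) z - hinn A (P (Suc n) (Y (Suc n) f)) z)"
    using assms by (simp add: inn_q P_adj)
  then show ?thesis using assms by (simp add: P_le P_Y_le)
qed

text \<open>The left side is what level n + 1 adds to the squared norm of \<open>f\<close>, the
  right side an increment of the sequence \<open>p\<close> in \<open>G_norm\<close>; the sum over
  the levels therefore telescopes.\<close>

lemma D_identity:
  assumes h: "h \<in> hcar A" and f: "f \<in> hcar B"
  shows "hinn B (D n h f) (D n h f) + hinn B (D n h f) f + hinn B f (D n h f) =
     of_real ((hnorm A (P (Suc n) h))\<^sup>2 - (hnorm A (P n h))\<^sup>2 + ((hnorm A (Y n f))\<^sup>2 - (hnorm A (Y (Suc n) f))\<^sup>2))"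
proof -
  \<comment> \<open>\<open>r\<close> is the part of \<open>q n h f\<close> in M (n + 1), the only
    part that \<open>X (Suc n)\<close> sees.\<close>
  define r where "r = hadd A (hsub A (P (Suc n) h) (P n h)) (hsub A (Y n f) (Y (Suc n) f))"
  have r [simp]: "r \<in> hcar A" using h f by (simp add: r_def)
  have Pq: "hinn A (q n h f) (P (Suc n) z) = hinn A r z" if "z \<in> hcar A" for z
    using h f that by (simp add: q_P r_def)
  have ry: "hinn A (q n h f) (Y (Suc n) f) = hinn A r (Y (Suc n) f)"
    using Pq[of "Y (Suc n) f"] P_r(3)[of "Suc n" "Suc n" h f "q n h f"] h f by simp
  have qr: "hinn A (q n h f) (P (Suc n) (q n h f)) = hinn A r r"
  proof -
    have "hinn A r (q n h f) = cnj (hinn A (q n h f) r)" using h f by (intro A.inn_cnj) auto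
    also have "hinn A (q n h f) r = hinn A (q n h f) (P (Suc n) r)"
      using h f P_r(1)[of n "Suc n" h f "q n h f"] P_r(2)[of "Suc n" "Suc n" h f "q n h f"]
        P_r(3)[of n "Suc n" h f "q n h f"] P_r(3)[of "Suc n" "Suc n" h f "q n h f"]
      by (simp add: r_def P_adj[symmetric])
    also have "\<dots> = hinn A r r" using Pq by simp
    finally show ?thesis using Pq[of "q n h f"] h f A.inn_cnj[of r r] by simp
  qed
  have 1: "hinn B (D n h f) (D n h f) = hinn A r r"
    using qr h f by (simp add: D_def Xadj P_def)
  have 2: "hinn B (D n h f) f = hinn A r (Y (Suc n) f)" using ry h f by (simp add: Dadj)
  have 3: "hinn B f (D n h f) = hinn A (Y (Suc n) f) r"
    using 2 h f B.inn_cnj[of "D n h f" f] A.inn_cnj[of r "Y (Suc n) f"] by simp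
  have PP: "hinn A (P k h) (P m h) = of_real ((hnorm A (P (min k m) h))\<^sup>2)" for k m
  proof -
    have s: "hinn A (P k h) h = of_real ((hnorm A (P k h))\<^sup>2)" for k
      using P_P[OF h h, of k] h A.inn_self[of "P k h"] by (simp add: P_adj)
    have "hinn A (P k h) (P m h) = hinn A (P (min k m) h) h"
      using h P_adj[of "P k h" h m] P_le(1)[of k m h h] P_le(2)[of m k h h]
      by (cases "k \<le> m") (simp_all add: min_def)
    then show ?thesis by (simp add: s)
  qed
  have PY: "hinn A (P (Suc n) h) (Y n f) = hinn A (P n h) (Y n f)"
     "hinn A (Y n f) (P (Suc n) h) = hinn A (Y n f) (P n h)"
  proof -
    show "hinn A (P (Suc n) h) (Y n f) = hinn A (P n h) (Y n f)"
      using h f P_r(3)[of n "Suc n" h f h] P_r(3)[of n n h f h] by (simp add: P_adj)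
    then show "hinn A (Y n f) (P (Suc n) h) = hinn A (Y n f) (P n h)"
      using A.inn_cnj[of "P (Suc n) h" "Y n f"] A.inn_cnj[of "P n h" "Y n f"] h f by simp
  qed
  show ?thesis unfolding 1 2 3 using h f
    by (simp add: r_def PP PY A.inn_self[of "Y n f"] A.inn_self[of "Y (Suc n) f"] algebra_simps)
qed

lemma D_summable:
  assumes h: "h \<in> hcar A" and f: "f \<in> hcar B"
  shows "orth_summable B (\<lambda>n. D n h f)"
  unfolding orth_summable_def
proof (intro conjI allI impI)
  show "hinn B (D m h f) (D n h f) = 0" if "m \<noteq> n" for m n
    using that h f by (simp add: D_def X_orth)
  define a where "a n = hnorm A (hsub A (P (Suc n) h) (P n h))" for n
  have le: "(hnorm B (D n h f))\<^sup>2 \<le> 3 * ((a n)\<^sup>2 + (hnorm A (Y n f))\<^sup>2 + (hnorm A (Y (Suc n) f))\<^sup>2)" for n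
  proof -
    \<comment> \<open>Bounding \<open>q n h f\<close> itself would not do, since the norms of
      \<open>h - P n h\<close> need not be square summable. Its part \<open>r\<close> in M (n + 1)
      contains only the increments of \<open>P n h\<close>, which are.\<close>
    define r where "r = hadd A (hsub A (P (Suc n) h) (P n h)) (hsub A (Y n f) (Y (Suc n) f))"
    have r [simp]: "r \<in> hcar A" using h f by (simp add: r_def)
    have "hnorm B (D n h f) = hnorm B (X (Suc n) r)"
    proof (rule B.norm_by_inn)
      fix z assume z: "z \<in> hcar B"
      have "hinn B (D n h f) z = hinn A (q n h f) (P (Suc n) (Y (Suc n) z))"
        using P_r(3)[of "Suc n" "Suc n" h z "q n h f"] h f z by (simp add: Dadj)
      also have "\<dots> = hinn A r (Y (Suc n) z)"
        using h f z by (simp add: q_P r_def)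
      finally show "hinn B (D n h f) z = hinn B (X (Suc n) r) z" using z by (simp add: Xadj)
    qed (use h f in auto)
    also have "\<dots> \<le> hnorm A r" using X_ctr by (simp add: contractive_def)
    also have "\<dots> \<le> a n + (hnorm A (Y n f) + hnorm A (Y (Suc n) f))"
      unfolding r_def a_def using h f
      by (intro order_trans[OF A.norm_add_le] add_mono A.norm_sub_le) auto
    finally have "(hnorm B (D n h f))\<^sup>2 \<le> (a n + (hnorm A (Y n f) + hnorm A (Y (Suc n) f)))\<^sup>2"
      using h f by (intro power_mono) auto
    also have "\<dots> \<le> 3 * ((a n)\<^sup>2 + (hnorm A (Y n f))\<^sup>2 + (hnorm A (Y (Suc n) f))\<^sup>2)"
    proof -
      have "(x + (y + z))\<^sup>2 \<le> 3 * (x\<^sup>2 + y\<^sup>2 + z\<^sup>2)" for x y z :: real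
      proof -
        have "0 \<le> (x - y)\<^sup>2 + (x - z)\<^sup>2 + (y - z)\<^sup>2" by simp
        then show ?thesis by (simp add: power2_eq_square algebra_simps)
      qed
      then show ?thesis .
    qed
    finally show ?thesis .
  qed
  have "summable (\<lambda>n. (a n)\<^sup>2)"
    using telescope_summable[OF P_tendsto[OF h]] by (simp add: a_def alpha_norm[OF h])
  then have "summable (\<lambda>n. 3 * ((a n)\<^sup>2 + (hnorm A (Y n f))\<^sup>2 + (hnorm A (Y (Suc n) f))\<^sup>2))"
    using Y_summable[OF f] summable_Suc_iff[of "\<lambda>n. (hnorm A (Y n f))\<^sup>2"]
    by (intro summable_mult summable_add) simp_all
  then show "summable (\<lambda>n. (hnorm B (D n h f))\<^sup>2)"
    by (rule summable_comparison_test'[of _ 0]) (use le in auto)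
qed (use h f in auto)

lemma G_in [simp]: "\<lbrakk>h \<in> hcar A; f \<in> hcar B\<rbrakk> \<Longrightarrow> G (h, f) \<in> hcar B"
  by (simp add: G_def B.orth_sum_in[OF D_summable])

lemma G_sums:
  assumes "h \<in> hcar A" "f \<in> hcar B" "z \<in> hcar B"
  shows "(\<lambda>n. hinn B (D n h f) z) sums (hinn B (G (h, f)) z - hinn B f z)"
  using B.orth_sum_sums[OF D_summable[OF assms(1,2)] assms(3)] assms
  by (simp add: G_def B.orth_sum_in[OF D_summable])

text \<open>By \<open>D_identity\<close> the gain over the squared norm of \<open>f\<close> is the
  limit of \<open>p\<close> minus \<open>p 0\<close>. Completeness of the levels and square
  summability of the \<open>Y n f\<close> make the limit the squared norm of \<open>h\<close>, and
  the trivial level 0 gives \<open>p 0 = 0\<close>.\<close>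

lemma G_norm:
  assumes h: "h \<in> hcar A" and f: "f \<in> hcar B"
  shows "hnorm B (G (h, f)) = hnorm (hs_dsum A B) (h, f)"
proof -
  define v where "v = orth_sum B (\<lambda>n. D n h f)"
  have o: "orth_summable B (\<lambda>n. D n h f)" by (rule D_summable[OF h f])
  have v [simp]: "v \<in> hcar B" unfolding v_def by (rule B.orth_sum_in[OF o])
  define p where "p n = (hnorm A (P n h))\<^sup>2 - (hnorm A (Y n f))\<^sup>2" for n
  have "(\<lambda>n. Re (hinn B (D n h f) (D n h f) + hinn B (D n h f) f + hinn B f (D n h f)))
      sums Re (hinn B v v + hinn B v f + hinn B f v)"
  proof (intro sums_Re sums_add)
    have "(\<lambda>n. complex_of_real ((hnorm B (D n h f))\<^sup>2)) sums of_real ((hnorm B v)\<^sup>2)"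
      using B.orth_sum_norm2[OF o] by (simp only: sums_of_real_iff v_def)
    then show "(\<lambda>n. hinn B (D n h f) (D n h f)) sums hinn B v v"
      using h f by (simp add: B.inn_self)
    show "(\<lambda>n. hinn B (D n h f) f) sums hinn B v f" "(\<lambda>n. hinn B f (D n h f)) sums hinn B f v"
      unfolding v_def by (rule B.orth_sum_sums[OF o f] B.orth_sum_sums_r[OF o f])+
  qed
  then have 1: "(\<lambda>n. p (Suc n) - p n) sums Re (hinn B v v + hinn B v f + hinn B f v)"
    by (simp only: D_identity[OF h f] Re_complex_of_real) (simp add: p_def algebra_simps)
  have "p \<longlonglongrightarrow> (hnorm A h)\<^sup>2 - 0"
    unfolding p_def by (intro tendsto_diff P_tendsto h summable_LIMSEQ_zero Y_summable f)
  from telescope_sums[OF this] 1 have "Re (hinn B v v + hinn B v f + hinn B f v) = (hnorm A h)\<^sup>2 - p 0"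
    using sums_unique2 by fastforce
  moreover have "p 0 = 0"
    using P0[of h "P 0 h"] Y0[of f "Y 0 f"] h f by (simp add: p_def A.norm2)
  moreover have "(hnorm B (G (h, f)))\<^sup>2 = Re (hinn B v v + hinn B v f + hinn B f v) + (hnorm B f)\<^sup>2"
    using f by (simp add: G_def v_def[symmetric] B.norm2)
  ultimately have "(hnorm B (G (h, f)))\<^sup>2 = (hnorm A h)\<^sup>2 + (hnorm B f)\<^sup>2" by simp
  then show ?thesis
    using h f unfolding hnorm_def[of "hs_dsum A B"] by (simp add: A.norm2[symmetric] B.norm2[symmetric] real_sqrt_unique)
qed

lemma inner_space_AB: "inner_space (hs_dsum A B)"
  by (rule inner_space_dsum) unfold_locales

lemma G_lin: "weakly_linear (hs_dsum A B) B G"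
proof -
  have ql: "hinn A (q n (hadd A h h') (hadd B f f')) z = hinn A (q n h f) z + hinn A (q n h' f') z"
    "hinn A (q n (hscl A a h) (hscl B a f)) z = a * hinn A (q n h f) z"
    if "h \<in> hcar A" "h' \<in> hcar A" "f \<in> hcar B" "f' \<in> hcar B" "z \<in> hcar A" for n h h' f f' z a
    using that by (simp_all add: inn_q P_adj Yadj algebra_simps)
  have "hinn B (G (hadd A h h', hadd B f f')) z = hinn B (G (h, f)) z + hinn B (G (h', f')) z"
    if "h \<in> hcar A" "h' \<in> hcar A" "f \<in> hcar B" "f' \<in> hcar B" "z \<in> hcar B" for h h' f f' z
  proof -
    have "(\<lambda>n. hinn B (D n (hadd A h h') (hadd B f f')) z) sums
      (hinn B (G (h, f)) z - hinn B f z + (hinn B (G (h', f')) z - hinn B f' z))"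
      using sums_add[OF G_sums[OF that(1,3,5)] G_sums[OF that(2,4,5)]] that by (simp add: Dadj ql)
    from sums_unique2[OF this G_sums] that show ?thesis by simp
  qed
  moreover have "hinn B (G (hscl A a h, hscl B a f)) z = a * hinn B (G (h, f)) z"
    if "h \<in> hcar A" "f \<in> hcar B" "z \<in> hcar B" for h f z a
  proof -
    have "(\<lambda>n. hinn B (D n (hscl A a h) (hscl B a f)) z) sums (a * (hinn B (G (h, f)) z - hinn B f z))"
      using sums_mult[OF G_sums[OF that], of a] that by (simp add: Dadj ql(2)[OF that(1) that(1) that(2) that(2)])
    from sums_unique2[OF this G_sums] that show ?thesis by (simp add: algebra_simps)
  qed
  ultimately show ?thesis unfolding weakly_linear_def by auto
qed

text \<open>The inverse runs the hotel backwards. The component of \<open>g\<close> in the copy of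
  level n + 1 splits into a part in M n, which returns to the copy of level n, and the part
  \<open>a n\<close> orthogonal to M n, which returns to \<open>A\<close>. Accordingly
  \<open>b n\<close> is the difference between the component wanted at level n and the one that
  \<open>g\<close> has there.\<close>

lemma G_surj:
  assumes g: "g \<in> hcar B"
  shows "\<exists>h\<in>hcar A. \<exists>f\<in>hcar B. heq B (G (h, f)) g"
proof -
  define a where "a n = hsub A (Y (Suc n) g) (P n (Y (Suc n) g))" for n
  define b where "b n = hsub A (P n (Y (Suc n) g)) (Y n g)" for n
  have a [simp]: "a n \<in> hcar A" and b [simp]: "b n \<in> hcar A" for n using g by (simp_all add: a_def b_def)
  have P_ctr: "hnorm A (P n h) \<le> hnorm A h" if "h \<in> hcar A" for n h
    using contractiveD(2)[OF Y_ctr, of "X n h" n] contractiveD(2)[OF X_ctr that, of n] that by (simp add: P_def)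
  have s: "summable (\<lambda>n. (hnorm A (Y (Suc n) g))\<^sup>2)" "summable (\<lambda>n. (hnorm A (Y n g))\<^sup>2)"
    using Y_summable[OF g] summable_Suc_iff[of "\<lambda>n. (hnorm A (Y n g))\<^sup>2"] by simp_all
  have two: "(x + y)\<^sup>2 \<le> 2 * (x\<^sup>2 + y\<^sup>2)" for x y :: real
    using sum_squares_bound[of x y] by (simp add: power2_sum)
  have na: "(hnorm A (a n))\<^sup>2 \<le> 4 * (hnorm A (Y (Suc n) g))\<^sup>2" for n
  proof -
    have "hnorm A (a n) \<le> 2 * hnorm A (Y (Suc n) g)"
      using A.norm_sub_le[of "Y (Suc n) g" "P n (Y (Suc n) g)"] P_ctr[of "Y (Suc n) g" n] g by (simp add: a_def)
    from power_mono[OF this, of 2] show ?thesis by (simp add: power_mult_distrib)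
  qed
  have nb: "(hnorm A (b n))\<^sup>2 \<le> 2 * ((hnorm A (Y (Suc n) g))\<^sup>2 + (hnorm A (Y n g))\<^sup>2)" for n
  proof -
    have "hnorm A (b n) \<le> hnorm A (Y (Suc n) g) + hnorm A (Y n g)"
      using A.norm_sub_le[of "P n (Y (Suc n) g)" "Y n g"] P_ctr[of "Y (Suc n) g" n] g by (simp add: b_def)
    from power_mono[OF this, of 2] show ?thesis using two order_trans by fastforce
  qed
  have aP: "hinn A (a n) (P m z) = (if n < m then hinn A (a n) z else 0)" if z: "z \<in> hcar A" for n m z
  proof -
    have "hinn A (a n) (P m z) = hinn A (P m (Y (Suc n) g)) z - hinn A (P m (P n (Y (Suc n) g))) z"
      using g z by (simp add: a_def P_adj)
    then show ?thesis
      using g z P_Y_le[of "Suc n" m g z] P_le(1)[of n m "Y (Suc n) g" z] P_le(2)[of m n "Y (Suc n) g" z]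
      by (cases "n < m") (simp_all add: a_def)
  qed
  have oa: "orth_summable A a"
    unfolding orth_summable_def
  proof (intro conjI allI impI)
    have *: "hinn A (a m) (a n) = 0" if "m < n" for m n
    proof -
      have "hinn A (a n) (P (Suc m) (a m)) = 0" using aP[of "a m" n "Suc m"] that by simp
      moreover have "hinn A (a m) (P (Suc m) (a n)) = hinn A (a m) (a n)" using aP[of "a n" m "Suc m"] by simp
      moreover have "hinn A (a m) (P (Suc m) (a n)) = cnj (hinn A (a n) (P (Suc m) (a m)))"
        using A.inn_cnj[of "a n" "P (Suc m) (a m)"] by (simp add: P_adj)
      ultimately show ?thesis by simp
    qed
    show "hinn A (a m) (a n) = 0" if "m \<noteq> n" for m n
      using *[of m n] *[of n m] A.inn_cnj[of "a n" "a m"] that by (cases "m < n") auto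
    show "summable (\<lambda>n. (hnorm A (a n))\<^sup>2)"
      by (rule summable_comparison_test'[OF summable_mult[OF s(1), of 4], of 0]) (use na in auto)
  qed simp
  have ob: "orth_summable B (\<lambda>n. X n (b n))"
    unfolding orth_summable_def
  proof (intro conjI allI impI)
    show "summable (\<lambda>n. (hnorm B (X n (b n)))\<^sup>2)"
    proof (rule summable_comparison_test'[OF summable_mult[OF summable_add[OF s], of 2], of 0])
      fix n
      have "(hnorm B (X n (b n)))\<^sup>2 \<le> (hnorm A (b n))\<^sup>2" using contractiveD(2)[OF X_ctr, of "b n" n] by (intro power_mono) auto
      then show "norm ((hnorm B (X n (b n)))\<^sup>2) \<le> 2 * ((hnorm A (Y (Suc n) g))\<^sup>2 + (hnorm A (Y n g))\<^sup>2)"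
        using order_trans[OF _ nb[of n]] by simp
    qed
  qed (auto simp: X_orth)
  define h where "h = orth_sum A a"
  define F where "F = orth_sum B (\<lambda>n. X n (b n))"
  define f where "f = hadd B g F"
  have h [simp]: "h \<in> hcar A" unfolding h_def by (rule A.orth_sum_in[OF oa])
  have F [simp]: "F \<in> hcar B" unfolding F_def by (rule B.orth_sum_in[OF ob])
  have f [simp]: "f \<in> hcar B" using g by (simp add: f_def)
  have Ph: "hinn A (P m h) z = (\<Sum>n<m. hinn A (a n) z)" if z: "z \<in> hcar A" for m z
  proof -
    have "(\<lambda>n. hinn A (a n) (P m z)) sums hinn A h (P m z)" unfolding h_def
      using z by (intro A.orth_sum_sums[OF oa]) simp
    then have "(\<lambda>n. if n \<in> {..<m} then hinn A (a n) z else 0) sums hinn A h (P m z)"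
      by (simp add: aP[OF z])
    from sums_unique2[OF this sums_If_finite_set] show ?thesis using z by (simp add: P_adj)
  qed
  have Yf: "hinn A (Y m f) z = hinn A (P m (Y (Suc m) g)) z" if z: "z \<in> hcar A" for m z
  proof -
    have "(\<lambda>n. hinn B (X n (b n)) (X m z)) sums hinn B F (X m z)" unfolding F_def
      using z by (intro B.orth_sum_sums[OF ob]) simp
    moreover have "(\<lambda>n. hinn B (X n (b n)) (X m z)) = (\<lambda>n. if n = m then hinn B (X m (b m)) (X m z) else 0)"
      using z X_orth by auto
    ultimately have "(\<lambda>n. if n = m then hinn B (X m (b m)) (X m z) else 0) sums hinn B F (X m z)" by simp
    from sums_unique2[OF this sums_single] have "hinn B F (X m z) = hinn B (X m (b m)) (X m z)" .
    also have "\<dots> = hinn A (b m) (P m z)" using z by (simp add: Xadj P_def)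
    also have "\<dots> = hinn A (b m) z"
    proof -
      have "hinn A (b m) (P m z) = hinn A (P m (P m (Y (Suc m) g))) z - hinn A (P m (Y m g)) z"
        using z g by (simp add: b_def P_adj)
      then show ?thesis using z g P_P[of "Y (Suc m) g" z m] P_Y[of g z m] by (simp add: b_def)
    qed
    finally show ?thesis using z g by (simp add: f_def Yadj b_def)
  qed
  have "hinn B (D n h f) z = - hinn B (X (Suc n) (b (Suc n))) z" if z: "z \<in> hcar B" for n z
  proof -
    let ?y = "Y (Suc n) z"
    have "hinn A h ?y = hinn A (P (Suc n) h) ?y" using z P_r(3)[of "Suc n" "Suc n" h z h] by (simp add: P_adj)
    then have "hinn B (D n h f) z = hinn A (a n) ?y + (hinn A (P n (Y (Suc n) g)) ?y - hinn A (P (Suc n) (Y (Suc (Suc n)) g)) ?y)"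
      using z by (simp add: Dadj inn_q Ph Yf)
    also have "\<dots> = - hinn B (X (Suc n) (b (Suc n))) z" using z g by (simp add: a_def b_def Xadj)
    finally show ?thesis .
  qed
  then have "hinn B (G (h, f)) z = hinn B g z" if z: "z \<in> hcar B" for z
  proof -
    have "(\<lambda>n. hinn B (X n (b n)) z) sums hinn B F z" unfolding F_def by (rule B.orth_sum_sums[OF ob z])
    \<comment> \<open>\<open>D n\<close> yields the correction of level \<open>Suc n\<close>, so its
      sum starts one index late; the missing term of level 0 is null because the vectors
      \<open>e 0 k\<close> are.\<close>
    moreover have "hinn B (X 0 (b 0)) z = 0"
      using z Y0[of z "b 0"] A.inn_cnj[of "Y 0 z" "b 0"] by (simp add: Xadj)
    ultimately have "(\<lambda>n. hinn B (X (Suc n) (b (Suc n))) z) sums hinn B F z"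
      using sums_Suc_iff[of "\<lambda>n. hinn B (X n (b n)) z" "hinn B F z"] by simp
    then have "(\<lambda>n. hinn B (D n h f) z) sums (- hinn B F z)"
      using sums_minus z \<open>\<And>z n. z \<in> hcar B \<Longrightarrow> hinn B (D n h f) z = - hinn B (X (Suc n) (b (Suc n))) z\<close> by simp
    from sums_unique2[OF this G_sums[OF h f z]] show ?thesis using z g by (simp add: f_def)
  qed
  then show ?thesis using g by (intro bexI[of _ h] bexI[of _ f]) (auto simp: B.heq_iff)
qed

text \<open>\<open>G\<close> alters its second argument only along the vectors \<open>w n k\<close>,
  and these are fixed by \<open>C\<close>. With \<open>C\<close> the cut to the half line this shows
  that \<open>G\<close> preserves functions on the half line up to null vectors.\<close>

lemma G_cut:
  assumes C: "adjoint_pair B B C C" and Cw: "\<And>n k. heq B (C (w n k)) (w n k)"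
    and h: "h \<in> hcar A" and f: "f \<in> hcar B"
  shows "heq B (C (G (h, f))) (G (h, C f))"
proof -
  have Cin [simp]: "g \<in> hcar B \<Longrightarrow> C g \<in> hcar B" for g using adjoint_pairD(1)[OF C] .
  have Cadj: "hinn B (C g) z = hinn B g (C z)" if "g \<in> hcar B" "z \<in> hcar B" for g z using adjoint_pairD(3)[OF C that] .
  have cw: "hinn B (w n k) (C z) = hinn B (w n k) z" if "z \<in> hcar B" for n k z
    using Cadj[of "w n k" z] that B.heq_inn_l[OF Cw _ _ that] by simp
  have XC: "hinn B (X n k) (C z) = hinn B (X n k) z" if "k \<in> hcar A" "z \<in> hcar B" for n k z
  proof -
    have "(\<lambda>j. hinn A k (e n j) * hinn B (w n j) (C z)) sums hinn B (X n k) (C z)"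
      "(\<lambda>j. hinn A k (e n j) * hinn B (w n j) z) sums hinn B (X n k) z"
      unfolding X_def using that by (intro AB.transfer_sums; simp)+
    then show ?thesis using that by (simp add: cw sums_unique2)
  qed
  have CX: "hinn B (C z) (X n k) = hinn B z (X n k)" if "k \<in> hcar A" "z \<in> hcar B" for n k z
    using XC[OF that, of n] B.inn_cnj[of "X n k" "C z"] B.inn_cnj[of "X n k" z] that by simp
  show ?thesis
  proof (subst B.heq_iff)
    show "\<forall>z\<in>hcar B. hinn B (C (G (h, f))) z = hinn B (G (h, C f)) z"
    proof
      fix z assume z: "z \<in> hcar B"
      have "hinn B (D n h f) (C z) = hinn B (D n h (C f)) z" for n
      proof -
        have "hinn B (D n h f) (C z) = hinn B (D n h f) z" unfolding D_def using z h f by (simp add: XC)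
        also have "\<dots> = hinn B (D n h (C f)) z" using h f z by (simp add: Dadj inn_q Yadj CX)
        finally show ?thesis .
      qed
      then have "(\<lambda>n. hinn B (D n h (C f)) z) sums (hinn B (G (h, f)) (C z) - hinn B f (C z))"
        using G_sums[OF h f, of "C z"] z by simp
      from sums_unique2[OF this G_sums] h f z show "hinn B (C (G (h, f))) z = hinn B (G (h, C f)) z"
        by (simp add: Cadj)
    qed
  qed (use h f in auto)
qed

end

section \<open>Trace bounds for the commutator with the unitary groups\<close>

lemma trace_bound_hadd:
  assumes "inner_space W" "trace_bound V W T B" "trace_bound V W R C" "\<And>x. x \<in> hcar V \<Longrightarrow> T x \<in> hcar W" "\<And>x. x \<in> hcar V \<Longrightarrow> R x \<in> hcar W"
  shows "trace_bound V W (\<lambda>x. hadd W (T x) (R x)) (B + C)" "trace_bound V W (\<lambda>x. hsub W (T x) (R x)) (B + C)"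
proof -
  interpret W: inner_space W by fact
  show "trace_bound V W (\<lambda>x. hadd W (T x) (R x)) (B + C)"
    by (rule trace_bound_add[OF assms(2,3)]) (simp add: assms(4,5) norm_triangle_ineq)
  show "trace_bound V W (\<lambda>x. hsub W (T x) (R x)) (B + C)"
    by (rule trace_bound_add[OF assms(2,3)]) (simp add: assms(4,5) norm_triangle_ineq4)
qed

definition isometry_adj :: "'v hspace \<Rightarrow> ('v \<Rightarrow> 'v) \<Rightarrow> ('v \<Rightarrow> 'v) \<Rightarrow> bool" where
  "isometry_adj V U U' \<longleftrightarrow> adjoint_pair V V U U' \<and> (\<forall>x\<in>hcar V. \<forall>y\<in>hcar V. hinn V (U x) (U y) = hinn V x y)"

lemma isometry_adjD:
  assumes "isometry_adj V U U'"
  shows "adjoint_pair V V U U'" "x \<in> hcar V \<Longrightarrow> U x \<in> hcar V" "x \<in> hcar V \<Longrightarrow> U' x \<in> hcar V"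
    "\<lbrakk>x \<in> hcar V; y \<in> hcar V\<rbrakk> \<Longrightarrow> hinn V (U x) y = hinn V x (U' y)"
    "\<lbrakk>x \<in> hcar V; y \<in> hcar V\<rbrakk> \<Longrightarrow> hinn V (U x) (U y) = hinn V x y"
  using assms unfolding isometry_adj_def adjoint_pair_def by blast+

lemma isometry_adj_contractive:
  assumes "inner_space V" "isometry_adj V U U'"
  shows "contractive V V U" "contractive V V U'"
proof -
  have n: "\<And>x. x \<in> hcar V \<Longrightarrow> hnorm V (U x) \<le> hnorm V x"
    by (simp add: hnorm_def isometry_adjD(5)[OF assms(2)])
  show "contractive V V U" "contractive V V U'" using adjoint_pair_contractive[OF assms(1,1) isometry_adjD(1)[OF assms(2)] n] by auto
qed

text \<open>The difference is the sum over \<open>k\<close> of the operators \<open>T k\<close>,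
  each built from two rank one terms whose factors are the eigenvector errors \<open>a k\<close> and
  \<open>b k\<close>. The main terms cancel because \<open>u k\<close> and \<open>v k\<close> share
  the approximate eigenvalue \<open>m k\<close>.\<close>

lemma trace_bound_intertwine:
  assumes "hilbert A" "hilbert B" and u: "on_or_zero_seq A u" and v: "on_or_zero_seq B v"
    and U: "isometry_adj A U U'" and S: "isometry_adj B S S'"
    and m: "\<And>k. cmod (m k) = 1" and s: "summable \<epsilon>"
    and Ue: "\<And>k. hnorm A (hsub A (U (u k)) (hscl A (m k) (u k))) \<le> \<epsilon> k"
    and Se: "\<And>k. hnorm B (hsub B (S (v k)) (hscl B (m k) (v k))) \<le> \<epsilon> k"
  shows "trace_bound A B (\<lambda>h. hsub B (transfer A B u v (U h)) (S (transfer A B u v h))) (2 * suminf \<epsilon>)"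
proof -
  interpret two_hilberts A B u v by (rule two_hilberts.intro) (use assms in \<open>auto simp: two_hilberts_axioms_def\<close>)
  note UU = isometry_adjD[OF U] and SS = isometry_adjD[OF S]
  have mm: "m k * cnj (m k) = 1" "cnj (m k) * m k = 1" for k
    using complex_norm_square[of "m k"] m[of k] by (simp_all add: mult.commute)
  \<comment> \<open>As \<open>m k\<close> is unimodular, \<open>a k\<close> has the norm of the
    eigenvector error of \<open>u k\<close>. Pairing it with \<open>U h\<close> gives
    \<open>hinn A (U h) (u k) - m k * hinn A h (u k)\<close>, since \<open>U\<close> preserves inner
    products.\<close>
  define a where "a k = hsub A (u k) (hscl A (cnj (m k)) (U (u k)))" for k
  define b where "b k = hsub B (hscl B (m k) (v k)) (S (v k))" for k
  have a [simp]: "a k \<in> hcar A" for k using UU(2) by (simp add: a_def)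
  have b [simp]: "b k \<in> hcar B" for k using SS(2) by (simp add: b_def)
  have na: "hnorm A (a k) \<le> \<epsilon> k" for k
  proof -
    have "hnorm A (a k) = hnorm A (hscl A (- cnj (m k)) (hsub A (U (u k)) (hscl A (m k) (u k))))"
    proof (rule A.norm_by_inn)
      fix z assume z: "z \<in> hcar A"
      have "cnj (m k) * (m k * hinn A (u k) z) = hinn A (u k) z" using mm(2)[of k] by (simp add: mult.assoc[symmetric])
      then show "hinn A (a k) z = hinn A (hscl A (- cnj (m k)) (hsub A (U (u k)) (hscl A (m k) (u k)))) z"
        using UU(2) z by (simp add: a_def algebra_simps)
    qed (use UU(2) in auto)
    also have "\<dots> \<le> \<epsilon> k" using Ue[of k] UU(2) m by (subst A.norm_scl) auto
    finally show ?thesis .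
  qed
  have nb: "hnorm B (b k) \<le> \<epsilon> k" for k
  proof -
    have "hnorm B (b k) = hdist B (S (v k)) (hscl B (m k) (v k))"
      using B.dist_sym[of "S (v k)" "hscl B (m k) (v k)"] SS(2) by (simp add: b_def hdist_def)
    then show ?thesis using Se[of k] by (simp add: hdist_def)
  qed
  define T where "T k h = hadd B (hscl B (hinn A (U h) (a k)) (v k)) (hscl B (hinn A h (u k)) (b k))" for k h
  have T: "trace_bound A B (T k) (\<epsilon> k + \<epsilon> k)" for k
  proof -
    have "trace_bound A B (\<lambda>h. hscl B (hinn A h (a k)) (v k)) (hnorm A (a k) * hnorm B (v k))"
      by (rule trace_bound_rank1) (auto intro: A.inner_space_axioms B.inner_space_axioms)
    then have "trace_bound A B (\<lambda>h. hscl B (hinn A (U h) (a k)) (v k)) (hnorm A (a k) * hnorm B (v k))"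
      by (rule trace_bound_right[OF A.inner_space_axioms A.inner_space_axioms _ isometry_adj_contractive(1)[OF A.inner_space_axioms U]])
    moreover have "hnorm A (a k) * hnorm B (v k) \<le> \<epsilon> k * 1"
      using na[of k] on_or_zero_seq_norm[OF v, of k] order_trans[OF A.norm_ge[OF a] na[of k]] by (intro mult_mono) auto
    ultimately have 1: "trace_bound A B (\<lambda>h. hscl B (hinn A (U h) (a k)) (v k)) (\<epsilon> k)"
      by (simp add: trace_bound_mono)
    have "trace_bound A B (\<lambda>h. hscl B (hinn A h (u k)) (b k)) (hnorm A (u k) * hnorm B (b k))"
      by (rule trace_bound_rank1) (auto intro: A.inner_space_axioms B.inner_space_axioms)
    moreover have "hnorm A (u k) * hnorm B (b k) \<le> 1 * \<epsilon> k"
      using nb[of k] on_or_zero_seq_norm[OF u, of k] A.norm_ge[OF uin, of k] by (intro mult_mono) auto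
    ultimately have 2: "trace_bound A B (\<lambda>h. hscl B (hinn A h (u k)) (b k)) (\<epsilon> k)"
      by (simp add: trace_bound_mono)
    show ?thesis unfolding T_def by (rule trace_bound_hadd(1)[OF B.inner_space_axioms 1 2]) auto
  qed
  have "trace_bound A B (\<lambda>h. hsub B (transfer A B u v (U h)) (S (transfer A B u v h))) (\<Sum>k. \<epsilon> k + \<epsilon> k)"
  proof (rule trace_bound_sums[OF T])
    show "summable (\<lambda>k. \<epsilon> k + \<epsilon> k)" using s by (intro summable_add)
    fix h z assume h: "h \<in> hcar A" and z: "z \<in> hcar B"
    have "(\<lambda>k. hinn A (U h) (u k) * hinn B (v k) z - hinn A h (u k) * hinn B (v k) (S' z)) sums
       (hinn B (transfer A B u v (U h)) z - hinn B (transfer A B u v h) (S' z))"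
      by (intro sums_diff transfer_sums) (use h z UU(2,3) SS(2,3) in auto)
    moreover have "hinn A (U h) (u k) * hinn B (v k) z - hinn A h (u k) * hinn B (v k) (S' z) = hinn B (T k h) z" for k
      using h z UU(2,3,5) SS(2,3) by (simp add: T_def a_def b_def SS(4)[symmetric] algebra_simps)
    ultimately show "(\<lambda>n. hinn B (T n h) z) sums hinn B (hsub B (transfer A B u v (U h)) (S (transfer A B u v h))) z"
      using h z UU(2,3) SS(2,3) by (simp add: SS(4))
  qed
  then show ?thesis using suminf_mult[OF s, of 2] by simp
qed

context absorb begin

text \<open>Each \<open>D n\<close> combines products of operators \<open>X\<close> and
  \<open>Y\<close>, so a Leibniz rule reduces its commutator to those of the single factors, bounded
  by \<open>c\<close>. Only the levels n and n + 1 occur in \<open>D n\<close>, hence the bounds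
  remain summable.\<close>

lemma trace_bound_G_commutator:
  assumes U: "isometry_adj A U U'" and S: "isometry_adj B S S'"
    and m: "\<And>n k. cmod (m n k) = 1" and s: "\<And>n. summable (\<epsilon> n)" "summable (\<lambda>n. suminf (\<epsilon> n))"
    and Ue: "\<And>n k. hnorm A (hsub A (U (e n k)) (hscl A (m n k) (e n k))) \<le> \<epsilon> n k"
    and Se: "\<And>n k. hnorm B (hsub B (S (w n k)) (hscl B (m n k) (w n k))) \<le> \<epsilon> n k"
  shows "\<exists>C. trace_bound (hs_dsum A B) B (\<lambda>p. hsub B (G (U (fst p), S (snd p))) (S (G p))) C"
proof -
  note UU = isometry_adjD[OF U] and SS = isometry_adjD[OF S]
  note wi = A.inner_space_axioms B.inner_space_axioms inner_space_AB
  define c where "c n = 2 * suminf (\<epsilon> n)" for n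
  define KX where "KX n h = hsub B (X n (U h)) (S (X n h))" for n h
  define KY where "KY n f = hsub A (Y n (S f)) (U (Y n f))" for n f
  have KXi [simp]: "h \<in> hcar A \<Longrightarrow> KX n h \<in> hcar B" for n h using UU(2) SS(2) by (simp add: KX_def)
  have KYi [simp]: "f \<in> hcar B \<Longrightarrow> KY n f \<in> hcar A" for n f using UU(2) SS(2) by (simp add: KY_def)
  have KX: "trace_bound A B (KX n) (c n)" for n unfolding KX_def X_def c_def
    by (rule trace_bound_intertwine[OF A.hilbert_axioms B.hilbert_axioms e w U S m s(1) Ue Se])
  have KY: "trace_bound B A (KY n) (c n)" for n unfolding KY_def Y_def c_def
    by (rule trace_bound_intertwine[OF B.hilbert_axioms A.hilbert_axioms w e S U m s(1) Se Ue])
  have cf: "contractive (hs_dsum A B) A fst" "contractive (hs_dsum A B) B snd"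
    unfolding contractive_def weakly_linear_def by (auto simp: hnorm_def A.inn_ge B.inn_ge)
  have P_ctr: "contractive A A (P n)" for n unfolding P_def by (rule contractive_comp[OF wi(1,2,1) X_ctr Y_ctr])
  have right: "trace_bound (hs_dsum A B) W (\<lambda>p. T (R p)) C" if "inner_space V" "trace_bound V W T C" "contractive (hs_dsum A B) V R" for V W T C R
    using trace_bound_right[OF wi(3) that] .
  have cP: "contractive (hs_dsum A B) A (\<lambda>p. P n (fst p))" for n by (rule contractive_comp[OF wi(3,1,1) cf(1) P_ctr])
  have cX: "contractive (hs_dsum A B) B (\<lambda>p. X n (fst p))" for n by (rule contractive_comp[OF wi(3,1,2) cf(1) X_ctr])
  have cY: "contractive (hs_dsum A B) A (\<lambda>p. Y n (snd p))" for n by (rule contractive_comp[OF wi(3,2,1) cf(2) Y_ctr])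
  have XL: "trace_bound (hs_dsum A B) B (\<lambda>p. X n (T p)) C" if "trace_bound (hs_dsum A B) A T C" "\<And>p. p \<in> hcar (hs_dsum A B) \<Longrightarrow> T p \<in> hcar A" for n T C
    by (rule trace_bound_left[OF wi(1,2) that(1) Y_ctr[of n]]) (use that(2) in \<open>auto simp: Xadj\<close>)
  have YL: "trace_bound (hs_dsum A B) A (\<lambda>p. Y n (T p)) C" if "trace_bound (hs_dsum A B) B T C" "\<And>p. p \<in> hcar (hs_dsum A B) \<Longrightarrow> T p \<in> hcar B" for n T C
    by (rule trace_bound_left[OF wi(2,1) that(1) X_ctr[of n]]) (use that(2) in \<open>auto simp: Yadj\<close>)
  have add: "trace_bound (hs_dsum A B) B (\<lambda>x. hadd B (T x) (R x)) (C1 + C2)" "trace_bound (hs_dsum A B) B (\<lambda>x. hsub B (T x) (R x)) (C1 + C2)"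
    if "trace_bound (hs_dsum A B) B T C1" "trace_bound (hs_dsum A B) B R C2" "\<And>x. x \<in> hcar (hs_dsum A B) \<Longrightarrow> T x \<in> hcar B"
      "\<And>x. x \<in> hcar (hs_dsum A B) \<Longrightarrow> R x \<in> hcar B" for T R C1 C2
    using trace_bound_hadd[OF wi(2) that] by auto
  \<comment> \<open>\<open>R1 n\<close>, \<open>R2 n\<close> and \<open>R3 k n\<close> are the
    commutators of \<open>X (Suc n)\<close>, of the product of \<open>X (Suc n)\<close>,
    \<open>Y n\<close>, \<open>X n\<close>, and of the product of \<open>X (Suc n)\<close>,
    \<open>Y k\<close>, with one summand for each factor.\<close>
  define R1 where "R1 n p = KX (Suc n) (fst p)" for n and p :: "'a \<times> 'b"
  define R2 where "R2 n p = hadd B (X (Suc n) (Y n (KX n (fst p))))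
      (hadd B (X (Suc n) (KY n (X n (fst p)))) (KX (Suc n) (P n (fst p))))" for n and p :: "'a \<times> 'b"
  define R3 where "R3 k n p = hadd B (X (Suc n) (KY k (snd p))) (KX (Suc n) (Y k (snd p)))" for k n and p :: "'a \<times> 'b"
  have in1 [simp]: "R1 n p \<in> hcar B" "R2 n p \<in> hcar B" "R3 k n p \<in> hcar B" if "p \<in> hcar (hs_dsum A B)" for n k p
    using that by (auto simp: R1_def R2_def R3_def)
  have T1: "trace_bound (hs_dsum A B) B (R1 n) (c (Suc n))" for n
    unfolding R1_def by (rule right[OF wi(1) KX cf(1)])
  have T2: "trace_bound (hs_dsum A B) B (R2 n) (c n + (c n + c (Suc n)))" for n
    unfolding R2_def
    by (intro add XL YL right[OF wi(1) KX cf(1)] right[OF wi(2) KY cX] right[OF wi(1) KX cP]) auto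
  have T3: "trace_bound (hs_dsum A B) B (R3 k n) (c k + c (Suc n))" for k n
    unfolding R3_def
    by (intro add XL right[OF wi(2) KY cf(2)] right[OF wi(1) KX cY]) auto
  define R where "R n p = hadd B (hsub B (R1 n p) (R2 n p)) (hsub B (R3 n n p) (R3 (Suc n) n p))" for n p
  have R [simp]: "R n p \<in> hcar B" if "p \<in> hcar (hs_dsum A B)" for n p using that by (simp add: R_def)
  define d where "d n = (c (Suc n) + (c n + (c n + c (Suc n)))) + ((c n + c (Suc n)) + (c (Suc n) + c (Suc n)))" for n
  have TR: "trace_bound (hs_dsum A B) B (R n) (d n)" for n
    unfolding R_def d_def by (intro add T1 T2 T3) auto
  have sc: "summable c" "summable (\<lambda>n. c (Suc n))"
    using s(2) summable_Suc_iff[of c] by (simp_all add: c_def[abs_def] summable_mult)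
  have sd: "summable d" unfolding d_def[abs_def] by (intro summable_add sc)
  have "trace_bound (hs_dsum A B) B (\<lambda>p. hsub B (G (U (fst p), S (snd p))) (S (G p))) (suminf d)"
  proof (rule trace_bound_sums[OF TR sd])
    fix p z assume p: "p \<in> hcar (hs_dsum A B)" and z: "z \<in> hcar B"
    obtain h f where hf: "p = (h, f)" "h \<in> hcar A" "f \<in> hcar B" using p by auto
    have tm: "hinn B (D n (U h) (S f)) z - hinn B (D n h f) (S' z) = hinn B (R n p) z" for n
    proof -
      have Xl: "hinn B (X k (hsub A x y)) v = hinn B (X k x) v - hinn B (X k y) v" if "x \<in> hcar A" "y \<in> hcar A" "v \<in> hcar B" for k x y v
        using that by (simp add: Xadj)
      have Yl: "hinn A (Y k (hsub B x y)) v = hinn A (Y k x) v - hinn A (Y k y) v" if "x \<in> hcar B" "y \<in> hcar B" "v \<in> hcar A" for k x y v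
        using that by (simp add: Yadj)
      have XYl: "hinn B (X j (Y k (hsub B x y))) v = hinn B (X j (Y k x)) v - hinn B (X j (Y k y)) v"
        if "x \<in> hcar B" "y \<in> hcar B" "v \<in> hcar B" for j k x y v
        using that by (simp add: Xadj Yl)
      have Dn: "hinn B (D n h f) v = hinn B (X (Suc n) h) v - hinn B (X (Suc n) (Y n (X n h))) v
          + (hinn B (X (Suc n) (Y n f)) v - hinn B (X (Suc n) (Y (Suc n) f)) v)"
        if "h \<in> hcar A" "f \<in> hcar B" "v \<in> hcar B" for h f v
        using that by (simp add: Dadj inn_q Xadj P_def)
      show ?thesis using hf z UU(2,3) SS(2,3)
        by (simp add: R_def R1_def R2_def R3_def KX_def KY_def Dn Xl Yl XYl P_def SS(4))
    qed
    have "(\<lambda>n. hinn B (D n (U h) (S f)) z - hinn B (D n h f) (S' z)) sums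
      (hinn B (G (U h, S f)) z - hinn B (S f) z - (hinn B (G (h, f)) (S' z) - hinn B f (S' z)))"
      by (intro sums_diff G_sums) (use hf z UU(2,3) SS(2,3) in auto)
    then show "(\<lambda>n. hinn B (R n p) z) sums hinn B (hsub B (G (U (fst p), S (snd p))) (S (G p))) z"
      using hf z UU(2,3) SS(2,3) by (simp add: tm SS(4))
  qed
  then show ?thesis by blast
qed

end

section \<open>The space L2 on the line\<close>

lemma borel_measurable_cnj [measurable (raw)]:
  "f \<in> borel_measurable M \<Longrightarrow> (\<lambda>x. cnj (f x)) \<in> borel_measurable M"
  by (rule measurable_compose[OF _ borel_measurable_continuous_onI]) (auto intro!: continuous_intros)

lemma L2R_simps [simp]:
  "f \<in> hcar L2R \<longleftrightarrow> f \<in> borel_measurable borel \<and> integrable lborel (\<lambda>x. (cmod (f x))\<^sup>2)"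
  "hadd L2R f g = (\<lambda>x. f x + g x)" "hscl L2R a f = (\<lambda>x. a * f x)" "hzero L2R = (\<lambda>x. 0)"
  "hsub L2R f g = (\<lambda>x. f x - g x)"
  by (auto simp: L2R_def hsub_def)

lemma inn_L2R: "hinn L2R f g = (LINT x|lborel. f x * cnj (g x))"
  by (simp add: L2R_def)

lemma L2_prod_integrable:
  assumes "f \<in> hcar L2R" "g \<in> hcar L2R"
  shows "integrable lborel (\<lambda>x. f x * cnj (g x))"
proof (rule Bochner_Integration.integrable_bound)
  have [measurable]: "f \<in> borel_measurable borel" "g \<in> borel_measurable borel" using assms by auto
  show "integrable lborel (\<lambda>x. (cmod (f x))\<^sup>2 + (cmod (g x))\<^sup>2)" using assms by simp
  show "(\<lambda>x. f x * cnj (g x)) \<in> borel_measurable lborel" by simp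
  have "a * b \<le> a\<^sup>2 + b\<^sup>2" if "0 \<le> a" "0 \<le> b" for a b :: real
    using sum_squares_bound[of a b] mult_nonneg_nonneg[OF that] by linarith
  then show "AE x in lborel. norm (f x * cnj (g x)) \<le> norm ((cmod (f x))\<^sup>2 + (cmod (g x))\<^sup>2)"
    by (auto simp: norm_mult)
qed

lemma L2_add_integrable:
  assumes "f \<in> hcar L2R" "g \<in> hcar L2R"
  shows "integrable lborel (\<lambda>x. (cmod (f x + g x))\<^sup>2)"
proof (rule Bochner_Integration.integrable_bound)
  have [measurable]: "f \<in> borel_measurable borel" "g \<in> borel_measurable borel" using assms by auto
  show "integrable lborel (\<lambda>x. 2 * ((cmod (f x))\<^sup>2 + (cmod (g x))\<^sup>2))" using assms by simp
  show "(\<lambda>x. (cmod (f x + g x))\<^sup>2) \<in> borel_measurable lborel" by simp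
  have "(cmod (a + b))\<^sup>2 \<le> 2 * ((cmod a)\<^sup>2 + (cmod b)\<^sup>2)" for a b
  proof -
    have "(cmod (a + b))\<^sup>2 \<le> (cmod a + cmod b)\<^sup>2" by (intro power_mono norm_triangle_ineq) auto
    also have "\<dots> \<le> 2 * ((cmod a)\<^sup>2 + (cmod b)\<^sup>2)"
      using sum_squares_bound[of "cmod a" "cmod b"] by (simp add: power2_sum)
    finally show ?thesis .
  qed
  then show "AE x in lborel. norm ((cmod (f x + g x))\<^sup>2) \<le> norm (2 * ((cmod (f x))\<^sup>2 + (cmod (g x))\<^sup>2))"
    by auto
qed

lemma inn_L2R_self: "hinn L2R f f = of_real (LINT x|lborel. (cmod (f x))\<^sup>2)"
proof -
  have "hinn L2R f f = (LINT x|lborel. of_real ((cmod (f x))\<^sup>2))"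
    unfolding inn_L2R by (simp only: complex_norm_square)
  then show ?thesis by (simp only: integral_complex_of_real)
qed

lemma norm_L2R: "hnorm L2R f = sqrt (LINT x|lborel. (cmod (f x))\<^sup>2)"
  by (simp add: hnorm_def inn_L2R_self)

lemma norm2_L2R: "(hnorm L2R f)\<^sup>2 = (LINT x|lborel. (cmod (f x))\<^sup>2)"
  by (simp add: norm_L2R)

interpretation L: inner_space L2R
proof (unfold_locales, goal_cases)
  case (2 f g)
  then show ?case using L2_add_integrable[OF 2] by (simp add: borel_measurable_add)
next
  case (3 f a)
  then show ?case by (auto simp: norm_mult power_mult_distrib intro!: borel_measurable_times)
next
  case (5 f g h)
  then show ?case using L2_prod_integrable
    by (simp add: inn_L2R distrib_right del: L2R_simps(1))
next
  case (6 f g a)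
  then show ?case by (simp add: inn_L2R mult.assoc)
next
  case (7 f g)
  have "hinn L2R g f = (LINT x|lborel. cnj (f x * cnj (g x)))" by (simp add: inn_L2R mult.commute)
  then show ?case using Bochner_Integration.integral_cnj[of lborel "\<lambda>x. f x * cnj (g x)"] by (simp add: inn_L2R)
qed (simp_all add: inn_L2R_self)

lemma heq_L2R_AE:
  assumes "f \<in> hcar L2R" "g \<in> hcar L2R" "AE x in lborel. f x = g x"
  shows "heq L2R f g"
proof -
  have [measurable]: "f \<in> borel_measurable borel" "g \<in> borel_measurable borel" using assms by auto
  have "(LINT x|lborel. (cmod (f x - g x))\<^sup>2) = (LINT x|(lborel :: real measure). (0::real))"
    using assms(3) by (intro Bochner_Integration.integral_cong_AE) auto
  then show ?thesis by (simp add: heq_def hdist_def norm_L2R)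
qed

text \<open>The Riesz-Fischer argument: a subsequence with geometrically small differences converges
  almost everywhere, and Fatou's lemma makes the pointwise limit a limit in norm of the whole
  sequence.\<close>

lemma L2_complete:
  assumes X: "\<And>n. X n \<in> hcar L2R" and C: "\<And>e. e > 0 \<Longrightarrow> \<exists>N. \<forall>m\<ge>N. \<forall>n\<ge>N. hdist L2R (X m) (X n) < e"
  shows "\<exists>f\<in>hcar L2R. (\<lambda>n. hdist L2R (X n) f) \<longlonglongrightarrow> 0"
proof -
  note Xm [measurable] = X[simplified, THEN conjunct1]
  have "\<forall>k. \<exists>N. \<forall>m\<ge>N. \<forall>n\<ge>N. hdist L2R (X m) (X n) < (1/2)^k" using C by simp
  then obtain N where N: "\<And>k m n. m \<ge> N k \<Longrightarrow> n \<ge> N k \<Longrightarrow> hdist L2R (X m) (X n) < (1/2)^k" by metis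
  \<comment> \<open>Adding up the \<open>N i\<close> and then \<open>k\<close> makes
    \<open>r\<close> nondecreasing, at least \<open>N\<close> and unbounded.\<close>
  define r where "r k = (\<Sum>i\<le>k. N i) + k" for k
  have rN: "N k \<le> r k" for k using member_le_sum[of k "{..k}" N] by (simp add: r_def)
  have rS: "r k \<le> r (Suc k)" for k by (simp add: r_def)
  have rk: "k \<le> r k" for k by (simp add: r_def)
  define d where "d k x = X (r (Suc k)) x - X (r k) x" for k x
  have dm [measurable]: "d k \<in> borel_measurable borel" for k unfolding d_def by measurable
  have di: "integrable lborel (\<lambda>x. (cmod (d k x))\<^sup>2)" for k
    using L.sub_in[OF X X, of "r (Suc k)" "r k"] by (simp add: d_def)
  \<comment> \<open>The squared norms of the \<open>d k\<close> decay like \<open>(1/4)^k\<close>,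
    so they can absorb the weight \<open>2^k\<close>; the weight yields geometric decay of
    \<open>cmod (d k x)\<close> for almost every \<open>x\<close>.\<close>
  have dn: "(\<integral>\<^sup>+x. ennreal (2^k * (cmod (d k x))\<^sup>2) \<partial>lborel) \<le> ennreal ((1/2)^k)" for k
  proof -
    have "hnorm L2R (d k) \<le> (1/2)^k"
      using N[of k "r (Suc k)" "r k"] rN[of k] rS[of k] by (simp add: hdist_def d_def[abs_def])
    then have "(hnorm L2R (d k))\<^sup>2 \<le> ((1/2)^k)\<^sup>2"
      by (intro power_mono) (simp_all add: norm_L2R)
    also have "((1/2)^k)\<^sup>2 = (1/2)^k * ((1/2)^k :: real)" by (simp add: power2_eq_square)
    finally have "2^k * (LINT x|lborel. (cmod (d k x))\<^sup>2) \<le> 2^k * ((1/2)^k * (1/2)^k)"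
      by (simp add: norm2_L2R)
    also have "\<dots> = (1/2)^k" by (simp add: power_mult_distrib[symmetric] flip: mult.assoc)
    finally have "(LINT x|lborel. 2^k * (cmod (d k x))\<^sup>2) \<le> (1/2)^k" by simp
    then show ?thesis using di by (subst nn_integral_eq_integral) (auto intro!: ennreal_leI)
  qed
  have "(\<integral>\<^sup>+x. (\<Sum>k. ennreal (2^k * (cmod (d k x))\<^sup>2)) \<partial>lborel) = (\<Sum>k. \<integral>\<^sup>+x. ennreal (2^k * (cmod (d k x))\<^sup>2) \<partial>lborel)"
    by (intro nn_integral_suminf) measurable
  also have "\<dots> \<le> (\<Sum>k. ennreal ((1/2)^k))" by (intro suminf_le dn) auto
  also have "\<dots> = ennreal (\<Sum>k. (1/2)^k)" by (intro suminf_ennreal2) auto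
  also have "\<dots> < \<infinity>" by simp
  finally have "AE x in lborel. (\<Sum>k. ennreal (2^k * (cmod (d k x))\<^sup>2)) \<noteq> \<infinity>"
    by (intro nn_integral_PInf_AE) auto
  then have conv: "AE x in lborel. convergent (\<lambda>k. X (r k) x)"
  proof eventually_elim
    case (elim x)
    then have "summable (\<lambda>k. 2^k * (cmod (d k x))\<^sup>2)"
      by (intro summable_suminf_not_top) auto
    then have "(\<lambda>k. 2^k * (cmod (d k x))\<^sup>2) \<longlonglongrightarrow> 0" by (rule summable_LIMSEQ_zero)
    then have "Bseq (\<lambda>k. 2^k * (cmod (d k x))\<^sup>2)" by (intro convergent_imp_Bseq convergentI)
    then obtain K where K: "K > 0" "\<And>k. norm (2^k * (cmod (d k x))\<^sup>2) \<le> K" unfolding Bseq_def by blast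
    have "cmod (d k x) \<le> sqrt K * (sqrt (1/2))^k" for k
    proof (rule power2_le_imp_le)
      have "2^k * (cmod (d k x))\<^sup>2 \<le> K" using K(2)[of k] by simp
      then have "(cmod (d k x))\<^sup>2 \<le> K * (1/2)^k" by (simp add: field_simps)
      also have "\<dots> = (sqrt K * (sqrt (1/2))^k)\<^sup>2"
      proof -
        have "((sqrt (1/2))^k)\<^sup>2 = ((sqrt (1/2))\<^sup>2)^k" by (simp only: power_mult[symmetric] mult.commute)
        then show ?thesis using K(1) by (simp add: power_mult_distrib)
      qed
      finally show "(cmod (d k x))\<^sup>2 \<le> (sqrt K * (sqrt (1/2))^k)\<^sup>2" .
    qed (use K in simp)
    then have "summable (\<lambda>k. d k x)"
      by (intro summable_comparison_test'[OF summable_mult[OF summable_geometric], of "sqrt (1/2)" 0 _ "sqrt K"]) (auto simp: real_sqrt_less_iff)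
    then have "convergent (\<lambda>n. \<Sum>k<n. d k x)" by (simp add: summable_iff_convergent)
    moreover have "(\<Sum>k<n. d k x) = X (r n) x - X (r 0) x" for n
      unfolding d_def by (rule sum_lessThan_telescope)
    ultimately have "convergent (\<lambda>n. (X (r n) x - X (r 0) x) + X (r 0) x)"
      by (intro convergent_add convergent_const) simp
    then show ?case by simp
  qed
  define f where "f x = lim (\<lambda>k. X (r k) x)" for x
  have fm [measurable]: "f \<in> borel_measurable borel"
    unfolding f_def using borel_measurable_lim_metric[of "\<lambda>k. X (r k)" borel] by simp
  have lim: "AE x in lborel. (\<lambda>k. X (r k) x) \<longlonglongrightarrow> f x"
    using conv by eventually_elim (simp add: f_def convergent_LIMSEQ_iff)
  have est: "(\<integral>\<^sup>+x. ennreal ((cmod (X m x - f x))\<^sup>2) \<partial>lborel) \<le> ennreal (e\<^sup>2)"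
    if e: "e > 0" and M: "\<And>m n. m \<ge> M \<Longrightarrow> n \<ge> M \<Longrightarrow> hdist L2R (X m) (X n) < e" and m: "m \<ge> M" for e M m
  proof -
    have "(\<integral>\<^sup>+x. ennreal ((cmod (X m x - f x))\<^sup>2) \<partial>lborel) =
        (\<integral>\<^sup>+x. liminf (\<lambda>k. ennreal ((cmod (X m x - X (r k) x))\<^sup>2)) \<partial>lborel)"
    proof (rule nn_integral_cong_AE, use lim in eventually_elim)
      case (elim x)
      then have "(\<lambda>k. ennreal ((cmod (X m x - X (r k) x))\<^sup>2)) \<longlonglongrightarrow> ennreal ((cmod (X m x - f x))\<^sup>2)"
        by (intro tendsto_intros)
      then show ?case by (rule lim_imp_Liminf[OF trivial_limit_sequentially, symmetric])
    qed
    also have "\<dots> \<le> liminf (\<lambda>k. \<integral>\<^sup>+x. ennreal ((cmod (X m x - X (r k) x))\<^sup>2) \<partial>lborel)"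
      by (intro nn_integral_liminf) measurable
    also have "\<dots> \<le> ennreal (e\<^sup>2)"
    proof (rule order_trans[OF Liminf_le_Limsup[OF trivial_limit_sequentially] Limsup_bounded],
        rule eventually_sequentiallyI[of M])
      fix k assume k: "M \<le> k"
      have "hdist L2R (X m) (X (r k)) < e" using M m k rk[of k] by (meson order_trans)
      then have "(hdist L2R (X m) (X (r k)))\<^sup>2 \<le> e\<^sup>2" using X by (intro power_mono) auto
      moreover have "integrable lborel (\<lambda>x. (cmod (X m x - X (r k) x))\<^sup>2)"
        using L.sub_in[OF X X, of m "r k"] by simp
      ultimately show "(\<integral>\<^sup>+x. ennreal ((cmod (X m x - X (r k) x))\<^sup>2) \<partial>lborel) \<le> ennreal (e\<^sup>2)"
        by (subst nn_integral_eq_integral) (auto simp: hdist_def norm2_L2R intro!: ennreal_leI)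
    qed
    finally show ?thesis .
  qed
  have int: "integrable lborel (\<lambda>x. (cmod (X m x - f x))\<^sup>2)"
    if e: "e > 0" and M: "\<And>m n. m \<ge> M \<Longrightarrow> n \<ge> M \<Longrightarrow> hdist L2R (X m) (X n) < e" and m: "m \<ge> M" for e M m
    using est[OF that] by (intro integrableI_bounded) (auto simp: less_top[symmetric] top_unique)
  obtain M1 where M1: "\<And>m n. m \<ge> M1 \<Longrightarrow> n \<ge> M1 \<Longrightarrow> hdist L2R (X m) (X n) < 1" using C[of 1] by auto
  have sub: "(\<lambda>x. X M1 x - f x) \<in> hcar L2R" using int[of 1 M1 M1] M1 by simp
  have f: "f \<in> hcar L2R" using L.sub_in[OF X[of M1] sub] by simp
  have "\<exists>M. \<forall>m\<ge>M. norm (hdist L2R (X m) f) < e" if "e > 0" for e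
  proof -
    obtain M where M: "\<And>m n. m \<ge> M \<Longrightarrow> n \<ge> M \<Longrightarrow> hdist L2R (X m) (X n) < e / 2" using C[of "e/2"] \<open>e > 0\<close> by auto
    have "hdist L2R (X m) f < e" if m: "m \<ge> M" for m
    proof -
      have 1: "(\<integral>\<^sup>+x. ennreal ((cmod (X m x - f x))\<^sup>2) \<partial>lborel) \<le> ennreal ((e/2)\<^sup>2)"
        by (rule est[of "e/2" M]) (use M m \<open>e > 0\<close> in simp_all)
      have 2: "integrable lborel (\<lambda>x. (cmod (X m x - f x))\<^sup>2)"
        by (rule int[of "e/2" M]) (use M m \<open>e > 0\<close> in simp_all)
      have "ennreal ((hdist L2R (X m) f)\<^sup>2) \<le> ennreal ((e/2)\<^sup>2)"
      proof -
        have "(\<integral>\<^sup>+x. ennreal ((cmod (X m x - f x))\<^sup>2) \<partial>(lborel :: real measure)) = ennreal ((hdist L2R (X m) f)\<^sup>2)"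
          unfolding hdist_def norm2_L2R L2R_simps by (rule nn_integral_eq_integral[OF 2]) simp
        then show ?thesis using 1 by (simp only:)
      qed
      then have "(hdist L2R (X m) f)\<^sup>2 \<le> (e/2)\<^sup>2" by (rule ennreal_le_iff[THEN iffD1, rotated]) (rule zero_le_power2)
      then have "hdist L2R (X m) f \<le> e/2" by (rule power2_le_imp_le) (use \<open>e > 0\<close> in linarith)
      then show ?thesis using \<open>e > 0\<close> by simp
    qed
    moreover have "0 \<le> hdist L2R (X m) f" for m by (rule L.dist_ge[OF X f])
    ultimately show ?thesis by auto
  qed
  then have "(\<lambda>n. hdist L2R (X n) f) \<longlonglongrightarrow> 0" by (simp add: LIMSEQ_iff)
  with f show ?thesis by blast
qed

lemma hilbert_L2R: "hilbert L2R"
  by unfold_locales (rule L2_complete)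

interpretation L: hilbert L2R by (rule hilbert_L2R)

section \<open>Translations and their strong continuity\<close>

lemma tshift_in [simp]: "f \<in> hcar L2R \<Longrightarrow> tshift t f \<in> hcar L2R"
  using lborel_integrable_real_affine[of "\<lambda>x. (cmod (f x))\<^sup>2" 1 "-t"]
  by (auto simp: tshift_def algebra_simps)

lemma tshift_isometry: "isometry_adj L2R (tshift t) (tshift (- t))"
proof -
  have 1: "hinn L2R (tshift t f) (tshift t g) = hinn L2R f g" for f g t
    using lborel_integral_real_affine[of 1 "\<lambda>x. f (x - t) * cnj (g (x - t))" t]
    by (simp add: inn_L2R tshift_def)
  have "hinn L2R (tshift t f) g = hinn L2R f (tshift (- t) g)" for f g
    using 1[of "-t" "tshift t f" g] by (simp add: tshift_def)
  then show ?thesis using 1 by (simp add: isometry_adj_def adjoint_pair_def del: L2R_simps(1))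
qed

lemma tshift_norm: "hnorm L2R (tshift t f) = hnorm L2R f"
  using lborel_integral_real_affine[of 1 "\<lambda>x. (cmod (f (x - t)))\<^sup>2" t]
  by (simp add: norm_L2R tshift_def)

lemma tshift_tshift: "tshift s (tshift t f) = tshift (s + t) f"
  by (simp add: tshift_def algebra_simps)

text \<open>Continuity at 0 is stated along sequences so that dominated convergence applies
  directly.\<close>

definition tcont :: "(real \<Rightarrow> complex) \<Rightarrow> bool" where
  "tcont f \<longleftrightarrow> f \<in> hcar L2R \<and> (\<forall>h. h \<longlonglongrightarrow> 0 \<longrightarrow> (\<lambda>i. hdist L2R (tshift (h i) f) f) \<longlonglongrightarrow> 0)"

lemma tcont_limit:
  assumes f: "f \<in> hcar L2R" and g: "\<And>e. e > 0 \<Longrightarrow> \<exists>g. tcont g \<and> hdist L2R f g < e"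
  shows "tcont f"
  unfolding tcont_def
proof (intro conjI f allI impI)
  fix h :: "nat \<Rightarrow> real" assume h: "h \<longlonglongrightarrow> 0"
  show "(\<lambda>i. hdist L2R (tshift (h i) f) f) \<longlonglongrightarrow> 0"
  proof (rule LIMSEQ_I)
    fix e :: real assume e: "e > 0"
    obtain g where g: "tcont g" "hdist L2R f g < e / 3" using assms(2)[of "e/3"] e by auto
    have gi: "g \<in> hcar L2R" and lim: "(\<lambda>i. hdist L2R (tshift (h i) g) g) \<longlonglongrightarrow> 0"
      using g(1) h unfolding tcont_def by blast+
    then obtain M where M: "\<And>i. i \<ge> M \<Longrightarrow> norm (hdist L2R (tshift (h i) g) g - 0) < e / 3"
      using LIMSEQ_D[OF lim, of "e/3"] e by auto
    have "norm (hdist L2R (tshift (h i) f) f - 0) < e" if "i \<ge> M" for i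
    proof -
      have "hdist L2R (tshift (h i) f) f \<le> hdist L2R (tshift (h i) f) (tshift (h i) g) + hdist L2R (tshift (h i) g) f"
        using f gi by (intro L.dist_triangle tshift_in)
      also have "hdist L2R (tshift (h i) g) f \<le> hdist L2R (tshift (h i) g) g + hdist L2R g f"
        using f gi by (intro L.dist_triangle tshift_in)
      also have "hdist L2R (tshift (h i) f) (tshift (h i) g) = hdist L2R f g"
        using tshift_norm[of "h i" "\<lambda>x. f x - g x"] by (simp add: hdist_def tshift_def)
      also have "hdist L2R g f = hdist L2R f g" using f gi by (rule L.dist_sym[rotated])
      finally have "hdist L2R (tshift (h i) f) f < e" using g(2) M[OF that] by simp
      moreover have "0 \<le> hdist L2R (tshift (h i) f) f" using f by (intro L.dist_ge tshift_in)
      ultimately show ?thesis by simp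
    qed
    then show "\<exists>M. \<forall>i\<ge>M. norm (hdist L2R (tshift (h i) f) f - 0) < e" by blast
  qed
qed

lemma tcont_add:
  assumes "tcont f" "tcont g" shows "tcont (\<lambda>x. f x + g x)"
  unfolding tcont_def
proof (intro conjI allI impI)
  have f: "f \<in> hcar L2R" and g: "g \<in> hcar L2R" using assms by (auto simp: tcont_def)
  show fg: "(\<lambda>x. f x + g x) \<in> hcar L2R" using L.add_in[OF f g] by simp
  fix h :: "nat \<Rightarrow> real" assume h: "h \<longlonglongrightarrow> 0"
  have lim: "(\<lambda>i. hdist L2R (tshift (h i) f) f + hdist L2R (tshift (h i) g) g) \<longlonglongrightarrow> 0"
    using assms h unfolding tcont_def by (intro tendsto_add_zero) blast+
  show "(\<lambda>i. hdist L2R (tshift (h i) (\<lambda>x. f x + g x)) (\<lambda>x. f x + g x)) \<longlonglongrightarrow> 0"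
  proof (rule Lim_null_comparison[OF always_eventually[OF allI] lim])
    fix i
    have "hdist L2R (tshift (h i) (\<lambda>x. f x + g x)) (\<lambda>x. f x + g x) =
        hnorm L2R (hadd L2R (hsub L2R (tshift (h i) f) f) (hsub L2R (tshift (h i) g) g))"
      by (simp add: hdist_def tshift_def algebra_simps)
    also have "\<dots> \<le> hdist L2R (tshift (h i) f) f + hdist L2R (tshift (h i) g) g"
      unfolding hdist_def using f g by (intro L.norm_add_le L.sub_in tshift_in)
    finally show "norm (hdist L2R (tshift (h i) (\<lambda>x. f x + g x)) (\<lambda>x. f x + g x)) \<le> hdist L2R (tshift (h i) f) f + hdist L2R (tshift (h i) g) g"
      using fg by (simp add: L.dist_ge del: L2R_simps)
  qed
qed

lemma tcont_scale:
  assumes "tcont f" shows "tcont (\<lambda>x. a * f x)"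
  unfolding tcont_def
proof (intro conjI allI impI)
  have f: "f \<in> hcar L2R" using assms by (auto simp: tcont_def)
  show "(\<lambda>x. a * f x) \<in> hcar L2R" using L.scl_in[OF f, of a] by simp
  fix h :: "nat \<Rightarrow> real" assume h: "h \<longlonglongrightarrow> 0"
  have "hdist L2R (tshift (h i) (\<lambda>x. a * f x)) (\<lambda>x. a * f x) = cmod a * hdist L2R (tshift (h i) f) f" for i
    using L.norm_scl[of "hsub L2R (tshift (h i) f) f" a] L.sub_in[OF tshift_in[OF f] f]
    by (simp add: hdist_def tshift_def right_diff_distrib)
  then show "(\<lambda>i. hdist L2R (tshift (h i) (\<lambda>x. a * f x)) (\<lambda>x. a * f x)) \<longlonglongrightarrow> 0"
    using tendsto_mult_right_zero[of _ _ "cmod a"] assms h by (auto simp: tcont_def)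
qed

lemma tcont_zero: "tcont (\<lambda>x. 0)"
  by (simp add: tcont_def hdist_def tshift_def norm_L2R)

lemma tcont_sum:
  assumes "\<And>y. y \<in> F \<Longrightarrow> tcont (\<phi> y)" shows "tcont (\<lambda>x. \<Sum>y\<in>F. \<phi> y x)"
  using assms by (induction F rule: infinite_finite_induct) (auto simp: tcont_zero intro: tcont_add)

lemma ind_L2:
  assumes "A \<in> sets borel" "emeasure lborel A < \<infinity>"
  shows "(\<lambda>x. indicator A x :: complex) \<in> hcar L2R"
proof -
  have "(\<lambda>x. (cmod (indicator A x))\<^sup>2) = (indicator A :: real \<Rightarrow> real)" by (auto simp: indicator_def)
  then show ?thesis using assms by simp
qed

text \<open>At each point of an open set the shifted indicators are eventually 1, so the integral of
  the product with the unshifted indicator converges by dominated convergence. Expanding the squared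
  distance reduces the claim to this integral.\<close>

lemma tcont_open:
  assumes "open U" "emeasure lborel U < \<infinity>"
  shows "tcont (\<lambda>x. indicator U x)"
  unfolding tcont_def
proof (intro conjI allI impI)
  have Um [measurable]: "U \<in> sets borel" using assms(1) by simp
  show U: "(\<lambda>x. indicator U x :: complex) \<in> hcar L2R" using assms by (intro ind_L2) auto
  fix h :: "nat \<Rightarrow> real" assume h: "h \<longlonglongrightarrow> 0"
  let ?u = "\<lambda>x. indicator U x :: real"
  have iu: "integrable lborel ?u" using assms by simp
  have ish: "integrable lborel (\<lambda>x. ?u (x - t))" for t
    using lborel_integrable_real_affine[OF iu, of 1 "-t"] by simp
  have "(\<lambda>i. LINT x|lborel. ?u (x - h i) * ?u x) \<longlonglongrightarrow> (LINT x|lborel. ?u x)"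
  proof (rule integral_dominated_convergence[where w = ?u])
    show "AE x in lborel. (\<lambda>i. ?u (x - h i) * ?u x) \<longlonglongrightarrow> ?u x"
    proof (rule AE_I2)
      fix x
      show "(\<lambda>i. ?u (x - h i) * ?u x) \<longlonglongrightarrow> ?u x"
      proof (cases "x \<in> U")
        case True
        have "(\<lambda>i. x - h i) \<longlonglongrightarrow> x - 0" by (intro tendsto_intros h)
        then have "eventually (\<lambda>i. x - h i \<in> U) sequentially"
          using assms(1) True topological_tendstoD by fastforce
        then have "eventually (\<lambda>i. ?u (x - h i) * ?u x = ?u x) sequentially"
          by eventually_elim (simp add: True)
        then show ?thesis by (rule tendsto_eventually)
      qed simp
    qed
  qed (use iu in \<open>auto simp: indicator_def\<close>)
  then have "(\<lambda>i. 2 * (LINT x|lborel. ?u x) - 2 * (LINT x|lborel. ?u (x - h i) * ?u x)) \<longlonglongrightarrow>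
     2 * (LINT x|lborel. ?u x) - 2 * (LINT x|lborel. ?u x)" by (intro tendsto_intros)
  moreover have "2 * (LINT x|lborel. ?u x) - 2 * (LINT x|lborel. ?u (x - t) * ?u x) = (hdist L2R (tshift t (\<lambda>x. indicator U x)) (\<lambda>x. indicator U x))\<^sup>2" for t
  proof -
    have ip: "integrable lborel (\<lambda>x. ?u (x - t) * ?u x)"
      by (rule Bochner_Integration.integrable_bound[OF iu]) (auto simp: indicator_def)
    have "(hdist L2R (tshift t (\<lambda>x. indicator U x)) (\<lambda>x. indicator U x))\<^sup>2 = (LINT x|lborel. ?u (x - t) + ?u x - 2 * (?u (x - t) * ?u x))"
      unfolding hdist_def norm2_L2R by (intro Bochner_Integration.integral_cong) (auto simp: tshift_def indicator_def)
    also have "\<dots> = (LINT x|lborel. ?u (x - t)) + (LINT x|lborel. ?u x) - 2 * (LINT x|lborel. ?u (x - t) * ?u x)"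
      using iu ish[of t] ip by simp
    also have "(LINT x|lborel. ?u (x - t)) = (LINT x|lborel. ?u x)"
      using lborel_integral_real_affine[of 1 "\<lambda>x. ?u (x - t)" t] by simp
    finally show ?thesis by simp
  qed
  ultimately have "(\<lambda>i. (hdist L2R (tshift (h i) (\<lambda>x. indicator U x)) (\<lambda>x. indicator U x))\<^sup>2) \<longlonglongrightarrow> 0" by simp
  from tendsto_real_sqrt[OF this]
  show "(\<lambda>i. hdist L2R (tshift (h i) (\<lambda>x. indicator U x)) (\<lambda>x. indicator U x)) \<longlonglongrightarrow> 0"
    using L.dist_ge[OF tshift_in[OF U] U] by simp
qed

text \<open>Outer regularity approximates the set by open sets of finite measure, to which
  \<open>tcont_open\<close> applies.\<close>

lemma tcont_indicator:
  assumes A: "A \<in> sets borel" "emeasure lborel A < \<infinity>"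
  shows "tcont (\<lambda>x. indicator A x)"
proof (rule tcont_limit)
  fix e :: real assume e: "e > 0"
  obtain U where U: "open U" "A \<subseteq> U" "emeasure lborel (U - A) < e\<^sup>2"
    using outer_regular_lborel[OF A(1), of "e\<^sup>2"] e by auto
  have Um [measurable]: "U \<in> sets borel" and [measurable]: "A \<in> sets borel" using U A by auto
  have "emeasure lborel U = emeasure lborel A + emeasure lborel (U - A)"
    using U A Um by (subst plus_emeasure) (auto simp: Un_absorb1)
  moreover have "emeasure lborel (U - A) < \<infinity>" using U(3) by (rule order_less_trans) simp
  ultimately have fin: "emeasure lborel U < \<infinity>" using A(2) by simp
  have "(hdist L2R (\<lambda>x. indicator A x) (\<lambda>x. indicator U x))\<^sup>2 = (LINT x|lborel. indicator (U - A) x)"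
    unfolding hdist_def norm2_L2R using U(2) by (intro Bochner_Integration.integral_cong) (auto simp: indicator_def)
  also have "\<dots> = measure lborel (U - A)" by simp
  also have "\<dots> < e\<^sup>2"
  proof -
    have "emeasure lborel (U - A) = ennreal (measure lborel (U - A))"
      using order_less_trans[OF U(3), of \<infinity>] by (intro emeasure_eq_ennreal_measure) auto
    then show ?thesis using U(3) by (simp add: ennreal_less_iff)
  qed
  finally have "hdist L2R (\<lambda>x. indicator A x) (\<lambda>x. indicator U x) < e" using e by (simp add: power2_less_imp_less)
  then show "\<exists>g. tcont g \<and> hdist L2R (\<lambda>x. indicator A x) g < e" using tcont_open[OF U(1) fin] by blast
qed (rule ind_L2[OF A])

text \<open>Simple functions dominated by a multiple of \<open>f\<close> converge to
  \<open>f\<close> in norm, and their level sets for nonzero values have finite measure by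
  Chebyshev's inequality.\<close>

lemma tcont_L2:
  assumes f: "f \<in> hcar L2R" shows "tcont f"
proof (rule tcont_limit[OF f])
  fix e :: real assume e: "e > 0"
  have fm [measurable]: "f \<in> borel_measurable borel" and fi: "integrable lborel (\<lambda>x. (cmod (f x))\<^sup>2)" using f by auto
  obtain s where s: "\<And>i. simple_function lborel (s i)" "\<And>x. (\<lambda>i. s i x) \<longlonglongrightarrow> f x" "\<And>i x. dist (s i x) 0 \<le> 2 * dist (f x) 0"
    using borel_measurable_implies_sequence_metric[of f lborel 0] by auto
  have sm [measurable]: "s i \<in> borel_measurable borel" for i using borel_measurable_simple_function[OF s(1)[of i]] by simp
  have b: "(cmod (s i x))\<^sup>2 \<le> 4 * (cmod (f x))\<^sup>2" for i x
    using power_mono[OF s(3)[of i x], of 2] by (simp add: power_mult_distrib)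
  have si: "integrable lborel (\<lambda>x. (cmod (s i x))\<^sup>2)" for i
    by (rule Bochner_Integration.integrable_bound[of _ "\<lambda>x. 4 * (cmod (f x))\<^sup>2"]) (use fi b in auto)
  have sc: "s i \<in> hcar L2R" for i using si by simp
  have ts: "tcont (s i)" for i
  proof -
    have fin: "finite (range (s i))" using s(1)[of i] by (simp add: simple_function_def)
    have "s i = (\<lambda>x. \<Sum>y\<in>range (s i). y * indicator (s i -` {y}) x)"
    proof
      fix x
      have "(\<Sum>y\<in>range (s i). y * indicator (s i -` {y}) x) = (\<Sum>y\<in>range (s i). if y = s i x then s i x else 0)"
        by (intro sum.cong refl) (auto simp: indicator_def)
      then show "s i x = (\<Sum>y\<in>range (s i). y * indicator (s i -` {y}) x)" using fin by simp
    qed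
    moreover have "tcont (\<lambda>x. y * indicator (s i -` {y}) x)" for y
    proof (cases "y = 0")
      case False
      have ms: "s i -` {y} \<in> sets borel" using measurable_sets[OF sm[of i], of "{y}"] by simp
      have "emeasure lborel (s i -` {y}) = (\<integral>\<^sup>+x. indicator (s i -` {y}) x \<partial>lborel)" using ms by simp
      also have "\<dots> \<le> (\<integral>\<^sup>+x. ennreal ((cmod (s i x))\<^sup>2 / (cmod y)\<^sup>2) \<partial>lborel)"
        using False by (intro nn_integral_mono) (auto simp: indicator_def)
      also have "\<dots> = ennreal (LINT x|lborel. (cmod (s i x))\<^sup>2 / (cmod y)\<^sup>2)"
        using si[of i] by (intro nn_integral_eq_integral) auto
      also have "\<dots> < \<infinity>" by simp
      finally show ?thesis using ms by (intro tcont_scale tcont_indicator)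
    qed (simp add: tcont_zero)
    ultimately show ?thesis using tcont_sum[of "range (s i)" "\<lambda>y x. y * indicator (s i -` {y}) x"] by simp
  qed
  have "(\<lambda>i. LINT x|lborel. (cmod (f x - s i x))\<^sup>2) \<longlonglongrightarrow> (LINT x|(lborel::real measure). 0)"
  proof (rule integral_dominated_convergence[where w = "\<lambda>x. 9 * (cmod (f x))\<^sup>2"])
    show "AE x in lborel. (\<lambda>i. (cmod (f x - s i x))\<^sup>2) \<longlonglongrightarrow> 0"
    proof (rule AE_I2)
      fix x
      have "(\<lambda>i. (cmod (f x - s i x))\<^sup>2) \<longlonglongrightarrow> (cmod (f x - f x))\<^sup>2" by (intro tendsto_intros s)
      then show "(\<lambda>i. (cmod (f x - s i x))\<^sup>2) \<longlonglongrightarrow> 0" by simp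
    qed
    show "AE x in lborel. norm ((cmod (f x - s i x))\<^sup>2) \<le> 9 * (cmod (f x))\<^sup>2" for i
    proof (rule AE_I2)
      fix x
      have "cmod (f x - s i x) \<le> 3 * cmod (f x)" using s(3)[of i x] norm_triangle_ineq4[of "f x" "s i x"] by simp
      from power_mono[OF this, of 2] show "norm ((cmod (f x - s i x))\<^sup>2) \<le> 9 * (cmod (f x))\<^sup>2"
        by (simp add: power_mult_distrib)
    qed
  qed (use fi in auto)
  then have lim: "(\<lambda>i. (hdist L2R f (s i))\<^sup>2) \<longlonglongrightarrow> 0" by (simp only: hdist_def norm2_L2R L2R_simps) simp
  have "eventually (\<lambda>i. (hdist L2R f (s i))\<^sup>2 < e\<^sup>2) sequentially"
    using e by (intro order_tendstoD(2)[OF lim]) auto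
  then obtain i where "(hdist L2R f (s i))\<^sup>2 < e\<^sup>2" by (auto simp: eventually_sequentially)
  then have "hdist L2R f (s i) < e" using e by (simp add: power2_less_imp_less)
  then show "\<exists>g. tcont g \<and> hdist L2R f g < e" using ts by blast
qed

lemma tshift_dist:
  assumes "f \<in> hcar L2R"
  shows "hdist L2R (tshift s f) (tshift t f) = hdist L2R (tshift (s - t) f) f"
  using tshift_norm[of t "\<lambda>x. tshift (s - t) f x - f x"] by (simp add: hdist_def tshift_def)

text \<open>Translations are isometric, so the distance depends on \<open>s - t\<close> only and
  continuity is uniform. A failure would produce shifts tending to 0 that contradict
  \<open>tcont_L2\<close>.\<close>

lemma tshift_cont:
  assumes f: "f \<in> hcar L2R" and e: "e > 0"
  shows "\<exists>d>0. \<forall>s t. \<bar>s - t\<bar> < d \<longrightarrow> hdist L2R (tshift s f) (tshift t f) < e"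
proof (rule ccontr)
  assume "\<not> ?thesis"
  then have "\<exists>h. \<bar>h\<bar> < 1 / real (Suc n) \<and> \<not> hdist L2R (tshift h f) f < e" for n
    unfolding tshift_dist[OF f] by (metis of_nat_0_less_iff zero_less_Suc zero_less_divide_1_iff)
  then obtain h where h: "\<And>n. \<bar>h n\<bar> < 1 / real (Suc n)" "\<And>n. \<not> hdist L2R (tshift (h n) f) f < e" by metis
  have "h \<longlonglongrightarrow> 0"
    by (rule Lim_null_comparison[OF always_eventually[OF allI] LIMSEQ_inverse_real_of_nat])
      (use h(1) in \<open>simp add: inverse_eq_divide less_imp_le\<close>)
  then have "(\<lambda>i. hdist L2R (tshift (h i) f) f) \<longlonglongrightarrow> 0"
    using tcont_L2[OF f] by (simp add: tcont_def)
  from order_tendstoD(2)[OF this e] h(2) show False by simp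
qed

section \<open>The cut to the half line and long plane waves\<close>

definition cut_pos :: "(real \<Rightarrow> complex) \<Rightarrow> real \<Rightarrow> complex" where
  "cut_pos f = (\<lambda>x. if x \<ge> 0 then f x else 0)"

lemma cut_pos_in [simp]: "f \<in> hcar L2R \<Longrightarrow> cut_pos f \<in> hcar L2R"
proof -
  assume f: "f \<in> hcar L2R"
  then have [measurable]: "f \<in> borel_measurable borel" by simp
  have "integrable lborel (\<lambda>x. (cmod (cut_pos f x))\<^sup>2)"
    by (rule Bochner_Integration.integrable_bound[of _ "\<lambda>x. (cmod (f x))\<^sup>2"]) (use f in \<open>auto simp: cut_pos_def\<close>)
  then show ?thesis by (simp add: cut_pos_def)
qed

lemma cut_pos_adj: "adjoint_pair L2R L2R cut_pos cut_pos"
proof -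
  have "hinn L2R (cut_pos f) g = hinn L2R f (cut_pos g)" for f g
    unfolding inn_L2R cut_pos_def by (intro Bochner_Integration.integral_cong) auto
  then show ?thesis by (simp add: adjoint_pair_def del: L2R_simps)
qed

text \<open>The interval has length \<open>4 ^ m\<close>, so the factor \<open>1 / 2 ^ m\<close>
  normalises the wave. Intervals for distinct \<open>m\<close> are disjoint whatever the
  frequencies, and the sign in the exponent makes a shift by \<open>t\<close> act like
  multiplication by \<open>exp (\<i> * (t * l))\<close> away from the ends.\<close>

definition wave :: "real \<Rightarrow> nat \<Rightarrow> real \<Rightarrow> complex" where
  "wave l m x = (if 4 ^ m \<le> x \<and> x < 2 * 4 ^ m then exp (- (\<i> * of_real (l * x))) / 2 ^ m else 0)"

lemma cmod_exp_i [simp]: "cmod (exp (- (\<i> * complex_of_real x))) = 1" "cmod (exp (\<i> * complex_of_real x)) = 1"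
  by (simp_all add: norm_exp_eq_Re)

lemma four_pow: "((2::real) ^ m)\<^sup>2 = 4 ^ m"
  by (simp add: power_mult[symmetric] mult.commute[of m]) (simp add: power_mult)

lemma wave_norm2: "(cmod (wave l m x))\<^sup>2 = indicator {4 ^ m..<2 * 4 ^ m} x / 4 ^ m"
  by (simp add: wave_def norm_divide norm_power power_divide four_pow indicator_def del: of_real_mult)

lemma wave_in [simp]: "wave l m \<in> hcar L2R"
proof -
  have "wave l m \<in> borel_measurable borel" unfolding wave_def by measurable
  moreover have "integrable lborel (\<lambda>x. (cmod (wave l m x))\<^sup>2)" unfolding wave_norm2 by simp
  ultimately show ?thesis by simp
qed

lemma wave_self: "hinn L2R (wave l m) (wave l m) = 1"
  unfolding inn_L2R_self wave_norm2 by simp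

lemma wave_orth:
  assumes "m < n" shows "hinn L2R (wave l m) (wave l' n) = 0" "hinn L2R (wave l n) (wave l' m) = 0"
proof -
  have "(4::real) ^ Suc m \<le> 4 ^ n" using assms by (intro power_increasing) auto
  then have "(2::real) * 4 ^ m \<le> 4 ^ n" by (simp add: order_trans[rotated])
  then have "(\<lambda>x. wave l m x * cnj (wave l' n x)) = (\<lambda>x. 0)" "(\<lambda>x. wave l n x * cnj (wave l' m x)) = (\<lambda>x. 0)"
    by (auto simp: wave_def fun_eq_iff)
  then show "hinn L2R (wave l m) (wave l' n) = 0" "hinn L2R (wave l n) (wave l' m) = 0" by (simp_all add: inn_L2R)
qed

lemma wave_cut: "cut_pos (wave l m) = wave l m"
proof
  fix x
  show "cut_pos (wave l m) x = wave l m x"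
    by (auto simp: cut_pos_def wave_def not_le intro: order_trans[rotated])
qed

text \<open>The two functions agree outside two intervals of length \<open>t\<close>, and there they
  differ by at most \<open>1 / 2 ^ m\<close> in modulus. The squared error is therefore at most
  \<open>2 * t / 4 ^ m\<close>.\<close>

lemma wave_shift:
  assumes t: "t \<ge> 0"
  shows "hnorm L2R (hsub L2R (tshift t (wave l m)) (hscl L2R (exp (\<i> * of_real (t * l))) (wave l m))) \<le> sqrt (2 * t) / 2 ^ m"
proof -
  let ?a = "(4::real) ^ m"
  let ?g = "\<lambda>x. (indicator {?a..<?a + t} x + indicator {2 * ?a..<2 * ?a + t} x) / ?a :: real"
  have a: "?a > 0" by simp
  have le: "(cmod (wave l m (x - t) - exp (\<i> * of_real (t * l)) * wave l m x))\<^sup>2 \<le> ?g x" for x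
  proof -
    have "exp (- (\<i> * complex_of_real (l * (x - t)))) = exp (\<i> * of_real (t * l)) * exp (- (\<i> * of_real (l * x)))"
      by (simp add: exp_add[symmetric] algebra_simps)
    moreover have "cmod (exp (\<i> * of_real (t * l)) * exp (- (\<i> * of_real (l * x))) / 2 ^ m) ^ 2 = 1 / ?a"
      by (simp add: norm_divide norm_mult norm_power power_divide four_pow del: of_real_mult)
    ultimately show ?thesis using t a
      unfolding wave_def by (auto simp: indicator_def)
  qed
  have ig: "integrable lborel ?g"
    using t by (intro integrable_divide Bochner_Integration.integrable_add) auto
  have mw [measurable]: "wave l m \<in> borel_measurable borel" using wave_in[of l m] by simp
  have "(LINT x|lborel. (cmod (wave l m (x - t) - exp (\<i> * of_real (t * l)) * wave l m x))\<^sup>2) \<le> (LINT x|lborel. ?g x)"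
  proof (rule integral_mono[OF Bochner_Integration.integrable_bound[OF ig]])
    show "(\<lambda>x. (cmod (wave l m (x - t) - exp (\<i> * of_real (t * l)) * wave l m x))\<^sup>2) \<in> borel_measurable lborel" by simp
    show "AE x in lborel. norm ((cmod (wave l m (x - t) - exp (\<i> * of_real (t * l)) * wave l m x))\<^sup>2) \<le> norm (?g x)"
      using le by (auto intro: order_trans[OF _ abs_ge_self])
  qed (use ig le in auto)
  also have "(LINT x|lborel. ?g x) = (t + t) / ?a"
    using t by simp
  finally have "hnorm L2R (hsub L2R (tshift t (wave l m)) (hscl L2R (exp (\<i> * of_real (t * l))) (wave l m))) \<le> sqrt ((t + t) / ?a)"
    by (simp add: norm_L2R tshift_def)
  also have "\<dots> = sqrt (2 * t) / 2 ^ m" by (simp add: real_sqrt_divide four_pow[symmetric])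
  finally show ?thesis .
qed

section \<open>Functions on the half line as a subspace\<close>

lemma L2Rp_simps [simp]:
  "f \<in> hcar L2Rp \<longleftrightarrow> f \<in> hcar L2R \<and> (\<forall>x<0. f x = 0)"
  "hadd L2Rp = hadd L2R" "hscl L2Rp = hscl L2R" "hzero L2Rp = hzero L2R" "hinn L2Rp = hinn L2R"
  "hsub L2Rp = hsub L2R" "hnorm L2Rp = hnorm L2R" "hdist L2Rp = hdist L2R" "heq L2Rp = heq L2R"
proof -
  show 1: "hinn L2Rp = hinn L2R" "hadd L2Rp = hadd L2R" "hscl L2Rp = hscl L2R" by (auto simp: L2Rp_def)
  show 2: "hsub L2Rp = hsub L2R" "hnorm L2Rp = hnorm L2R" by (auto simp: 1 hsub_def fun_eq_iff hnorm_def)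
  show 3: "hdist L2Rp = hdist L2R" by (auto simp: 2 hdist_def fun_eq_iff)
  show "heq L2Rp = heq L2R" by (auto simp: 3 heq_def fun_eq_iff)
qed (auto simp: L2Rp_def)

lemma lincomb_L2Rp: "lincomb L2Rp c ys n = lincomb L2R c ys n"
  by (induction n) auto

lemma inner_space_L2Rp: "inner_space L2Rp"
  by (unfold_locales; simp del: L2R_simps; simp add: L.inn_ge L.inn_cnj[symmetric] del: L2R_simps(1); simp)

lemma cut_pos_L2Rp: "f \<in> hcar L2R \<Longrightarrow> cut_pos f \<in> hcar L2Rp"
  by (simp add: cut_pos_def del: L2R_simps) (simp add: cut_pos_def[symmetric] del: L2R_simps)

lemma cut_pos_id: "f \<in> hcar L2Rp \<Longrightarrow> cut_pos f = f"
  by (auto simp: cut_pos_def)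

lemma bessel_family_L2Rp: "bessel_family L2Rp N x \<Longrightarrow> bessel_family L2R N x"
  by (auto simp: bessel_family_def lincomb_L2Rp simp del: L2R_simps)

text \<open>\<open>shift\<close> is defined by a strict inequality, so the two functions can differ
  only at the point \<open>t\<close>.\<close>

lemma shift_tshift:
  assumes "f \<in> hcar L2Rp" "t \<ge> 0"
  shows "shift t f \<in> hcar L2Rp" "heq L2R (shift t f) (tshift t f)"
proof -
  have f: "f \<in> hcar L2R" and f0: "\<And>x. x < 0 \<Longrightarrow> f x = 0" using assms by auto
  have [measurable]: "f \<in> borel_measurable borel" using f by simp
  have m: "shift t f \<in> borel_measurable borel" unfolding shift_def by measurable
  have ae: "AE x in lborel. shift t f x = tshift t f x"
  proof (rule AE_I'[of "{t}"])
    have "x = t" if "shift t f x \<noteq> tshift t f x" for x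
      using that f0[of "x - t"] by (cases x t rule: linorder_cases) (auto simp: shift_def tshift_def)
    then show "{x \<in> space lborel. shift t f x \<noteq> tshift t f x} \<subseteq> {t}" by auto
  qed (auto simp: null_sets_def)
  have "integrable lborel (\<lambda>x. (cmod (shift t f x))\<^sup>2) \<longleftrightarrow> integrable lborel (\<lambda>x. (cmod (tshift t f x))\<^sup>2)"
    using m tshift_in[OF f, of t] ae by (intro integrable_cong_AE) auto
  then have s: "shift t f \<in> hcar L2R" using m tshift_in[OF f, of t] by simp
  then show "shift t f \<in> hcar L2Rp" using assms(2) by (auto simp: shift_def)
  show "heq L2R (shift t f) (tshift t f)" by (rule heq_L2R_AE[OF s tshift_in[OF f] ae])
qed

section \<open>Functional calculus on cyclic subspaces\<close>

locale definite_hilbert = hilbert V for V :: "'v hspace" +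
  assumes heq_eq: "\<lbrakk>heq V x y; x \<in> hcar V; y \<in> hcar V\<rbrakk> \<Longrightarrow> x = y"
begin

lemma eqI: "\<lbrakk>x \<in> hcar V; y \<in> hcar V; \<And>z. z \<in> hcar V \<Longrightarrow> hinn V x z = hinn V y z\<rbrakk> \<Longrightarrow> x = y"
  by (rule heq_eq) (simp_all add: heq_iff)

end

lemma complex_hilbert_imp_definite:
  assumes "complex_hilbert V" shows "definite_hilbert V"
proof -
  have sh: "semi_hilbert V" and def: "\<And>x. x \<in> hcar V \<Longrightarrow> hinn V x x = 0 \<Longrightarrow> x = hzero V"
    using assms by (auto simp: complex_hilbert_def)
  interpret hilbert V by (rule semi_hilbert_imp_hilbert[OF sh])
  have assoc: "\<forall>x\<in>hcar V. \<forall>y\<in>hcar V. \<forall>z\<in>hcar V. hadd V (hadd V x y) z = hadd V x (hadd V y z)"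
    and comm: "\<forall>x\<in>hcar V. \<forall>y\<in>hcar V. hadd V x y = hadd V y x"
    and inv: "\<forall>x\<in>hcar V. hadd V x (hscl V (-1) x) = hzero V"
    using sh unfolding semi_hilbert_def by - (elim conjE, assumption)+
  show ?thesis
  proof unfold_locales
    fix x y assume h: "heq V x y" and [simp]: "x \<in> hcar V" "y \<in> hcar V"
    have "hsub V x y = hzero V"
      using h by (intro def) (simp_all add: heq_iff)
    then have "hadd V (hadd V x (hscl V (-1) y)) y = y" by (simp add: hsub_def)
    moreover have "hadd V (hadd V x (hscl V (-1) y)) y = hadd V x (hadd V (hscl V (-1) y) y)"
      using assoc by simp
    moreover have "hadd V (hscl V (-1) y) y = hzero V"
      using comm[rule_format, of "hscl V (-1) y" y] inv by simp
    moreover have "hadd V x (hzero V) = x" using comm[rule_format, of x "hzero V"] by simp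
    ultimately show "x = y" by simp
  qed
qed

text \<open>Polarisation: the norm of a sum gives the real parts, and passing to the multiple of
  \<open>x\<close> by \<open>\<i>\<close> gives the imaginary parts.\<close>

lemma isometric_inn:
  assumes "inner_space V" "inner_space W" "weakly_linear V W T" "\<And>x. x \<in> hcar V \<Longrightarrow> hnorm W (T x) = hnorm V x"
    "x \<in> hcar V" "y \<in> hcar V"
  shows "hinn W (T x) (T y) = hinn V x y"
proof -
  interpret V: inner_space V by fact
  interpret W: inner_space W by fact
  have T: "z \<in> hcar V \<Longrightarrow> T z \<in> hcar W" for z using weakly_linearD(1)[OF assms(3)] .
  have re: "Re (hinn W (T a) (T b)) = Re (hinn V a b)" if ab: "a \<in> hcar V" "b \<in> hcar V" for a b
  proof -
    have "hnorm W (T (hadd V a b)) = hnorm W (hadd W (T a) (T b))"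
      using ab T by (intro W.norm_by_inn) (auto simp: weakly_linearD[OF assms(3)])
    then have "(hnorm W (hadd W (T a) (T b)))\<^sup>2 = (hnorm V (hadd V a b))\<^sup>2" using assms(4) ab by simp
    moreover have "(hnorm W (T a))\<^sup>2 = (hnorm V a)\<^sup>2" "(hnorm W (T b))\<^sup>2 = (hnorm V b)\<^sup>2" using assms(4) ab by simp_all
    moreover have "Re (hinn W (T b) (T a)) = Re (hinn W (T a) (T b))" "Re (hinn V b a) = Re (hinn V a b)"
      using W.inn_cnj[of "T a" "T b"] V.inn_cnj[of a b] ab T by simp_all
    ultimately show ?thesis using ab T by (simp add: V.norm2 W.norm2)
  qed
  have "Re (\<i> * hinn W (T x) (T y)) = Re (\<i> * hinn V x y)"
    using re[of "hscl V \<i> x" y] assms(5,6) T by (simp add: weakly_linearD[OF assms(3)])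
  then show ?thesis using re[OF assms(5,6)] by (simp add: complex_eq_iff)
qed

text \<open>In a definite space the group laws hold as genuine equations and can be used for
  rewriting; \<open>U (- s)\<close> supplies the adjoint of \<open>U s\<close>.\<close>

locale ugroup = definite_hilbert V for V :: "'v hspace" +
  fixes U :: "real \<Rightarrow> 'v \<Rightarrow> 'v"
  assumes U_in [simp]: "x \<in> hcar V \<Longrightarrow> U s x \<in> hcar V"
    and U_adj: "\<lbrakk>x \<in> hcar V; y \<in> hcar V\<rbrakk> \<Longrightarrow> hinn V (U s x) y = hinn V x (U (- s) y)"
    and U_U: "x \<in> hcar V \<Longrightarrow> U s (U t x) = U (s + t) x"
    and U_0: "x \<in> hcar V \<Longrightarrow> U 0 x = x"
begin

lemma U_isom: "isometry_adj V (U s) (U (- s))"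
  by (simp add: isometry_adj_def adjoint_pair_def U_adj U_U U_0)

lemma U_add: "\<lbrakk>x \<in> hcar V; y \<in> hcar V\<rbrakk> \<Longrightarrow> U s (hadd V x y) = hadd V (U s x) (U s y)"
  by (rule eqI) (simp_all add: U_adj)

lemma U_scl: "x \<in> hcar V \<Longrightarrow> U s (hscl V a x) = hscl V a (U s x)"
  by (rule eqI) (simp_all add: U_adj)

lemma U_inn: "\<lbrakk>x \<in> hcar V; y \<in> hcar V\<rbrakk> \<Longrightarrow> hinn V (U s x) (U t y) = hinn V (U (s - t) x) y"
  by (simp add: U_adj U_U)

lemma U_norm: "x \<in> hcar V \<Longrightarrow> hnorm V (U s x) = hnorm V x"
  by (simp add: hnorm_def U_inn U_0)

end

text \<open>Negative times are given by inverses. Since every \<open>U c\<close> is injective, the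
  group law may be checked after applying one of them, and for large \<open>c\<close> all times
  involved are nonnegative.\<close>

lemma unitary_group_ex:
  assumes "definite_hilbert V" "unitary_semigroup V U"
  shows "\<exists>Ug. ugroup V Ug \<and> (\<forall>t\<ge>0. \<forall>x\<in>hcar V. Ug t x = U t x)"
proof -
  interpret definite_hilbert V by fact
  note w = inner_space_axioms
  have un: "\<And>t. t \<ge> 0 \<Longrightarrow> unitary_op V V (U t)" and U0: "op_eq V V (U 0) id"
    and sg: "\<And>s t. s \<ge> 0 \<Longrightarrow> t \<ge> 0 \<Longrightarrow> op_eq V V (U (s + t)) (U s \<circ> U t)"
    using assms(2) by (auto simp: unitary_semigroup_def)
  have l: "weakly_linear V V (U t)" if "t \<ge> 0" for t using un[OF that] blin_iff[OF w w] by (auto simp: unitary_op_def)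
  have i [simp]: "U t x \<in> hcar V" if "t \<ge> 0" "x \<in> hcar V" for t x using weakly_linearD(1)[OF l[OF that(1)] that(2)] .
  have n: "hnorm V (U t x) = hnorm V x" if "t \<ge> 0" "x \<in> hcar V" for t x using un[OF that(1)] that by (auto simp: unitary_op_def)
  have iso: "hinn V (U t x) (U t y) = hinn V x y" if "t \<ge> 0" "x \<in> hcar V" "y \<in> hcar V" for t x y
    by (rule isometric_inn[OF w w l[OF that(1)] n[OF that(1)] that(2,3)])
  have inj: "x = y" if "t \<ge> 0" "x \<in> hcar V" "y \<in> hcar V" "U t x = U t y" for t x y
    using iso[OF that(1,2)] iso[OF that(1,3)] that by (intro eqI) metis+
  have add: "U (s + t) x = U s (U t x)" if "s \<ge> 0" "t \<ge> 0" "x \<in> hcar V" for s t x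
    using sg[OF that(1,2)] that by (intro heq_eq) (auto simp: op_eq_def)
  have z: "U 0 x = x" if "x \<in> hcar V" for x using U0 that by (intro heq_eq) (auto simp: op_eq_def)
  have surj: "\<exists>x\<in>hcar V. U t x = y" if "t \<ge> 0" "y \<in> hcar V" for t y
  proof -
    obtain x where "x \<in> hcar V" "heq V (U t x) y" using un[OF \<open>t \<ge> 0\<close>] \<open>y \<in> hcar V\<close> by (auto simp: unitary_op_def)
    then show ?thesis using heq_eq[of "U t x" y] that by auto
  qed
  define Ug where "Ug s x = (if s \<ge> 0 then U s x else (SOME y. y \<in> hcar V \<and> U (- s) y = x))" for s x
  have Ug_in [simp]: "Ug s x \<in> hcar V" if "x \<in> hcar V" for s x
    using someI_ex[OF surj[of "-s" x, unfolded Bex_def]] that by (auto simp: Ug_def)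
  have K: "U c (Ug s x) = U (c + s) x" if "c \<ge> 0" "c + s \<ge> 0" "x \<in> hcar V" for c s x
  proof (cases "s \<ge> 0")
    case True
    then show ?thesis using that by (simp add: Ug_def add)
  next
    case False
    then have "U (- s) (Ug s x) = x"
      using someI_ex[OF surj[of "-s" x, unfolded Bex_def]] that by (auto simp: Ug_def)
    moreover have "U c (Ug s x) = U (c + s) (U (- s) (Ug s x))"
      using that False by (simp flip: add)
    ultimately show ?thesis by simp
  qed
  have grp: "Ug s (Ug t x) = Ug (s + t) x" if x: "x \<in> hcar V" for s t x
  proof -
    define c where "c = \<bar>s\<bar> + \<bar>t\<bar>"
    have c: "c \<ge> 0" "c + s \<ge> 0" "c + s + t \<ge> 0" "c + (s + t) \<ge> 0" by (auto simp: c_def)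
    have eq: "U c (Ug s (Ug t x)) = U c (Ug (s + t) x)"
      using K[OF c(1,2), of "Ug t x"] K[OF c(2,3) x] K[OF c(1,4) x] x by (simp add: add.assoc)
    show ?thesis by (rule inj[OF c(1) _ _ eq]) (use x in auto)
  qed
  have Ui: "hinn V (Ug s x) (Ug s y) = hinn V x y" if "x \<in> hcar V" "y \<in> hcar V" for s x y
  proof (cases "s \<ge> 0")
    case False
    then have "U (- s) (Ug s x) = x" "U (- s) (Ug s y) = y" using K[of "-s" s] that z by auto
    then show ?thesis using iso[of "-s" "Ug s x" "Ug s y"] that False by simp
  qed (use that iso in \<open>simp add: Ug_def\<close>)
  have "ugroup V Ug"
  proof unfold_locales
    show "hinn V (Ug s x) y = hinn V x (Ug (- s) y)" if "x \<in> hcar V" "y \<in> hcar V" for x y s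
    proof -
      have "y = Ug s (Ug (- s) y)" using grp[of y s "-s"] z that by (simp add: Ug_def)
      then show ?thesis using Ui[of x "Ug (- s) y" s] that by simp
    qed
  qed (use grp z in \<open>auto simp: Ug_def[of 0]\<close>)
  then show ?thesis by (intro exI[of _ Ug]) (simp add: Ug_def)
qed

section \<open>Bounded Borel functions and the calculus of a cyclic vector\<close>

definition character :: "real \<Rightarrow> real \<Rightarrow> complex" where
  "character s l = exp (\<i> * complex_of_real (s * l))"

lemma character_props [simp]: "cmod (character s l) = 1" "cnj (character s l) = character (- s) l" "character 0 l = 1"
  by (simp_all add: character_def exp_cnj)

lemma character_mult: "character s l * character t l = character (s + t) l"
  by (simp add: character_def exp_add[symmetric] algebra_simps)

lemma character_meas [measurable]: "character s \<in> borel_measurable borel"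
  unfolding character_def by measurable

definition bounded_borel :: "(real \<Rightarrow> complex) \<Rightarrow> bool" where
  "bounded_borel f \<longleftrightarrow> f \<in> borel_measurable borel \<and> (\<exists>B. \<forall>l. cmod (f l) \<le> B)"

lemma bounded_borel_meas: "bounded_borel f \<Longrightarrow> f \<in> borel_measurable borel"
  by (simp add: bounded_borel_def)

lemma bounded_borel_ex: "bounded_borel (character s)"
  by (auto simp: bounded_borel_def intro!: exI[of _ 1])

lemma bounded_borel_add: assumes "bounded_borel f" "bounded_borel g" shows "bounded_borel (\<lambda>l. f l + g l)"
proof -
  obtain B C where "\<And>l. cmod (f l) \<le> B" "\<And>l. cmod (g l) \<le> C" using assms by (auto simp: bounded_borel_def)
  then have "cmod (f l + g l) \<le> B + C" for l by (intro norm_triangle_le add_mono)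
  then show ?thesis using assms by (auto simp: bounded_borel_def intro!: borel_measurable_add)
qed

lemma bounded_borel_mult: assumes "bounded_borel f" "bounded_borel g" shows "bounded_borel (\<lambda>l. f l * g l)"
proof -
  obtain B C where "\<And>l. cmod (f l) \<le> B" "\<And>l. cmod (g l) \<le> C" using assms by (auto simp: bounded_borel_def)
  then have "cmod (f l * g l) \<le> B * C" for l unfolding norm_mult by (intro mult_mono') auto
  then show ?thesis using assms by (auto simp: bounded_borel_def intro!: borel_measurable_times)
qed

lemma bounded_borel_const: "bounded_borel (\<lambda>l. a)"
  by (auto simp: bounded_borel_def)

lemma bounded_borel_cnj: "bounded_borel f \<Longrightarrow> bounded_borel (\<lambda>l. cnj (f l))"
  unfolding bounded_borel_def by (auto intro!: borel_measurable_cnj)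

lemma bounded_borel_lim:
  assumes "\<And>n. bounded_borel (F n)" "\<And>n l. cmod (F n l) \<le> B" "\<And>l. (\<lambda>n. F n l) \<longlonglongrightarrow> f l"
  shows "bounded_borel f"
proof -
  have "f \<in> borel_measurable borel"
    by (rule borel_measurable_LIMSEQ_metric[of F]) (use assms in \<open>auto simp: bounded_borel_def\<close>)
  moreover have "cmod (f l) \<le> B" for l
    using tendsto_norm[OF assms(3)[of l]] assms(2) by (intro LIMSEQ_le_const2[of _ "cmod (f l)"]) auto
  ultimately show ?thesis by (auto simp: bounded_borel_def)
qed

text \<open>\<open>corr0\<close> identifies \<open>\<mu>\<close> as the spectral measure of
  \<open>y\<close>, whose Fourier transform is the correlation function of the orbit.\<close>

locale cyclic = ugroup V U for V :: "'v hspace" and U +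
  fixes y :: 'v and \<mu> :: "real measure"
  assumes y [simp]: "y \<in> hcar V" and fm: "finite_measure \<mu>" and sets_mu: "sets \<mu> = sets borel"
    and corr0: "\<And>t. t \<ge> 0 \<Longrightarrow> hinn V (U t y) y = (LINT l|\<mu>. character t l)"
begin

sublocale fin: finite_measure \<mu> by (rule fm)

lemma space_mu [simp]: "space \<mu> = UNIV"
  using sets_eq_imp_space_eq[OF sets_mu] by simp

lemma meas_mu: "f \<in> borel_measurable borel \<Longrightarrow> f \<in> borel_measurable \<mu>"
  using measurable_cong_sets[OF sets_mu refl] by blast

lemma bounded_borel_int: "bounded_borel f \<Longrightarrow> integrable \<mu> f"
  unfolding bounded_borel_def by (elim conjE exE, rule fin.integrable_const_bound) (auto intro: meas_mu)

lemma dct: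
  assumes "\<And>n. bounded_borel (F n)" "\<And>n l. cmod (F n l) \<le> B" "\<And>l. (\<lambda>n. F n l) \<longlonglongrightarrow> f l" "bounded_borel g"
  shows "(\<lambda>n. LINT l|\<mu>. F n l * g l) \<longlonglongrightarrow> (LINT l|\<mu>. f l * g l)"
proof -
  obtain C where C: "\<And>l. cmod (g l) \<le> C" using assms(4) by (auto simp: bounded_borel_def)
  show ?thesis
  proof (rule integral_dominated_convergence[where w = "\<lambda>_. \<bar>B\<bar> * \<bar>C\<bar>"])
    show "AE l in \<mu>. (\<lambda>n. F n l * g l) \<longlonglongrightarrow> f l * g l" using assms(3) by (intro AE_I2 tendsto_intros)
    have "cmod (F n l * g l) \<le> \<bar>B\<bar> * \<bar>C\<bar>" for n l
      unfolding norm_mult by (intro mult_mono order_trans[OF assms(2) abs_ge_self] order_trans[OF C abs_ge_self]) auto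
    then show "AE l in \<mu>. norm (F n l * g l) \<le> \<bar>B\<bar> * \<bar>C\<bar>" for n by auto
    show "(\<lambda>l. f l * g l) \<in> borel_measurable \<mu>"
      by (rule meas_mu[OF bounded_borel_meas[OF bounded_borel_mult[OF bounded_borel_lim[OF assms(1-3)] assms(4)]]])
    show "(\<lambda>l. F n l * g l) \<in> borel_measurable \<mu>" for n
      by (rule meas_mu[OF bounded_borel_meas[OF bounded_borel_mult[OF assms(1,4)]]])
  qed simp
qed

lemma corr: "hinn V (U t y) y = (LINT l|\<mu>. character t l)"
proof (cases "t \<ge> 0")
  case False
  have "hinn V (U t y) y = cnj (hinn V (U (- t) y) y)"
    using inn_cnj[of "U (- t) y" y] by (simp add: U_adj)
  also have "\<dots> = (LINT l|\<mu>. cnj (character (- t) l))"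
    using False by (simp only: corr0 Bochner_Integration.integral_cnj)
  finally show ?thesis by simp
qed (rule corr0)

text \<open>\<open>calculus f v\<close> encodes \<open>v = f(A) y\<close>, where \<open>U t = exp(i t A)\<close>.\<close>

inductive calculus :: "(real \<Rightarrow> complex) \<Rightarrow> 'v \<Rightarrow> bool" where
  calculus_ex: "calculus (character s) (U s y)"
| calculus_add: "calculus f v \<Longrightarrow> calculus g w \<Longrightarrow> calculus (\<lambda>l. f l + g l) (hadd V v w)"
| calculus_scl: "calculus f v \<Longrightarrow> calculus (\<lambda>l. a * f l) (hscl V a v)"
| calculus_lim: "(\<And>n. calculus (F n) (x n)) \<Longrightarrow> (\<And>n l. cmod (F n l) \<le> B) \<Longrightarrow> (\<And>l. (\<lambda>n. F n l) \<longlonglongrightarrow> f l)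
    \<Longrightarrow> v \<in> hcar V \<Longrightarrow> (\<lambda>n. hdist V (x n) v) \<longlonglongrightarrow> 0 \<Longrightarrow> calculus f v"

lemma calculus_in: assumes "calculus f v" shows "v \<in> hcar V" "bounded_borel f"
proof -
  have "v \<in> hcar V \<and> bounded_borel f" using assms
  proof induction
    case (calculus_lim F x B f v)
    then show ?case using bounded_borel_lim[of F B f] by blast
  qed (auto intro: bounded_borel_ex bounded_borel_add bounded_borel_mult[OF bounded_borel_const])
  then show "v \<in> hcar V" "bounded_borel f" by auto
qed

text \<open>Inner products are compared with the generators \<open>U s y\<close> before general
  vectors: \<open>calculus_inn\<close> follows by a second induction whose base case is this lemma
  with the arguments exchanged.\<close>

lemma calculus_inn_ex:
  assumes "calculus f v" shows "hinn V v (U s y) = (LINT l|\<mu>. f l * character (- s) l)"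
  using assms
proof induction
  case (calculus_ex r)
  then show ?case by (simp add: U_inn corr character_mult)
next
  case (calculus_add f v g w)
  have "integrable \<mu> (\<lambda>l. f l * character (- s) l)" "integrable \<mu> (\<lambda>l. g l * character (- s) l)"
    using calculus_in calculus_add by (auto intro!: bounded_borel_int bounded_borel_mult bounded_borel_ex)
  then show ?case using calculus_add calculus_in by (simp add: distrib_right)
next
  case (calculus_scl f v a)
  then show ?case using calculus_in by (simp add: mult.assoc)
next
  case (calculus_lim F x B f v)
  note xi = calculus_in[OF calculus_lim.hyps(1)]
  have "(\<lambda>n. hinn V (x n) (U s y)) \<longlonglongrightarrow> hinn V v (U s y)"
    using calculus_lim xi by (intro tendsto_inn_l) auto
  moreover have "(\<lambda>n. LINT l|\<mu>. F n l * character (- s) l) \<longlonglongrightarrow> (LINT l|\<mu>. f l * character (- s) l)"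
    using calculus_lim xi by (intro dct[of F B f] bounded_borel_ex) auto
  ultimately show ?case using calculus_lim LIMSEQ_unique by auto
qed

lemma calculus_inn:
  assumes "calculus g w" "calculus f v" shows "hinn V w v = (LINT l|\<mu>. g l * cnj (f l))"
  using assms(1)
proof induction
  case (calculus_ex r)
  have "hinn V (U r y) v = cnj (hinn V v (U r y))" using calculus_in[OF assms(2)] by (intro inn_cnj) auto
  also have "\<dots> = (LINT l|\<mu>. cnj (f l * character (- r) l))"
    by (simp only: calculus_inn_ex[OF assms(2)] Bochner_Integration.integral_cnj)
  finally show ?case by (simp add: mult.commute)
next
  case (calculus_add g w g' w')
  have "integrable \<mu> (\<lambda>l. g l * cnj (f l))" "integrable \<mu> (\<lambda>l. g' l * cnj (f l))"
    using calculus_in calculus_add assms(2) by (auto intro!: bounded_borel_int bounded_borel_mult bounded_borel_cnj)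
  then show ?case using calculus_add calculus_in assms(2) by (simp add: distrib_right)
next
  case (calculus_scl g w a)
  then show ?case using calculus_in assms(2) by (simp add: mult.assoc)
next
  case (calculus_lim F x B g w)
  note xi = calculus_in[OF calculus_lim.hyps(1)]
  have "(\<lambda>n. hinn V (x n) v) \<longlonglongrightarrow> hinn V w v"
    using calculus_lim xi calculus_in[OF assms(2)] assms(2) by (intro tendsto_inn_l) auto
  moreover have "(\<lambda>n. LINT l|\<mu>. F n l * cnj (f l)) \<longlonglongrightarrow> (LINT l|\<mu>. g l * cnj (f l))"
    using calculus_lim xi calculus_in[OF assms(2)] by (intro dct[of F B g] bounded_borel_cnj) auto
  ultimately show ?case using calculus_lim LIMSEQ_unique by auto
qed

lemma calculus_sub: "calculus f v \<Longrightarrow> calculus g w \<Longrightarrow> calculus (\<lambda>l. f l - g l) (hsub V v w)"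
  using calculus_add[OF _ calculus_scl[of g w "-1"], of f v] by (simp add: hsub_def)

lemma calculus_norm2: "calculus f v \<Longrightarrow> (hnorm V v)\<^sup>2 = (LINT l|\<mu>. (cmod (f l))\<^sup>2)"
proof -
  assume r: "calculus f v"
  have "of_real ((hnorm V v)\<^sup>2) = (LINT l|\<mu>. complex_of_real ((cmod (f l))\<^sup>2))"
    unfolding inn_self[OF calculus_in(1)[OF r], symmetric] calculus_inn[OF r r] by (simp only: complex_norm_square)
  then show ?thesis unfolding integral_complex_of_real of_real_eq_iff .
qed

lemma calculus_U: "calculus f v \<Longrightarrow> calculus (\<lambda>l. character t l * f l) (U t v)"
proof (induction rule: calculus.induct)
  case (calculus_ex s)
  have "(\<lambda>l. character t l * character s l) = character (t + s)" by (auto simp: character_mult)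
  then show ?case using calculus.calculus_ex[of "t + s"] by (simp add: U_U)
next
  case (calculus_add f v g w)
  then show ?case using calculus.calculus_add[OF calculus_add.IH] calculus_in by (simp add: U_add distrib_left)
next
  case (calculus_scl f v a)
  then show ?case using calculus.calculus_scl[OF calculus_scl.IH, of a] calculus_in by (simp add: U_scl algebra_simps)
next
  case (calculus_lim F x B f v)
  show ?case
  proof (rule calculus.calculus_lim[OF calculus_lim.IH])
    show "cmod (character t l * F n l) \<le> B" for n l using calculus_lim by (simp add: norm_mult)
    show "(\<lambda>n. character t l * F n l) \<longlonglongrightarrow> character t l * f l" for l using calculus_lim by (intro tendsto_intros)
    have "hdist V (U t (x n)) (U t v) = hdist V (x n) v" for n
    proof -
      have "hsub V (U t (x n)) (U t v) = U t (hsub V (x n) v)"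
        using calculus_lim calculus_in(1)[of "F n" "x n"] by (simp add: hsub_def U_add U_scl)
      then show ?thesis using calculus_lim calculus_in(1)[of "F n" "x n"] by (simp add: hdist_def U_norm)
    qed
    then show "(\<lambda>n. hdist V (U t (x n)) (U t v)) \<longlonglongrightarrow> 0" using calculus_lim by simp
  qed (use calculus_lim in simp)
qed

text \<open>Every vector of the calculus lies in the closed span of the orbit of
  \<open>y\<close>.\<close>

lemma calculus_perp: 
  assumes "calculus f v" "z \<in> hcar V" "\<And>s. hinn V (U s y) z = 0"
  shows "hinn V v z = 0"
  using assms(1)
proof induction
  case (calculus_lim F x B f v)
  note xi = calculus_in[OF calculus_lim.hyps(1)]
  have "(\<lambda>n. hinn V (x n) z) \<longlonglongrightarrow> hinn V v z"
    using calculus_lim xi assms(2) by (intro tendsto_inn_l) auto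
  then show ?case using calculus_lim LIMSEQ_unique[OF _ tendsto_const] by auto
qed (use assms calculus_in in auto)

definition in_calculus :: "(real \<Rightarrow> complex) \<Rightarrow> bool" where "in_calculus f \<longleftrightarrow> (\<exists>v. calculus f v)"

lemma in_calculus_add: "in_calculus f \<Longrightarrow> in_calculus g \<Longrightarrow> in_calculus (\<lambda>l. f l + g l)"
  and in_calculus_scl: "in_calculus f \<Longrightarrow> in_calculus (\<lambda>l. a * f l)"
  and in_calculus_U: "in_calculus f \<Longrightarrow> in_calculus (\<lambda>l. character t l * f l)"
  unfolding in_calculus_def by (blast intro: calculus_add calculus_scl calculus_U)+

lemma in_calculus_one: "in_calculus (\<lambda>l. 1)"
  unfolding in_calculus_def using calculus_ex[of 0] by (auto simp: character_props(3)[abs_def])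

text \<open>A bounded pointwise limit is a limit in L2 of \<open>\<mu>\<close>. The calculus is
  isometric, so the corresponding vectors form a Cauchy sequence, and completeness supplies the
  vector for \<open>f\<close>. Such limits lead from characters to indicators of intervals and take
  the place of the spectral theorem.\<close>

lemma in_calculus_lim:
  assumes "\<And>n. in_calculus (F n)" "\<And>n l. cmod (F n l) \<le> B" "\<And>l. (\<lambda>n. F n l) \<longlonglongrightarrow> f l"
  shows "in_calculus f"
proof -
  obtain x where x: "\<And>n. calculus (F n) (x n)" using assms(1) unfolding in_calculus_def by metis
  note bF = calculus_in(2)[OF x] and xi = calculus_in(1)[OF x]
  have bf: "bounded_borel f" by (rule bounded_borel_lim[OF bF assms(2,3)])
  define a where "a n = (LINT l|\<mu>. (cmod (F n l - f l))\<^sup>2)" for n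
  have fB: "cmod (f l) \<le> B" for l
    using tendsto_norm[OF assms(3)[of l]] assms(2) by (intro LIMSEQ_le_const2[of _ "cmod (f l)"]) auto
  have ib: "integrable \<mu> (\<lambda>l. (cmod (f l - g l))\<^sup>2)" if "bounded_borel f" "bounded_borel g" for f g
  proof -
    have "bounded_borel (\<lambda>l. of_real ((cmod (f l - g l))\<^sup>2))"
      using bounded_borel_mult[OF bounded_borel_add[OF that(1) bounded_borel_mult[OF bounded_borel_const that(2)], of "-1"] bounded_borel_cnj[OF bounded_borel_add[OF that(1) bounded_borel_mult[OF bounded_borel_const that(2)], of "-1"]]]
      unfolding complex_norm_square by simp
    from integrable_Re[OF bounded_borel_int[OF this]] show ?thesis by (simp only: Re_complex_of_real)
  qed
  have a0: "a \<longlonglongrightarrow> 0"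
  proof -
    have "(\<lambda>n. LINT l|\<mu>. (cmod (F n l - f l))\<^sup>2) \<longlonglongrightarrow> (LINT l|\<mu>. 0)"
    proof (rule integral_dominated_convergence[where w = "\<lambda>_. (2 * B)\<^sup>2"])
      show "AE l in \<mu>. (\<lambda>n. (cmod (F n l - f l))\<^sup>2) \<longlonglongrightarrow> 0"
      proof (rule AE_I2)
        fix l
        have "(\<lambda>n. (cmod (F n l - f l))\<^sup>2) \<longlonglongrightarrow> (cmod (f l - f l))\<^sup>2" by (intro tendsto_intros assms(3))
        then show "(\<lambda>n. (cmod (F n l - f l))\<^sup>2) \<longlonglongrightarrow> 0" by simp
      qed
      have "(cmod (F n l - f l))\<^sup>2 \<le> (2 * B)\<^sup>2" for n l
        using norm_triangle_ineq4[of "F n l" "f l"] assms(2)[of n l] fB[of l] by (intro power_mono) auto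
      then show "AE l in \<mu>. norm ((cmod (F n l - f l))\<^sup>2) \<le> (2 * B)\<^sup>2" for n by simp
      show "(\<lambda>l. (cmod (F n l - f l))\<^sup>2) \<in> borel_measurable \<mu>" for n
        using ib[OF bF bf] by (rule borel_measurable_integrable)
    qed simp_all
    then show ?thesis by (simp add: a_def[abs_def])
  qed
  have d: "(hdist V (x m) (x n))\<^sup>2 \<le> 2 * (a m + a n)" for m n
  proof -
    have "(cmod (F m l - F n l))\<^sup>2 \<le> 2 * ((cmod (F m l - f l))\<^sup>2 + (cmod (F n l - f l))\<^sup>2)" for l
    proof -
      have "cmod (F m l - F n l) \<le> cmod (F m l - f l) + cmod (F n l - f l)"
        using norm_triangle_ineq4[of "F m l - f l" "F n l - f l"] by simp
      then have "(cmod (F m l - F n l))\<^sup>2 \<le> (cmod (F m l - f l) + cmod (F n l - f l))\<^sup>2" by (intro power_mono) auto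
      also have "\<dots> \<le> 2 * ((cmod (F m l - f l))\<^sup>2 + (cmod (F n l - f l))\<^sup>2)"
        using sum_squares_bound[of "cmod (F m l - f l)" "cmod (F n l - f l)"] by (simp add: power2_sum)
      finally show ?thesis .
    qed
    then have "(LINT l|\<mu>. (cmod (F m l - F n l))\<^sup>2) \<le> (LINT l|\<mu>. 2 * ((cmod (F m l - f l))\<^sup>2 + (cmod (F n l - f l))\<^sup>2))"
      by (intro integral_mono ib bF bf integrable_mult_right Bochner_Integration.integrable_add)
    also have "\<dots> = 2 * (a m + a n)" unfolding a_def using ib[OF bF bf] by simp
    finally show ?thesis using calculus_norm2[OF calculus_sub[OF x x], of m n] by (simp add: hdist_def)
  qed
  have "\<exists>N. \<forall>m\<ge>N. \<forall>n\<ge>N. hdist V (x m) (x n) < e" if e: "e > 0" for e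
  proof -
    have "eventually (\<lambda>n. a n < e\<^sup>2 / 4) sequentially" using e by (intro order_tendstoD(2)[OF a0]) auto
    then obtain N where N: "\<And>n. n \<ge> N \<Longrightarrow> a n < e\<^sup>2 / 4" by (auto simp: eventually_sequentially)
    have "hdist V (x m) (x n) < e" if "m \<ge> N" "n \<ge> N" for m n
    proof (rule power2_less_imp_less)
      show "(hdist V (x m) (x n))\<^sup>2 < e\<^sup>2" using d[of m n] N[OF that(1)] N[OF that(2)] by simp
    qed (use e in simp)
    then show ?thesis by blast
  qed
  from complete[OF xi this] obtain v where "v \<in> hcar V" "(\<lambda>n. hdist V (x n) v) \<longlonglongrightarrow> 0" by blast
  then show ?thesis unfolding in_calculus_def using calculus_lim[OF x assms(2,3)] by blast
qed

text \<open>The multiplier is a trigonometric polynomial with the frequencies 0 and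
  \<open>\<plusminus>\<theta>\<close>. It is scaled to take values between 0 and 1, the domain of
  the Bernstein polynomials used next.\<close>

lemma in_calculus_cos_mult:
  assumes "in_calculus f" shows "in_calculus (\<lambda>l. of_real ((1 + cos (\<theta> * (l - c))) / 2) * f l)"
proof -
  have "in_calculus (\<lambda>l. 1/2 * f l + (character (- \<theta>) c / 4 * (character \<theta> l * f l) + character \<theta> c / 4 * (character (- \<theta>) l * f l)))"
    using assms by (intro in_calculus_add in_calculus_scl in_calculus_U)
  moreover have "1/2 * f l + (character (- \<theta>) c / 4 * (character \<theta> l * f l) + character \<theta> c / 4 * (character (- \<theta>) l * f l))
      = of_real ((1 + cos (\<theta> * (l - c))) / 2) * f l" for l
  proof -
    have 1: "character (- \<theta>) c * character \<theta> l = exp (\<i> * of_real (\<theta> * (l - c)))"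
      by (simp add: character_def exp_add[symmetric] algebra_simps)
    have 2: "character \<theta> c * character (- \<theta>) l = exp (- (\<i> * of_real (\<theta> * (l - c))))"
      by (simp add: character_def exp_add[symmetric] algebra_simps)
    have 3: "complex_of_real (cos x) = (exp (\<i> * of_real x) + exp (- (\<i> * of_real x))) / 2" for x
      by (simp only: cos_of_real[symmetric] cos_exp_eq)
    have "1/2 * f l + (character (- \<theta>) c / 4 * (character \<theta> l * f l) + character \<theta> c / 4 * (character (- \<theta>) l * f l))
      = (1 / 2 + (character (- \<theta>) c * character \<theta> l + character \<theta> c * character (- \<theta>) l) / 4) * f l"
      by (simp add: algebra_simps)
    also have "\<dots> = of_real ((1 + cos (\<theta> * (l - c))) / 2) * f l"
      unfolding 1 2 by (simp add: 3 add_divide_distrib)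
    finally show ?thesis .
  qed
  ultimately show ?thesis by (simp only:)
qed

lemma in_calculus_sum: "(\<And>k. k \<in> S \<Longrightarrow> in_calculus (F k)) \<Longrightarrow> in_calculus (\<lambda>l. \<Sum>k\<in>S. F k l)"
proof (induction S rule: infinite_finite_induct)
  case (insert k S)
  then show ?case using in_calculus_add[of "F k" "\<lambda>l. \<Sum>k\<in>S. F k l"] by simp
qed (use in_calculus_scl[OF in_calculus_one, of 0] in auto)

text \<open>Polynomials in \<open>u\<close> and \<open>1 - u\<close> are available by repeated
  multiplication, and the Bernstein polynomials of \<open>\<psi>\<close> converge uniformly on the
  unit interval.\<close>

lemma in_calculus_cont:
  fixes \<psi> :: "real \<Rightarrow> real"
  assumes "continuous_on {0..1} \<psi>"
  shows "in_calculus (\<lambda>l. of_real (\<psi> ((1 + cos (\<theta> * (l - c))) / 2)))"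
proof -
  define u where "u l = (1 + cos (\<theta> * (l - c))) / 2" for l
  have u: "u l \<in> {0..1}" for l
  proof -
    have "(1 + x) / 2 \<in> {0..1}" if "-1 \<le> x" "x \<le> 1" for x :: real using that by auto
    from this[OF cos_ge_minus_one cos_le_one] show ?thesis by (simp only: u_def)
  qed
  have pow: "in_calculus (\<lambda>l. of_real (u l) ^ k * f l)" if "in_calculus f" for k f
  proof (induction k)
    case (Suc k)
    then show ?case using in_calculus_cos_mult[OF Suc, of \<theta> c] by (simp add: u_def mult.assoc)
  qed (simp add: that)
  have pow1: "in_calculus (\<lambda>l. of_real (1 - u l) ^ k * f l)" if f: "in_calculus f" for k f
  proof (induction k)
    case (Suc k)
    have "in_calculus (\<lambda>l. of_real (1 - u l) ^ k * f l + (- 1) * (of_real (u l) ^ 1 * (of_real (1 - u l) ^ k * f l)))"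
      by (intro in_calculus_add in_calculus_scl pow Suc)
    then show ?case by (simp add: algebra_simps)
  qed (simp add: that)
  define B where "B n x = (\<Sum>k\<le>n. \<psi> (real k / real n) * Bernstein n k x)" for n x
  have rB: "in_calculus (\<lambda>l. of_real (B n (u l)))" for n
  proof -
    have "in_calculus (\<lambda>l. \<Sum>k\<le>n. of_real (\<psi> (real k / real n) * real (n choose k)) * (of_real (u l) ^ k * (of_real (1 - u l) ^ (n - k) * 1)))"
      by (intro in_calculus_sum in_calculus_scl pow pow1 in_calculus_one)
    then show ?thesis by (simp add: B_def Bernstein_def mult.assoc)
  qed
  have BW: "\<exists>N. \<forall>n x. N \<le> n \<and> x \<in> {0..1} \<longrightarrow> \<bar>\<psi> x - B n x\<bar> < e" if "e > 0" for e
    unfolding B_def by (rule Bernstein_Weierstrass[OF assms that])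
  \<comment> \<open>Starting the sequence at \<open>N1\<close> keeps all approximants within
    distance 1 of \<open>\<psi>\<close>, which provides the uniform bound demanded by
    \<open>in_calculus_lim\<close>.\<close>
  obtain N1 where N1: "\<And>n x. N1 \<le> n \<Longrightarrow> x \<in> {0..1} \<Longrightarrow> \<bar>\<psi> x - B n x\<bar> < 1" using BW[of 1] by auto
  have "bounded (\<psi> ` {0..1})" by (intro compact_imp_bounded compact_continuous_image assms compact_Icc)
  then obtain K where K: "\<And>x. x \<in> {0..1} \<Longrightarrow> \<bar>\<psi> x\<bar> \<le> K" by (auto simp: bounded_iff simp del: atLeastAtMost_iff)
  have "in_calculus (\<lambda>l. of_real (\<psi> (u l)))"
  proof (rule in_calculus_lim[of "\<lambda>n l. of_real (B (n + N1) (u l))"])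
    show "cmod (of_real (B (n + N1) (u l))) \<le> K + 1" for n l
      using N1[of "n + N1" "u l"] K[OF u, of l] u by simp
    show "(\<lambda>n. complex_of_real (B (n + N1) (u l))) \<longlonglongrightarrow> of_real (\<psi> (u l))" for l
    proof (intro tendsto_of_real LIMSEQ_I)
      fix e :: real assume "e > 0"
      then obtain N where N: "\<And>n x. N \<le> n \<Longrightarrow> x \<in> {0..1} \<Longrightarrow> \<bar>\<psi> x - B n x\<bar> < e" using BW by blast
      have "norm (B (n + N1) (u l) - \<psi> (u l)) < e" if "n \<ge> N" for n
        using N[of "n + N1" "u l"] u that by (simp add: abs_minus_commute)
      then show "\<exists>no. \<forall>n\<ge>no. norm (B (n + N1) (u l) - \<psi> (u l)) < e" by blast
    qed
  qed (rule rB)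
  then show ?thesis by (simp add: u_def)
qed

text \<open>The ramps of slope \<open>n\<close> are 0 where the value is at most \<open>c0\<close>
  and eventually 1 where it exceeds \<open>c0\<close>.\<close>

lemma in_calculus_level:
  fixes c0 :: real
  shows "in_calculus (\<lambda>l. of_bool ((1 + cos (\<theta> * (l - c))) / 2 > c0))"
proof (rule in_calculus_lim[of "\<lambda>n l. of_real (min 1 (real n * max 0 ((1 + cos (\<theta> * (l - c))) / 2 - c0)))" 1])
  show "in_calculus (\<lambda>l. of_real (min 1 (real n * max 0 ((1 + cos (\<theta> * (l - c))) / 2 - c0))))" for n
    by (rule in_calculus_cont[of "\<lambda>x. min 1 (real n * max 0 (x - c0))"]) (intro continuous_intros)
  show "cmod (of_real (min 1 (real n * max 0 ((1 + cos (\<theta> * (l - c))) / 2 - c0)))) \<le> 1" for n l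
    by (simp add: min_def)
  fix l
  define d where "d = (1 + cos (\<theta> * (l - c))) / 2 - c0"
  show "(\<lambda>n. complex_of_real (min 1 (real n * max 0 ((1 + cos (\<theta> * (l - c))) / 2 - c0)))) \<longlonglongrightarrow> of_bool ((1 + cos (\<theta> * (l - c))) / 2 > c0)"
  proof (cases "d > 0")
    case True
    obtain N :: nat where N: "1 / d < N" using reals_Archimedean2 by blast
    have "min 1 (real n * max 0 d) = 1" if "n \<ge> N" for n
    proof -
      have "1 < real N * d" using N True by (simp add: field_simps)
      also have "\<dots> \<le> real n * d" using that True by (intro mult_right_mono) auto
      finally show ?thesis using True by simp
    qed
    then have "eventually (\<lambda>n. complex_of_real (min 1 (real n * max 0 d)) = 1) sequentially"
      by (auto simp: eventually_sequentially)
    then show ?thesis using True tendsto_eventually by (fastforce simp: d_def)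
  next
    case False
    then have "max 0 d = 0" by simp
    then show ?thesis using False by (simp add: d_def)
  qed
qed

text \<open>Within one period the interval is a superlevel set of a cosine centred at its midpoint;
  letting the period tend to infinity removes the periodic copies.\<close>

lemma in_calculus_interval: "in_calculus (\<lambda>l. of_bool (l \<in> {a<..<b}))"
proof (cases "a < b")
  case True
  define c where "c = (a + b) / 2"
  define r where "r = (b - a) / 2"
  have r: "r > 0" using True by (simp add: r_def)
  \<comment> \<open>The half period \<open>r + 1 + real n\<close> exceeds both \<open>r\<close> and
    every distance \<open>\<bar>l - c\<bar>\<close> up to \<open>real n\<close>, so on the relevant
    range the cosine decreases with the distance from \<open>c\<close>.\<close>
  define F where "F n l = (of_bool ((1 + cos (pi / (r + 1 + real n) * (l - c))) / 2 > (1 + cos (pi / (r + 1 + real n) * r)) / 2) :: complex)" for n l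
  show ?thesis
  proof (rule in_calculus_lim[of F 1])
    show "in_calculus (F n)" for n unfolding F_def by (rule in_calculus_level)
    show "cmod (F n l) \<le> 1" for n l by (simp add: F_def)
    fix l
    have "F n l = of_bool (l \<in> {a<..<b})" if n: "\<bar>l - c\<bar> \<le> real n" for n
    proof -
      define L where "L = r + 1 + real n"
      have L: "L > 0" using r by (simp add: L_def)
      have le: "pi / L * x \<le> pi" if "x \<le> L" "0 \<le> x" for x
        using mult_left_mono[OF that(1), of "pi / L"] L by simp
      have "cos (pi / L * x) = cos (pi / L * \<bar>x\<bar>)" for x by (cases "x \<ge> 0") simp_all
      then have "cos (pi / L * (l - c)) = cos (pi / L * \<bar>l - c\<bar>)" .
      moreover have "cos (pi / L * r) < cos (pi / L * \<bar>l - c\<bar>) \<longleftrightarrow> pi / L * \<bar>l - c\<bar> < pi / L * r"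
        using L r n by (intro cos_mono_less_eq le) (auto simp: L_def)
      moreover have "\<dots> \<longleftrightarrow> \<bar>l - c\<bar> < r" using L by (simp add: divide_less_cancel)
      moreover have "\<dots> \<longleftrightarrow> l \<in> {a<..<b}" by (auto simp: c_def r_def abs_if field_simps)
      ultimately show ?thesis by (simp add: F_def L_def)
    qed
    moreover obtain N :: nat where "\<bar>l - c\<bar> \<le> real N" using real_arch_simple by blast
    ultimately have "eventually (\<lambda>n. F n l = of_bool (l \<in> {a<..<b})) sequentially"
      unfolding eventually_sequentially by (auto intro!: exI[of _ N] elim: order_trans)
    then show "(\<lambda>n. F n l) \<longlonglongrightarrow> of_bool (l \<in> {a<..<b})" by (rule tendsto_eventually)
  qed
next
  case False
  then have "(\<lambda>l. of_bool (l \<in> {a<..<b})) = (\<lambda>l. 0 :: complex)" by (auto simp: fun_eq_iff)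
  then show ?thesis using in_calculus_scl[OF in_calculus_one, of 0] by simp
qed

end

section \<open>Short open covers of a null set and their components\<close>

lemma null_set_cover:
  fixes N :: "real set" and \<delta> :: "nat \<Rightarrow> real"
  assumes N: "N \<in> sets borel" "emeasure lborel N = 0" and \<delta>: "\<And>n. \<delta> n > 0"
  shows "\<exists>Ov. \<forall>n. open (Ov n) \<and> N \<subseteq> Ov n \<and> Ov (Suc n) \<subseteq> Ov n \<and> emeasure lborel (Ov n) \<le> ennreal (\<delta> n)"
proof -
  have "\<exists>U. open U \<and> N \<subseteq> U \<and> emeasure lborel U \<le> ennreal (\<delta> n)" for n
  proof -
    obtain U where U: "open U" "N \<subseteq> U" "emeasure lborel (U - N) < \<delta> n"
      using outer_regular_lborel[OF N(1) \<delta>] by blast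
    have "emeasure lborel U = emeasure lborel (N \<union> (U - N))" using U(2) by (simp add: Un_absorb1)
    also have "\<dots> \<le> emeasure lborel N + emeasure lborel (U - N)"
      using U(1) N(1) by (intro emeasure_subadditive) auto
    finally show ?thesis using U N(2) by (intro exI[of _ U]) auto
  qed
  then obtain U where U: "\<And>n. open (U n)" "\<And>n. N \<subseteq> U n" "\<And>n. emeasure lborel (U n) \<le> ennreal (\<delta> n)" by metis
  \<comment> \<open>Finite intersections make the covers decreasing without losing openness or the
    measure bound.\<close>
  define Ov where "Ov n = (\<Inter>i\<le>n. U i)" for n :: nat
  have "emeasure lborel (Ov n) \<le> ennreal (\<delta> n)" for n
    using U by (intro order_trans[OF emeasure_mono U(3)]) (auto simp: Ov_def)
  moreover have "open (Ov n)" for n unfolding Ov_def using U by (intro open_INT) auto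
  moreover have "N \<subseteq> Ov n" "Ov (Suc n) \<subseteq> Ov n" for n using U(2) by (auto simp: Ov_def)
  ultimately show ?thesis by blast
qed

lemma enum_components:
  fixes Ov :: "real set"
  assumes "open Ov"
  shows "\<exists>cs :: nat \<Rightarrow> real set. (\<forall>i. cs i \<in> components Ov \<or> cs i = {}) \<and> disjoint_family cs \<and> (\<Union>i. cs i) = Ov"
proof -
  have "pairwise disjnt (components Ov)" by (auto simp: pairwise_def disjnt_def components_nonoverlap)
  then have "countable (components Ov)"
    using open_components[OF assms] by (intro countable_disjoint_open_subsets) auto
  then obtain f :: "nat \<Rightarrow> real set" and I where f: "bij_betw f I (components Ov)" by (rule countableE_bij)
  define cs where "cs i = (if i \<in> I then f i else {})" for i
  have "cs i \<in> components Ov \<or> cs i = {}" for i using f by (auto simp: cs_def bij_betw_def)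
  moreover have "disjoint_family cs"
    unfolding disjoint_family_on_def
  proof (intro ballI impI)
    fix i j :: nat assume "i \<noteq> j"
    show "cs i \<inter> cs j = {}"
    proof (cases "i \<in> I \<and> j \<in> I")
      case True
      then have "f i \<noteq> f j" using f \<open>i \<noteq> j\<close> by (auto simp: bij_betw_def inj_on_def)
      moreover have "f i \<in> components Ov" "f j \<in> components Ov" using f True by (auto simp: bij_betw_def)
      ultimately show ?thesis using components_nonoverlap[of "f i" Ov "f j"] True by (simp add: cs_def)
    qed (auto simp: cs_def)
  qed
  moreover have "(\<Union>i. cs i) = \<Union>(components Ov)"
    using f by (auto simp: cs_def bij_betw_def split: if_splits)
  ultimately show ?thesis using Union_components[of Ov] by auto
qed

text \<open>A connected set contains the segment between any two of its points, so its measure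
  bounds their distance. Finite measure thus makes the set bounded, and openness excludes its end
  points.\<close>

lemma connected_open_real:
  fixes C :: "real set"
  assumes C: "connected C" "open C" and fin: "emeasure lborel C < \<infinity>"
  shows "\<exists>a b. C = {a<..<b}" "\<And>x y. x \<in> C \<Longrightarrow> y \<in> C \<Longrightarrow> \<bar>x - y\<bar> \<le> measure lborel C"
proof -
  have iv: "{x..y} \<subseteq> C" if "x \<in> C" "y \<in> C" for x y
    using C(1) that connected_contains_Icc by blast
  have Cm [measurable]: "C \<in> sets lborel" using C by simp
  have le: "y - x \<le> measure lborel C" if "x \<in> C" "y \<in> C" "x \<le> y" for x y
  proof -
    have "measure lborel {x..y} \<le> measure lborel C"
      using iv[OF that(1,2)] fin Cm by (intro measure_mono_fmeasurable) (auto simp: fmeasurable_def)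
    then show ?thesis using that by simp
  qed
  then show d: "\<bar>x - y\<bar> \<le> measure lborel C" if "x \<in> C" "y \<in> C" for x y
    using le[OF that] le[OF that(2,1)] by linarith
  show "\<exists>a b. C = {a<..<b}"
  proof (cases "C = {}")
    case True
    then show ?thesis by (intro exI[of _ 0]) auto
  next
    case False
    then obtain x0 where x0: "x0 \<in> C" by blast
    have b: "bdd_above C" "bdd_below C"
      using d[OF x0] by (auto intro!: bdd_aboveI[of _ "x0 + measure lborel C"] bdd_belowI[of _ "x0 - measure lborel C"] simp: abs_le_iff)
        (smt (verit))+
    have "C = {Inf C<..<Sup C}"
    proof (intro equalityI subsetI)
      fix x assume x: "x \<in> C"
      obtain e where e: "e > 0" "ball x e \<subseteq> C" using C(2) x open_contains_ball by blast
      have "x - e/2 \<in> C" "x + e/2 \<in> C" using e by (auto intro!: subsetD[OF e(2)] simp: dist_real_def)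
      then show "x \<in> {Inf C<..<Sup C}"
        using cInf_lower[OF _ b(2), of "x - e/2"] cSup_upper[OF _ b(1), of "x + e/2"] e(1) by auto
    next
      fix x assume x: "x \<in> {Inf C<..<Sup C}"
      then obtain p q where "p \<in> C" "p < x" "q \<in> C" "x < q"
        using less_cSupD[OF False, of x] cInf_lessD[OF False, of x] by auto
      then show "x \<in> C" using iv[of p q] by auto
    qed
    then show ?thesis by blast
  qed
qed

lemma character_diff: "cmod (character t x - character t y) \<le> \<bar>t\<bar> * \<bar>x - y\<bar>"
proof -
  have "character t x - character t y = character t y * (exp (\<i> * of_real (t * (x - y))) - 1)"
    by (simp add: character_def right_diff_distrib exp_diff field_simps)
  then have "cmod (character t x - character t y) = cmod (exp (\<i> * of_real (t * (x - y))) - 1)"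
    by (simp only: norm_mult character_props mult_1)
  also have "\<dots> = 2 * \<bar>sin (t * (x - y) / 2)\<bar>" by (rule dist_exp_i_1)
  also have "\<dots> \<le> 2 * \<bar>t * (x - y) / 2\<bar>" by (rule mult_left_mono[OF abs_sin_x_le_abs_x]) simp
  finally show ?thesis by (simp add: abs_mult)
qed

text \<open>The norm identity is the case of equality in Bessel's inequality: \<open>x\<close>
  agrees with its projection \<open>p\<close> onto the span of \<open>u\<close> up to a null vector,
  so the expansion holds against every \<open>z\<close>.\<close>

lemma (in hilbert) parseval_expand:
  assumes u: "on_or_zero_seq V u" and x: "x \<in> hcar V" and z: "z \<in> hcar V"
    and s: "(\<lambda>l. (cmod (hinn V x (u l)))\<^sup>2) sums (hnorm V x)\<^sup>2"
  shows "(\<lambda>l. hinn V x (u l) * hinn V (u l) z) sums hinn V x z"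
proof -
  interpret t: two_hilberts V V u u by (rule two_hilberts.intro) (use u hilbert_axioms in \<open>auto simp: two_hilberts_axioms_def\<close>)
  define p where "p = transfer V V u u x"
  have p [simp]: "p \<in> hcar V" unfolding p_def using x by (rule t.transfer_in)
  have "(\<lambda>l. complex_of_real ((cmod (hinn V x (u l)))\<^sup>2)) sums hinn V p x"
    using t.transfer_sums[OF x x] inn_cnj[OF x t.uin] by (simp add: p_def complex_norm_square del: of_real_power)
  then have px: "hinn V p x = of_real ((hnorm V x)\<^sup>2)" using s by (metis sums_of_real sums_unique2)
  have xp: "hinn V x p = of_real ((hnorm V x)\<^sup>2)" using inn_cnj[OF p x] px by simp
  have "hnorm V p \<le> hnorm V x" unfolding p_def using x by (rule t.transfer_norm)
  then have "(hnorm V p)\<^sup>2 \<le> (hnorm V x)\<^sup>2" by (intro power_mono) auto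
  then have "(hnorm V (hsub V x p))\<^sup>2 \<le> 0"
    using x by (simp add: norm2[of "hsub V x p"] px xp inn_self[OF x] inn_self[OF p] flip: of_real_power)
  then have "hnorm V (hsub V x p) = 0" by simp
  then have "hinn V (hsub V x p) z = 0" using x z by (intro norm_eq_0_inn) auto
  then show ?thesis using t.transfer_sums[OF x z] x z by (simp add: p_def)
qed

section \<open>Approximate eigenvectors inside a cyclic subspace\<close>

context cyclic begin

lemma int_bool: "A \<in> sets borel \<Longrightarrow> (LINT l|\<mu>. of_bool (l \<in> A) :: complex) = of_real (measure \<mu> A)"
proof -
  assume A: "A \<in> sets borel"
  have "(LINT l|\<mu>. of_bool (l \<in> A) :: complex) = (LINT l|\<mu>. complex_of_real (indicator A l))"
    by (intro Bochner_Integration.integral_cong) (auto simp: indicator_def)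
  also have "\<dots> = of_real (LINT l|\<mu>. indicator A l)" by (rule integral_complex_of_real)
  also have "(LINT l|\<mu>. indicator A l) = measure \<mu> A" by simp
  finally show ?thesis .
qed

lemma y_norm2: "(hnorm V y)\<^sup>2 = measure \<mu> UNIV"
  using calculus_norm2[OF calculus_ex, of 0] by (simp add: U_0)

text \<open>\<open>e n k\<close> is the normalised spectral projection of \<open>y\<close> onto a
  component of the n-th cover, hence an eigenvector up to \<open>\<bar>t\<bar>\<close> times the
  length of that component. The total length \<open>\<delta> n\<close> is left free because the
  errors of infinitely many cyclic subspaces must later be summed. The clause on vectors orthogonal
  to the orbit records that \<open>e n k\<close> lies in the cyclic subspace.\<close>

lemma cyclic_level_basis:
  fixes \<delta> :: "nat \<Rightarrow> real"
  assumes N: "N \<in> sets borel" "emeasure lborel N = 0" "emeasure \<mu> (UNIV - N) = 0"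
    and \<delta>: "\<And>n. \<delta> n > 0" "\<delta> \<longlonglongrightarrow> 0"
  shows "\<exists>e \<Lambda> \<eta>. (\<forall>n. on_or_zero_seq V (e n)) \<and>
    (\<forall>n k z. z \<in> hcar V \<longrightarrow> (\<forall>s. hinn V (U s y) z = 0) \<longrightarrow> hinn V (e n k) z = 0) \<and>
    (\<forall>n k z. z \<in> hcar V \<longrightarrow> (\<lambda>l. hinn V (e n k) (e (Suc n) l) * hinn V (e (Suc n) l) z) sums hinn V (e n k) z) \<and>
    (\<forall>n k t. hnorm V (hsub V (U t (e n k)) (hscl V (character t (\<Lambda> n k)) (e n k))) \<le> \<bar>t\<bar> * \<eta> n k) \<and>
    (\<forall>n k. \<eta> n k \<ge> 0) \<and> (\<forall>n. summable (\<eta> n)) \<and> (\<forall>n. suminf (\<eta> n) \<le> \<delta> n) \<and>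
    (\<forall>s. (\<lambda>n. \<Sum>k. (cmod (hinn V (U s y) (e n k)))\<^sup>2) \<longlonglongrightarrow> (hnorm V y)\<^sup>2)"
proof -
  obtain Ov where Ov: "\<And>n. open (Ov n)" "\<And>n. N \<subseteq> Ov n" "\<And>n. Ov (Suc n) \<subseteq> Ov n" "\<And>n. emeasure lborel (Ov n) \<le> ennreal (\<delta> n)"
  proof -
    have "\<exists>Ov. \<forall>n. open (Ov n) \<and> N \<subseteq> Ov n \<and> Ov (Suc n) \<subseteq> Ov n \<and> emeasure lborel (Ov n) \<le> ennreal (\<delta> n)"
      by (rule null_set_cover) (use N \<delta> in auto)
    then show ?thesis using that by blast
  qed
  have "\<forall>n. \<exists>cs :: nat \<Rightarrow> real set. (\<forall>i. cs i \<in> components (Ov n) \<or> cs i = {}) \<and> disjoint_family cs \<and> (\<Union>i. cs i) = Ov n"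
    using enum_components[OF Ov(1)] by blast
  then obtain C :: "nat \<Rightarrow> nat \<Rightarrow> real set" where C: "\<And>n i. C n i \<in> components (Ov n) \<or> C n i = {}"
    "\<And>n. disjoint_family (C n)" "\<And>n. (\<Union>i. C n i) = Ov n" by metis
  have Cconn: "connected (C n i)" "open (C n i)" for n i
    using C(1)[of n i] Ov(1) by (auto intro: in_components_connected open_components)
  have Csub: "C n i \<subseteq> Ov n" for n i using C(3) by blast
  have Cmeas [measurable]: "C n i \<in> sets borel" "Ov n \<in> sets borel" for n i using Cconn Ov(1) by auto
  have Ofin: "emeasure lborel (Ov n) < \<infinity>" for n using Ov(4)[of n] by (simp add: order_le_less_trans)
  have Cfin: "emeasure lborel (C n i) < \<infinity>" for n i
    using emeasure_mono[OF Csub[of n i], of lborel] Ofin[of n] by (auto intro: order_le_less_trans)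
  note Civ = connected_open_real[OF Cconn Cfin]
  define \<eta> where "\<eta> n k = measure lborel (C n k)" for n k
  have \<eta>0: "\<eta> n k \<ge> 0" for n k by (simp add: \<eta>_def)
  have \<eta>s: "\<eta> n sums measure lborel (Ov n)" for n
    unfolding \<eta>_def C(3)[symmetric] using C(2)[of n] Ofin[of n] C(3)[of n] by (intro measure_UNION) auto
  have \<eta>\<delta>: "suminf (\<eta> n) \<le> \<delta> n" for n
  proof -
    have "measure lborel (Ov n) \<le> \<delta> n"
      using Ov(4)[of n] \<delta>(1)[of n] by (simp add: measure_def enn2real_leI)
    then show ?thesis using sums_unique[OF \<eta>s[of n]] by simp
  qed
  have \<eta>le: "\<eta> n k \<le> \<delta> n" for n k
    using sum_le_suminf[of "\<eta> n" "{k}"] \<eta>s[of n] \<eta>0 \<eta>\<delta>[of n] by (auto simp: sums_iff)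
  define m where "m A = measure \<mu> A" for A
  have m0: "m A \<ge> 0" for A by (simp add: m_def)
  \<comment> \<open>Singularity enters here: \<open>\<mu>\<close> is concentrated on
    \<open>N\<close>, so the short cover \<open>Ov n\<close> carries all of the mass.\<close>
  have mOv: "m (A \<inter> Ov n) = m A" if "A \<in> sets borel" for A n
  proof -
    have "AE l in \<mu>. l \<in> N"
      using N(1,3) by (intro AE_I'[of "UNIV - N"]) (auto simp: null_sets_def sets_mu)
    then have "AE l in \<mu>. (l \<in> A \<inter> Ov n) = (l \<in> A)" by eventually_elim (use Ov(2) in auto)
    then show ?thesis unfolding m_def using that by (intro measure_eq_AE) (auto simp: sets_mu)
  qed
  have mC: "(\<lambda>k. m (A \<inter> C n k)) sums m A" if A: "A \<in> sets borel" for A n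
  proof -
    have "(\<lambda>k. m (A \<inter> C n k)) sums m (\<Union>k. A \<inter> C n k)"
      unfolding m_def using A C(2)[of n]
      by (intro fin.finite_measure_UNION) (auto simp: sets_mu disjoint_family_on_def)
    also have "(\<Union>k. A \<inter> C n k) = A \<inter> Ov n" using C(3) by blast
    finally show ?thesis by (simp add: mOv[OF A])
  qed
  have "\<exists>v. calculus (\<lambda>l. of_bool (l \<in> C n k)) v" for n k
    using in_calculus_interval Civ(1)[of n k] unfolding in_calculus_def by metis
  then obtain v where v: "\<And>n k. calculus (\<lambda>l. of_bool (l \<in> C n k)) (v n k)" by metis
  have vin [simp]: "v n k \<in> hcar V" for n k using calculus_in(1)[OF v] .
  \<comment> \<open>Components without mass receive the coefficient 0, which makes their
    \<open>e n k\<close> null.\<close>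
  define a where "a n k = (if m (C n k) > 0 then 1 / sqrt (m (C n k)) else 0)" for n k
  have a0: "a n k \<ge> 0" for n k by (simp add: a_def)
  have am: "(a n k)\<^sup>2 * (m (C n k))\<^sup>2 = m (C n k)" "(a n k)\<^sup>2 * m (C n k) \<le> 1"
    "(a n k)\<^sup>2 * m (C n k) \<in> {0, 1}" for n k
    using m0[of "C n k"] by (auto simp: a_def power_divide power2_eq_square)
  define e where "e n k = hscl V (of_real (a n k)) (v n k)" for n k
  have ein [simp]: "e n k \<in> hcar V" for n k by (simp add: e_def)
  have vv: "hinn V (v n k) (v n' l) = of_real (m (C n k \<inter> C n' l))" for n k n' l
  proof -
    have "hinn V (v n k) (v n' l) = (LINT x|\<mu>. of_bool (x \<in> C n k \<inter> C n' l))"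
      unfolding calculus_inn[OF v v] by (intro Bochner_Integration.integral_cong) auto
    then show ?thesis using int_bool[of "C n k \<inter> C n' l"] by (simp add: m_def)
  qed
  have ee: "hinn V (e n k) (e n' l) = of_real (a n k * a n' l * m (C n k \<inter> C n' l))" for n k n' l
    by (simp add: e_def vv)
  have disj: "C n k \<inter> C n l = {}" if "k \<noteq> l" for n k l using C(2)[of n] that by (auto simp: disjoint_family_on_def)
  have on_or_zero_seq: "on_or_zero_seq V (e n)" for n
    unfolding on_or_zero_seq_def
  proof (intro conjI allI impI)
    show "hinn V (e n k) (e n k) \<in> {0, 1}" for k
    proof -
      have "a n k * a n k * m (C n k) = 0 \<or> a n k * a n k * m (C n k) = 1"
        using am(3)[of n k] by (simp add: power2_eq_square)
      then show ?thesis unfolding ee Int_absorb by (metis insertCI of_real_0 of_real_1)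
    qed
    show "hinn V (e n k) (e n l) = 0" if "k \<noteq> l" for k l by (simp only: ee disj[OF that]) (simp add: m_def)
  qed simp
  \<comment> \<open>As the covers decrease, a component of the finer one is either disjoint from
    \<open>C n k\<close> or contained in it, so the intersection is empty or all of
    \<open>C (Suc n) l\<close>.\<close>
  have nest: "(a (Suc n) l)\<^sup>2 * (m (C n k \<inter> C (Suc n) l))\<^sup>2 = m (C n k \<inter> C (Suc n) l)" for n k l
  proof (cases "C n k \<inter> C (Suc n) l = {}")
    case False
    then have "C n k \<in> components (Ov n)" using C(1)[of n k] by auto
    moreover have "C (Suc n) l \<subseteq> Ov n" using Csub[of "Suc n" l] Ov(3)[of n] by blast
    ultimately have "C (Suc n) l \<subseteq> C n k"
      using components_maximal[of "C n k" "Ov n" "C (Suc n) l"] Cconn False by blast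
    then have "C n k \<inter> C (Suc n) l = C (Suc n) l" by blast
    then show ?thesis using am(1) by simp
  qed (simp add: m_def)
  have nested: "(\<lambda>l. hinn V (e n k) (e (Suc n) l) * hinn V (e (Suc n) l) z) sums hinn V (e n k) z"
    if z: "z \<in> hcar V" for n k z
  proof (rule parseval_expand[OF on_or_zero_seq ein z])
    have "(\<lambda>l. (a n k)\<^sup>2 * m (C n k \<inter> C (Suc n) l)) sums ((a n k)\<^sup>2 * m (C n k))"
      by (intro sums_mult mC) simp
    moreover have "(cmod (hinn V (e n k) (e (Suc n) l)))\<^sup>2 = (a n k)\<^sup>2 * m (C n k \<inter> C (Suc n) l)" for l
      unfolding ee norm_of_real power2_abs power_mult_distrib using nest[of n l k] by (simp add: algebra_simps)
    moreover have "(hnorm V (e n k))\<^sup>2 = (a n k)\<^sup>2 * m (C n k)"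
    proof -
      have "complex_of_real ((hnorm V (e n k))\<^sup>2) = of_real ((a n k)\<^sup>2 * m (C n k))"
        unfolding inn_self[OF ein, symmetric] ee by (simp add: power2_eq_square)
      then show ?thesis by (simp only: of_real_eq_iff)
    qed
    ultimately show "(\<lambda>l. (cmod (hinn V (e n k) (e (Suc n) l)))\<^sup>2) sums (hnorm V (e n k))\<^sup>2" by simp
  qed
  \<comment> \<open>Any point of the component serves as eigenvalue. For an empty component an
    arbitrary value does no harm, since \<open>e n k\<close> is then null.\<close>
  define \<Lambda> where "\<Lambda> n k = (SOME l. l \<in> C n k)" for n k
  have \<Lambda>: "\<bar>l - \<Lambda> n k\<bar> \<le> \<eta> n k" if "l \<in> C n k" for n k l
    using Civ(2)[OF that someI[of "\<lambda>l. l \<in> C n k", OF that]] by (simp add: \<eta>_def \<Lambda>_def)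
  have exd: "cmod (character t l - character t (\<Lambda> n k)) \<le> \<bar>t\<bar> * \<eta> n k" if "l \<in> C n k" for t l n k
    using character_diff[of t l "\<Lambda> n k"] mult_left_mono[OF \<Lambda>[OF that], of "\<bar>t\<bar>"] by simp
  have eig: "hnorm V (hsub V (U t (e n k)) (hscl V (character t (\<Lambda> n k)) (e n k))) \<le> \<bar>t\<bar> * \<eta> n k" for n k t
  proof -
    let ?x = "hsub V (U t (v n k)) (hscl V (character t (\<Lambda> n k)) (v n k))"
    let ?f = "\<lambda>l. character t l * of_bool (l \<in> C n k) - character t (\<Lambda> n k) * of_bool (l \<in> C n k)"
    have r: "calculus ?f ?x" by (intro calculus_sub calculus_U calculus_scl v)
    have "integrable \<mu> (\<lambda>l. (cmod (?f l))\<^sup>2)"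
      using integrable_Re[OF bounded_borel_int[OF bounded_borel_mult[OF calculus_in(2)[OF r] bounded_borel_cnj[OF calculus_in(2)[OF r]]]]]
      by (simp only: complex_norm_square[symmetric] Re_complex_of_real)
    moreover have "(cmod (?f l))\<^sup>2 \<le> (\<bar>t\<bar> * \<eta> n k)\<^sup>2 * indicator (C n k) l" for l
      using power_mono[OF exd[of l n k t], of 2] by (cases "l \<in> C n k") auto
    ultimately have "(LINT l|\<mu>. (cmod (?f l))\<^sup>2) \<le> (LINT l|\<mu>. (\<bar>t\<bar> * \<eta> n k)\<^sup>2 * indicator (C n k) l)"
      by (intro integral_mono) (auto simp: sets_mu fin.emeasure_finite less_top[symmetric])
    then have "(hnorm V ?x)\<^sup>2 \<le> (\<bar>t\<bar> * \<eta> n k)\<^sup>2 * m (C n k)"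
      unfolding calculus_norm2[OF r] by (simp add: m_def)
    then have "(a n k * hnorm V ?x)\<^sup>2 \<le> (a n k)\<^sup>2 * ((\<bar>t\<bar> * \<eta> n k)\<^sup>2 * m (C n k))"
      unfolding power_mult_distrib by (intro mult_left_mono) auto
    also have "\<dots> = (\<bar>t\<bar> * \<eta> n k)\<^sup>2 * ((a n k)\<^sup>2 * m (C n k))" by simp
    also have "\<dots> \<le> (\<bar>t\<bar> * \<eta> n k)\<^sup>2 * 1" using am(2) by (intro mult_left_mono) auto
    finally have "(a n k * hnorm V ?x)\<^sup>2 \<le> (\<bar>t\<bar> * \<eta> n k)\<^sup>2" unfolding mult_1_right .
    then have "a n k * hnorm V ?x \<le> \<bar>t\<bar> * \<eta> n k"
      by (rule power2_le_imp_le) (simp add: \<eta>0)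
    moreover have "hnorm V (hsub V (U t (e n k)) (hscl V (character t (\<Lambda> n k)) (e n k))) = hnorm V (hscl V (of_real (a n k)) ?x)"
      by (intro norm_by_inn) (simp_all add: e_def U_scl algebra_simps)
    ultimately show ?thesis using a0[of n k] by (simp add: norm_scl)
  qed
  \<comment> \<open>On a component the character deviates from its value at
    \<open>\<Lambda> n k\<close> by at most \<open>\<bar>s\<bar> * \<delta> n\<close>, so for large
    \<open>n\<close> the squared coefficient of \<open>U s y\<close> at \<open>e n k\<close> is at
    least \<open>(1 - \<bar>s\<bar> * \<delta> n)\<^sup>2\<close> times the mass. Summed over the
    components, this squeezes the Bessel sums towards the squared norm of \<open>y\<close>.\<close>
  have compl: "(\<lambda>n. \<Sum>k. (cmod (hinn V (U s y) (e n k)))\<^sup>2) \<longlonglongrightarrow> (hnorm V y)\<^sup>2" for s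
  proof (rule tendsto_sandwich)
    have lower: "m (C n k) * (1 - \<bar>s\<bar> * \<delta> n)\<^sup>2 \<le> (cmod (hinn V (U s y) (e n k)))\<^sup>2" if n: "\<bar>s\<bar> * \<delta> n \<le> 1" for n k
    proof -
      let ?Ic = "LINT l|\<mu>. of_bool (l \<in> C n k) * character (- s) l"
      let ?Kc = "LINT l|\<mu>. character (- s) (\<Lambda> n k) * of_bool (l \<in> C n k)"
      have bC: "bounded_borel (\<lambda>l. of_bool (l \<in> C n k))" using calculus_in(2)[OF v] .
      have i1: "integrable \<mu> (\<lambda>l. of_bool (l \<in> C n k) * character (- s) l)" by (intro bounded_borel_int bounded_borel_mult bC bounded_borel_ex)
      have i2: "integrable \<mu> (\<lambda>l. character (- s) (\<Lambda> n k) * of_bool (l \<in> C n k))" by (intro bounded_borel_int bounded_borel_mult bC bounded_borel_const)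
      have "cmod (?Ic - ?Kc) = cmod (LINT l|\<mu>. of_bool (l \<in> C n k) * character (- s) l - character (- s) (\<Lambda> n k) * of_bool (l \<in> C n k))"
        by (rule arg_cong[where f = cmod, OF Bochner_Integration.integral_diff[OF i1 i2, symmetric]])
      also have "\<dots> \<le> (LINT l|\<mu>. \<bar>s\<bar> * \<eta> n k * indicator (C n k) l)"
      proof (rule Bochner_Integration.integral_norm_bound_integral)
        show "integrable \<mu> (\<lambda>l. \<bar>s\<bar> * \<eta> n k * indicator (C n k) l)"
          by (auto simp: sets_mu fin.emeasure_finite less_top[symmetric])
        show "norm (of_bool (l \<in> C n k) * character (- s) l - character (- s) (\<Lambda> n k) * of_bool (l \<in> C n k)) \<le> \<bar>s\<bar> * \<eta> n k * indicator (C n k) l" for l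
          using exd[of l n k "- s"] by (cases "l \<in> C n k") auto
      qed (rule Bochner_Integration.integrable_diff[OF i1 i2])
      also have "\<dots> = \<bar>s\<bar> * \<eta> n k * m (C n k)" by (simp add: m_def)
      also have "\<dots> \<le> \<bar>s\<bar> * \<delta> n * m (C n k)" using \<eta>le m0 by (intro mult_right_mono mult_left_mono) auto
      finally have "cmod (?Ic - ?Kc) \<le> \<bar>s\<bar> * \<delta> n * m (C n k)" .
      moreover have "cmod ?Kc = m (C n k)" using m0 by (simp add: int_bool norm_mult m_def)
      ultimately have "m (C n k) * (1 - \<bar>s\<bar> * \<delta> n) \<le> cmod ?Ic"
        using norm_triangle_ineq2[of ?Kc ?Ic] by (simp add: norm_minus_commute algebra_simps)
      then have "a n k * (m (C n k) * (1 - \<bar>s\<bar> * \<delta> n)) \<le> a n k * cmod ?Ic" using a0 by (intro mult_left_mono)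
      then have "(a n k * (m (C n k) * (1 - \<bar>s\<bar> * \<delta> n)))\<^sup>2 \<le> (a n k * cmod ?Ic)\<^sup>2"
        using a0 m0 n by (intro power_mono mult_nonneg_nonneg) auto
      also have "a n k * cmod ?Ic = cmod (hinn V (e n k) (U s y))"
        using a0[of n k] by (simp add: e_def calculus_inn_ex[OF v] norm_mult)
      also have "\<dots> = cmod (hinn V (U s y) (e n k))" using inn_cnj[of "U s y" "e n k"] by simp
      also have "(a n k * (m (C n k) * (1 - \<bar>s\<bar> * \<delta> n)))\<^sup>2 = (a n k)\<^sup>2 * (m (C n k))\<^sup>2 * (1 - \<bar>s\<bar> * \<delta> n)\<^sup>2"
        by (simp only: power_mult_distrib mult.assoc)
      finally show ?thesis by (simp only: am(1))
    qed
    have ev: "eventually (\<lambda>n. \<bar>s\<bar> * \<delta> n < 1) sequentially"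
      using tendsto_mult_right_zero[OF \<delta>(2), of "\<bar>s\<bar>"] by (rule order_tendstoD(2)) simp
    then show "eventually (\<lambda>n. (1 - \<bar>s\<bar> * \<delta> n)\<^sup>2 * (hnorm V y)\<^sup>2 \<le> (\<Sum>k. (cmod (hinn V (U s y) (e n k)))\<^sup>2)) sequentially"
    proof eventually_elim
      case (elim n)
      have "(\<lambda>k. m (C n k) * (1 - \<bar>s\<bar> * \<delta> n)\<^sup>2) sums (m UNIV * (1 - \<bar>s\<bar> * \<delta> n)\<^sup>2)"
        using mC[of UNIV n] by (intro sums_mult2) simp
      then have "m UNIV * (1 - \<bar>s\<bar> * \<delta> n)\<^sup>2 \<le> (\<Sum>k. (cmod (hinn V (U s y) (e n k)))\<^sup>2)"
        using lower[of n] elim bessel_sums(1)[OF on_or_zero_seq, of "U s y" n]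
        by (intro sums_le[OF _ _ summable_sums]) auto
      then show ?case by (simp add: y_norm2 m_def mult.commute)
    qed
    show "eventually (\<lambda>n. (\<Sum>k. (cmod (hinn V (U s y) (e n k)))\<^sup>2) \<le> (hnorm V y)\<^sup>2) sequentially"
      using bessel_sums(2)[OF on_or_zero_seq, of "U s y"] by (simp add: U_norm)
    have "(\<lambda>n. (1 - \<bar>s\<bar> * \<delta> n)\<^sup>2 * (hnorm V y)\<^sup>2) \<longlonglongrightarrow> (1 - \<bar>s\<bar> * 0)\<^sup>2 * (hnorm V y)\<^sup>2"
      by (intro tendsto_intros \<delta>(2))
    then show "(\<lambda>n. (1 - \<bar>s\<bar> * \<delta> n)\<^sup>2 * (hnorm V y)\<^sup>2) \<longlonglongrightarrow> (hnorm V y)\<^sup>2" by simp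
  qed simp
  have perp: "hinn V (e n k) z = 0" if "z \<in> hcar V" "\<forall>s. hinn V (U s y) z = 0" for n k z
    using calculus_perp[OF v that(1)] that by (simp add: e_def)
  show ?thesis
    by (intro exI[of _ e] exI[of _ \<Lambda>] exI[of _ \<eta>] conjI allI impI)
      (fact on_or_zero_seq | rule perp, assumption, assumption | rule nested, assumption | fact eig | fact \<eta>0
        | rule sums_summable, rule \<eta>s | fact \<eta>\<delta> | fact compl)+
qed

end

section \<open>Decomposition into cyclic subspaces and merging of their bases\<close>

context ugroup begin

text \<open>Zorn's lemma gives a maximal family of unit vectors with mutually orthogonal orbits. A
  vector of nonzero norm orthogonal to all these orbits could be normalised and added, since the
  adjoint of \<open>U s\<close> is again a member of the group.\<close>

lemma cyclic_family_ex:
  "\<exists>Y \<subseteq> hcar V. (\<forall>y\<in>Y. hinn V y y = 1) \<and> (\<forall>y\<in>Y. \<forall>y'\<in>Y. y \<noteq> y' \<longrightarrow> (\<forall>s. hinn V (U s y) y' = 0)) \<and>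
     (\<forall>z\<in>hcar V. (\<forall>y\<in>Y. \<forall>s. hinn V (U s y) z = 0) \<longrightarrow> hnorm V z = 0)"
proof -
  define F where "F = {Y. Y \<subseteq> hcar V \<and> (\<forall>y\<in>Y. hinn V y y = 1) \<and> (\<forall>y\<in>Y. \<forall>y'\<in>Y. y \<noteq> y' \<longrightarrow> (\<forall>s. hinn V (U s y) y' = 0))}"
  have "\<exists>M\<in>F. \<forall>X\<in>F. M \<subseteq> X \<longrightarrow> X = M"
  proof (rule subset_Zorn')
    fix C assume C: "subset.chain F C"
    show "\<Union>C \<in> F" unfolding F_def
    proof (intro CollectI conjI ballI impI allI)
      have CF: "Y \<in> F" if "Y \<in> C" for Y using C that by (auto simp: subset.chain_def)
      show "\<Union>C \<subseteq> hcar V" by (rule Union_least) (use CF in \<open>simp add: F_def\<close>)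
      show "hinn V y y = 1" if "y \<in> \<Union>C" for y using CF that by (auto simp: F_def)
      show "hinn V (U s y) y' = 0" if y: "y \<in> \<Union>C" "y' \<in> \<Union>C" "y \<noteq> y'" for y y' s
      proof -
        obtain Y Y' where Y: "Y \<in> C" "y \<in> Y" "Y' \<in> C" "y' \<in> Y'" using y by blast
        have "Y \<subseteq> Y' \<or> Y' \<subseteq> Y" using C Y by (auto simp: subset.chain_def)
        then show ?thesis using Y CF[OF Y(1)] CF[OF Y(3)] y(3) by (auto simp: F_def)
      qed
    qed
  qed
  then obtain Y where Y: "Y \<in> F" and max: "\<And>X. X \<in> F \<Longrightarrow> Y \<subseteq> X \<Longrightarrow> X = Y" by blast
  have Yc: "Y \<subseteq> hcar V" and Y1: "\<And>y. y \<in> Y \<Longrightarrow> hinn V y y = 1"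
    and Yo: "\<And>y y' s. y \<in> Y \<Longrightarrow> y' \<in> Y \<Longrightarrow> y \<noteq> y' \<Longrightarrow> hinn V (U s y) y' = 0" using Y by (auto simp: F_def)
  have "hnorm V z = 0" if z: "z \<in> hcar V" "\<forall>y\<in>Y. \<forall>s. hinn V (U s y) z = 0" for z
  proof (rule ccontr)
    assume nz: "hnorm V z \<noteq> 0"
    define x where "x = hscl V (of_real (1 / hnorm V z)) z"
    have x [simp]: "x \<in> hcar V" using z by (simp add: x_def)
    have x1: "hinn V x x = 1" unfolding x_def
      using z nz norm_ge[OF z(1)] by (intro normalize[OF inner_space_axioms]) linarith+
    have xo: "hinn V (U s y) x = 0" if "y \<in> Y" for y s
      using z that Yc by (auto simp: x_def subset_iff)
    have xo': "hinn V (U s x) y = 0" if "y \<in> Y" for y s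
    proof -
      have yc: "y \<in> hcar V" using that Yc by auto
      have "hinn V (U s x) y = hinn V x (U (- s) y)" using yc by (simp add: U_adj)
      also have "\<dots> = cnj (hinn V (U (- s) y) x)" using yc by (intro inn_cnj) auto
      finally show ?thesis using xo[OF that] by simp
    qed
    have "insert x Y \<in> F" unfolding F_def using Yc Y1 Yo x1 xo xo' by auto
    then have "x \<in> Y" using max[of "insert x Y"] by blast
    then have "hinn V (U 0 x) x = 0" by (rule xo)
    then show False using x1 by (simp add: U_0)
  qed
  then show ?thesis using Yc Y1 Yo by (intro exI[of _ Y]) simp
qed

text \<open>Two orthonormal vectors have distance sqrt 2, so points of the dense set within 1/2 of
  them are distinct.\<close>

lemma orthonormal_countable:
  assumes "separable_hs V" "Y \<subseteq> hcar V" "\<And>y. y \<in> Y \<Longrightarrow> hinn V y y = 1"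
    and "\<And>y y'. y \<in> Y \<Longrightarrow> y' \<in> Y \<Longrightarrow> y \<noteq> y' \<Longrightarrow> hinn V y y' = 0"
  shows "countable Y"
proof -
  from assms(1) obtain D where D: "countable D" "D \<subseteq> hcar V" "\<forall>x\<in>hcar V. \<forall>e>0. \<exists>d\<in>D. hdist V x d < e"
    unfolding separable_hs_def by (elim exE conjE)
  have "\<forall>y\<in>Y. \<exists>d\<in>D. hdist V y d < 1/2" using D(3) assms(2) by (meson half_gt_zero_iff subsetD zero_less_one)
  then obtain f where f: "\<And>y. y \<in> Y \<Longrightarrow> f y \<in> D" "\<And>y. y \<in> Y \<Longrightarrow> hdist V y (f y) < 1/2" by metis
  have "inj_on f Y"
  proof (rule inj_onI, rule ccontr)
    fix y y' assume y: "y \<in> Y" "y' \<in> Y" "f y = f y'" "y \<noteq> y'"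
    have c: "y \<in> hcar V" "y' \<in> hcar V" "f y \<in> hcar V" using y f D(2) assms(2) by auto
    have "hdist V y y' \<le> hdist V y (f y) + hdist V (f y) y'" using c by (intro dist_triangle)
    also have "\<dots> < 1" using f(2)[OF y(1)] f(2)[OF y(2)] y(3) dist_sym[of "f y" y'] c by simp
    finally have lt: "hdist V y y' < 1" .
    have "(hdist V y y')\<^sup>2 = 2"
      using c assms(3)[OF y(1)] assms(3)[OF y(2)] assms(4)[OF y(1,2,4)] assms(4)[OF y(2,1)] y(4)
      by (simp add: hdist_def norm2)
    moreover have "(hdist V y y')\<^sup>2 \<le> 1\<^sup>2" using lt c by (intro power_mono) auto
    ultimately show False by simp
  qed
  moreover have "f ` Y \<subseteq> D" using f(1) by (rule image_subsetI)
  ultimately show ?thesis using countable_image_inj_on[of f Y] countable_subset[OF _ D(1), of "f ` Y"] by simp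
qed

end

text \<open>An index below \<open>K\<close> decodes to a pair of numbers below \<open>K\<close>, so
  partial sums of the merged series are bounded by sums over rows.\<close>

lemma summable_prod_decode:
  fixes f :: "nat \<Rightarrow> nat \<Rightarrow> real"
  assumes f0: "\<And>j i. f j i \<ge> 0" and s: "\<And>j. summable (f j)" and le: "\<And>j. suminf (f j) \<le> b j" and b: "summable b"
  shows "summable (\<lambda>k. f (fst (prod_decode k)) (snd (prod_decode k)))"
    "(\<Sum>k. f (fst (prod_decode k)) (snd (prod_decode k))) \<le> suminf b"
proof -
  let ?g = "\<lambda>k. f (fst (prod_decode k)) (snd (prod_decode k))"
  have b0: "b j \<ge> 0" for j using order_trans[OF suminf_nonneg[OF s f0] le] .
  have bd: "(\<Sum>k<K. ?g k) \<le> suminf b" for K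
  proof -
    have "(\<Sum>k<K. ?g k) = (\<Sum>p\<in>prod_decode ` {..<K}. f (fst p) (snd p))"
      by (subst sum.reindex) (auto intro: inj_prod_decode inj_on_subset)
    also have "\<dots> \<le> (\<Sum>p\<in>{..<K} \<times> {..<K}. f (fst p) (snd p))"
    proof (rule sum_mono2)
      have "prod_decode k \<in> {..<K} \<times> {..<K}" if "k < K" for k
        using le_prod_encode_1[of "fst (prod_decode k)" "snd (prod_decode k)"]
          le_prod_encode_2[of "snd (prod_decode k)" "fst (prod_decode k)"] that
        by (simp add: mem_Times_iff)
      then show "prod_decode ` {..<K} \<subseteq> {..<K} \<times> {..<K}" by blast
    qed (use f0 in auto)
    also have "\<dots> = (\<Sum>j<K. \<Sum>i<K. f j i)" by (simp add: sum.cartesian_product split_def)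
    also have "\<dots> \<le> (\<Sum>j<K. b j)"
      by (intro sum_mono order_trans[OF sum_le_suminf le] s) (use f0 in auto)
    also have "\<dots> \<le> suminf b" using b b0 by (intro sum_le_suminf) auto
    finally show ?thesis .
  qed
  show sm: "summable ?g" by (rule summableI_nonneg_bounded[OF _ bd]) (use f0 in auto)
  show "suminf ?g \<le> suminf b" by (rule suminf_le_const[OF sm bd])
qed

text \<open>This carries a series over one cyclic subspace over to the merged sequence, where the
  terms from all other subspaces vanish.\<close>

lemma sums_prod_decode_row:
  fixes g :: "nat \<Rightarrow> 'a :: {comm_monoid_add, t2_space}"
  shows "(\<lambda>k. if fst (prod_decode k) = j then g (snd (prod_decode k)) else 0) sums c \<longleftrightarrow> g sums c"
proof -
  have m: "strict_mono (\<lambda>i. prod_encode (j, i))"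
    by (intro strict_mono_Suc_iff[THEN iffD2] allI) (simp add: prod_encode_def)
  have "(\<lambda>i. (\<lambda>k. if fst (prod_decode k) = j then g (snd (prod_decode k)) else 0) (prod_encode (j, i))) sums c
     \<longleftrightarrow> (\<lambda>k. if fst (prod_decode k) = j then g (snd (prod_decode k)) else 0) sums c"
  proof (rule sums_mono_reindex[OF m])
    fix k assume k: "k \<notin> range (\<lambda>i. prod_encode (j, i))"
    have "prod_encode (fst (prod_decode k), snd (prod_decode k)) = k" by simp
    then have "fst (prod_decode k) \<noteq> j" using k by (metis rangeI)
    then show "(if fst (prod_decode k) = j then g (snd (prod_decode k)) else 0) = 0" by simp
  qed
  then show ?thesis by simp
qed

text \<open>The bases of the cyclic subspaces are interleaved by pairing. Vectors from different
  subspaces are orthogonal, so nesting and completeness reduce to one row; summability involves all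
  rows and is arranged through the choice of \<open>\<delta>\<close>. \<open>D\<close> consists of
  the orbits of the cyclic vectors, on which completeness is known and whose span is dense.\<close>

lemma singular_level_basis:
  assumes "ugroup V U" "separable_hs V"
    and sing: "\<And>x. x \<in> hcar V \<Longrightarrow> \<exists>\<mu> :: real measure. finite_measure \<mu> \<and> sets \<mu> = sets borel \<and>
      (\<exists>N\<in>sets borel. emeasure lborel N = 0 \<and> emeasure \<mu> (UNIV - N) = 0) \<and>
      (\<forall>t\<ge>0. hinn V (U t x) x = (LINT l|\<mu>. exp (\<i> * complex_of_real (t * l))))"
  shows "\<exists>E \<Lambda> \<eta>. (\<forall>n. on_or_zero_seq V (E n)) \<and> (\<forall>k. hnorm V (E 0 k) = 0) \<and>
    (\<forall>n k z. z \<in> hcar V \<longrightarrow> (\<lambda>l. hinn V (E n k) (E (Suc n) l) * hinn V (E (Suc n) l) z) sums hinn V (E n k) z) \<and>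
    (\<forall>n k t. hnorm V (hsub V (U t (E n k)) (hscl V (character t (\<Lambda> n k)) (E n k))) \<le> \<bar>t\<bar> * \<eta> n k) \<and>
    (\<forall>n k. \<eta> n k \<ge> 0) \<and> (\<forall>n. summable (\<eta> n)) \<and> summable (\<lambda>n. suminf (\<eta> n)) \<and>
    (\<exists>D\<subseteq>hcar V. (\<forall>d\<in>D. (\<lambda>n. \<Sum>k. (cmod (hinn V d (E n k)))\<^sup>2) \<longlonglongrightarrow> (hnorm V d)\<^sup>2) \<and>
       (\<forall>z\<in>hcar V. (\<forall>d\<in>D. hinn V z d = 0) \<longrightarrow> hnorm V z = 0))"
proof -
  interpret ugroup V U by fact
  from cyclic_family_ex obtain Y where Y0: "Y \<subseteq> hcar V \<and> (\<forall>y\<in>Y. hinn V y y = 1) \<and>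
      (\<forall>y\<in>Y. \<forall>y'\<in>Y. y \<noteq> y' \<longrightarrow> (\<forall>s. hinn V (U s y) y' = 0)) \<and>
      (\<forall>z\<in>hcar V. (\<forall>y\<in>Y. \<forall>s. hinn V (U s y) z = 0) \<longrightarrow> hnorm V z = 0)" by (elim exE)
  have Y: "Y \<subseteq> hcar V" "\<And>y. y \<in> Y \<Longrightarrow> hinn V y y = 1"
    "\<And>y y' s. y \<in> Y \<Longrightarrow> y' \<in> Y \<Longrightarrow> y \<noteq> y' \<Longrightarrow> hinn V (U s y) y' = 0"
    "\<And>z. z \<in> hcar V \<Longrightarrow> (\<And>y s. y \<in> Y \<Longrightarrow> hinn V (U s y) z = 0) \<Longrightarrow> hnorm V z = 0"
    using Y0 by simp_all
  have "countable Y"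
  proof (rule orthonormal_countable[OF assms(2) Y(1,2)])
    show "hinn V y y' = 0" if "y \<in> Y" "y' \<in> Y" "y \<noteq> y'" for y y'
      using Y(3)[OF that, of 0] Y(1) that by (simp add: U_0 subset_iff)
  qed
  then obtain f :: "nat \<Rightarrow> _" and I where f: "bij_betw f I Y" by (rule countableE_bij)
  \<comment> \<open>The family may be finite; null vectors fill the remaining indices.\<close>
  define yj where "yj j = (if j \<in> I then f j else hzero V)" for j
  have yjc [simp]: "yj j \<in> hcar V" for j using f Y(1) by (auto simp: yj_def bij_betw_def)
  have yo: "hinn V (U s (yj i)) (yj j) = 0" if "i \<noteq> j" for i j s
  proof (cases "i \<in> I \<and> j \<in> I")
    case True
    then have "f i \<in> Y" "f j \<in> Y" "f i \<noteq> f j" using f that by (auto simp: bij_betw_def inj_on_def)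
    then show ?thesis using Y(3) True by (simp add: yj_def)
  next
    case False
    have "hinn V (U s (hzero V)) z = 0" if "z \<in> hcar V" for z using that by (simp add: U_adj)
    then show ?thesis using False yjc[of j] yjc[of i] by (auto simp: yj_def)
  qed
  have yo': "hinn V (U s (yj i)) (U t (yj j)) = 0" if "i \<noteq> j" for i j s t
    using yo[OF that, of "s - t"] by (simp add: U_inn)
  have ytot: "hnorm V z = 0" if "z \<in> hcar V" "\<And>j s. hinn V (U s (yj j)) z = 0" for z
  proof (rule Y(4)[OF that(1)])
    fix y s assume "y \<in> Y"
    then obtain j where "j \<in> I" "y = f j" using f by (auto simp: bij_betw_def)
    then show "hinn V (U s y) z = 0" using that(2)[of s j] by (simp add: yj_def)
  qed
  \<comment> \<open>The double geometric decay makes the lengths summable over the cyclic vectors at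
    each level, with total \<open>2 * (1/2) ^ n\<close>, and then over the levels.\<close>
  define \<delta> where "\<delta> j n = (1/2 :: real) ^ j * (1/2) ^ n" for j n :: nat
  define Q where "Q j e \<Lambda> \<eta> \<longleftrightarrow> (\<forall>n. on_or_zero_seq V (e n)) \<and>
    (\<forall>n k z. z \<in> hcar V \<longrightarrow> (\<forall>s. hinn V (U s (yj j)) z = 0) \<longrightarrow> hinn V (e n k) z = 0) \<and>
    (\<forall>n k z. z \<in> hcar V \<longrightarrow> (\<lambda>l. hinn V (e n k) (e (Suc n) l) * hinn V (e (Suc n) l) z) sums hinn V (e n k) z) \<and>
    (\<forall>n k t. hnorm V (hsub V (U t (e n k)) (hscl V (character t (\<Lambda> n k)) (e n k))) \<le> \<bar>t\<bar> * \<eta> n k) \<and>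
    (\<forall>n k. \<eta> n k \<ge> 0) \<and> (\<forall>n. summable (\<eta> n)) \<and> (\<forall>n. suminf (\<eta> n) \<le> \<delta> j n) \<and>
    (\<forall>s. (\<lambda>n. \<Sum>k. (cmod (hinn V (U s (yj j)) (e n k)))\<^sup>2) \<longlonglongrightarrow> (hnorm V (yj j))\<^sup>2)" for j e and \<Lambda> \<eta> :: "nat \<Rightarrow> nat \<Rightarrow> real"
  have "\<forall>j. \<exists>e \<Lambda> \<eta>. Q j e \<Lambda> \<eta>"
  proof
    fix j
    obtain \<mu> :: "real measure" and N where \<mu>: "finite_measure \<mu>" "sets \<mu> = sets borel"
      "\<And>t. t \<ge> 0 \<Longrightarrow> hinn V (U t (yj j)) (yj j) = (LINT l|\<mu>. character t l)"
      and N: "N\<in>sets borel" "emeasure lborel N = 0" "emeasure \<mu> (UNIV - N) = 0"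
      using sing[OF yjc[of j]] unfolding character_def by blast
    interpret c: cyclic V U "yj j" \<mu>
      by (intro cyclic.intro cyclic_axioms.intro ugroup_axioms) (use \<mu> in auto)
    show "\<exists>e \<Lambda> \<eta>. Q j e \<Lambda> \<eta>" unfolding Q_def
    proof (rule c.cyclic_level_basis[OF N])
      show "\<delta> j n > 0" for n by (simp add: \<delta>_def)
      show "\<delta> j \<longlonglongrightarrow> 0" unfolding \<delta>_def[abs_def] by (intro tendsto_mult_right_zero LIMSEQ_realpow_zero) auto
    qed
  qed
  then obtain e \<Lambda> \<eta> where Q: "\<And>j. Q j (e j) (\<Lambda> j) (\<eta> j)" by metis
  have e: "\<And>j n. on_or_zero_seq V (e j n)"
    and perp: "\<And>j n k z. z \<in> hcar V \<Longrightarrow> (\<And>s. hinn V (U s (yj j)) z = 0) \<Longrightarrow> hinn V (e j n k) z = 0"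
    and nested: "\<And>j n k z. z \<in> hcar V \<Longrightarrow> (\<lambda>l. hinn V (e j n k) (e j (Suc n) l) * hinn V (e j (Suc n) l) z) sums hinn V (e j n k) z"
    and eig: "\<And>j n k t. hnorm V (hsub V (U t (e j n k)) (hscl V (character t (\<Lambda> j n k)) (e j n k))) \<le> \<bar>t\<bar> * \<eta> j n k"
    and \<eta>: "\<And>j n k. \<eta> j n k \<ge> 0" "\<And>j n. summable (\<eta> j n)" "\<And>j n. suminf (\<eta> j n) \<le> \<delta> j n"
    and good: "\<And>j s. (\<lambda>n. \<Sum>k. (cmod (hinn V (U s (yj j)) (e j n k)))\<^sup>2) \<longlonglongrightarrow> (hnorm V (yj j))\<^sup>2"
    using Q unfolding Q_def by simp_all
  have ec [simp]: "e j n k \<in> hcar V" for j n k using on_or_zero_seqD(1)[OF e] .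
  have ey: "hinn V (e j n k) (U s (yj i)) = 0" if "i \<noteq> j" for i j n k s
    using that by (intro perp) (auto intro: yo')
  have ye: "hinn V (U s (yj i)) (e j n k) = 0" if "i \<noteq> j" for i j n k s
    using ey[OF that] inn_cnj[of "e j n k" "U s (yj i)"] by simp
  have ee: "hinn V (e i m k) (e j n l) = 0" if "i \<noteq> j" for i j m n k l
    using that by (intro perp) (auto intro: ye)
  \<comment> \<open>Level 0 is overwritten by null vectors because the construction of the unitary
    starts from the trivial subspace.\<close>
  define E where "E n k = (if n = 0 then hzero V else e (fst (prod_decode k)) n (snd (prod_decode k)))" for n k
  define L where "L n k = \<Lambda> (fst (prod_decode k)) n (snd (prod_decode k))" for n k
  define H where "H n k = \<eta> (fst (prod_decode k)) n (snd (prod_decode k))" for n k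
  have Ec [simp]: "E n k \<in> hcar V" for n k by (simp add: E_def)
  have ozE: "on_or_zero_seq V (E n)" for n
  proof (cases "n = 0")
    case True
    then show ?thesis by (simp add: on_or_zero_seq_def E_def)
  next
    case False
    have "hinn V (E n k) (E n l) = 0" if "k \<noteq> l" for k l
    proof (cases "fst (prod_decode k) = fst (prod_decode l)")
      case True
      then have "snd (prod_decode k) \<noteq> snd (prod_decode l)" using that by (metis prod_decode_inverse prod_eqI)
      then show ?thesis using True False on_or_zero_seqD(3)[OF e] by (simp add: E_def)
    qed (use False ee in \<open>simp add: E_def\<close>)
    then show ?thesis using False on_or_zero_seqD(2)[OF e] by (simp add: on_or_zero_seq_def) (simp add: E_def)
  qed
  have rs: "summable (\<lambda>j. \<delta> j n)" "(\<Sum>j. \<delta> j n) = 2 * (1/2) ^ n" for n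
    unfolding \<delta>_def by (intro summable_mult2 summable_geometric; simp) (subst suminf_mult2[symmetric]; simp add: suminf_geometric)
  have HS: "summable (H n)" "suminf (H n) \<le> 2 * (1/2) ^ n" for n
    using summable_prod_decode[of "\<lambda>j. \<eta> j n" "\<lambda>j. \<delta> j n"] \<eta> rs by (simp_all add: H_def[abs_def])
  have HS2: "summable (\<lambda>n. suminf (H n))"
  proof (rule summable_comparison_test'[of "\<lambda>n. 2 * (1/2 :: real) ^ n" 0])
    show "norm (suminf (H n)) \<le> 2 * (1/2) ^ n" for n
      using HS(2)[of n] suminf_nonneg[OF HS(1)[of n]] \<eta>(1) by (simp add: H_def)
  qed (intro summable_mult summable_geometric; simp)
  have nestE: "(\<lambda>l. hinn V (E n k) (E (Suc n) l) * hinn V (E (Suc n) l) z) sums hinn V (E n k) z" if z: "z \<in> hcar V" for n k z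
  proof (cases "n = 0")
    case True
    then show ?thesis using z by (simp add: E_def)
  next
    case False
    define j where "j = fst (prod_decode k)"
    define i where "i = snd (prod_decode k)"
    have "(\<lambda>l. if fst (prod_decode l) = j then hinn V (e j n i) (e j (Suc n) (snd (prod_decode l))) * hinn V (e j (Suc n) (snd (prod_decode l))) z else 0)
      sums hinn V (e j n i) z"
      unfolding sums_prod_decode_row[of j "\<lambda>l. hinn V (e j n i) (e j (Suc n) l) * hinn V (e j (Suc n) l) z"] by (rule nested[OF z])
    moreover have "(if fst (prod_decode l) = j then hinn V (e j n i) (e j (Suc n) (snd (prod_decode l))) * hinn V (e j (Suc n) (snd (prod_decode l))) z else 0)
       = hinn V (E n k) (E (Suc n) l) * hinn V (E (Suc n) l) z" for l
      using False ee by (auto simp: E_def j_def i_def)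
    ultimately show ?thesis using False by (simp add: E_def j_def i_def)
  qed
  have eigE: "hnorm V (hsub V (U t (E n k)) (hscl V (character t (L n k)) (E n k))) \<le> \<bar>t\<bar> * H n k" for n k t
  proof (cases "n = 0")
    case True
    have "hnorm V (hsub V (U t (E n k)) (hscl V (character t (L n k)) (E n k))) = hnorm V (hzero V)"
      by (rule norm_by_inn) (simp_all add: U_adj, simp add: E_def True)
    then show ?thesis using \<eta>(1) by (simp add: H_def)
  qed (use eig in \<open>simp add: E_def L_def H_def\<close>)
  define D where "D = {U s (yj j) | s j. True}"
  have goodE: "(\<lambda>n. \<Sum>k. (cmod (hinn V d (E n k)))\<^sup>2) \<longlonglongrightarrow> (hnorm V d)\<^sup>2" if d: "d \<in> D" for d
  proof -
    obtain s j where d: "d = U s (yj j)" using d by (auto simp: D_def)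
    have "(\<Sum>k. (cmod (hinn V d (E n k)))\<^sup>2) = (\<Sum>k. (cmod (hinn V d (e j n k)))\<^sup>2)" if n: "n \<noteq> 0" for n
    proof -
      have dc: "d \<in> hcar V" by (simp add: d)
      have "(\<lambda>k. if fst (prod_decode k) = j then (cmod (hinn V d (e j n (snd (prod_decode k)))))\<^sup>2 else 0) sums (\<Sum>k. (cmod (hinn V d (e j n k)))\<^sup>2)"
        unfolding sums_prod_decode_row[of j "\<lambda>k. (cmod (hinn V d (e j n k)))\<^sup>2"]
        using bessel_sums(1)[OF e dc] by (rule summable_sums)
      moreover have "(if fst (prod_decode k) = j then (cmod (hinn V d (e j n (snd (prod_decode k)))))\<^sup>2 else 0) = (cmod (hinn V d (E n k)))\<^sup>2" for k
        using n ye[of j "fst (prod_decode k)"] by (auto simp: E_def d)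
      ultimately show ?thesis by (simp add: sums_iff)
    qed
    then have "eventually (\<lambda>n. (\<Sum>k. (cmod (hinn V d (e j n k)))\<^sup>2) = (\<Sum>k. (cmod (hinn V d (E n k)))\<^sup>2)) sequentially"
      unfolding eventually_sequentially by (intro exI[of _ 1]) auto
    from Lim_transform_eventually[OF good[of s j, folded d] this] show ?thesis by (simp add: d U_norm)
  qed
  have totE: "hnorm V z = 0" if z: "z \<in> hcar V" "\<forall>d\<in>D. hinn V z d = 0" for z
  proof (rule ytot[OF z(1)])
    show "hinn V (U s (yj j)) z = 0" for j s
    proof -
      have "U s (yj j) \<in> D" unfolding D_def mem_Collect_eq by (rule exI[of _ s], rule exI[of _ j]) simp
      then have "hinn V z (U s (yj j)) = 0" using z(2) by blast
      then show ?thesis using inn_cnj[of z "U s (yj j)"] z(1) by simp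
    qed
  qed
  have "D \<subseteq> hcar V" by (auto simp: D_def)
  then have "\<exists>D\<subseteq>hcar V. (\<forall>d\<in>D. (\<lambda>n. \<Sum>k. (cmod (hinn V d (E n k)))\<^sup>2) \<longlonglongrightarrow> (hnorm V d)\<^sup>2) \<and>
       (\<forall>z\<in>hcar V. (\<forall>d\<in>D. hinn V z d = 0) \<longrightarrow> hnorm V z = 0)"
    using goodE totE by (intro exI[of _ D]) simp
  note exD = this
  have E0: "hnorm V (E 0 k) = 0" for k by (simp add: E_def)
  have H0: "H n k \<ge> 0" for n k using \<eta>(1) by (simp add: H_def)
  show ?thesis
    by (intro exI[of _ E] exI[of _ L] exI[of _ H] conjI allI impI)
      (fact ozE | fact E0 | rule nestE, assumption | fact eigE | fact H0 | fact HS(1) | fact HS2 | fact exD)+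
qed

section \<open>The cocycle\<close>

lemma weakly_linear_isom_dist:
  assumes "inner_space V" "inner_space W" "weakly_linear V W T" "\<And>x. x \<in> hcar V \<Longrightarrow> hnorm W (T x) = hnorm V x" "x \<in> hcar V" "y \<in> hcar V"
  shows "hdist W (T x) (T y) = hdist V x y"
proof -
  interpret V: inner_space V by fact
  interpret W: inner_space W by fact
  have "hnorm W (hsub W (T x) (T y)) = hnorm W (T (hsub V x y))"
    using assms(5,6) weakly_linearD(1)[OF assms(3)] by (intro W.norm_by_inn) (auto simp: weakly_linear_sub[OF assms(1-3)])
  then show ?thesis using assms(4)[of "hsub V x y"] assms(5,6) by (simp add: hdist_def)
qed

lemma dsum_L2Rp:
  "hadd (hs_dsum V L2Rp) = hadd (hs_dsum V L2R)" "hscl (hs_dsum V L2Rp) = hscl (hs_dsum V L2R)"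
  "hinn (hs_dsum V L2Rp) = hinn (hs_dsum V L2R)" "hsub (hs_dsum V L2Rp) = hsub (hs_dsum V L2R)"
  "hnorm (hs_dsum V L2Rp) = hnorm (hs_dsum V L2R)" "heq (hs_dsum V L2Rp) = heq (hs_dsum V L2R)"
proof -
  show 1: "hadd (hs_dsum V L2Rp) = hadd (hs_dsum V L2R)" "hscl (hs_dsum V L2Rp) = hscl (hs_dsum V L2R)"
    "hinn (hs_dsum V L2Rp) = hinn (hs_dsum V L2R)"
    by (auto simp: hs_dsum_def)
  show 2: "hsub (hs_dsum V L2Rp) = hsub (hs_dsum V L2R)" "hnorm (hs_dsum V L2Rp) = hnorm (hs_dsum V L2R)"
    by (auto simp: 1 hsub_def hnorm_def fun_eq_iff)
  show "heq (hs_dsum V L2Rp) = heq (hs_dsum V L2R)"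
    by (auto simp: 2 heq_def hdist_def fun_eq_iff)
qed

text \<open>\<open>m t n k\<close> is the common approximate eigenvalue of \<open>e n k\<close> and
  \<open>w n k\<close> at time \<open>t\<close>, and \<open>\<epsilon> t n k\<close> bounds the
  error on both sides. \<open>cut_pos_w\<close> places the waves on the positive half line, so that
  \<open>G\<close> does not touch functions supported on the negative one.\<close>

locale shift_absorb = absorb A L2R e w + ugroup A U
  for A :: "'a hspace" and e :: "nat \<Rightarrow> nat \<Rightarrow> 'a" and w :: "nat \<Rightarrow> nat \<Rightarrow> real \<Rightarrow> complex" and U :: "real \<Rightarrow> 'a \<Rightarrow> 'a" +
  fixes m :: "real \<Rightarrow> nat \<Rightarrow> nat \<Rightarrow> complex" and \<epsilon> :: "real \<Rightarrow> nat \<Rightarrow> nat \<Rightarrow> real"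
  assumes cut_pos_w: "cut_pos (w n k) = w n k"
    and cmod_m: "cmod (m t n k) = 1"
    and eps_summable: "t \<ge> 0 \<Longrightarrow> summable (\<epsilon> t n)" "t \<ge> 0 \<Longrightarrow> summable (\<lambda>n. suminf (\<epsilon> t n))"
    and eig_e: "t \<ge> 0 \<Longrightarrow> hnorm A (hsub A (U t (e n k)) (hscl A (m t n k) (e n k))) \<le> \<epsilon> t n k"
    and eig_w: "t \<ge> 0 \<Longrightarrow> hnorm L2R (hsub L2R (tshift t (w n k)) (hscl L2R (m t n k) (w n k))) \<le> \<epsilon> t n k"
    and U_cont: "strongly_cont A U"
begin

abbreviation "AL \<equiv> hs_dsum A L2R"

declare L2R_simps [simp del]
declare hs_dsum_simps(1) [simp del]

lemma mem_dsum [simp]: "(a, b) \<in> hcar (hs_dsum V W) \<longleftrightarrow> a \<in> hcar V \<and> b \<in> hcar W"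
  by (simp add: hs_dsum_simps(1))

lemma dsum_fst_snd [simp]:
  "p \<in> hcar (hs_dsum V W) \<Longrightarrow> fst p \<in> hcar V" "p \<in> hcar (hs_dsum V W) \<Longrightarrow> snd p \<in> hcar W"
  by (cases p; simp)+

lemma inn_dsum: "hinn (hs_dsum V W) p r = hinn V (fst p) (fst r) + hinn W (snd p) (snd r)"
  by (cases p; cases r) simp

sublocale AL: inner_space AL by (rule inner_space_AB)

lemma G_norm': "p \<in> hcar AL \<Longrightarrow> hnorm L2R (G p) = hnorm AL p"
  using G_norm by (cases p) auto

lemma G_in' [simp]: "p \<in> hcar AL \<Longrightarrow> G p \<in> hcar L2R"
  using G_in by (cases p) auto

lemma G_inn: "\<lbrakk>p \<in> hcar AL; r \<in> hcar AL\<rbrakk> \<Longrightarrow> hinn L2R (G p) (G r) = hinn AL p r"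
  by (rule isometric_inn[OF inner_space_AB B.inner_space_axioms G_lin G_norm'])

text \<open>The inverse of \<open>G\<close>, fixed only up to null vectors by the choice;
  \<open>J0_adj\<close> shows that it is also the adjoint.\<close>

definition J0 :: "(real \<Rightarrow> complex) \<Rightarrow> 'a \<times> (real \<Rightarrow> complex)" where
  "J0 g = (SOME p. p \<in> hcar AL \<and> heq L2R (G p) g)"

lemma J0: 
  assumes "g \<in> hcar L2R" shows "J0 g \<in> hcar AL" "heq L2R (G (J0 g)) g"
proof -
  obtain h f where "h \<in> hcar A" "f \<in> hcar L2R" "heq L2R (G (h, f)) g" using G_surj[OF assms] by blast
  then have "\<exists>p. p \<in> hcar AL \<and> heq L2R (G p) g" by (intro exI[of _ "(h, f)"]) simp
  from someI_ex[OF this] show "J0 g \<in> hcar AL" "heq L2R (G (J0 g)) g" by (simp_all add: J0_def)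
qed

lemma J0_fst [simp]: "g \<in> hcar L2R \<Longrightarrow> fst (J0 g) \<in> hcar A"
  and J0_snd [simp]: "g \<in> hcar L2R \<Longrightarrow> snd (J0 g) \<in> hcar L2R"
  by (rule dsum_fst_snd[OF J0(1)], assumption)+

lemma G_J0: "\<lbrakk>g \<in> hcar L2R; z \<in> hcar L2R\<rbrakk> \<Longrightarrow> hinn L2R (G (J0 g)) z = hinn L2R g z"
  using B.heq_inn_l[OF J0(2)] J0(1) by simp

lemma J0_adj: "adjoint_pair L2R AL J0 G"
proof -
  have "hinn AL (J0 g) p = hinn L2R g (G p)" if "g \<in> hcar L2R" "p \<in> hcar AL" for g p
    using G_inn[OF J0(1)[OF that(1)] that(2)] G_J0[OF that(1), of "G p"] that(2) by simp
  then show ?thesis using J0(1) by (simp add: adjoint_pair_def)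
qed

lemma G_adj: "adjoint_pair AL L2R G J0"
  by (rule adjoint_pair_sym[OF B.inner_space_axioms inner_space_AB J0_adj])

lemma J0_G: "\<lbrakk>p \<in> hcar AL; r \<in> hcar AL\<rbrakk> \<Longrightarrow> hinn AL (J0 (G p)) r = hinn AL p r"
  using adjoint_pairD(3)[OF J0_adj, of "G p" r] G_inn by simp

lemma J0_inn: "\<lbrakk>f \<in> hcar L2R; g \<in> hcar L2R\<rbrakk> \<Longrightarrow> hinn AL (J0 f) (J0 g) = hinn L2R f g"
  using adjoint_pairD(3)[OF G_adj J0(1), of f g] G_J0[of f g] by simp

lemma J0_norm: "f \<in> hcar L2R \<Longrightarrow> hnorm AL (J0 f) = hnorm L2R f"
  by (simp add: hnorm_def[of AL] hnorm_def[of L2R] J0_inn)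

lemma J0_ctr: "contractive L2R AL J0"
  using adjoint_pair_contractive(1)[OF B.inner_space_axioms inner_space_AB J0_adj] J0_norm by simp

lemma tshift_0: "tshift 0 f = f"
  by (simp add: tshift_def)

lemma tshift_adj: "\<lbrakk>f \<in> hcar L2R; g \<in> hcar L2R\<rbrakk> \<Longrightarrow> hinn L2R (tshift t f) g = hinn L2R f (tshift (- t) g)"
  by (rule isometry_adjD(4)[OF tshift_isometry])

section \<open>The perturbed unitary group on the line\<close>

definition K :: "real \<Rightarrow> 'a \<times> (real \<Rightarrow> complex) \<Rightarrow> 'a \<times> (real \<Rightarrow> complex)" where
  "K t p = (U t (fst p), tshift t (snd p))"

lemma K_in [simp]: "p \<in> hcar AL \<Longrightarrow> K t p \<in> hcar AL"
  by (simp add: K_def)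

lemma K_adj: "adjoint_pair AL AL (K t) (K (- t))"
  by (simp add: adjoint_pair_def inn_dsum) (simp add: K_def U_adj tshift_adj)

lemma K_K: "p \<in> hcar AL \<Longrightarrow> K s (K t p) = K (s + t) p"
  by (simp add: K_def U_U tshift_tshift)

lemma K_0: "p \<in> hcar AL \<Longrightarrow> K 0 p = p"
  by (simp add: K_def U_0 tshift_0)

lemma K_norm: "p \<in> hcar AL \<Longrightarrow> hnorm AL (K t p) = hnorm AL p"
  by (simp add: hnorm_def[of AL] adjoint_pairD(3)[OF K_adj] K_K K_0)

text \<open>The direct sum group \<open>K\<close> transported to the line. For nonnegative times its
  restriction to the half line is, up to null vectors, the cocyclic perturbation.\<close>

definition Vt :: "real \<Rightarrow> (real \<Rightarrow> complex) \<Rightarrow> real \<Rightarrow> complex" where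
  "Vt t g = G (K t (J0 g))"

lemma Vt_in [simp]: "g \<in> hcar L2R \<Longrightarrow> Vt t g \<in> hcar L2R"
  by (simp add: Vt_def J0)

lemma Vt_inn: "\<lbrakk>g \<in> hcar L2R; z \<in> hcar L2R\<rbrakk> \<Longrightarrow> hinn L2R (Vt t g) z = hinn AL (K t (J0 g)) (J0 z)"
  unfolding Vt_def by (rule adjoint_pairD(3)[OF G_adj]) (simp_all add: J0)

lemma Vt_adj: "\<lbrakk>g \<in> hcar L2R; z \<in> hcar L2R\<rbrakk> \<Longrightarrow> hinn L2R (Vt t g) z = hinn L2R g (Vt (- t) z)"
proof -
  assume gz: "g \<in> hcar L2R" "z \<in> hcar L2R"
  have "hinn L2R (Vt t g) z = hinn AL (J0 g) (K (- t) (J0 z))"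
    using gz by (simp add: Vt_inn adjoint_pairD(3)[OF K_adj] J0)
  also have "\<dots> = hinn L2R g (Vt (- t) z)" unfolding Vt_def using gz by (intro adjoint_pairD(3)[OF J0_adj]) (simp_all add: J0)
  finally show ?thesis .
qed

lemma Vt_Vt: "\<lbrakk>g \<in> hcar L2R; z \<in> hcar L2R\<rbrakk> \<Longrightarrow> hinn L2R (Vt s (Vt t g)) z = hinn L2R (Vt (s + t) g) z"
proof -
  assume gz: "g \<in> hcar L2R" "z \<in> hcar L2R"
  note j = J0(1)[OF gz(1)] J0(1)[OF gz(2)]
  have "hinn L2R (Vt s (Vt t g)) z = hinn L2R (Vt t g) (Vt (- s) z)" using gz by (simp add: Vt_adj)
  also have "\<dots> = hinn AL (K t (J0 g)) (J0 (G (K (- s) (J0 z))))"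
    using gz by (simp add: Vt_inn) (simp add: Vt_def)
  also have "\<dots> = cnj (hinn AL (J0 (G (K (- s) (J0 z)))) (K t (J0 g)))"
    using j gz by (intro AL.inn_cnj J0(1) G_in' K_in)
  also have "\<dots> = cnj (hinn AL (K (- s) (J0 z)) (K t (J0 g)))" using j by (simp add: J0_G)
  also have "\<dots> = hinn AL (K t (J0 g)) (K (- s) (J0 z))" using j AL.inn_cnj[of "K (- s) (J0 z)" "K t (J0 g)"] by simp
  also have "\<dots> = hinn AL (K s (K t (J0 g))) (J0 z)" using j by (simp add: adjoint_pairD(3)[OF K_adj])
  also have "\<dots> = hinn L2R (Vt (s + t) g) z" using gz j by (simp add: Vt_inn K_K)
  finally show ?thesis .
qed

lemma Vt_0: "\<lbrakk>g \<in> hcar L2R; z \<in> hcar L2R\<rbrakk> \<Longrightarrow> hinn L2R (Vt 0 g) z = hinn L2R g z"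
  by (simp add: Vt_inn K_0 J0 J0_inn)

definition Wt :: "real \<Rightarrow> (real \<Rightarrow> complex) \<Rightarrow> real \<Rightarrow> complex" where
  "Wt t g = Vt t (tshift (- t) g)"

text \<open>Both the adjoint and the inverse of \<open>Wt t\<close>, up to null vectors.\<close>

definition Ws :: "real \<Rightarrow> (real \<Rightarrow> complex) \<Rightarrow> real \<Rightarrow> complex" where
  "Ws t g = tshift t (Vt (- t) g)"

lemma Wt_in [simp]: "g \<in> hcar L2R \<Longrightarrow> Wt t g \<in> hcar L2R"
  and Ws_in [simp]: "g \<in> hcar L2R \<Longrightarrow> Ws t g \<in> hcar L2R"
  by (simp_all add: Wt_def Ws_def)

lemma Wt_adj: "\<lbrakk>g \<in> hcar L2R; z \<in> hcar L2R\<rbrakk> \<Longrightarrow> hinn L2R (Wt t g) z = hinn L2R g (Ws t z)"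
  by (simp add: Wt_def Ws_def Vt_adj tshift_adj)

lemma Wt_Ws: "\<lbrakk>g \<in> hcar L2R; z \<in> hcar L2R\<rbrakk> \<Longrightarrow> hinn L2R (Wt t (Ws t g)) z = hinn L2R g z"
  by (simp add: Wt_def Ws_def tshift_tshift tshift_0 Vt_Vt Vt_0)

lemma Ws_Wt: "\<lbrakk>g \<in> hcar L2R; z \<in> hcar L2R\<rbrakk> \<Longrightarrow> hinn L2R (Ws t (Wt t g)) z = hinn L2R g z"
  by (simp add: Wt_def Ws_def tshift_adj Vt_Vt Vt_0 tshift_tshift tshift_0)

lemma Wt_isom: "\<lbrakk>g \<in> hcar L2R; z \<in> hcar L2R\<rbrakk> \<Longrightarrow> hinn L2R (Wt t g) (Wt t z) = hinn L2R g z"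
proof -
  assume gz: "g \<in> hcar L2R" "z \<in> hcar L2R"
  have "hinn L2R (Wt t g) (Wt t z) = cnj (hinn L2R (Ws t (Wt t z)) g)"
    using gz B.inn_cnj[of "Ws t (Wt t z)" g] by (simp add: Wt_adj)
  also have "\<dots> = hinn L2R g z" using gz B.inn_cnj[of z g] by (simp add: Ws_Wt)
  finally show ?thesis .
qed

lemma cut_pos_inn: "\<lbrakk>f \<in> hcar L2R; g \<in> hcar L2R\<rbrakk> \<Longrightarrow> hinn L2R (cut_pos f) g = hinn L2R f (cut_pos g)"
  by (rule adjoint_pairD(3)[OF cut_pos_adj])

definition supp_neg :: "(real \<Rightarrow> complex) \<Rightarrow> bool" where
  "supp_neg z \<longleftrightarrow> z \<in> hcar L2R \<and> (\<forall>x\<ge>0. z x = 0)"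

lemma supp_neg_in: "supp_neg z \<Longrightarrow> z \<in> hcar L2R"
  by (simp add: supp_neg_def)

lemma supp_neg_cut: "supp_neg z \<Longrightarrow> cut_pos z = hzero L2R"
  by (auto simp: supp_neg_def cut_pos_def L2R_simps)

lemma supp_neg_diff: "f \<in> hcar L2R \<Longrightarrow> supp_neg (hsub L2R f (cut_pos f))"
  using B.sub_in[of f "cut_pos f"] by (auto simp: supp_neg_def) (simp add: L2R_simps cut_pos_def)

text \<open>A function orthogonal to everything supported on the negative half line vanishes there
  almost everywhere, so the cut changes it by a null vector. In this way exact membership in
  \<open>L2Rp\<close> is obtained from statements about inner products.\<close>

lemma cut_pos_eqI:
  assumes "f \<in> hcar L2R" "\<And>z. supp_neg z \<Longrightarrow> hinn L2R f z = 0" "z \<in> hcar L2R"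
  shows "hinn L2R (cut_pos f) z = hinn L2R f z"
  using assms(2)[OF supp_neg_diff[OF assms(3)]] assms(1,3) by (simp add: cut_pos_inn)

lemma pos_neg: "\<lbrakk>f \<in> hcar L2Rp; supp_neg z\<rbrakk> \<Longrightarrow> hinn L2R f z = 0"
  using cut_pos_inn[of f z] cut_pos_id[of f] supp_neg_cut[of z] supp_neg_in[of z] by simp

text \<open>All waves are orthogonal to \<open>z\<close>, hence so is every \<open>D n h f\<close>.
  Paired with \<open>z\<close>, the unitary \<open>G\<close> thus returns its second argument, and
  its adjoint \<open>J0\<close> sends \<open>z\<close> to \<open>(0, z)\<close> up to null
  vectors.\<close>

lemma J0_neg:
  assumes z: "supp_neg z" and p: "h \<in> hcar A" "f \<in> hcar L2R"
  shows "hinn AL (J0 z) (h, f) = hinn L2R z f"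
proof -
  note zi = supp_neg_in[OF z]
  have wz: "hinn L2R (w n k) z = 0" for n k
  proof -
    have "hinn L2R (w n k) z = hinn L2R (w n k) (cut_pos z)"
      using cut_pos_inn[of "w n k" z] zi by (simp add: cut_pos_w)
    then show ?thesis using supp_neg_cut[OF z] by simp
  qed
  have "hinn L2R (D n h f) z = 0" for n
  proof -
    have "(\<lambda>k. hinn A (q n h f) (e (Suc n) k) * hinn L2R (w (Suc n) k) z) sums hinn L2R (D n h f) z"
      unfolding D_def X_def using p zi by (intro AB.transfer_sums) auto
    then have "(\<lambda>k. 0 :: complex) sums hinn L2R (D n h f) z" by (simp add: wz)
    then show ?thesis by (metis sums_unique2 sums_zero)
  qed
  then have "(\<lambda>n. 0 :: complex) sums (hinn L2R (G (h, f)) z - hinn L2R f z)" using G_sums[OF p zi] by simp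
  then have "hinn L2R (G (h, f)) z = hinn L2R f z" using sums_unique2[OF sums_zero] by fastforce
  then have "hinn L2R z (G (h, f)) = hinn L2R z f"
    using p zi B.inn_cnj[of "G (h, f)" z] B.inn_cnj[of f z] by simp
  then show ?thesis using adjoint_pairD(3)[OF J0_adj zi, of "(h, f)"] p by simp
qed

lemma J0_neg': "\<lbrakk>supp_neg z; p \<in> hcar AL\<rbrakk> \<Longrightarrow> hinn AL (J0 z) p = hinn L2R z (snd p)"
  using J0_neg by (cases p) auto

text \<open>For \<open>t \<ge> 0\<close> the shift by \<open>- t\<close> keeps \<open>g\<close> on
  the negative half line, where \<open>J0\<close> is the embedding into the second summand; the two
  opposite shifts then cancel.\<close>

lemma Wt_neg:
  assumes g: "supp_neg g" and t: "t \<ge> 0" and z: "z \<in> hcar L2R"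
  shows "hinn L2R (Wt t g) z = hinn L2R g z"
proof -
  note gi = supp_neg_in[OF g]
  have n: "supp_neg (tshift (- t) g)" using g t tshift_in[OF gi, of "-t"] by (auto simp: supp_neg_def tshift_def)
  have "hinn L2R (Wt t g) z = hinn AL (J0 (tshift (- t) g)) (K (- t) (J0 z))"
    using gi z by (simp add: Wt_def Vt_inn adjoint_pairD(3)[OF K_adj] J0)
  also have "\<dots> = hinn L2R (tshift (- t) g) (snd (K (- t) (J0 z)))"
    using z by (intro J0_neg'[OF n]) (simp add: J0)
  also have "\<dots> = hinn L2R g (snd (J0 z))"
    using gi z by (simp add: K_def tshift_adj tshift_tshift tshift_0)
  also have "\<dots> = hinn AL (J0 g) (J0 z)" using J0_neg'[OF g J0(1)[OF z]] by simp
  finally show ?thesis using gi z by (simp add: J0_inn)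
qed

section \<open>Restriction to the half line and the cocycle property\<close>

definition W :: "real \<Rightarrow> (real \<Rightarrow> complex) \<Rightarrow> real \<Rightarrow> complex" where
  "W t f = cut_pos (Wt t f)"

lemma pos_in: "f \<in> hcar L2Rp \<Longrightarrow> f \<in> hcar L2R"
  by simp

lemma W_in: "f \<in> hcar L2R \<Longrightarrow> W t f \<in> hcar L2Rp"
  unfolding W_def by (intro cut_pos_L2Rp Wt_in)

text \<open>\<open>Wt t\<close> preserves inner products and fixes the functions supported on the
  negative half line, so it maps their orthogonal complement into itself. The cut in
  \<open>W\<close> therefore only selects a representative that vanishes exactly for negative
  arguments.\<close>

lemma W_Wt:
  assumes "f \<in> hcar L2Rp" "t \<ge> 0" "z \<in> hcar L2R"
  shows "hinn L2R (W t f) z = hinn L2R (Wt t f) z"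
  unfolding W_def
proof (rule cut_pos_eqI[OF _ _ assms(3)])
  have f: "f \<in> hcar L2R" using assms(1) by simp
  show "Wt t f \<in> hcar L2R" using f by simp
  fix z assume n: "supp_neg z"
  note zi = supp_neg_in[OF n]
  have "hinn L2R z (Wt t f) = hinn L2R (Wt t z) (Wt t f)" using Wt_neg[OF n assms(2), of "Wt t f"] f by simp
  also have "\<dots> = cnj (hinn L2R f z)" using Wt_isom[OF zi f] B.inn_cnj[OF f zi] by simp
  finally show "hinn L2R (Wt t f) z = 0" using pos_neg[OF assms(1) n] B.inn_cnj[of z "Wt t f"] zi f by simp
qed

lemma W_norm: "\<lbrakk>f \<in> hcar L2Rp; t \<ge> 0\<rbrakk> \<Longrightarrow> hnorm L2R (W t f) = hnorm L2R f"
proof -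
  assume f: "f \<in> hcar L2Rp" "t \<ge> 0"
  have "hnorm L2R (W t f) = hnorm L2R (Wt t f)"
    using pos_in[OF f(1)] pos_in[OF W_in[OF pos_in[OF f(1)], of t]] W_Wt[OF f] by (intro B.norm_by_inn) auto
  then show ?thesis using Wt_isom[OF pos_in[OF f(1)] pos_in[OF f(1)]] by (simp add: hnorm_def)
qed

interpretation Rp: inner_space L2Rp by (rule inner_space_L2Rp)

lemma W_lin: assumes t: "t \<ge> 0" shows "weakly_linear L2Rp L2Rp (W t)"
  unfolding weakly_linear_def
proof (intro conjI ballI allI)
  fix f g z assume f: "f \<in> hcar L2Rp" and g: "g \<in> hcar L2Rp" and z: "z \<in> hcar L2Rp"
  show "hinn L2Rp (W t (hadd L2Rp f g)) z = hinn L2Rp (W t f) z + hinn L2Rp (W t g) z"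
    using W_Wt[OF Rp.add_in[OF f g] t pos_in[OF z]] W_Wt[OF f t pos_in[OF z]] W_Wt[OF g t pos_in[OF z]]
      pos_in[OF f] pos_in[OF g] pos_in[OF z] by (simp add: Wt_adj del: L2Rp_simps(1))
next
  fix a f z assume f: "f \<in> hcar L2Rp" and z: "z \<in> hcar L2Rp"
  show "hinn L2Rp (W t (hscl L2Rp a f)) z = a * hinn L2Rp (W t f) z"
    using W_Wt[OF Rp.scl_in[OF f] t pos_in[OF z], of a] W_Wt[OF f t pos_in[OF z]]
      pos_in[OF f] pos_in[OF z] by (simp add: Wt_adj del: L2Rp_simps(1))
qed (rule W_in, simp)

lemma W_ctr: "t \<ge> 0 \<Longrightarrow> contractive L2Rp L2Rp (W t)"
  using W_lin W_norm by (simp add: contractive_def del: L2Rp_simps(1))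

text \<open>For surjectivity the preimage is \<open>Ws t y\<close>, cut to a representative in
  \<open>L2Rp\<close>. It is orthogonal to the functions supported on the negative half line because
  \<open>Wt t\<close> fixes them and \<open>y\<close> is orthogonal to them.\<close>

lemma W_unitary: assumes t: "t \<ge> 0" shows "unitary_op L2Rp L2Rp (W t)"
  unfolding unitary_op_def
proof (intro conjI ballI)
  show "blin L2Rp L2Rp (W t)" by (rule contractive_blin[OF inner_space_L2Rp inner_space_L2Rp W_ctr[OF t]])
  show "hnorm L2Rp (W t f) = hnorm L2Rp f" if "f \<in> hcar L2Rp" for f using W_norm[OF that t] by simp
  fix y assume y: "y \<in> hcar L2Rp"
  note yi = pos_in[OF y]
  define x where "x = Ws t y"
  have x: "x \<in> hcar L2R" using yi by (simp add: x_def)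
  have cx: "hinn L2R (cut_pos x) z = hinn L2R x z" if z: "z \<in> hcar L2R" for z
  proof (rule cut_pos_eqI[OF x _ z])
    fix z assume n: "supp_neg z"
    have "hinn L2R z x = hinn L2R (Wt t z) y" using Wt_adj[OF supp_neg_in[OF n] yi] by (simp add: x_def)
    also have "\<dots> = hinn L2R z y" by (rule Wt_neg[OF n t yi])
    finally show "hinn L2R x z = 0"
      using pos_neg[OF y n] B.inn_cnj[OF supp_neg_in[OF n] x] B.inn_cnj[OF supp_neg_in[OF n] yi] by simp
  qed
  have cp: "cut_pos x \<in> hcar L2Rp" using x by (rule cut_pos_L2Rp)
  have "heq L2R (W t (cut_pos x)) y"
  proof (subst B.heq_iff)
    show "W t (cut_pos x) \<in> hcar L2R" using W_in[OF pos_in[OF cp]] by simp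
    show "\<forall>z\<in>hcar L2R. hinn L2R (W t (cut_pos x)) z = hinn L2R y z"
    proof
      fix z assume z: "z \<in> hcar L2R"
      have "hinn L2R (W t (cut_pos x)) z = hinn L2R (cut_pos x) (Ws t z)" using W_Wt[OF cp t z] Wt_adj[OF pos_in[OF cp] z] by simp
      also have "\<dots> = hinn L2R (Wt t x) z" using cx[of "Ws t z"] Wt_adj[OF x z] z by simp
      also have "\<dots> = hinn L2R y z" unfolding x_def using yi z by (rule Wt_Ws)
      finally show "hinn L2R (W t (cut_pos x)) z = hinn L2R y z" .
    qed
  qed (rule yi)
  then show "\<exists>x\<in>hcar L2Rp. heq L2Rp (W t x) y" using cp by auto
qed

lemma ext_op_in: "g \<in> hcar L2R \<Longrightarrow> ext_op (W t) g = hadd L2R (W t (cut_pos g)) (hsub L2R g (cut_pos g))"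
  unfolding ext_op_def by (auto simp: L2R_simps cut_pos_def fun_eq_iff)

text \<open>Extended by the identity, \<open>W t\<close> becomes \<open>Wt t\<close> on the whole
  line, since both fix the functions supported on the negative half line. The cocycle identity
  thereby reduces to the group law of \<open>Vt\<close>.\<close>

lemma ext_op_inn:
  assumes g: "g \<in> hcar L2R" and t: "t \<ge> 0" and z: "z \<in> hcar L2R"
  shows "ext_op (W t) g \<in> hcar L2R" "hinn L2R (ext_op (W t) g) z = hinn L2R (Wt t g) z"
proof -
  note cg = cut_pos_L2Rp[OF g] and cg' = cut_pos_in[OF g]
  note Wg = pos_in[OF W_in[OF cg']]
  note ng = supp_neg_diff[OF g]
  show "ext_op (W t) g \<in> hcar L2R" using g cg' Wg by (simp add: ext_op_in)
  have "hinn L2R (ext_op (W t) g) z = hinn L2R (W t (cut_pos g)) z + hinn L2R (hsub L2R g (cut_pos g)) z"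
    unfolding ext_op_in[OF g] using g cg' Wg z by (intro B.inn_add_l) auto
  also have "hinn L2R (hsub L2R g (cut_pos g)) z = hinn L2R (Wt t (hsub L2R g (cut_pos g))) z"
    by (rule Wt_neg[OF ng t z, symmetric])
  also have "hinn L2R (W t (cut_pos g)) z = hinn L2R (Wt t (cut_pos g)) z" by (rule W_Wt[OF cg t z])
  also have "hinn L2R (Wt t (cut_pos g)) z + hinn L2R (Wt t (hsub L2R g (cut_pos g))) z = hinn L2R (Wt t g) z"
    using g cg' z by (simp add: Wt_adj)
  finally show "hinn L2R (ext_op (W t) g) z = hinn L2R (Wt t g) z" .
qed

text \<open>Up to null vectors \<open>W s f\<close> is \<open>G (K s (p s))\<close>, in which
  \<open>p s\<close> varies with \<open>s\<close> as well. As \<open>K s\<close> and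
  \<open>J0\<close> are isometric, the variation of \<open>p\<close> is that of a translate of
  \<open>f\<close>; for the fixed vector \<open>p t\<close> the two summands of \<open>K\<close> are
  estimated separately.\<close>

lemma W_cont: "strongly_cont L2Rp W"
  unfolding strongly_cont_def
proof (intro ballI allI impI)
  fix f and t e :: real assume f: "f \<in> hcar L2Rp" and t: "t \<ge> 0" and e: "e > 0"
  note fi = pos_in[OF f]
  define p where "p s = J0 (tshift (- s) f)" for s
  have p [simp]: "p s \<in> hcar AL" for s using fi by (simp add: p_def J0)
  obtain h k where hk: "p t = (h, k)" "h \<in> hcar A" "k \<in> hcar L2R" using p[of t] by (cases "p t") (auto simp del: p)
  obtain d1 where d1: "d1 > 0" "\<And>a b. \<bar>a - b\<bar> < d1 \<Longrightarrow> hdist L2R (tshift a f) (tshift b f) < e / 3"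
    using tshift_cont[OF fi, of "e/3"] e by auto
  obtain d2 where d2: "d2 > 0" "\<And>a b. \<bar>a - b\<bar> < d2 \<Longrightarrow> hdist L2R (tshift a k) (tshift b k) < e / 3"
    using tshift_cont[OF hk(3), of "e/3"] e by auto
  obtain d3 where d3: "d3 > 0" "\<And>s. s \<ge> 0 \<Longrightarrow> \<bar>s - t\<bar> < d3 \<Longrightarrow> hdist A (U s h) (U t h) < e / 3"
  proof -
    have "e / 3 > 0" using e by simp
    then show ?thesis using U_cont hk(2) t that unfolding strongly_cont_def by meson
  qed
  have "hdist L2Rp (W s f) (W t f) < e" if s: "s \<ge> 0" "\<bar>s - t\<bar> < min d1 (min d2 d3)" for s
  proof -
    have "hdist L2R (W s f) (W t f) = hdist L2R (Wt s f) (Wt t f)"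
    proof (rule B.dist_heq)
      have "heq L2R (W r f) (Wt r f)" if "r \<ge> 0" for r
        using pos_in[OF W_in[OF fi]] fi W_Wt[OF f that] by (subst B.heq_iff) auto
      then show "heq L2R (W s f) (Wt s f)" "heq L2R (W t f) (Wt t f)" using s t by auto
    qed (use fi pos_in[OF W_in[OF fi]] in auto)
    also have "\<dots> = hdist AL (K s (p s)) (K t (p t))"
      unfolding Wt_def Vt_def p_def[symmetric]
      by (rule weakly_linear_isom_dist[OF inner_space_AB B.inner_space_axioms G_lin G_norm']) auto
    also have "\<dots> \<le> hdist AL (K s (p s)) (K s (p t)) + hdist AL (K s (p t)) (K t (p t))"
      by (rule AL.dist_triangle) auto
    also have "hdist AL (K s (p s)) (K s (p t)) = hdist AL (p s) (p t)"
      by (rule weakly_linear_isom_dist[OF inner_space_AB inner_space_AB adjoint_pair_linear[OF inner_space_AB inner_space_AB K_adj] K_norm]) auto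
    also have "\<dots> = hdist L2R (tshift (- s) f) (tshift (- t) f)"
      unfolding p_def using fi by (intro weakly_linear_isom_dist[OF B.inner_space_axioms inner_space_AB contractiveD(1)[OF J0_ctr] J0_norm]) auto
    also have "\<dots> < e / 3" using s by (intro d1(2)) auto
    also have "hdist AL (K s (p t)) (K t (p t)) \<le> hdist A (U s h) (U t h) + hdist L2R (tshift s k) (tshift t k)"
    proof -
      let ?a = "hsub A (U s h) (U t h)" and ?b = "hsub L2R (tshift s k) (tshift t k)"
      have ab: "?a \<in> hcar A" "?b \<in> hcar L2R" using hk by auto
      have "hsub AL (K s (p t)) (K t (p t)) = (?a, ?b)"
        by (simp add: K_def hk(1) hsub_def)
      then have "(hdist AL (K s (p t)) (K t (p t)))\<^sup>2 = (hnorm A ?a)\<^sup>2 + (hnorm L2R ?b)\<^sup>2"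
        using ab AL.norm2[of "(?a, ?b)"] by (simp add: hdist_def A.norm2 B.norm2)
      also have "\<dots> \<le> (hnorm A ?a + hnorm L2R ?b)\<^sup>2" using ab by (simp add: power2_sum)
      finally show ?thesis unfolding hdist_def[of A] hdist_def[of L2R]
        by (rule power2_le_imp_le) (use ab in simp)
    qed
    also have "hdist A (U s h) (U t h) < e / 3" using s by (intro d3(2)) auto
    also have "hdist L2R (tshift s k) (tshift t k) < e / 3" using s by (intro d2(2)) auto
    finally show ?thesis by simp
  qed
  then show "\<exists>d>0. \<forall>s\<ge>0. \<bar>s - t\<bar> < d \<longrightarrow> hdist L2Rp (W s f) (W t f) < e"
    using d1 d2 d3 by (intro exI[of _ "min d1 (min d2 d3)"]) auto
qed

lemma W_cocycle: "cocycle W"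
  unfolding cocycle_def
proof (intro conjI allI impI)
  show "unitary_op L2Rp L2Rp (W t)" if "t \<ge> 0" for t by (rule W_unitary[OF that])
  show "strongly_cont L2Rp W" by (rule W_cont)
  show "op_eq L2Rp L2Rp (W 0) id"
    unfolding op_eq_def
  proof
    fix f assume f: "f \<in> hcar L2Rp"
    note fi = pos_in[OF f]
    have "heq L2R (W 0 f) f"
      using fi pos_in[OF W_in[OF fi]] by (subst B.heq_iff) (auto simp: W_Wt[OF f] Wt_def tshift_0 Vt_0)
    then show "heq L2Rp (W 0 f) (id f)" by simp
  qed
  fix t s :: real assume t: "t \<ge> 0" and s: "s \<ge> 0"
  show "op_eq L2R L2R (ext_op (W (t + s))) (ext_op (W t) \<circ> tshift t \<circ> ext_op (W s) \<circ> tshift (- t))"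
    unfolding op_eq_def
  proof
    fix g assume g: "g \<in> hcar L2R"
    let ?g = "tshift (- t) g"
    note g' = tshift_in[OF g, of "- t"]
    note e1 = ext_op_inn[OF g'  s]
    have e1i: "ext_op (W s) ?g \<in> hcar L2R" using e1(1) g by blast
    note e2 = ext_op_inn[OF tshift_in[OF e1i, of t] t]
    have e2i: "ext_op (W t) (tshift t (ext_op (W s) ?g)) \<in> hcar L2R" using e2(1) g by blast
    have ts: "t + s \<ge> 0" using t s by simp
    have e3i: "ext_op (W (t + s)) g \<in> hcar L2R" using ext_op_inn(1)[OF g ts g] .
    have "hinn L2R (ext_op (W (t + s)) g) z = hinn L2R (ext_op (W t) (tshift t (ext_op (W s) ?g))) z"
      if z: "z \<in> hcar L2R" for z
    proof -
      \<comment> \<open>The forward shift cancels against the backward shift contained in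
        \<open>Wt t\<close>, which leaves \<open>Vt t\<close>.\<close>
      have "hinn L2R (ext_op (W t) (tshift t (ext_op (W s) ?g))) z = hinn L2R (Vt t (ext_op (W s) ?g)) z"
        using e2(2)[OF z] by (simp add: Wt_def tshift_tshift tshift_0)
      also have "\<dots> = hinn L2R (ext_op (W s) ?g) (Vt (- t) z)" using e1i z by (rule Vt_adj)
      also have "\<dots> = hinn L2R (Wt s ?g) (Vt (- t) z)" using z by (intro e1(2)) simp
      also have "\<dots> = hinn L2R (Vt t (Vt s (tshift (- s) ?g))) z" using z g by (simp add: Wt_def Vt_adj)
      also have "\<dots> = hinn L2R (Vt (t + s) (tshift (- (t + s)) g)) z"
        using z g by (simp add: Vt_Vt tshift_tshift add.commute)
      finally show ?thesis using ext_op_inn(2)[OF g ts z] by (simp add: Wt_def)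
    qed
    then show "heq L2R (ext_op (W (t + s)) g) ((ext_op (W t) \<circ> tshift t \<circ> ext_op (W s) \<circ> tshift (- t)) g)"
      using e2i e3i by (simp add: B.heq_iff)
  qed
qed

text \<open>For \<open>p = J0 (tshift (- t) f)\<close> the vector \<open>G (K t p)\<close> is
  \<open>Wt t f\<close> and \<open>tshift t (G p)\<close> is \<open>f\<close> up to a null vector,
  so the bound for the commutator is the one sought.\<close>

lemma trace_bound_W:
  assumes t: "t \<ge> 0"
  shows "\<exists>C. trace_bound L2Rp L2Rp (\<lambda>f. hsub L2Rp (W t f) f) C"
proof -
  obtain C where C: "trace_bound AL L2R (\<lambda>p. hsub L2R (G (U t (fst p), tshift t (snd p))) (tshift t (G p))) C"
    using trace_bound_G_commutator[OF U_isom tshift_isometry cmod_m eps_summable(1)[OF t] eps_summable(2)[OF t] eig_e[OF t] eig_w[OF t]]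
    by blast
  have tc: "contractive L2R L2R (tshift (- t))" using isometry_adj_contractive(1)[OF B.inner_space_axioms tshift_isometry] .
  have c: "contractive L2R AL (\<lambda>f. J0 (tshift (- t) f))"
    by (rule contractive_comp[OF B.inner_space_axioms B.inner_space_axioms inner_space_AB tc J0_ctr])
  have T: "trace_bound L2R L2R (\<lambda>f. hsub L2R (Wt t f) f) C"
  proof (rule trace_bound_cong[OF trace_bound_right[OF B.inner_space_axioms inner_space_AB C c]])
    fix f z assume f: "f \<in> hcar L2R" and z: "z \<in> hcar L2R"
    let ?p = "J0 (tshift (- t) f)"
    have p: "?p \<in> hcar AL" using f by (simp add: J0)
    have "hinn L2R (tshift t (G ?p)) z = hinn L2R f z"
      using f z p by (simp add: tshift_adj G_J0 tshift_tshift tshift_0)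
    moreover have "G (U t (fst ?p), tshift t (snd ?p)) = Wt t f" by (simp add: Wt_def Vt_def K_def)
    ultimately show "cmod (hinn L2R (hsub L2R (Wt t f) f) z)
       = cmod (hinn L2R (hsub L2R (G (U t (fst ?p), tshift t (snd ?p))) (tshift t (G ?p))) z)"
      using f z p by simp
  qed
  have "trace_bound L2Rp L2Rp (\<lambda>f. hsub L2Rp (W t f) f) C"
    unfolding trace_bound_def
  proof (intro allI impI)
    fix N x z assume b: "bessel_family L2Rp N x" "bessel_family L2Rp N z"
    have "(\<Sum>i<N. cmod (hinn L2Rp (hsub L2Rp (W t (x i)) (x i)) (z i))) = (\<Sum>i<N. cmod (hinn L2R (hsub L2R (Wt t (x i)) (x i)) (z i)))"
    proof (intro sum.cong refl)
      fix i assume "i \<in> {..<N}"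
      then have xz: "x i \<in> hcar L2Rp" "z i \<in> hcar L2Rp" using b by (auto simp: bessel_family_def simp del: L2Rp_simps)
      show "cmod (hinn L2Rp (hsub L2Rp (W t (x i)) (x i)) (z i)) = cmod (hinn L2R (hsub L2R (Wt t (x i)) (x i)) (z i))"
        using W_Wt[OF xz(1) t pos_in[OF xz(2)]] pos_in[OF xz(1)] pos_in[OF xz(2)] pos_in[OF W_in[OF pos_in[OF xz(1)], of t]]
        by (simp del: L2Rp_simps(1))
    qed
    also have "\<dots> \<le> C" using T bessel_family_L2Rp[OF b(1)] bessel_family_L2Rp[OF b(2)] unfolding trace_bound_def by blast
    finally show "(\<Sum>i<N. cmod (hinn L2Rp (hsub L2Rp (W t (x i)) (x i)) (z i))) \<le> C" .
  qed
  then show ?thesis by blast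
qed

lemma shift_ctr: assumes t: "t \<ge> 0" shows "contractive L2Rp L2Rp (shift t)"
proof -
  have si: "shift t f \<in> hcar L2Rp" if "f \<in> hcar L2Rp" for f using shift_tshift(1)[OF that t] .
  have st: "hinn L2R (shift t f) z = hinn L2R (tshift t f) z" if "f \<in> hcar L2Rp" "z \<in> hcar L2R" for f z
    using B.heq_inn_l[OF shift_tshift(2)[OF that(1) t] pos_in[OF si[OF that(1)]] tshift_in[OF pos_in[OF that(1)]] that(2)] .
  have n: "hnorm L2R (shift t f) = hnorm L2R f" if "f \<in> hcar L2Rp" for f
    using B.heq_norm[OF shift_tshift(2)[OF that t] pos_in[OF si[OF that]] tshift_in[OF pos_in[OF that]]] by (simp add: tshift_norm)
  have "weakly_linear L2Rp L2Rp (shift t)"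
    unfolding weakly_linear_def
  proof (intro conjI ballI allI)
    fix f g z assume f: "f \<in> hcar L2Rp" and g: "g \<in> hcar L2Rp" and z: "z \<in> hcar L2Rp"
    show "hinn L2Rp (shift t (hadd L2Rp f g)) z = hinn L2Rp (shift t f) z + hinn L2Rp (shift t g) z"
      using st[OF Rp.add_in[OF f g] pos_in[OF z]] st[OF f pos_in[OF z]] st[OF g pos_in[OF z]]
        pos_in[OF f] pos_in[OF g] pos_in[OF z] by (simp add: tshift_adj del: L2Rp_simps(1))
  next
    fix a f z assume f: "f \<in> hcar L2Rp" and z: "z \<in> hcar L2Rp"
    show "hinn L2Rp (shift t (hscl L2Rp a f)) z = a * hinn L2Rp (shift t f) z"
      using st[OF Rp.scl_in[OF f] pos_in[OF z], of a] st[OF f pos_in[OF z]]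
        pos_in[OF f] pos_in[OF z] by (simp add: tshift_adj del: L2Rp_simps(1))
  qed (rule si)
  then show ?thesis using n by (simp add: contractive_def del: L2Rp_simps(1))
qed

text \<open>The second operator is the first one composed with the contraction
  \<open>shift t\<close>, so a single trace bound serves both, and it covers all exponents from 1
  on.\<close>

lemma W_schatten:
  assumes t: "t \<ge> 0" and p: "p \<ge> 1"
  shows "schatten p L2Rp L2Rp (\<lambda>f. hsub L2Rp (W t f) f)"
    "schatten p L2Rp L2Rp (\<lambda>f. hsub L2Rp (W t (shift t f)) (shift t f))"
proof -
  note w = inner_space_L2Rp
  obtain C where C: "trace_bound L2Rp L2Rp (\<lambda>f. hsub L2Rp (W t f) f) C" using trace_bound_W[OF t] by blast
  have idc: "contractive L2Rp L2Rp (\<lambda>f. f)" by (auto simp: contractive_def weakly_linear_def simp del: L2Rp_simps)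
  show "schatten p L2Rp L2Rp (\<lambda>f. hsub L2Rp (W t f) f)"
    by (rule trace_bound_schatten[OF w w _ C p]) (intro blin_sub contractive_blin w W_ctr t idc)
  show "schatten p L2Rp L2Rp (\<lambda>f. hsub L2Rp (W t (shift t f)) (shift t f))"
    by (rule trace_bound_schatten[OF w w _ trace_bound_right[OF w w C shift_ctr[OF t]] p])
      (intro blin_sub contractive_blin w contractive_comp[OF w w w shift_ctr[OF t] W_ctr[OF t]] shift_ctr t)
qed

section \<open>The unitary that realises the equivalence\<close>

definition J :: "(real \<Rightarrow> complex) \<Rightarrow> 'a \<times> (real \<Rightarrow> complex)" where
  "J f = (fst (J0 f), cut_pos (snd (J0 f)))"

text \<open>\<open>J0\<close> preserves inner products and embeds the functions supported on the
  negative half line into the second summand. The second component of \<open>J0 f\<close> is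
  therefore orthogonal to them, and the cut changes it by a null vector only.\<close>

lemma J_J0:
  assumes f: "f \<in> hcar L2Rp"
  shows "J f \<in> hcar (hs_dsum A L2Rp)" "J f \<in> hcar AL" "p \<in> hcar AL \<Longrightarrow> hinn AL (J f) p = hinn AL (J0 f) p"
    "z \<in> hcar L2R \<Longrightarrow> hinn L2R (cut_pos (snd (J0 f))) z = hinn L2R (snd (J0 f)) z"
proof -
  note fi = pos_in[OF f]
  show "J f \<in> hcar (hs_dsum A L2Rp)" using fi cut_pos_L2Rp[OF J0_snd[OF fi]] by (simp add: J_def del: L2Rp_simps)
  show "J f \<in> hcar AL" using fi by (simp add: J_def)
  have c: "hinn L2R (cut_pos (snd (J0 f))) z = hinn L2R (snd (J0 f)) z" if z: "z \<in> hcar L2R" for z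
  proof (rule cut_pos_eqI[OF J0_snd[OF fi] _ z])
    fix z assume n: "supp_neg z"
    note zi = supp_neg_in[OF n]
    have "hinn L2R z (snd (J0 f)) = hinn AL (J0 z) (J0 f)" using J0_neg'[OF n J0(1)[OF fi]] by simp
    also have "\<dots> = cnj (hinn L2R f z)" using J0_inn[OF zi fi] B.inn_cnj[OF fi zi] by simp
    finally show "hinn L2R (snd (J0 f)) z = 0"
      using pos_neg[OF f n] B.inn_cnj[OF zi J0_snd[OF fi]] by simp
  qed
  then show "z \<in> hcar L2R \<Longrightarrow> hinn L2R (cut_pos (snd (J0 f))) z = hinn L2R (snd (J0 f)) z" .
  show "hinn AL (J f) p = hinn AL (J0 f) p" if "p \<in> hcar AL"
  proof -
    obtain h k where p: "p = (h, k)" "k \<in> hcar L2R" using \<open>p \<in> hcar AL\<close> by (cases p) auto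
    obtain a b where ab: "J0 f = (a, b)" by (cases "J0 f")
    show ?thesis using c[OF p(2)] by (simp add: J_def p ab)
  qed
qed

lemma inner_space_ALp: "inner_space (hs_dsum A L2Rp)"
  by (rule inner_space_dsum[OF A.inner_space_axioms inner_space_L2Rp])

lemma ALp_sub: "p \<in> hcar (hs_dsum A L2Rp) \<Longrightarrow> p \<in> hcar AL"
  by (cases p) auto

text \<open>For surjectivity the preimage of \<open>p\<close> is \<open>G p\<close>; by
  \<open>G_cut\<close> it is supported on the half line up to a null vector whenever the second
  component of \<open>p\<close> is.\<close>

lemma J_unitary: "unitary_op L2Rp (hs_dsum A L2Rp) J"
  unfolding unitary_op_def
proof (intro conjI ballI)
  have n: "hnorm AL (J f) = hnorm L2R f" if f: "f \<in> hcar L2Rp" for f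
  proof -
    have "hnorm AL (J f) = hnorm AL (J0 f)"
      using J_J0[OF f] J0(1)[OF pos_in[OF f]] by (intro AL.norm_by_inn) auto
    then show ?thesis using J0_norm[OF pos_in[OF f]] by simp
  qed
  then show "hnorm (hs_dsum A L2Rp) (J f) = hnorm L2Rp f" if "f \<in> hcar L2Rp" for f
    using that by (simp add: dsum_L2Rp del: L2Rp_simps(1))
  have "weakly_linear L2Rp (hs_dsum A L2Rp) J"
    unfolding weakly_linear_def dsum_L2Rp
  proof (intro conjI ballI allI)
    fix f g z assume f: "f \<in> hcar L2Rp" and g: "g \<in> hcar L2Rp" and z: "z \<in> hcar (hs_dsum A L2Rp)"
    show "hinn AL (J (hadd L2Rp f g)) z = hinn AL (J f) z + hinn AL (J g) z"
      using J_J0(3)[OF Rp.add_in[OF f g] ALp_sub[OF z]] J_J0(3)[OF f ALp_sub[OF z]] J_J0(3)[OF g ALp_sub[OF z]]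
        weakly_linearD(2)[OF contractiveD(1)[OF J0_ctr] pos_in[OF f] pos_in[OF g] ALp_sub[OF z]] by simp
  next
    fix a f z assume f: "f \<in> hcar L2Rp" and z: "z \<in> hcar (hs_dsum A L2Rp)"
    show "hinn AL (J (hscl L2Rp a f)) z = a * hinn AL (J f) z"
      using J_J0(3)[OF Rp.scl_in[OF f] ALp_sub[OF z], of a] J_J0(3)[OF f ALp_sub[OF z]]
        weakly_linearD(3)[OF contractiveD(1)[OF J0_ctr] pos_in[OF f] ALp_sub[OF z], of a] by simp
  qed (rule J_J0(1))
  then have "contractive L2Rp (hs_dsum A L2Rp) J" using n by (simp add: contractive_def dsum_L2Rp del: L2Rp_simps(1))
  then show "blin L2Rp (hs_dsum A L2Rp) J" by (rule contractive_blin[OF inner_space_L2Rp inner_space_ALp])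
  fix p assume p: "p \<in> hcar (hs_dsum A L2Rp)"
  note pi = ALp_sub[OF p]
  obtain h k where hk: "p = (h, k)" "h \<in> hcar A" "k \<in> hcar L2Rp" using p by (cases p) (auto simp del: L2Rp_simps)
  note ki = pos_in[OF hk(3)]
  define f where "f = cut_pos (G p)"
  have f: "f \<in> hcar L2Rp" unfolding f_def by (intro cut_pos_L2Rp G_in' pi)
  have "heq L2R (cut_pos (G (h, k))) (G (h, cut_pos k))"
    by (rule G_cut[OF cut_pos_adj _ hk(2) ki]) (simp add: cut_pos_w)
  then have fe: "heq L2R f (G p)" using cut_pos_id[OF hk(3)] by (simp add: f_def hk(1))
  have "heq AL (J f) p"
  proof (subst AL.heq_iff)
    show "\<forall>z\<in>hcar AL. hinn AL (J f) z = hinn AL p z"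
    proof
      fix z assume z: "z \<in> hcar AL"
      have "hinn AL (J f) z = hinn L2R f (G z)" using J_J0(3)[OF f z] adjoint_pairD(3)[OF J0_adj pos_in[OF f] z] by simp
      also have "\<dots> = hinn L2R (G p) (G z)" using fe pos_in[OF f] pi z by (intro B.heq_inn_l) auto
      finally show "hinn AL (J f) z = hinn AL p z" using G_inn[OF pi z] by simp
    qed
  qed (use J_J0(2)[OF f] pi in auto)
  then show "\<exists>f\<in>hcar L2Rp. heq (hs_dsum A L2Rp) (J f) p" using f unfolding dsum_L2Rp by blast
qed

text \<open>Tested against \<open>p\<close>, the left side becomes \<open>Vt t f\<close>, that is
  \<open>G (K t (J0 f))\<close>, paired with \<open>G p\<close>; as \<open>G\<close> preserves inner
  products, only \<open>K t (J0 f)\<close> remains. The shifts of the half line and of the line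
  agree up to null vectors.\<close>

lemma J_intertwines:
  assumes t: "t \<ge> 0"
  shows "op_eq L2Rp (hs_dsum A L2Rp) (J \<circ> (W t \<circ> shift t)) (opsum (U t) (shift t) \<circ> J)"
  unfolding op_eq_def dsum_L2Rp
proof
  fix f assume f: "f \<in> hcar L2Rp"
  note fi = pos_in[OF f]
  note sf = shift_tshift[OF f t]
  note sfi = pos_in[OF sf(1)]
  note Wsf = W_in[OF sfi, of t]
  let ?k = "cut_pos (snd (J0 f))"
  have k: "?k \<in> hcar L2Rp" using cut_pos_L2Rp[OF J0_snd[OF fi]] .
  note sk = shift_tshift[OF k t]
  have rhs: "(opsum (U t) (shift t) \<circ> J) f = (U t (fst (J0 f)), shift t ?k)" by (simp add: opsum_def J_def)
  show "heq AL ((J \<circ> (W t \<circ> shift t)) f) ((opsum (U t) (shift t) \<circ> J) f)"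
    unfolding rhs unfolding comp_apply
  proof (subst AL.heq_iff)
    show "J (W t (shift t f)) \<in> hcar AL" by (rule J_J0(2)[OF Wsf])
    show "(U t (fst (J0 f)), shift t ?k) \<in> hcar AL" using fi pos_in[OF sk(1)] by simp
    show "\<forall>p\<in>hcar AL. hinn AL (J (W t (shift t f))) p = hinn AL (U t (fst (J0 f)), shift t ?k) p"
    proof
      fix p assume p: "p \<in> hcar AL"
      obtain a b where ab: "p = (a, b)" "a \<in> hcar A" "b \<in> hcar L2R" using p by (cases p) auto
      have "hinn AL (J (W t (shift t f))) p = hinn L2R (W t (shift t f)) (G p)"
        using J_J0(3)[OF Wsf p] adjoint_pairD(3)[OF J0_adj pos_in[OF Wsf] p] by simp
      also have "\<dots> = hinn L2R (Wt t (shift t f)) (G p)" using p by (intro W_Wt[OF sf(1) t]) simp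
      also have "\<dots> = hinn L2R (shift t f) (Ws t (G p))" using sfi p by (simp add: Wt_adj)
      also have "\<dots> = hinn L2R (tshift t f) (Ws t (G p))" using sf(2) sfi fi p by (intro B.heq_inn_l) auto
      also have "\<dots> = hinn L2R (Vt t f) (G p)" using fi p by (simp add: Ws_def tshift_adj tshift_tshift tshift_0 Vt_adj)
      also have "\<dots> = hinn AL (K t (J0 f)) p" unfolding Vt_def using p fi by (intro G_inn) (simp_all add: J0)
      also have "\<dots> = hinn A (U t (fst (J0 f))) a + hinn L2R (tshift t (snd (J0 f))) b" by (simp add: K_def ab)
      also have "hinn L2R (tshift t (snd (J0 f))) b = hinn L2R (shift t ?k) b"
        using B.heq_inn_l[OF sk(2) pos_in[OF sk(1)] tshift_in[OF pos_in[OF k]] ab(3)] J_J0(4)[OF f tshift_in[OF ab(3)], of "- t"]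
          fi ab(3) by (simp add: tshift_adj)
      finally show "hinn AL (J (W t (shift t f))) p = hinn AL (U t (fst (J0 f)), shift t ?k) p" by (simp add: ab)
    qed
  qed
qed

end

section \<open>Assembly of eigenvalues, waves and error bounds\<close>

lemma prod_encode_ge: "n + k \<le> prod_encode (n, k)"
proof -
  have "m \<le> triangle m" for m by (induction m) auto
  from this[of "n + k"] show ?thesis by (simp add: prod_encode_def)
qed

theorem theorem1:
  fixes H0 :: "'h hspace" and U :: "real \<Rightarrow> 'h \<Rightarrow> 'h"
  assumes "complex_hilbert H0" and "separable_hs H0"
    and "unitary_semigroup H0 U"
    and "singular_spectrum H0 U"
  shows "\<exists>W. cocycle W \<and>
     (\<forall>p>1. \<forall>t\<ge>0. schatten p L2Rp L2Rp (\<lambda>f. hsub L2Rp (W t f) f)) \<and>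
     (\<exists>J. unitary_op L2Rp (hs_dsum H0 L2Rp) J \<and>
        (\<forall>t\<ge>0. op_eq L2Rp (hs_dsum H0 L2Rp) (J \<circ> (W t \<circ> shift t)) (opsum (U t) (shift t) \<circ> J))) \<and>
     (\<forall>t\<ge>0. schatten 1 L2Rp L2Rp (\<lambda>f. hsub L2Rp (W t (shift t f)) (shift t f)))"
proof -
  interpret definite_hilbert H0 by (rule complex_hilbert_imp_definite[OF assms(1)])
  obtain Ug where Ug: "ugroup H0 Ug" and UgU: "\<And>t x. t \<ge> 0 \<Longrightarrow> x \<in> hcar H0 \<Longrightarrow> Ug t x = U t x"
    using unitary_group_ex[OF definite_hilbert_axioms assms(3)] by blast
  interpret Ug: ugroup H0 Ug by (rule Ug)
  define Q where "Q E \<Lambda> \<eta> \<longleftrightarrow> (\<forall>n. on_or_zero_seq H0 (E n)) \<and> (\<forall>k. hnorm H0 (E 0 k) = 0) \<and>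
    (\<forall>n k z. z \<in> hcar H0 \<longrightarrow> (\<lambda>l. hinn H0 (E n k) (E (Suc n) l) * hinn H0 (E (Suc n) l) z) sums hinn H0 (E n k) z) \<and>
    (\<forall>n k t. hnorm H0 (hsub H0 (Ug t (E n k)) (hscl H0 (character t (\<Lambda> n k)) (E n k))) \<le> \<bar>t\<bar> * \<eta> n k) \<and>
    (\<forall>n k. \<eta> n k \<ge> 0) \<and> (\<forall>n. summable (\<eta> n)) \<and> summable (\<lambda>n. suminf (\<eta> n)) \<and>
    (\<exists>D\<subseteq>hcar H0. (\<forall>d\<in>D. (\<lambda>n. \<Sum>k. (cmod (hinn H0 d (E n k)))\<^sup>2) \<longlonglongrightarrow> (hnorm H0 d)\<^sup>2) \<and>
       (\<forall>z\<in>hcar H0. (\<forall>d\<in>D. hinn H0 z d = 0) \<longrightarrow> hnorm H0 z = 0))" for E and \<Lambda> \<eta> :: "nat \<Rightarrow> nat \<Rightarrow> real"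
  have "\<exists>E \<Lambda> \<eta>. Q E \<Lambda> \<eta>" unfolding Q_def
  proof (rule singular_level_basis[OF Ug assms(2)])
    fix x assume x: "x \<in> hcar H0"
    from assms(4) x show "\<exists>\<mu> :: real measure. finite_measure \<mu> \<and> sets \<mu> = sets borel \<and>
      (\<exists>N\<in>sets borel. emeasure lborel N = 0 \<and> emeasure \<mu> (UNIV - N) = 0) \<and>
      (\<forall>t\<ge>0. hinn H0 (Ug t x) x = (LINT l|\<mu>. exp (\<i> * complex_of_real (t * l))))"
      unfolding singular_spectrum_def by (simp add: UgU x)
  qed
  then obtain E \<Lambda> \<eta> where Q: "Q E \<Lambda> \<eta>" by blast
  have ozE: "\<And>n. on_or_zero_seq H0 (E n)" and E0: "\<And>k. hnorm H0 (E 0 k) = 0"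
    and nest: "\<And>n k z. z \<in> hcar H0 \<Longrightarrow> (\<lambda>l. hinn H0 (E n k) (E (Suc n) l) * hinn H0 (E (Suc n) l) z) sums hinn H0 (E n k) z"
    and eigE: "\<And>n k t. hnorm H0 (hsub H0 (Ug t (E n k)) (hscl H0 (character t (\<Lambda> n k)) (E n k))) \<le> \<bar>t\<bar> * \<eta> n k"
    and \<eta>: "\<And>n k. \<eta> n k \<ge> 0" "\<And>n. summable (\<eta> n)" "summable (\<lambda>n. suminf (\<eta> n))"
    using Q unfolding Q_def by simp_all
  from Q[unfolded Q_def] have exD: "\<exists>D\<subseteq>hcar H0. (\<forall>d\<in>D. (\<lambda>n. \<Sum>k. (cmod (hinn H0 d (E n k)))\<^sup>2) \<longlonglongrightarrow> (hnorm H0 d)\<^sup>2) \<and>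
       (\<forall>z\<in>hcar H0. (\<forall>d\<in>D. hinn H0 z d = 0) \<longrightarrow> hnorm H0 z = 0)" by (elim conjE)
  then obtain D where D: "D \<subseteq> hcar H0" "\<forall>d\<in>D. (\<lambda>n. \<Sum>k. (cmod (hinn H0 d (E n k)))\<^sup>2) \<longlonglongrightarrow> (hnorm H0 d)\<^sup>2"
    "\<forall>z\<in>hcar H0. (\<forall>d\<in>D. hinn H0 z d = 0) \<longrightarrow> hnorm H0 z = 0" by (elim exE conjE)
  \<comment> \<open>The frequency matches the approximate eigenvalue of \<open>E n k\<close>. Taking
    the code of the pair as scale gives all waves disjoint supports, and
    \<open>prod_encode_ge\<close> makes their errors decay in both \<open>n\<close> and
    \<open>k\<close>.\<close>
  define w where "w n k = wave (\<Lambda> n k) (prod_encode (n, k))" for n k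
  have w_orth: "hinn L2R (w m k) (w n l) = 0" if "(m, k) \<noteq> (n, l)" for m k n l
  proof -
    have "prod_encode (m, k) \<noteq> prod_encode (n, l)" using that by (simp add: prod_encode_eq)
    then show ?thesis unfolding w_def by (cases rule: linorder_cases[of "prod_encode (m, k)" "prod_encode (n, l)"]) (simp_all add: wave_orth)
  qed
  interpret a0: absorb0 H0 L2R E w
  proof unfold_locales
    show "on_or_zero_seq L2R (w n)" for n
      using w_orth by (auto simp: on_or_zero_seq_def w_def wave_self simp del: L2R_simps)
  qed (use ozE E0 nest w_orth in \<open>auto simp: w_def wave_self\<close>)
  interpret a: absorb H0 L2R E w
    by unfold_locales (rule a0.complI[of D], use D in \<open>auto simp: subset_iff\<close>)
  \<comment> \<open>The two summands are the errors of \<open>E n k\<close> and of its wave, so one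
    summable bound serves both sides.\<close>
  define \<epsilon> where "\<epsilon> t n k = \<bar>t\<bar> * \<eta> n k + sqrt (2 * t) * ((1/2) ^ n * (1/2) ^ k)" for t n k
  have g: "summable (\<lambda>k. c * (d * (1/2 :: real) ^ k))" for c d
    by (intro summable_mult summable_geometric) simp
  have gs: "(\<Sum>k. c * (d * (1/2 :: real) ^ k)) = c * (d * 2)" for c d
    by (simp add: suminf_mult suminf_geometric summable_mult summable_geometric)
  interpret s: shift_absorb H0 E w Ug "\<lambda>t n k. character t (\<Lambda> n k)" \<epsilon>
  proof unfold_locales
    show "cut_pos (w n k) = w n k" for n k by (simp add: w_def wave_cut)
    show "cmod (character t (\<Lambda> n k)) = 1" for t n k by simp
    show "summable (\<epsilon> t n)" for t n unfolding \<epsilon>_def[abs_def]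
      by (intro summable_add summable_mult \<eta> g)
    have "suminf (\<epsilon> t n) = \<bar>t\<bar> * suminf (\<eta> n) + sqrt (2 * t) * ((1/2) ^ n * 2)" for t n
      unfolding \<epsilon>_def[abs_def] by (subst suminf_add[symmetric]) (simp_all add: \<eta> g gs suminf_mult summable_mult)
    moreover have "summable (\<lambda>n. \<bar>t\<bar> * suminf (\<eta> n) + sqrt (2 * t) * ((1/2) ^ n * 2))" for t
      by (intro summable_add summable_mult \<eta>(3) summable_mult2 summable_geometric) simp
    ultimately show "summable (\<lambda>n. suminf (\<epsilon> t n))" for t by simp
    show "hnorm H0 (hsub H0 (Ug t (E n k)) (hscl H0 (character t (\<Lambda> n k)) (E n k))) \<le> \<epsilon> t n k" if "t \<ge> 0" for t n k
      using eigE[where n = n and k = k and t = t] that by (simp add: \<epsilon>_def add_increasing2)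
    show "hnorm L2R (hsub L2R (tshift t (w n k)) (hscl L2R (character t (\<Lambda> n k)) (w n k))) \<le> \<epsilon> t n k" if t: "t \<ge> 0" for t n k
    proof -
      have "hnorm L2R (hsub L2R (tshift t (w n k)) (hscl L2R (character t (\<Lambda> n k)) (w n k))) \<le> sqrt (2 * t) / 2 ^ prod_encode (n, k)"
        unfolding w_def character_def by (rule wave_shift[OF t])
      also have "\<dots> = sqrt (2 * t) * (1/2) ^ prod_encode (n, k)" by (simp add: power_divide)
      also have "\<dots> \<le> sqrt (2 * t) * (1/2) ^ (n + k)"
        using t prod_encode_ge[of n k] by (intro mult_left_mono power_decreasing) auto
      also have "\<dots> \<le> \<epsilon> t n k" using \<eta>(1) by (simp add: \<epsilon>_def power_add)
      finally show ?thesis .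
    qed
    show "strongly_cont H0 Ug"
      using assms(3) unfolding unitary_semigroup_def strongly_cont_def by (simp add: UgU)
  qed
  have "op_eq L2Rp (hs_dsum H0 L2Rp) (s.J \<circ> (s.W t \<circ> shift t)) (opsum (U t) (shift t) \<circ> s.J)" if t: "t \<ge> 0" for t
  proof -
    \<comment> \<open>The construction works with the group extension \<open>Ug\<close>, which is
      known to agree with \<open>U\<close> at nonnegative times on vectors of
      \<open>H0\<close>.\<close>
    have "(opsum (U t) (shift t) \<circ> s.J) f = (opsum (Ug t) (shift t) \<circ> s.J) f" if "f \<in> hcar L2Rp" for f
      using UgU[OF t s.J0_fst[OF s.pos_in[OF that]]] by (simp add: opsum_def s.J_def)
    then show ?thesis using s.J_intertwines[OF t] by (simp add: op_eq_def del: L2Rp_simps comp_apply)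
  qed
  then show ?thesis
    using s.W_cocycle s.W_schatten s.J_unitary by (intro exI[of _ s.W] conjI exI[of _ s.J]) auto
qed

end
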